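(* The bilinear form $$\mathcal{E}(\varphi,\psi)=\frac12\int\langle\Pi\nabla\varphi,\nabla\psi\rangle_{V^{-1}}\,d\nu,\qquad\varphi,\psi\in\mathcal{F}C_b^\infty,$$ is closable in $L^2(E,\nu)$, and its closure $(\mathcal{E},D(\mathcal{E}))$ is a symmetric quasi-regular Dirichlet form.
   Context: Torus $\mathbb{T}^2\cong[0,1]^2$, $A=\Delta$, eigenbasis $e_0=1,e_k$, $Ae_k=-\lambda_ke_k$, $\lambda_k=\pi^2|k|^2$; $m(h)=\langle h,e_0\rangle$; $V^\alpha=\{u\in\mathcal{S}':\sum_k\lambda_k^\alpha|\langle u,e_k\rangle|^2<\infty\}$ with inner product $m(u)m(v)+\sum_k\lambda_k^\alpha\langle u,e_k\rangle\langle v,e_k\rangle$; $\Pi h=h-m(h)$; $\bar Qh=(-A)^{-1}(h-m(h))+m(h)e_0$. Fix small $s_0>0$, $E=V^{-1-s_0}$, $E^*=V^{s_0-1}$, pairing ${}_{E^*}\langle u,v\rangle_E=\sum_k\langle\bar Qu,e_k\rangle\langle v,e_k\rangle$. $\mathcal{F}C_b^\infty$ = functions $f({}_{E^*}\langle l_1,\cdot\rangle_E,\dots,{}_{E^*}\langle l_m,\cdot\rangle_E)$, $f\in C_b^\infty(\mathbb{R}^m)$, $l_i\in E^*$. For such $\varphi$, $\nabla\varphi:E\to V^{-1}$ is defined by $\langle\nabla\varphi(z),h\rangle_{V^{-1}}=\partial_h\varphi(z)$ for $h\in V^{-1}$ (directional derivative). $\mu$ is the centered Gaussian measure with covariance $(-A)^{-1}$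 on mean-zero part; $:\phi^4:$ is the Wick power (limit of $c_\varepsilon^{2}P_4(c_\varepsilon^{-1/2}\rho_\varepsilon*\phi)$ with $c_\varepsilon=\int(\rho_\varepsilon*\phi)^2d\mu$, $P_4$ the Hermite polynomial, $\rho_\varepsilon$ a standard mollifier); $N(\phi)=\langle\frac14:\phi^4:,e_0\rangle$ and $\nu=c\,e^{-N}\mu$, a probability measure on $E$. *)

theory Defs
  imports "HOL-Probability.Probability"
begin

text \<open>Forms are given by a domain D (a set of real functions, i.e. representatives
of elements of L2(M)) and a bilinear map Ef on it.\<close>

definition L2 :: "'a measure \<Rightarrow> ('a \<Rightarrow> real) set" where
  "L2 M = {f. f \<in> borel_measurable M \<and> integrable M (\<lambda>x. (f x)\<^sup>2)}"

definition l2dist2 :: "'a measure \<Rightarrow> ('a \<Rightarrow> real) \<Rightarrow> ('a \<Rightarrow> real) \<Rightarrow> real" where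
  "l2dist2 M f g = (\<integral>x. (f x - g x)\<^sup>2 \<partial>M)"

definition E1 :: "'a measure \<Rightarrow> (('a \<Rightarrow> real) \<Rightarrow> ('a \<Rightarrow> real) \<Rightarrow> real)
    \<Rightarrow> ('a \<Rightarrow> real) \<Rightarrow> ('a \<Rightarrow> real) \<Rightarrow> real" where
  "E1 M Ef u v = Ef u v + (\<integral>x. u x * v x \<partial>M)"

definition fdiff :: "('a \<Rightarrow> real) \<Rightarrow> ('a \<Rightarrow> real) \<Rightarrow> 'a \<Rightarrow> real" where
  "fdiff u v = (\<lambda>x. u x - v x)"

definition form_cauchy :: "(('a \<Rightarrow> real) \<Rightarrow> ('a \<Rightarrow> real) \<Rightarrow> real) \<Rightarrow> (nat \<Rightarrow> 'a \<Rightarrow> real) \<Rightarrow> bool" where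
  "form_cauchy Ef u \<longleftrightarrow>
     (\<forall>e>0. \<exists>N. \<forall>n\<ge>N. \<forall>m\<ge>N. Ef (fdiff (u n) (u m)) (fdiff (u n) (u m)) < e)"

text \<open>Closability (Ma--Roeckner, Def. I.3.1).\<close>
definition closable_form :: "'a measure \<Rightarrow> ('a \<Rightarrow> real) set
    \<Rightarrow> (('a \<Rightarrow> real) \<Rightarrow> ('a \<Rightarrow> real) \<Rightarrow> real) \<Rightarrow> bool" where
  "closable_form M D Ef \<longleftrightarrow> D \<subseteq> L2 M \<and>
     (\<forall>u. (\<forall>n. u n \<in> D) \<and> (\<lambda>n. l2dist2 M (u n) (\<lambda>_. 0)) \<longlonglongrightarrow> 0 \<and> form_cauchy Ef u
        \<longrightarrow> (\<lambda>n. Ef (u n) (u n)) \<longlonglongrightarrow> 0)"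

definition approximates :: "'a measure \<Rightarrow> ('a \<Rightarrow> real) set
    \<Rightarrow> (('a \<Rightarrow> real) \<Rightarrow> ('a \<Rightarrow> real) \<Rightarrow> real) \<Rightarrow> (nat \<Rightarrow> 'a \<Rightarrow> real) \<Rightarrow> ('a \<Rightarrow> real) \<Rightarrow> bool" where
  "approximates M D Ef v u \<longleftrightarrow> (\<forall>n. v n \<in> D) \<and> (\<lambda>n. l2dist2 M (v n) u) \<longlonglongrightarrow> 0 \<and> form_cauchy Ef v"

definition closure_dom :: "'a measure \<Rightarrow> ('a \<Rightarrow> real) set
    \<Rightarrow> (('a \<Rightarrow> real) \<Rightarrow> ('a \<Rightarrow> real) \<Rightarrow> real) \<Rightarrow> ('a \<Rightarrow> real) set" where
  "closure_dom M D Ef = {u \<in> L2 M. \<exists>v. approximates M D Ef v u}"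

definition closure_form :: "'a measure \<Rightarrow> ('a \<Rightarrow> real) set
    \<Rightarrow> (('a \<Rightarrow> real) \<Rightarrow> ('a \<Rightarrow> real) \<Rightarrow> real) \<Rightarrow> ('a \<Rightarrow> real) \<Rightarrow> ('a \<Rightarrow> real) \<Rightarrow> real" where
  "closure_form M D Ef u w =
     lim (\<lambda>n. Ef ((SOME v. approximates M D Ef v u) n) ((SOME v. approximates M D Ef v w) n))"

text \<open>Symmetric Dirichlet form on L2(M) (Ma--Roeckner, Def. I.4.5 / I.2.3).\<close>
definition dirichlet_form :: "'a measure \<Rightarrow> ('a \<Rightarrow> real) set
    \<Rightarrow> (('a \<Rightarrow> real) \<Rightarrow> ('a \<Rightarrow> real) \<Rightarrow> real) \<Rightarrow> bool" where
  "dirichlet_form M D Ef \<longleftrightarrow>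
     D \<subseteq> L2 M
   \<and> (\<forall>u\<in>D. \<forall>v\<in>D. \<forall>a b::real. (\<lambda>x. a * u x + b * v x) \<in> D)
   \<and> (\<forall>u\<in>D. \<forall>v\<in>D. Ef u v = Ef v u)
   \<and> (\<forall>u\<in>D. \<forall>v\<in>D. \<forall>w\<in>D. \<forall>a b::real. Ef (\<lambda>x. a * u x + b * v x) w = a * Ef u w + b * Ef v w)
   \<and> (\<forall>u\<in>D. 0 \<le> Ef u u)
   \<and> (\<forall>f\<in>L2 M. \<forall>e>0. \<exists>u\<in>D. l2dist2 M f u < e)
   \<and> (\<forall>u. (\<forall>n. u n \<in> D) \<and> form_cauchy (E1 M Ef) u \<longrightarrow>
         (\<exists>w\<in>D. (\<lambda>n. E1 M Ef (fdiff (u n) w) (fdiff (u n) w)) \<longlonglongrightarrow> 0))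
   \<and> (\<forall>u\<in>D. (\<lambda>x. min 1 (max 0 (u x))) \<in> D \<and>
         Ef (\<lambda>x. min 1 (max 0 (u x))) (\<lambda>x. min 1 (max 0 (u x))) \<le> Ef u u)"

text \<open>Capacity, nests, exceptional sets, quasi-continuity w.r.t. a topology T whose
carrier is the state space (Ma--Roeckner, Ch. III, symmetric case).\<close>
definition cap_open :: "'a topology \<Rightarrow> 'a measure \<Rightarrow> ('a \<Rightarrow> real) set
    \<Rightarrow> (('a \<Rightarrow> real) \<Rightarrow> ('a \<Rightarrow> real) \<Rightarrow> real) \<Rightarrow> 'a set \<Rightarrow> ennreal" where
  "cap_open T M D Ef U =
     Inf {ennreal (E1 M Ef u u) | u. u \<in> D \<and> (AE x in M. x \<in> U \<longrightarrow> 1 \<le> u x)}"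

definition capacity :: "'a topology \<Rightarrow> 'a measure \<Rightarrow> ('a \<Rightarrow> real) set
    \<Rightarrow> (('a \<Rightarrow> real) \<Rightarrow> ('a \<Rightarrow> real) \<Rightarrow> real) \<Rightarrow> 'a set \<Rightarrow> ennreal" where
  "capacity T M D Ef A = Inf {cap_open T M D Ef U | U. openin T U \<and> A \<subseteq> U}"

definition is_nest :: "'a topology \<Rightarrow> 'a measure \<Rightarrow> ('a \<Rightarrow> real) set
    \<Rightarrow> (('a \<Rightarrow> real) \<Rightarrow> ('a \<Rightarrow> real) \<Rightarrow> real) \<Rightarrow> (nat \<Rightarrow> 'a set) \<Rightarrow> bool" where
  "is_nest T M D Ef F \<longleftrightarrow> (\<forall>k. closedin T (F k)) \<and> incseq F \<and>
     (\<lambda>k. capacity T M D Ef (topspace T - F k)) \<longlonglongrightarrow> 0"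

definition exceptional :: "'a topology \<Rightarrow> 'a measure \<Rightarrow> ('a \<Rightarrow> real) set
    \<Rightarrow> (('a \<Rightarrow> real) \<Rightarrow> ('a \<Rightarrow> real) \<Rightarrow> real) \<Rightarrow> 'a set \<Rightarrow> bool" where
  "exceptional T M D Ef N \<longleftrightarrow> (\<exists>F. is_nest T M D Ef F \<and> N \<subseteq> (\<Inter>k. topspace T - F k))"

definition quasi_continuous :: "'a topology \<Rightarrow> 'a measure \<Rightarrow> ('a \<Rightarrow> real) set
    \<Rightarrow> (('a \<Rightarrow> real) \<Rightarrow> ('a \<Rightarrow> real) \<Rightarrow> real) \<Rightarrow> ('a \<Rightarrow> real) \<Rightarrow> bool" where
  "quasi_continuous T M D Ef f \<longleftrightarrow>
     (\<exists>F. is_nest T M D Ef F \<and> (\<forall>k. continuous_map (subtopology T (F k)) euclideanreal f))"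

definition qc_version :: "'a topology \<Rightarrow> 'a measure \<Rightarrow> ('a \<Rightarrow> real) set
    \<Rightarrow> (('a \<Rightarrow> real) \<Rightarrow> ('a \<Rightarrow> real) \<Rightarrow> real) \<Rightarrow> ('a \<Rightarrow> real) \<Rightarrow> ('a \<Rightarrow> real) \<Rightarrow> bool" where
  "qc_version T M D Ef u v \<longleftrightarrow> quasi_continuous T M D Ef v \<and> (AE x in M. u x = v x)"

text \<open>Quasi-regularity (Ma--Roeckner, Def. IV.3.1).\<close>
definition quasi_regular :: "'a topology \<Rightarrow> 'a measure \<Rightarrow> ('a \<Rightarrow> real) set
    \<Rightarrow> (('a \<Rightarrow> real) \<Rightarrow> ('a \<Rightarrow> real) \<Rightarrow> real) \<Rightarrow> bool" where
  "quasi_regular T M D Ef \<longleftrightarrow>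
     (\<exists>F. is_nest T M D Ef F \<and> (\<forall>k. compactin T (F k)))
   \<and> (\<exists>D0 \<subseteq> D. (\<forall>u\<in>D. \<forall>e>0. \<exists>v\<in>D0. E1 M Ef (fdiff u v) (fdiff u v) < e)
        \<and> (\<forall>u\<in>D0. \<exists>v. qc_version T M D Ef u v))
   \<and> (\<exists>u v N. (\<forall>n::nat. u n \<in> D \<and> qc_version T M D Ef (u n) (v n)) \<and> exceptional T M D Ef N
        \<and> (\<forall>x\<in>topspace T - N. \<forall>y\<in>topspace T - N. x \<noteq> y \<longrightarrow> (\<exists>n. v n x \<noteq> v n y)))"

text \<open>A distribution u is represented by its coefficients u k = <u, e_k>, k in Z^2.
The index (0,0) is the constant mode e_0 = 1.\<close>
type_synonym coeffs = "int \<times> int \<Rightarrow> real"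

definition lam :: "int \<times> int \<Rightarrow> real" where
  "lam k = pi\<^sup>2 * ((real_of_int (fst k))\<^sup>2 + (real_of_int (snd k))\<^sup>2)"

definition nz :: "(int \<times> int) set" where "nz = UNIV - {(0,0)}"

definition in_V :: "real \<Rightarrow> coeffs \<Rightarrow> bool" where
  "in_V \<alpha> u \<longleftrightarrow> (\<lambda>k. lam k powr \<alpha> * (u k)\<^sup>2) summable_on nz"

definition Vinner :: "real \<Rightarrow> coeffs \<Rightarrow> coeffs \<Rightarrow> real" where
  "Vinner \<alpha> u v = u (0,0) * v (0,0) + (\<Sum>\<^sub>\<infinity>k\<in>nz. lam k powr \<alpha> * u k * v k)"

definition Espace :: "real \<Rightarrow> coeffs set" where
  "Espace s0 = {u. in_V (-1 - s0) u}"

definition Estar :: "real \<Rightarrow> coeffs set" where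
  "Estar s0 = {u. in_V (s0 - 1) u}"

definition Qbar :: "coeffs \<Rightarrow> coeffs" where
  "Qbar u = (\<lambda>k. if k = (0,0) then u k else u k / lam k)"

definition pairing :: "coeffs \<Rightarrow> coeffs \<Rightarrow> real" where
  "pairing u v = (\<Sum>\<^sub>\<infinity>k. Qbar u k * v k)"

definition Edist :: "real \<Rightarrow> coeffs \<Rightarrow> coeffs \<Rightarrow> real" where
  "Edist s0 u v = sqrt (Vinner (-1 - s0) (\<lambda>k. u k - v k) (\<lambda>k. u k - v k))"

definition Etop :: "real \<Rightarrow> coeffs topology" where
  "Etop s0 = Metric_space.mtopology (Espace s0) (Edist s0)"

text \<open>Iterated partial derivatives of f : R^m -> R (R^m embedded as functions on nat
depending only on the first m coordinates).\<close>
fun pds :: "nat list \<Rightarrow> ((nat \<Rightarrow> real) \<Rightarrow> real) \<Rightarrow> (nat \<Rightarrow> real) \<Rightarrow> real" where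
  "pds [] f = f"
| "pds (i # is) f = (\<lambda>x. deriv (\<lambda>t. pds is f (x(i := t))) (x i))"

definition Cb_inf :: "nat \<Rightarrow> ((nat \<Rightarrow> real) \<Rightarrow> real) \<Rightarrow> bool" where
  "Cb_inf m f \<longleftrightarrow> (\<forall>x. f x = f (\<lambda>i. if i < m then x i else 0)) \<and>
     (\<forall>is. set is \<subseteq> {..<m} \<longrightarrow>
        continuous_on UNIV (pds is f) \<and> bounded (range (pds is f)) \<and>
        (\<forall>i<m. \<forall>x. (\<lambda>t. pds is f (x(i := t))) differentiable (at (x i))))"

definition FC :: "real \<Rightarrow> (coeffs \<Rightarrow> real) set" where
  "FC s0 = {\<phi>. \<exists>m f l. Cb_inf m f \<and> (\<forall>i<m. l i \<in> Estar s0) \<and>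
              \<phi> = (\<lambda>z. f (\<lambda>i. if i < m then pairing (l i) z else 0))}"

definition dirderiv :: "(coeffs \<Rightarrow> real) \<Rightarrow> coeffs \<Rightarrow> coeffs \<Rightarrow> real" where
  "dirderiv \<phi> z h = deriv (\<lambda>t. \<phi> (\<lambda>k. z k + t * h k)) 0"

definition grad :: "(coeffs \<Rightarrow> real) \<Rightarrow> coeffs \<Rightarrow> coeffs" where
  "grad \<phi> z = (THE g. in_V (-1) g \<and> (\<forall>h. in_V (-1) h \<longrightarrow> Vinner (-1) g h = dirderiv \<phi> z h))"

definition Pi0 :: "coeffs \<Rightarrow> coeffs" where
  "Pi0 h = h((0,0) := 0)"

text \<open>Real orthonormal trigonometric basis of L2([0,1]^2), e_(0,0) = 1.\<close>
definition ebasis :: "int \<times> int \<Rightarrow> real \<times> real \<Rightarrow> real" where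
  "ebasis k x =
     (let d = real_of_int (fst k) * fst x + real_of_int (snd k) * snd x in
      if k = (0,0) then 1
      else if 0 < fst k \<or> (fst k = 0 \<and> 0 < snd k) then sqrt 2 * cos (2 * pi * d)
      else sqrt 2 * sin (2 * pi * d))"

definition bump :: "real \<times> real \<Rightarrow> real" where
  "bump x = (if norm x < 1 then exp (- 1 / (1 - (norm x)\<^sup>2)) else 0)"

definition rho :: "real \<times> real \<Rightarrow> real" where
  "rho x = bump x / (\<integral>y. bump y \<partial>lborel)"

definition rho_eps :: "real \<Rightarrow> real \<times> real \<Rightarrow> real" where
  "rho_eps \<epsilon> x = rho ((1 / \<epsilon>) *\<^sub>R x) / \<epsilon>\<^sup>2"

definition conv_e :: "real \<Rightarrow> int \<times> int \<Rightarrow> real \<times> real \<Rightarrow> real" where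
  "conv_e \<epsilon> k x = (\<integral>y. rho_eps \<epsilon> y * ebasis k (x - y) \<partial>lborel)"

definition moll :: "real \<Rightarrow> coeffs \<Rightarrow> real \<times> real \<Rightarrow> real" where
  "moll \<epsilon> \<phi> x = (\<Sum>\<^sub>\<infinity>k. \<phi> k * conv_e \<epsilon> k x)"

definition gff :: "coeffs measure" where
  "gff = PiM UNIV (\<lambda>k. if k = (0,0) then return borel 0
                       else density lborel (normal_density 0 (1 / sqrt (lam k))))"

definition c_eps :: "real \<Rightarrow> real \<times> real \<Rightarrow> real" where
  "c_eps \<epsilon> x = (\<integral>\<phi>. (moll \<epsilon> \<phi> x)\<^sup>2 \<partial>gff)"

definition hermite4 :: "real \<Rightarrow> real" where
  "hermite4 t = t ^ 4 - 6 * t\<^sup>2 + 3"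

definition wick4_eps :: "real \<Rightarrow> coeffs \<Rightarrow> real \<times> real \<Rightarrow> real" where
  "wick4_eps \<epsilon> \<phi> x = (c_eps \<epsilon> x)\<^sup>2 * hermite4 (moll \<epsilon> \<phi> x / sqrt (c_eps \<epsilon> x))"

definition N_eps :: "real \<Rightarrow> coeffs \<Rightarrow> real" where
  "N_eps \<epsilon> \<phi> = (LINT x : {0..1} \<times> {0..1} | lborel. (1/4) * wick4_eps \<epsilon> \<phi> x * ebasis (0,0) x)"

definition Nphi :: "coeffs \<Rightarrow> real" where
  "Nphi = (SOME N. N \<in> borel_measurable gff \<and>
      ((\<lambda>\<epsilon>. \<integral>\<^sup>+ \<phi>. ennreal ((N_eps \<epsilon> \<phi> - N \<phi>)\<^sup>2) \<partial>gff) \<longlongrightarrow> 0) (at_right 0))"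

definition nu :: "coeffs measure" where
  "nu = density gff (\<lambda>\<phi>. ennreal (exp (- Nphi \<phi>) / (\<integral>\<psi>. exp (- Nphi \<psi>) \<partial>gff)))"

definition Eform :: "(coeffs \<Rightarrow> real) \<Rightarrow> (coeffs \<Rightarrow> real) \<Rightarrow> real" where
  "Eform \<phi> \<psi> = (1/2) * (\<integral>z. Vinner (-1) (Pi0 (grad \<phi> z)) (grad \<psi> z) \<partial>nu)"

end

theory Submission
  imports Defs
begin

text \<open>
  The interaction is an almost sure limit of functions that are polynomials of degree at most four in
  each coordinate, hence is itself such a polynomial for almost all values of the other coordinates.
  So along every \<open>e\<^sub>k\<close> the conditional density of \<open>\<nu>\<close> is a Gaussian times the exponential of a quartic,
  and one can integrate by parts after cutting off where the coordinate or the coefficients of the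
  quartic are large; no integrability of the logarithmic derivative is needed. Cauchy--Schwarz and
  removal of the cutoff make the energy lower semicontinuous along form-Cauchy sequences that tend to \<open>0\<close>,
  which is closability.

  The unit contraction is approximated by polynomials with derivative at most \<open>1 + \<epsilon>\<close>. For
  quasi-regularity let \<open>Q(z) = z\<^sub>0\<^sup>2 + \<Sum> z\<^sub>k\<^sup>2 / \<lambda>\<^sub>k\<close>: its sublevel sets are compact in \<open>E\<close>, and
  \<open>1 - exp (- Q / R)\<close> is a limit of cylinder functions of energy at most \<open>\<nu>(E) / R\<close>, so the
  complements of these sets have capacity tending to \<open>0\<close>.
\<close>

section \<open>Nonnegative forms and their closures\<close>

text \<open>The coefficients of the quartic along a mode \<open>k\<close> are measurable functions
  of the other modes with no moment bound at hand, so the adjoint of differentiation along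
  \<open>k\<close> is controlled only under the cutoff. There it is bounded, hence continuous on L2;
  the cutoff lies between 0 and 1 and tends to 1, so an energy density can be recovered from it.
  That an almost sure limit of quartics along a line is again a quartic rests on interpolation: five
  values determine such a polynomial linearly, so convergence at five points, which Fubini and the
  translation invariance of Lebesgue measure provide, gives convergence on the whole line. The
  almost sure limit comes from an explicit L2 distance: by orthogonality of Hermite polynomials it
  is a sum over frequency quadruples with k1+k2+k3+k4 = 0, weighted by the product of the
  1/\<open>lam\<close>, and in dimension two this weight is summable. Polynomials are the right
  approximants of the contraction because cylinder functions are bounded and form an algebra, so a
  C1 approximation on a compact interval suffices.\<close>

locale pos_form =
  fixes D :: "('a \<Rightarrow> real) set" and B :: "('a \<Rightarrow> real) \<Rightarrow> ('a \<Rightarrow> real) \<Rightarrow> real"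
  assumes lin: "u \<in> D \<Longrightarrow> v \<in> D \<Longrightarrow> (\<lambda>x. a * u x + b * v x) \<in> D"
    and sym: "u \<in> D \<Longrightarrow> v \<in> D \<Longrightarrow> B u v = B v u"
    and bil: "u \<in> D \<Longrightarrow> v \<in> D \<Longrightarrow> w \<in> D \<Longrightarrow>
      B (\<lambda>x. a * u x + b * v x) w = a * B u w + b * B v w"
    and pos: "u \<in> D \<Longrightarrow> 0 \<le> B u u"
begin

lemma expand:
  assumes "u \<in> D" "v \<in> D"
  shows "B (\<lambda>x. a * u x + b * v x) (\<lambda>x. a * u x + b * v x)
    = a\<^sup>2 * B u u + 2 * a * b * B u v + b\<^sup>2 * B v v"
proof -
  let ?s = "\<lambda>x. a * u x + b * v x"
  have s: "?s \<in> D" using assms lin by blast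
  have "B ?s ?s = a * B u ?s + b * B v ?s" using bil[OF assms s] .
  moreover have "B u ?s = a * B u u + b * B v u" 
    using sym[OF assms(1) s] bil[OF assms assms(1)] by simp
  moreover have "B v ?s = a * B u v + b * B v v"
    using sym[OF assms(2) s] bil[OF assms assms(2)] by simp
  ultimately show ?thesis using sym[OF assms] by (simp add: power2_eq_square algebra_simps)
qed

text \<open>The form may be degenerate, so the case \<open>B v v = 0\<close> is separate: there the
  energy of u + t v is affine in t and nonnegative, which forces its slope to vanish. Otherwise the
  energy of \<open>B v v\<close> u - \<open>B u v\<close> v is used, which avoids division.\<close>

lemma Cauchy_Schwarz:
  assumes "u \<in> D" "v \<in> D"
  shows "(B u v)\<^sup>2 \<le> B u u * B v v"
proof (cases "B v v = 0")
  case True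
  have ineq: "0 \<le> B u u + 2 * t * B u v" for t
    using pos[OF lin[OF assms, of 1 t]] expand[OF assms, of 1 t] True by simp
  have "B u v = 0"
  proof (rule ccontr)
    assume "B u v \<noteq> 0"
    then show False using ineq[of "- (B u u + 1) / (2 * B u v)"] by (simp add: field_simps)
  qed
  then show ?thesis using True by simp
next
  case False
  then have p: "B v v > 0" using pos[OF assms(2)] by simp
  have "0 \<le> (B v v)\<^sup>2 * B u u + 2 * B v v * (- B u v) * B u v + (- B u v)\<^sup>2 * B v v"
    using pos[OF lin[OF assms, of "B v v" "- B u v"]] expand[OF assms, of "B v v" "- B u v"] by simp
  also have "\<dots> = B v v * (B u u * B v v - (B u v)\<^sup>2)"
    by (simp add: power2_eq_square algebra_simps)
  finally show ?thesis using p by (simp add: zero_le_mult_iff)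
qed

text \<open>Only a seminorm: elements of \<open>D\<close> are functions rather than classes, and
  \<open>B\<close> may vanish on nonzero ones.\<close>

definition nrm :: "('a \<Rightarrow> real) \<Rightarrow> real" where "nrm u = sqrt (B u u)"

lemma nrm_nonneg: "u \<in> D \<Longrightarrow> 0 \<le> nrm u"
  by (simp add: nrm_def pos)

lemma nrm_sq: "u \<in> D \<Longrightarrow> (nrm u)\<^sup>2 = B u u"
  by (simp add: nrm_def pos)

lemma abs_le_nrm: "u \<in> D \<Longrightarrow> v \<in> D \<Longrightarrow> \<bar>B u v\<bar> \<le> nrm u * nrm v"
  using Cauchy_Schwarz[of u v] unfolding nrm_def
  by (metis real_sqrt_abs real_sqrt_le_mono real_sqrt_mult)

lemma add_mem: "u \<in> D \<Longrightarrow> v \<in> D \<Longrightarrow> (\<lambda>x. u x + v x) \<in> D"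
  using lin[of u v 1 1] by simp

lemma diff_mem: "u \<in> D \<Longrightarrow> v \<in> D \<Longrightarrow> fdiff u v \<in> D"
  using lin[of u v 1 "-1"] by (simp add: fdiff_def)

lemma scale_mem: "u \<in> D \<Longrightarrow> (\<lambda>x. c * u x) \<in> D"
  using lin[of u u c 0] by simp

lemma nrm_add: 
  assumes "u \<in> D" "v \<in> D"
  shows "nrm (\<lambda>x. u x + v x) \<le> nrm u + nrm v"
proof -
  have "B (\<lambda>x. u x + v x) (\<lambda>x. u x + v x) = B u u + 2 * B u v + B v v"
    using expand[OF assms, of 1 1] by simp
  also have "\<dots> \<le> (nrm u)\<^sup>2 + 2 * (nrm u * nrm v) + (nrm v)\<^sup>2"
    using abs_le_nrm[OF assms] nrm_sq assms by simp
  also have "\<dots> = (nrm u + nrm v)\<^sup>2" by (simp add: power2_sum)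
  finally show ?thesis unfolding nrm_def[of "\<lambda>x. u x + v x"]
    using nrm_nonneg assms by (meson add_nonneg_nonneg real_le_lsqrt)
qed

lemma nrm_triangle:
  assumes "u \<in> D" "v \<in> D" "w \<in> D"
  shows "nrm (fdiff u w) \<le> nrm (fdiff u v) + nrm (fdiff v w)"
proof -
  have "fdiff u w = (\<lambda>x. fdiff u v x + fdiff v w x)" by (simp add: fdiff_def)
  then show ?thesis using nrm_add diff_mem assms by metis
qed

lemma nrm_scale: "u \<in> D \<Longrightarrow> nrm (\<lambda>x. c * u x) = \<bar>c\<bar> * nrm u"
  using expand[of u u c 0] by (simp add: nrm_def real_sqrt_mult)

lemma nrm_commute: "u \<in> D \<Longrightarrow> v \<in> D \<Longrightarrow> nrm (fdiff u v) = nrm (fdiff v u)"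
  using nrm_scale[OF diff_mem, of u v "-1"] by (simp add: fdiff_def)

lemma B_diff_left: "u \<in> D \<Longrightarrow> v \<in> D \<Longrightarrow> w \<in> D \<Longrightarrow> B (fdiff u v) w = B u w - B v w"
  using bil[of u v w 1 "-1"] by (simp add: fdiff_def)

lemma B_diff_right: "u \<in> D \<Longrightarrow> v \<in> D \<Longrightarrow> w \<in> D \<Longrightarrow> B w (fdiff u v) = B w u - B w v"
  using B_diff_left sym diff_mem by metis

lemma B_lipschitz:
  assumes "u \<in> D" "u' \<in> D" "w \<in> D" "w' \<in> D"
  shows "\<bar>B u w - B u' w'\<bar> \<le> nrm (fdiff u u') * nrm w + nrm u' * nrm (fdiff w w')"
proof -
  have "B u w - B u' w' = B (fdiff u u') w + B u' (fdiff w w')"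
    using assms by (simp add: B_diff_left B_diff_right)
  then show ?thesis
    using abs_le_nrm[OF diff_mem[OF assms(1,2)] assms(3)] abs_le_nrm[OF assms(2) diff_mem[OF assms(3,4)]] by linarith
qed

lemma nrm_le_add_diff:
  assumes "u \<in> D" "v \<in> D" shows "nrm u \<le> nrm v + nrm (fdiff u v)"
proof -
  have "u = (\<lambda>x. v x + fdiff u v x)" by (simp add: fdiff_def)
  then show ?thesis using nrm_add[OF assms(2) diff_mem[OF assms]] by simp
qed

lemma form_cauchy_iff:
  assumes "\<And>n. u n \<in> D"
  shows "form_cauchy B u \<longleftrightarrow> (\<forall>e>0. \<exists>N. \<forall>n\<ge>N. \<forall>m\<ge>N. nrm (fdiff (u n) (u m)) < e)"
proof
  assume L: "form_cauchy B u"
  show "\<forall>e>0. \<exists>N. \<forall>n\<ge>N. \<forall>m\<ge>N. nrm (fdiff (u n) (u m)) < e"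
  proof (intro allI impI)
    fix e :: real assume "e > 0"
    then obtain N where "\<forall>n\<ge>N. \<forall>m\<ge>N. B (fdiff (u n) (u m)) (fdiff (u n) (u m)) < e\<^sup>2"
      using L unfolding form_cauchy_def by (meson zero_less_power)
    then show "\<exists>N. \<forall>n\<ge>N. \<forall>m\<ge>N. nrm (fdiff (u n) (u m)) < e"
      using \<open>e > 0\<close> unfolding nrm_def by (metis real_sqrt_less_mono real_sqrt_abs abs_of_pos)
  qed
next
  assume R: "\<forall>e>0. \<exists>N. \<forall>n\<ge>N. \<forall>m\<ge>N. nrm (fdiff (u n) (u m)) < e"
  show "form_cauchy B u" unfolding form_cauchy_def
  proof (intro allI impI)
    fix e :: real assume "e > 0"
    then obtain N where N: "\<forall>n\<ge>N. \<forall>m\<ge>N. nrm (fdiff (u n) (u m)) < sqrt e"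
      using R by (meson real_sqrt_gt_zero)
    show "\<exists>N. \<forall>n\<ge>N. \<forall>m\<ge>N. B (fdiff (u n) (u m)) (fdiff (u n) (u m)) < e"
      using N unfolding nrm_def by (auto)
  qed
qed

lemma cauchy_nrm_bounded:
  assumes "\<And>n. u n \<in> D" "form_cauchy B u"
  obtains C where "C \<ge> 0" "\<And>n. nrm (u n) \<le> C"
proof -
  obtain N where N: "\<forall>n\<ge>N. \<forall>m\<ge>N. nrm (fdiff (u n) (u m)) < 1"
    using assms form_cauchy_iff[of u] by (metis zero_less_one)
  define C where "C = (\<Sum>n\<le>N. nrm (u n)) + 1"
  have "nrm (u n) \<le> C" for n
  proof (cases "n \<le> N")
    case True
    then have "nrm (u n) \<le> (\<Sum>n\<le>N. nrm (u n))"
      using nrm_nonneg assms(1) by (intro member_le_sum) auto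
    then show ?thesis by (simp add: C_def)
  next
    case False
    then have "nrm (u n) \<le> nrm (u N) + 1"
      using nrm_le_add_diff[OF assms(1) assms(1), of n N] N 
      by (metis add_left_mono le_refl less_imp_le nat_le_linear order_trans)
    moreover have "nrm (u N) \<le> (\<Sum>n\<le>N. nrm (u n))"
      using nrm_nonneg assms(1) by (intro member_le_sum) auto
    ultimately show ?thesis by (simp add: C_def)
  qed
  moreover have "C \<ge> 0" using nrm_nonneg assms(1) by (auto simp: C_def intro!: add_nonneg_nonneg sum_nonneg)
  ultimately show thesis using that by blast
qed

lemma convergent_B:
  assumes u: "\<And>n. u n \<in> D" "form_cauchy B u" and w: "\<And>n. w n \<in> D" "form_cauchy B w"
  shows "convergent (\<lambda>n. B (u n) (w n))"
proof -
  obtain C where C: "C \<ge> 0" "\<And>n. nrm (u n) \<le> C" using cauchy_nrm_bounded[OF u] by blast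
  obtain C' where C': "C' \<ge> 0" "\<And>n. nrm (w n) \<le> C'" using cauchy_nrm_bounded[OF w] by blast
  define K where "K = C + C' + 1"
  have K: "K > 0" "C \<le> K" "C' \<le> K" using C C' by (auto simp: K_def)
  have "Cauchy (\<lambda>n. B (u n) (w n))"
  proof (rule metric_CauchyI)
    fix e :: real assume e: "e > 0"
    have e2: "e / (2 * K) > 0" using e K by simp
    obtain N1 where N1: "\<forall>n\<ge>N1. \<forall>m\<ge>N1. nrm (fdiff (u n) (u m)) < e / (2 * K)"
      using u form_cauchy_iff[of u] e2 by metis
    obtain N2 where N2: "\<forall>n\<ge>N2. \<forall>m\<ge>N2. nrm (fdiff (w n) (w m)) < e / (2 * K)"
      using w form_cauchy_iff[of w] e2 by metis
    show "\<exists>M. \<forall>m\<ge>M. \<forall>n\<ge>M. dist (B (u m) (w m)) (B (u n) (w n)) < e"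
    proof (intro exI allI impI)
      fix m n assume mn: "m \<ge> max N1 N2" "n \<ge> max N1 N2"
      have "\<bar>B (u m) (w m) - B (u n) (w n)\<bar> \<le> nrm (fdiff (u m) (u n)) * nrm (w m) + nrm (u n) * nrm (fdiff (w m) (w n))"
        using B_lipschitz u(1) w(1) by blast
      also have "\<dots> \<le> nrm (fdiff (u m) (u n)) * K + K * nrm (fdiff (w m) (w n))"
        using C C' K nrm_nonneg diff_mem u(1) w(1)
        by (intro add_mono mult_mono) (auto intro: order_trans)
      also have "\<dots> < e / (2 * K) * K + K * (e / (2 * K))"
        using N1 N2 mn K by (intro add_strict_mono mult_strict_right_mono mult_strict_left_mono) auto
      also have "\<dots> = e" using K by simp
      finally show "dist (B (u m) (w m)) (B (u n) (w n)) < e" by (simp add: dist_real_def)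
    qed
  qed
  then show ?thesis by (simp add: Cauchy_convergent_iff)
qed

text \<open>This makes the values of \<open>closure_form\<close> independent of the sequences chosen
  by \<open>SOME\<close>. Boundedness is known for the unprimed sequences only;
  \<open>nrm (u' n)\<close> is bounded through \<open>nrm (u n)\<close> and the difference.\<close>

lemma B_diff_tendsto_0:
  assumes u: "\<And>n. u n \<in> D" "form_cauchy B u" and w: "\<And>n. w n \<in> D" "form_cauchy B w"
    and u': "\<And>n. u' n \<in> D" "(\<lambda>n. nrm (fdiff (u n) (u' n))) \<longlonglongrightarrow> 0"
    and w': "\<And>n. w' n \<in> D" "(\<lambda>n. nrm (fdiff (w n) (w' n))) \<longlonglongrightarrow> 0"
  shows "(\<lambda>n. B (u n) (w n) - B (u' n) (w' n)) \<longlonglongrightarrow> 0"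
proof -
  obtain C where C: "C \<ge> 0" "\<And>n. nrm (u n) \<le> C" using cauchy_nrm_bounded[OF u] by blast
  obtain C' where C': "C' \<ge> 0" "\<And>n. nrm (w n) \<le> C'" using cauchy_nrm_bounded[OF w] by blast
  show ?thesis
  proof (rule Lim_null_comparison)
    show "\<forall>\<^sub>F n in sequentially. norm (B (u n) (w n) - B (u' n) (w' n)) \<le>
       nrm (fdiff (u n) (u' n)) * C' + (C + nrm (fdiff (u n) (u' n))) * nrm (fdiff (w n) (w' n))"
    proof (rule always_eventually, rule allI)
      fix n
      have "\<bar>B (u n) (w n) - B (u' n) (w' n)\<bar> \<le> nrm (fdiff (u n) (u' n)) * nrm (w n) + nrm (u' n) * nrm (fdiff (w n) (w' n))"
        using B_lipschitz u(1) w(1) u'(1) w'(1) by blast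
      moreover have "nrm (u' n) \<le> C + nrm (fdiff (u n) (u' n))"
        using nrm_le_add_diff[OF u'(1) u(1), of n n] nrm_commute[OF u'(1) u(1), of n n] C(2)[of n] by linarith
      ultimately show "norm (B (u n) (w n) - B (u' n) (w' n)) \<le>
        nrm (fdiff (u n) (u' n)) * C' + (C + nrm (fdiff (u n) (u' n))) * nrm (fdiff (w n) (w' n))"
        using C' nrm_nonneg diff_mem u(1) w(1) u'(1) w'(1)
        by (simp, meson add_mono mult_left_mono mult_right_mono order_trans)
    qed
    show "(\<lambda>n. nrm (fdiff (u n) (u' n)) * C' + (C + nrm (fdiff (u n) (u' n))) * nrm (fdiff (w n) (w' n))) \<longlonglongrightarrow> 0"
      using tendsto_add[OF tendsto_mult_right[OF u'(2), of C'] tendsto_mult[OF tendsto_add[OF tendsto_const u'(2), of C] w'(2)]] by (simp add: mult.commute)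
  qed
qed

end

section \<open>Square-integrable functions and their completeness\<close>

definition L2ip :: "'a measure \<Rightarrow> ('a \<Rightarrow> real) \<Rightarrow> ('a \<Rightarrow> real) \<Rightarrow> real" where
  "L2ip M u v = (\<integral>x. u x * v x \<partial>M)"

lemma L2_mult_integrable:
  assumes "u \<in> L2 M" "v \<in> L2 M" shows "integrable M (\<lambda>x. u x * v x)"
proof (rule Bochner_Integration.integrable_bound)
  show "integrable M (\<lambda>x. (u x)\<^sup>2 + (v x)\<^sup>2)" using assms by (auto simp: L2_def)
  show "(\<lambda>x. u x * v x) \<in> borel_measurable M" using assms by (auto simp: L2_def)
  show "AE x in M. norm (u x * v x) \<le> norm ((u x)\<^sup>2 + (v x)\<^sup>2)"
  proof (rule AE_I2)
    fix x
    have "0 \<le> (\<bar>u x\<bar> - \<bar>v x\<bar>)\<^sup>2" by simp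
    then have "2 * (\<bar>u x\<bar> * \<bar>v x\<bar>) \<le> (u x)\<^sup>2 + (v x)\<^sup>2" by (simp add: power2_diff)
    moreover have "0 \<le> \<bar>u x\<bar> * \<bar>v x\<bar>" by simp
    ultimately have "\<bar>u x\<bar> * \<bar>v x\<bar> \<le> (u x)\<^sup>2 + (v x)\<^sup>2" by linarith
    then show "norm (u x * v x) \<le> norm ((u x)\<^sup>2 + (v x)\<^sup>2)" by (simp add: abs_mult)
  qed
qed

lemma L2_lin: 
  assumes "u \<in> L2 M" "v \<in> L2 M" shows "(\<lambda>x. a * u x + b * v x) \<in> L2 M"
proof -
  have "(\<lambda>x. (a * u x + b * v x)\<^sup>2) = (\<lambda>x. a\<^sup>2 * (u x)\<^sup>2 + 2 * a * b * (u x * v x) + b\<^sup>2 * (v x)\<^sup>2)"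
    by (simp add: power2_eq_square algebra_simps)
  then show ?thesis using assms L2_mult_integrable[OF assms] by (auto simp: L2_def)
qed

interpretation L2: pos_form "L2 M" "L2ip M" for M
proof
  fix u v w :: "'a \<Rightarrow> real" and a b :: real
  show "u \<in> L2 M \<Longrightarrow> v \<in> L2 M \<Longrightarrow> (\<lambda>x. a * u x + b * v x) \<in> L2 M" by (rule L2_lin)
  show "L2ip M u v = L2ip M v u" by (simp add: L2ip_def mult.commute)
  show "0 \<le> L2ip M u u" by (simp add: L2ip_def)
  assume *: "u \<in> L2 M" "v \<in> L2 M" "w \<in> L2 M"
  have "(\<lambda>x. (a * u x + b * v x) * w x) = (\<lambda>x. a * (u x * w x) + b * (v x * w x))"
    by (simp add: algebra_simps)
  then show "L2ip M (\<lambda>x. a * u x + b * v x) w = a * L2ip M u w + b * L2ip M v w"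
    unfolding L2ip_def using L2_mult_integrable[OF *(1,3)] L2_mult_integrable[OF *(2,3)] by simp
qed

lemma l2dist2_eq: "l2dist2 M f g = L2ip M (fdiff f g) (fdiff f g)"
  by (simp add: l2dist2_def L2ip_def fdiff_def power2_eq_square)

lemma l2dist2_nonneg[simp]: "0 \<le> l2dist2 M f g"
  by (simp add: l2dist2_def)

lemma l2dist2_nrm: "sqrt (l2dist2 M f g) = L2.nrm M (fdiff f g)"
  by (simp add: l2dist2_eq L2.nrm_def)

lemma l2dist2_tendsto_iff: "((\<lambda>n. l2dist2 M (f n) (g n)) \<longlongrightarrow> 0) F \<longleftrightarrow> ((\<lambda>n. L2.nrm M (fdiff (f n) (g n))) \<longlongrightarrow> 0) F"
proof
  assume "((\<lambda>n. l2dist2 M (f n) (g n)) \<longlongrightarrow> 0) F"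
  from tendsto_real_sqrt[OF this] show "((\<lambda>n. L2.nrm M (fdiff (f n) (g n))) \<longlongrightarrow> 0) F"
    by (simp add: l2dist2_nrm)
next
  assume "((\<lambda>n. L2.nrm M (fdiff (f n) (g n))) \<longlongrightarrow> 0) F"
  from tendsto_power[OF this, of 2] show "((\<lambda>n. l2dist2 M (f n) (g n)) \<longlongrightarrow> 0) F"
    by (simp add: l2dist2_nrm[symmetric])
qed

text \<open>Riesz-Fischer for representatives. Along a fast subsequence the sum of 2^k times the
  squared increments is integrable, so the increments are summable almost everywhere; Fatou then
  turns the pointwise limit into an L2 limit of the whole sequence.\<close>

lemma L2_complete:
  fixes u :: "nat \<Rightarrow> 'a \<Rightarrow> real"
  assumes u: "\<And>n. u n \<in> L2 M"
    and cau: "\<And>e. e > 0 \<Longrightarrow> \<exists>N. \<forall>n\<ge>N. \<forall>m\<ge>N. l2dist2 M (u n) (u m) < e"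
  obtains w where "w \<in> L2 M" "(\<lambda>n. l2dist2 M (u n) w) \<longlonglongrightarrow> 0"
proof -
  have [measurable]: "u n \<in> borel_measurable M" for n using u by (auto simp: L2_def)
  have "\<exists>N. \<forall>n\<ge>N. \<forall>m\<ge>N. l2dist2 M (u n) (u m) < (1/4)^k" for k :: nat
    by (rule cau) simp
  then obtain N0 where N0: "\<And>k n m. n \<ge> N0 k \<Longrightarrow> m \<ge> N0 k \<Longrightarrow> l2dist2 M (u n) (u m) < (1/4::real)^k"
    by metis
  \<comment> \<open>Adding the index \<open>k\<close> to the partial sums of \<open>N0\<close> gives
    \<open>r k \<ge> k\<close> together with \<open>r k \<ge> N0 k\<close> and makes
    \<open>r\<close> increasing, so both \<open>r k\<close> and \<open>r (Suc k)\<close> lie beyond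
    \<open>N0 k\<close>.\<close>
  define r where "r k = k + (\<Sum>j\<le>k. N0 j)" for k
  have rN: "r k \<ge> N0 k" "r (Suc k) \<ge> N0 k" for k
  proof -
    have "N0 k \<le> (\<Sum>j\<le>k. N0 j)" by (rule member_le_sum) auto
    then show "r k \<ge> N0 k" "r (Suc k) \<ge> N0 k" by (auto simp: r_def)
  qed
  have r_ge: "r k \<ge> k" for k by (simp add: r_def)
  define d where "d k x = u (r (Suc k)) x - u (r k) x" for k x
  have [measurable]: "d k \<in> borel_measurable M" for k unfolding d_def by measurable
  have dint: "integrable M (\<lambda>x. (d k x)\<^sup>2)" for k
    using L2.diff_mem[OF u u, of "r (Suc k)" "r k"] by (simp add: d_def fdiff_def L2_def)
  have dn: "(\<integral>\<^sup>+x. ennreal (2^k * (d k x)\<^sup>2) \<partial>M) \<le> ennreal ((1/2)^k)" for k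
  proof -
    have eq: "(\<integral>\<^sup>+x. ennreal (2^k * (d k x)\<^sup>2) \<partial>M) = ennreal (2^k * (\<integral>x. (d k x)\<^sup>2 \<partial>M))"
      using dint by (subst nn_integral_eq_integral) auto
    have "(\<integral>x. (d k x)\<^sup>2 \<partial>M) \<le> (1/4)^k"
      using N0[OF rN(2) rN(1), of k] by (simp add: l2dist2_def d_def)
    then have "ennreal (2^k * (\<integral>x. (d k x)\<^sup>2 \<partial>M)) \<le> ennreal (2^k * (1/4)^k)"
      by (intro ennreal_leI) simp
    also have "(2::real)^k * (1/4)^k = (1/2)^k"
      by (simp add: power_mult_distrib[symmetric])
    finally show ?thesis using eq by simp
  qed
  have "(\<integral>\<^sup>+x. (\<Sum>k. ennreal (2^k * (d k x)\<^sup>2)) \<partial>M) = (\<Sum>k. \<integral>\<^sup>+x. ennreal (2^k * (d k x)\<^sup>2) \<partial>M)"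
    by (rule nn_integral_suminf) simp
  also have "\<dots> \<le> (\<Sum>k. ennreal ((1/2)^k))"
    by (intro suminf_le dn summableI)
  also have "\<dots> = ennreal (\<Sum>k. (1/2::real)^k)"
    by (rule suminf_ennreal2) auto
  also have "\<dots> < \<infinity>" by simp
  finally have "AE x in M. (\<Sum>k. ennreal (2^k * (d k x)\<^sup>2)) \<noteq> \<infinity>"
    by (intro nn_integral_PInf_AE) auto
  then have conv: "AE x in M. convergent (\<lambda>k. u (r k) x)"
  proof eventually_elim
    case (elim x)
    have s: "summable (\<lambda>k. 2^k * (d k x)\<^sup>2)"
      using elim by (intro summable_suminf_not_top) (auto simp: top_ennreal_def infinity_ennreal_def)
    have "summable (\<lambda>k. ((1/2)^k + 2^k * (d k x)\<^sup>2))"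
      by (intro summable_add s summable_geometric) simp
    then have "summable (\<lambda>k. d k x)"
    proof (rule summable_comparison_test')
      fix k
      \<comment> \<open>Expanding this square gives 2|d| <= 2^-k + 2^k d^2, and both terms on the
        right are summable.\<close>
      have "0 \<le> (1/2)^k * (1 - 2^k * \<bar>d k x\<bar>)\<^sup>2" by simp
      also have "\<dots> = (1/2)^k - 2 * \<bar>d k x\<bar> + 2^k * (d k x)\<^sup>2"
        by (simp add: power2_eq_square algebra_simps power_one_over)
      finally show "norm (d k x) \<le> (1/2)^k + 2^k * (d k x)\<^sup>2"
        using abs_ge_zero[of "d k x"] unfolding real_norm_def by linarith
    qed
    then have "convergent (\<lambda>n. \<Sum>k<n. d k x)" by (simp add: summable_iff_convergent)
    moreover have "(\<Sum>k<n. d k x) = u (r n) x - u (r 0) x" for n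
      by (induction n) (auto simp: d_def)
    ultimately have "convergent (\<lambda>n. u (r n) x - u (r 0) x)" by simp
    from convergent_add[OF this convergent_const[of "u (r 0) x"]] show ?case by simp
  qed
  \<comment> \<open>Off the convergence set \<open>lim\<close> has an arbitrary value;
    \<open>w\<close> is still measurable, and that set is null.\<close>
  define w where "w x = lim (\<lambda>k. u (r k) x)" for x
  have [measurable]: "w \<in> borel_measurable M" unfolding w_def by measurable
  have lim: "AE x in M. (\<lambda>k. u (r k) x) \<longlonglongrightarrow> w x"
    using conv by eventually_elim (simp add: w_def convergent_LIMSEQ_iff)
  have fat: "(\<integral>\<^sup>+x. ennreal ((u n x - w x)\<^sup>2) \<partial>M) \<le> ennreal e"
    if e: "e > 0" and n: "\<forall>m\<ge>N. l2dist2 M (u n) (u m) < e" for n e N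
  proof -
    have "(\<integral>\<^sup>+x. ennreal ((u n x - w x)\<^sup>2) \<partial>M) = (\<integral>\<^sup>+x. liminf (\<lambda>k. ennreal ((u n x - u (r k) x)\<^sup>2)) \<partial>M)"
    proof (rule nn_integral_cong_AE, use lim in eventually_elim)
      case (elim x)
      have "(\<lambda>k. ennreal ((u n x - u (r k) x)\<^sup>2)) \<longlonglongrightarrow> ennreal ((u n x - w x)\<^sup>2)"
        using elim by (intro tendsto_intros)
      from lim_imp_Liminf[OF _ this] show ?case by simp
    qed
    also have "\<dots> \<le> liminf (\<lambda>k. \<integral>\<^sup>+x. ennreal ((u n x - u (r k) x)\<^sup>2) \<partial>M)"
      by (rule nn_integral_liminf) simp
    also have "\<dots> \<le> liminf (\<lambda>k. ennreal e)"
    proof (rule Liminf_mono, rule eventually_sequentiallyI)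
      fix k assume "k \<ge> N"
      then have "r k \<ge> N" using r_ge[of k] by simp
      then have l: "l2dist2 M (u n) (u (r k)) < e" using n by blast
      have "integrable M (\<lambda>x. (u n x - u (r k) x)\<^sup>2)"
        using L2.diff_mem[OF u u] by (auto simp: fdiff_def L2_def)
      then have "(\<integral>\<^sup>+x. ennreal ((u n x - u (r k) x)\<^sup>2) \<partial>M) = ennreal (l2dist2 M (u n) (u (r k)))"
        unfolding l2dist2_def by (intro nn_integral_eq_integral) auto
      then show "(\<integral>\<^sup>+x. ennreal ((u n x - u (r k) x)\<^sup>2) \<partial>M) \<le> ennreal e"
        using l by (simp add: ennreal_leI)
    qed
    finally show ?thesis by (simp add: Liminf_const)
  qed
  have intd: "integrable M (\<lambda>x. (u n x - w x)\<^sup>2) \<and> l2dist2 M (u n) w \<le> e"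
    if e: "e > 0" and n: "\<forall>m\<ge>N. l2dist2 M (u n) (u m) < e" for n e N
  proof -
    have f: "(\<integral>\<^sup>+x. ennreal ((u n x - w x)\<^sup>2) \<partial>M) \<le> ennreal e" using fat[OF e n] .
    have "integrable M (\<lambda>x. (u n x - w x)\<^sup>2)"
      using f by (intro integrableI_bounded) (auto intro: le_less_trans)
    moreover from this have "ennreal (l2dist2 M (u n) w) \<le> ennreal e"
      using f unfolding l2dist2_def by (subst nn_integral_eq_integral[symmetric]) auto
    ultimately show ?thesis using e by simp
  qed
  have "w \<in> L2 M"
  proof -
    obtain N where "\<forall>n\<ge>N. \<forall>m\<ge>N. l2dist2 M (u n) (u m) < 1" using cau[of 1] by auto
    then have "integrable M (\<lambda>x. (u N x - w x)\<^sup>2)" using intd[of 1 N N] by auto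
    then have "fdiff (u N) w \<in> L2 M" by (simp add: L2_def fdiff_def)
    from L2.diff_mem[OF u this, of N] show ?thesis by (simp add: fdiff_def)
  qed
  moreover have "(\<lambda>n. l2dist2 M (u n) w) \<longlonglongrightarrow> 0"
  proof (rule LIMSEQ_I)
    fix e :: real assume "e > 0"
    then obtain N where "\<forall>n\<ge>N. \<forall>m\<ge>N. l2dist2 M (u n) (u m) < e/2" using cau[of "e/2"] by auto
    then have "\<forall>n\<ge>N. l2dist2 M (u n) w \<le> e/2" using intd[of "e/2" N] \<open>e > 0\<close> by auto
    then show "\<exists>no. \<forall>n\<ge>no. norm (l2dist2 M (u n) w - 0) < e"
      using \<open>e > 0\<close> by (intro exI[of _ N]) auto
  qed
  ultimately show thesis using that by blast
qed

lemma fdiff_fdiff: "fdiff (fdiff a b) (fdiff c d) = fdiff (fdiff a c) (fdiff b d)"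
  by (simp add: fdiff_def fun_eq_iff)

lemma fdiff_lin: "fdiff (\<lambda>x. a * u x + b * v x) (\<lambda>x. a * u' x + b * v' x)
    = (\<lambda>x. a * fdiff u u' x + b * fdiff v v' x)"
  by (simp add: fdiff_def algebra_simps fun_eq_iff)

section \<open>The closure of a closable form\<close>

locale closable_pos_form = pos_form D Ef for D :: "('a \<Rightarrow> real) set" and Ef +
  fixes M :: "'a measure"
  assumes closable: "closable_form M D Ef"
begin

abbreviation "cD \<equiv> closure_dom M D Ef"
abbreviation "cE \<equiv> closure_form M D Ef"

lemma D_L2: "u \<in> D \<Longrightarrow> u \<in> L2 M"
  using closable by (auto simp: closable_form_def)

lemma closable_nrm:
  assumes "\<And>n. u n \<in> D" "(\<lambda>n. l2dist2 M (u n) (\<lambda>_. 0)) \<longlonglongrightarrow> 0" "form_cauchy Ef u"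
  shows "(\<lambda>n. nrm (u n)) \<longlonglongrightarrow> 0"
proof -
  have "(\<lambda>n. Ef (u n) (u n)) \<longlonglongrightarrow> 0"
    using closable[unfolded closable_form_def, THEN conjunct2, rule_format, of u] assms by simp
  from tendsto_real_sqrt[OF this] show ?thesis by (simp add: nrm_def)
qed

lemma approximates_nrm: 
  assumes "approximates M D Ef v u" shows "(\<lambda>n. L2.nrm M (fdiff (v n) u)) \<longlonglongrightarrow> 0"
proof -
  have "(\<lambda>n. l2dist2 M (v n) u) \<longlonglongrightarrow> 0" using assms by (simp add: approximates_def)
  then show ?thesis by (rule l2dist2_tendsto_iff[THEN iffD1])
qed

text \<open>The differences tend to 0 in L2 and are form-Cauchy, since both sequences are;
  closability then sends their energy to 0. That the closed form is well defined rests on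
  this.\<close>

lemma approximates_diff:
  assumes v: "approximates M D Ef v u" and v': "approximates M D Ef v' u" and u: "u \<in> L2 M"
  shows "(\<lambda>n. nrm (fdiff (v n) (v' n))) \<longlonglongrightarrow> 0"
proof (rule closable_nrm[of "\<lambda>n. fdiff (v n) (v' n)"])
  have mem: "v n \<in> D" "v' n \<in> D" for n using v v' by (simp_all only: approximates_def)
  show "fdiff (v n) (v' n) \<in> D" for n using mem diff_mem by blast
  have lim0: "(\<lambda>n. L2.nrm M (fdiff (v n) u) + L2.nrm M (fdiff (v' n) u)) \<longlonglongrightarrow> 0 + 0"
    by (rule tendsto_add[OF approximates_nrm[OF v] approximates_nrm[OF v']])
  have "(\<lambda>n. L2.nrm M (fdiff (v n) (v' n))) \<longlonglongrightarrow> 0"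
  proof (rule Lim_null_comparison[OF always_eventually lim0[simplified]], rule allI)
    fix n
    show "norm (L2.nrm M (fdiff (v n) (v' n))) \<le> L2.nrm M (fdiff (v n) u) + L2.nrm M (fdiff (v' n) u)"
      using L2.nrm_triangle[OF D_L2[OF mem(1)] u D_L2[OF mem(2)], of n n] L2.nrm_commute[OF u D_L2[OF mem(2)], of n]
        L2.nrm_nonneg[OF L2.diff_mem[OF D_L2[OF mem(1)] D_L2[OF mem(2)]], of n n] by simp
  qed
  then show "(\<lambda>n. l2dist2 M (fdiff (v n) (v' n)) (\<lambda>_. 0)) \<longlonglongrightarrow> 0"
    by (intro l2dist2_tendsto_iff[THEN iffD2]) (simp add: fdiff_def)
  show "form_cauchy Ef (\<lambda>n. fdiff (v n) (v' n))"
    unfolding form_cauchy_iff[of "\<lambda>n. fdiff (v n) (v' n)", OF diff_mem[OF mem]]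
  proof (intro allI impI)
    fix e :: real assume "e > 0"
    then have e: "e/2 > 0" by simp
    obtain N1 where N1: "\<forall>n\<ge>N1. \<forall>m\<ge>N1. nrm (fdiff (v n) (v m)) < e/2"
      using v e form_cauchy_iff[of v, OF mem(1)] unfolding approximates_def by meson
    obtain N2 where N2: "\<forall>n\<ge>N2. \<forall>m\<ge>N2. nrm (fdiff (v' n) (v' m)) < e/2"
      using v' e form_cauchy_iff[of v', OF mem(2)] unfolding approximates_def by meson
    show "\<exists>N. \<forall>n\<ge>N. \<forall>m\<ge>N. nrm (fdiff (fdiff (v n) (v' n)) (fdiff (v m) (v' m))) < e"
    proof (intro exI allI impI)
      fix n m assume nm: "n \<ge> max N1 N2" "m \<ge> max N1 N2"
      let ?a = "fdiff (v n) (v m)" let ?b = "fdiff (v' n) (v' m)"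
      have ab: "?a \<in> D" "?b \<in> D" using mem diff_mem by blast+
      have z: "(\<lambda>_. 0) \<in> D" using scale_mem[OF ab(1), of 0] by simp
      have "nrm ?a < e/2" "nrm ?b < e/2" using N1 N2 nm by auto
      moreover have "nrm (fdiff ?a ?b) \<le> nrm (fdiff ?a (\<lambda>_. 0)) + nrm (fdiff (\<lambda>_. 0) ?b)"
        using nrm_triangle[OF ab(1) z ab(2)] .
      moreover have "nrm (fdiff ?a (\<lambda>_. 0)) = nrm ?a" "nrm (fdiff (\<lambda>_. 0) ?b) = nrm ?b"
        using nrm_commute[OF z ab(2)] by (simp_all add: fdiff_def)
      ultimately have "nrm (fdiff ?a ?b) < e" by linarith
      then show "nrm (fdiff (fdiff (v n) (v' n)) (fdiff (v m) (v' m))) < e"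
        by (simp add: fdiff_fdiff)
    qed
  qed
qed

text \<open>Any approximating sequences are compared with the ones picked by \<open>SOME\<close>.
  The algebraic laws of the closed form then become limits of the laws on \<open>D\<close>.\<close>

lemma closure_form_limit:
  assumes v: "approximates M D Ef v u" and u: "u \<in> L2 M" 
    and w: "approximates M D Ef w t" and t: "t \<in> L2 M"
  shows "(\<lambda>n. Ef (v n) (w n)) \<longlonglongrightarrow> cE u t"
proof -
  define v' where "v' = (SOME v. approximates M D Ef v u)"
  define w' where "w' = (SOME v. approximates M D Ef v t)"
  have v': "approximates M D Ef v' u" unfolding v'_def using v by (rule someI[of "\<lambda>v. approximates M D Ef v u"])
  have w': "approximates M D Ef w' t" unfolding w'_def using w by (rule someI[of "\<lambda>v. approximates M D Ef v t"])
  have "convergent (\<lambda>n. Ef (v' n) (w' n))"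
    using v' w' by (intro convergent_B) (auto simp: approximates_def)
  then have l: "(\<lambda>n. Ef (v' n) (w' n)) \<longlonglongrightarrow> cE u t"
    unfolding closure_form_def v'_def[symmetric] w'_def[symmetric] by (simp add: convergent_LIMSEQ_iff)
  have "(\<lambda>n. Ef (v n) (w n) - Ef (v' n) (w' n)) \<longlonglongrightarrow> 0"
    using v w v' w' approximates_diff[OF v v' u] approximates_diff[OF w w' t]
    by (intro B_diff_tendsto_0) (auto simp: approximates_def)
  from tendsto_add[OF this l] show ?thesis by simp
qed

lemma closure_domE:
  assumes "u \<in> cD" obtains v where "u \<in> L2 M" "approximates M D Ef v u" "\<And>n. v n \<in> D"
  using assms that by (auto simp: closure_dom_def approximates_def)

lemma approximates_lin:
  assumes v: "approximates M D Ef v u" and u: "u \<in> L2 M" 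
    and w: "approximates M D Ef w t" and t: "t \<in> L2 M"
  shows "approximates M D Ef (\<lambda>n x. a * v n x + b * w n x) (\<lambda>x. a * u x + b * t x)"
  unfolding approximates_def
proof (intro conjI allI)
  have mem: "v n \<in> D" "w n \<in> D" for n using v w by (auto simp: approximates_def)
  show mem2: "(\<lambda>x. a * v n x + b * w n x) \<in> D" for n using mem lin by blast
  have bd: "nrm (fdiff (\<lambda>x. a * v n x + b * w n x) (\<lambda>x. a * v m x + b * w m x)) \<le>
      \<bar>a\<bar> * nrm (fdiff (v n) (v m)) + \<bar>b\<bar> * nrm (fdiff (w n) (w m))" for n m
    unfolding fdiff_lin
    using nrm_add[OF scale_mem scale_mem, OF diff_mem diff_mem, OF mem(1) mem(1) mem(2) mem(2), of a n m b n m]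
      by (simp add: nrm_scale[OF diff_mem[OF mem(1) mem(1)]] nrm_scale[OF diff_mem[OF mem(2) mem(2)]])
  have bd2: "L2.nrm M (fdiff (\<lambda>x. a * v n x + b * w n x) (\<lambda>x. a * u x + b * t x)) \<le>
      \<bar>a\<bar> * L2.nrm M (fdiff (v n) u) + \<bar>b\<bar> * L2.nrm M (fdiff (w n) t)" for n
    unfolding fdiff_lin
    using L2.nrm_add[OF L2.scale_mem L2.scale_mem, OF L2.diff_mem L2.diff_mem, OF D_L2[OF mem(1)] u D_L2[OF mem(2)] t, of a n b n]
      by (simp add: L2.nrm_scale[OF L2.diff_mem[OF D_L2[OF mem(1)] u]] L2.nrm_scale[OF L2.diff_mem[OF D_L2[OF mem(2)] t]])
  have lim0: "(\<lambda>n. \<bar>a\<bar> * L2.nrm M (fdiff (v n) u) + \<bar>b\<bar> * L2.nrm M (fdiff (w n) t)) \<longlonglongrightarrow> \<bar>a\<bar> * 0 + \<bar>b\<bar> * 0"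
    by (rule tendsto_add[OF tendsto_mult_left[OF approximates_nrm[OF v]] tendsto_mult_left[OF approximates_nrm[OF w]]])
  show "(\<lambda>n. l2dist2 M (\<lambda>x. a * v n x + b * w n x) (\<lambda>x. a * u x + b * t x)) \<longlonglongrightarrow> 0"
  proof (rule l2dist2_tendsto_iff[THEN iffD2], rule Lim_null_comparison[OF always_eventually lim0[simplified]], rule allI)
    fix n
    have "fdiff (\<lambda>x. a * v n x + b * w n x) (\<lambda>x. a * u x + b * t x) \<in> L2 M"
      by (intro L2.diff_mem L2_lin D_L2 mem u t)
    from L2.nrm_nonneg[OF this] show "norm (L2.nrm M (fdiff (\<lambda>x. a * v n x + b * w n x) (\<lambda>x. a * u x + b * t x)))
      \<le> \<bar>a\<bar> * L2.nrm M (fdiff (v n) u) + \<bar>b\<bar> * L2.nrm M (fdiff (w n) t)"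
      using bd2[of n] by simp
  qed
  show "form_cauchy Ef (\<lambda>n x. a * v n x + b * w n x)"
    unfolding form_cauchy_iff[of "\<lambda>n x. a * v n x + b * w n x", OF mem2]
  proof (intro allI impI)
    fix e :: real assume "e > 0"
    define K where "K = \<bar>a\<bar> + \<bar>b\<bar> + 1"
    have K: "K > 0" by (simp add: K_def add_nonneg_pos)
    then have e: "e/K > 0" using \<open>e > 0\<close> by simp
    obtain N1 where N1: "\<forall>n\<ge>N1. \<forall>m\<ge>N1. nrm (fdiff (v n) (v m)) < e/K"
      using v e form_cauchy_iff[of v, OF mem(1)] unfolding approximates_def by meson
    obtain N2 where N2: "\<forall>n\<ge>N2. \<forall>m\<ge>N2. nrm (fdiff (w n) (w m)) < e/K"
      using w e form_cauchy_iff[of w, OF mem(2)] unfolding approximates_def by meson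
    show "\<exists>N. \<forall>n\<ge>N. \<forall>m\<ge>N. nrm (fdiff (\<lambda>x. a * v n x + b * w n x) (\<lambda>x. a * v m x + b * w m x)) < e"
    proof (intro exI allI impI)
      fix n m assume nm: "n \<ge> max N1 N2" "m \<ge> max N1 N2"
      have "nrm (fdiff (\<lambda>x. a * v n x + b * w n x) (\<lambda>x. a * v m x + b * w m x)) \<le>
        \<bar>a\<bar> * nrm (fdiff (v n) (v m)) + \<bar>b\<bar> * nrm (fdiff (w n) (w m))" by (rule bd)
      also have "\<dots> \<le> \<bar>a\<bar> * (e/K) + \<bar>b\<bar> * (e/K)"
        using N1 N2 nm by (intro add_mono mult_left_mono) (auto intro: less_imp_le)
      also have "\<dots> < (\<bar>a\<bar> + \<bar>b\<bar> + 1) * (e/K)" using e unfolding distrib_right by linarith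
      also have "\<dots> = e" using K by (simp add: K_def)
      finally show "nrm (fdiff (\<lambda>x. a * v n x + b * w n x) (\<lambda>x. a * v m x + b * w m x)) < e" .
    qed
  qed
qed

lemma pos_form_closure: "pos_form cD cE"
proof
  fix u v w :: "'a \<Rightarrow> real" and a b :: real
  assume u: "u \<in> cD" and v: "v \<in> cD"
  obtain un where un: "u \<in> L2 M" "approximates M D Ef un u" "\<And>n. un n \<in> D" using closure_domE[OF u] by blast
  obtain vn where vn: "v \<in> L2 M" "approximates M D Ef vn v" "\<And>n. vn n \<in> D" using closure_domE[OF v] by blast
  have s: "approximates M D Ef (\<lambda>n x. a * un n x + b * vn n x) (\<lambda>x. a * u x + b * v x)"
    using approximates_lin un vn by blast
  show mem: "(\<lambda>x. a * u x + b * v x) \<in> cD"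
    using s L2_lin un vn by (auto simp: closure_dom_def)
  show "cE u v = cE v u"
  proof (rule LIMSEQ_unique)
    show "(\<lambda>n. Ef (un n) (vn n)) \<longlonglongrightarrow> cE u v" using closure_form_limit un vn by blast
    have "(\<lambda>n. Ef (vn n) (un n)) \<longlonglongrightarrow> cE v u" using closure_form_limit un vn by blast
    then show "(\<lambda>n. Ef (un n) (vn n)) \<longlonglongrightarrow> cE v u" using sym un vn by simp
  qed
  assume "w \<in> cD"
  then obtain wn where wn: "w \<in> L2 M" "approximates M D Ef wn w" "\<And>n. wn n \<in> D" using closure_domE by blast
  show "cE (\<lambda>x. a * u x + b * v x) w = a * cE u w + b * cE v w"
  proof (rule LIMSEQ_unique)
    show "(\<lambda>n. Ef (\<lambda>x. a * un n x + b * vn n x) (wn n)) \<longlonglongrightarrow> cE (\<lambda>x. a * u x + b * v x) w"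
      using closure_form_limit[OF s] L2_lin un vn wn by blast
    have "(\<lambda>n. a * Ef (un n) (wn n) + b * Ef (vn n) (wn n)) \<longlonglongrightarrow> a * cE u w + b * cE v w"
      using closure_form_limit un vn wn by (intro tendsto_intros) blast+
    then show "(\<lambda>n. Ef (\<lambda>x. a * un n x + b * vn n x) (wn n)) \<longlonglongrightarrow> a * cE u w + b * cE v w"
      using bil un vn wn by simp
  qed
next
  fix u assume "u \<in> cD"
  then obtain un where un: "u \<in> L2 M" "approximates M D Ef un u" "\<And>n. un n \<in> D" using closure_domE by blast
  show "0 \<le> cE u u"
    using closure_form_limit[OF un(2,1) un(2,1)] pos un by (intro LIMSEQ_le_const) auto
qed

sublocale cl: pos_form cD cE by (rule pos_form_closure)

lemma approximates_const: "u \<in> D \<Longrightarrow> approximates M D Ef (\<lambda>_. u) u"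
  using bil[of u u "fdiff u u" 0 0] diff_mem[of u u] by (auto simp: approximates_def l2dist2_def form_cauchy_def fdiff_def)

lemma D_cD: "u \<in> D \<Longrightarrow> u \<in> cD"
  using approximates_const D_L2 by (auto simp: closure_dom_def)

lemma cE_eq: "u \<in> D \<Longrightarrow> v \<in> D \<Longrightarrow> cE u v = Ef u v"
  using closure_form_limit[OF approximates_const D_L2 approximates_const D_L2, of u v]
  by (simp add: tendsto_const_iff)

lemma cl_nrm_eq: "u \<in> D \<Longrightarrow> cl.nrm u = nrm u"
  by (simp add: cl.nrm_def nrm_def cE_eq)

lemma cD_L2: "u \<in> cD \<Longrightarrow> u \<in> L2 M"
  by (simp add: closure_dom_def)

text \<open>For fixed \<open>n\<close> the norms of v n - v m tend, as m grows, to the closed norm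
  of v n - u, so the Cauchy bound survives the limit.\<close>

lemma approximates_cl_tendsto:
  assumes v: "approximates M D Ef v u" and u: "u \<in> cD"
  shows "(\<lambda>n. cl.nrm (fdiff (v n) u)) \<longlonglongrightarrow> 0"
proof (rule LIMSEQ_I)
  fix e :: real assume "e > 0"
  then have e: "e/2 > 0" by simp
  have mem: "v n \<in> D" for n using v by (auto simp: approximates_def)
  obtain N where N: "\<forall>n\<ge>N. \<forall>m\<ge>N. nrm (fdiff (v n) (v m)) < e/2"
    using v e form_cauchy_iff[of v, OF mem] unfolding approximates_def by meson
  have "cl.nrm (fdiff (v n) u) \<le> e/2" if n: "n \<ge> N" for n
  proof -
    have "approximates M D Ef (\<lambda>m x. 1 * v n x + (-1) * v m x) (\<lambda>x. 1 * v n x + (-1) * u x)"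
      by (rule approximates_lin[OF approximates_const[OF mem] D_L2[OF mem] v cD_L2[OF u]])
    then have ap: "approximates M D Ef (\<lambda>m. fdiff (v n) (v m)) (fdiff (v n) u)" by (simp add: fdiff_def)
    have l2: "fdiff (v n) u \<in> L2 M" using mem D_L2 cD_L2[OF u] L2.diff_mem by blast
    have "(\<lambda>m. nrm (fdiff (v n) (v m))) \<longlonglongrightarrow> cl.nrm (fdiff (v n) u)"
      unfolding nrm_def cl.nrm_def by (intro tendsto_real_sqrt closure_form_limit[OF ap l2 ap l2])
    moreover have "\<forall>m\<ge>N. nrm (fdiff (v n) (v m)) \<le> e/2" using N n less_imp_le by blast
    ultimately show ?thesis by (intro LIMSEQ_le_const2[of _ "cl.nrm (fdiff (v n) u)"]) blast+
  qed
  moreover have "0 \<le> cl.nrm (fdiff (v n) u)" for n using mem D_cD u cl.nrm_nonneg cl.diff_mem by blast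
  moreover have "e/2 < e" using \<open>e > 0\<close> by simp
  ultimately show "\<exists>no. \<forall>n\<ge>no. norm (cl.nrm (fdiff (v n) u) - 0) < e"
    by (intro exI[of _ N] allI impI) (metis abs_of_nonneg diff_zero le_less_trans real_norm_def)
qed

lemma D_dense_cD:
  assumes "u \<in> cD" "e > 0"
  obtains v where "v \<in> D" "cl.nrm (fdiff v u) < e" "l2dist2 M v u < e"
proof -
  obtain v where v: "approximates M D Ef v u" using closure_domE[OF assms(1)] by blast
  have "\<forall>\<^sub>F n in sequentially. cl.nrm (fdiff (v n) u) < e \<and> l2dist2 M (v n) u < e"
    using v by (intro eventually_conj order_tendstoD(2)[OF _ assms(2)] approximates_cl_tendsto[OF v assms(1)])
      (simp add: approximates_def)
  then obtain n where "cl.nrm (fdiff (v n) u) < e \<and> l2dist2 M (v n) u < e"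
    using eventually_happens'[OF sequentially_bot] by blast
  then show thesis using that v by (auto simp: approximates_def)
qed

lemma E1_cl: "E1 M cE u v = cE u v + L2ip M u v"
  by (simp add: E1_def L2ip_def)

lemma E1_diff: "E1 M cE (fdiff u v) (fdiff u v) = cE (fdiff u v) (fdiff u v) + l2dist2 M u v"
  by (simp add: E1_cl l2dist2_eq)

lemma D_E1_dense:
  assumes "u \<in> cD" "e > 0"
  shows "\<exists>v\<in>D. E1 M cE (fdiff u v) (fdiff u v) < e"
proof -
  define d where "d = min 1 (e/2)"
  have d: "d > 0" "d \<le> 1" "d \<le> e/2" using assms(2) by (auto simp: d_def)
  obtain v where v: "v \<in> D" "cl.nrm (fdiff v u) < d" "l2dist2 M v u < d" using D_dense_cD[OF assms(1) d(1)] by blast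
  have m: "fdiff u v \<in> cD" "fdiff v u \<in> cD" using v D_cD assms(1) cl.diff_mem by blast+
  have "cE (fdiff u v) (fdiff u v) = (cl.nrm (fdiff v u))\<^sup>2"
    using cl.nrm_sq[OF m(1)] cl.nrm_commute[OF assms(1) D_cD[OF v(1)]] by simp
  also have "\<dots> \<le> cl.nrm (fdiff v u) * 1"
    using cl.nrm_nonneg[OF m(2)] v(2) d(2) unfolding power2_eq_square by (intro mult_left_mono) auto
  also have "\<dots> < d" using v by simp
  finally have "cE (fdiff u v) (fdiff u v) < d" .
  moreover have "l2dist2 M u v = l2dist2 M v u" by (simp add: l2dist2_def power2_commute)
  ultimately show ?thesis using v(1,3) d by (intro bexI[of _ v]) (auto simp: E1_diff)
qed

lemma approximatesI:
  assumes "\<And>n. v n \<in> D" "w \<in> L2 M" "(\<lambda>n. l2dist2 M (v n) w) \<longlonglongrightarrow> 0" "form_cauchy Ef v"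
  shows "w \<in> cD" "approximates M D Ef v w"
  using assms by (auto simp: closure_dom_def approximates_def)

text \<open>Each \<open>u n\<close> is replaced by an element of \<open>D\<close> within 1/(n+1) in
  both distances. The new sequence is form-Cauchy on \<open>D\<close> and has an L2 limit, which
  lies in the closure by definition; the original sequence then converges to the same limit.\<close>

lemma closure_complete:
  assumes u: "\<And>n. u n \<in> cD" and cau: "form_cauchy (E1 M cE) u"
  shows "\<exists>w\<in>cD. (\<lambda>n. E1 M cE (fdiff (u n) w) (fdiff (u n) w)) \<longlonglongrightarrow> 0"
proof -
  have um: "fdiff (u n) (u m) \<in> cD" for n m using u cl.diff_mem by blast
  have cl_le: "cE (fdiff (u n) (u m)) (fdiff (u n) (u m)) \<le> E1 M cE (fdiff (u n) (u m)) (fdiff (u n) (u m))" for n m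
    by (simp add: E1_diff)
  have l2_le: "l2dist2 M (u n) (u m) \<le> E1 M cE (fdiff (u n) (u m)) (fdiff (u n) (u m))" for n m
    using cl.pos[OF um] by (simp add: E1_diff)
  have c1: "form_cauchy cE u" unfolding form_cauchy_def
  proof (intro allI impI)
    fix e :: real assume "e > 0"
    then obtain N where N: "\<forall>n\<ge>N. \<forall>m\<ge>N. E1 M cE (fdiff (u n) (u m)) (fdiff (u n) (u m)) < e"
      using cau unfolding form_cauchy_def by meson
    show "\<exists>N. \<forall>n\<ge>N. \<forall>m\<ge>N. cE (fdiff (u n) (u m)) (fdiff (u n) (u m)) < e"
      using N cl_le le_less_trans by (intro exI[of _ N]) blast
  qed
  have c2: "\<exists>N. \<forall>n\<ge>N. \<forall>m\<ge>N. l2dist2 M (u n) (u m) < e" if e: "e > 0" for e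
  proof -
    obtain N where N: "\<forall>n\<ge>N. \<forall>m\<ge>N. E1 M cE (fdiff (u n) (u m)) (fdiff (u n) (u m)) < e"
      using cau e unfolding form_cauchy_def by meson
    show ?thesis using N l2_le le_less_trans by (intro exI[of _ N]) blast
  qed
  obtain w where w: "w \<in> L2 M" "(\<lambda>n. l2dist2 M (u n) w) \<longlonglongrightarrow> 0"
    using L2_complete[of u M, OF cD_L2[OF u] c2] by blast
  have "\<exists>v\<in>D. cl.nrm (fdiff v (u n)) < 1 / Suc n \<and> l2dist2 M v (u n) < 1 / Suc n" for n
    using D_dense_cD[OF u, of "1 / Suc n" n] by (metis of_nat_0_less_iff zero_less_Suc zero_less_divide_1_iff)
  then obtain v where v: "\<And>n. v n \<in> D" "\<And>n. cl.nrm (fdiff (v n) (u n)) < 1 / Suc n"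
     "\<And>n. l2dist2 M (v n) (u n) < 1 / Suc n" by metis
  have vc: "v n \<in> cD" for n using v D_cD by blast
  have lim1: "(\<lambda>n. cl.nrm (fdiff (v n) (u n))) \<longlonglongrightarrow> 0"
  proof (rule tendsto_sandwich[OF _ _ tendsto_const lim_inverse_n'[THEN LIMSEQ_Suc]])
    show "\<forall>\<^sub>F n in sequentially. 0 \<le> cl.nrm (fdiff (v n) (u n))"
      using cl.nrm_nonneg cl.diff_mem vc u by simp
    show "\<forall>\<^sub>F n in sequentially. cl.nrm (fdiff (v n) (u n)) \<le> 1 / real (Suc n)"
      by (intro always_eventually allI less_imp_le v(2))
  qed
  have lim2: "(\<lambda>n. l2dist2 M (v n) (u n)) \<longlonglongrightarrow> 0"
  proof (rule tendsto_sandwich[OF _ _ tendsto_const lim_inverse_n'[THEN LIMSEQ_Suc]])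
    show "\<forall>\<^sub>F n in sequentially. l2dist2 M (v n) (u n) \<le> 1 / real (Suc n)"
      by (intro always_eventually allI less_imp_le v(3))
  qed simp
  have vl2: "(\<lambda>n. l2dist2 M (v n) w) \<longlonglongrightarrow> 0"
  proof (rule l2dist2_tendsto_iff[THEN iffD2], rule Lim_null_comparison)
    show "\<forall>\<^sub>F n in sequentially. norm (L2.nrm M (fdiff (v n) w)) \<le> L2.nrm M (fdiff (v n) (u n)) + L2.nrm M (fdiff (u n) w)"
      using L2.nrm_triangle[OF D_L2[OF v(1)] cD_L2[OF u] w(1)] L2.nrm_nonneg[OF L2.diff_mem[OF D_L2[OF v(1)] w(1)]]
      by simp
    show "(\<lambda>n. L2.nrm M (fdiff (v n) (u n)) + L2.nrm M (fdiff (u n) w)) \<longlonglongrightarrow> 0"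
      using tendsto_add[OF l2dist2_tendsto_iff[THEN iffD1, OF lim2] l2dist2_tendsto_iff[THEN iffD1, OF w(2)]] by simp
  qed
  have vcau: "form_cauchy Ef v"
    unfolding form_cauchy_iff[of v, OF v(1)]
  proof (intro allI impI)
    fix e :: real assume "e > 0"
    then have e: "e/3 > 0" by simp
    obtain N1 where N1: "\<forall>n\<ge>N1. \<forall>m\<ge>N1. cl.nrm (fdiff (u n) (u m)) < e/3"
      using c1 cl.form_cauchy_iff[of u, OF u] e by meson
    obtain N2 where N2: "\<forall>n\<ge>N2. cl.nrm (fdiff (v n) (u n)) < e/3"
      using order_tendstoD(2)[OF lim1 e] by (auto simp: eventually_sequentially)
    show "\<exists>N. \<forall>n\<ge>N. \<forall>m\<ge>N. nrm (fdiff (v n) (v m)) < e"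
    proof (intro exI allI impI)
      fix n m assume nm: "n \<ge> max N1 N2" "m \<ge> max N1 N2"
      have "cl.nrm (fdiff (v n) (u n)) < e/3" "cl.nrm (fdiff (v m) (u m)) < e/3" "cl.nrm (fdiff (u n) (u m)) < e/3"
        using N1 N2 nm by auto
      moreover have "cl.nrm (fdiff (v n) (v m)) \<le> cl.nrm (fdiff (v n) (u n)) + cl.nrm (fdiff (u n) (v m))"
        by (rule cl.nrm_triangle[OF vc u vc])
      moreover have "cl.nrm (fdiff (u n) (v m)) \<le> cl.nrm (fdiff (u n) (u m)) + cl.nrm (fdiff (u m) (v m))"
        by (rule cl.nrm_triangle[OF u u vc])
      moreover have "cl.nrm (fdiff (u m) (v m)) = cl.nrm (fdiff (v m) (u m))" by (rule cl.nrm_commute[OF u vc])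
      ultimately have "cl.nrm (fdiff (v n) (v m)) < e" by linarith
      then show "nrm (fdiff (v n) (v m)) < e" using cl_nrm_eq diff_mem v(1) by simp
    qed
  qed
  note ap = approximatesI[of v, OF v(1) w(1) vl2 vcau]
  have "(\<lambda>n. cl.nrm (fdiff (u n) w)) \<longlonglongrightarrow> 0"
  proof (rule Lim_null_comparison)
    show "\<forall>\<^sub>F n in sequentially. norm (cl.nrm (fdiff (u n) w)) \<le> cl.nrm (fdiff (v n) (u n)) + cl.nrm (fdiff (v n) w)"
    proof (rule always_eventually, rule allI)
      fix n
      show "norm (cl.nrm (fdiff (u n) w)) \<le> cl.nrm (fdiff (v n) (u n)) + cl.nrm (fdiff (v n) w)"
        using cl.nrm_triangle[OF u vc ap(1), of n n] cl.nrm_nonneg[OF cl.diff_mem[OF u ap(1)], of n] cl.nrm_commute[OF u vc, of n n]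
        by simp
    qed
    show "(\<lambda>n. cl.nrm (fdiff (v n) (u n)) + cl.nrm (fdiff (v n) w)) \<longlonglongrightarrow> 0"
      using tendsto_add[OF lim1 approximates_cl_tendsto[OF ap(2,1)]] by simp
  qed
  from tendsto_power[OF this, of 2] have "(\<lambda>n. cE (fdiff (u n) w) (fdiff (u n) w)) \<longlonglongrightarrow> 0"
    using cl.nrm_sq[OF cl.diff_mem[OF u ap(1)]] by simp
  from tendsto_add[OF this w(2)] show ?thesis
    using ap(1) by (intro bexI[of _ w]) (auto simp: E1_diff)
qed

text \<open>Minimising the form over the shrinking balls \<open>{v. \<parallel>v - u\<parallel> \<le> 1/n}\<close> of \<open>L\<^sup>2\<close>
  yields, by the parallelogram identity, a form-Cauchy sequence; this replaces weak compactness.\<close>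
lemma closure_bounded_limit:
  assumes u: "\<And>n. u n \<in> D" and w: "w \<in> L2 M" and lim: "(\<lambda>n. l2dist2 M (u n) w) \<longlonglongrightarrow> 0"
    and C: "\<And>n. Ef (u n) (u n) \<le> C n" "C \<longlonglongrightarrow> c"
  shows "w \<in> cD" "cE w w \<le> c"
proof -
  define K where "K n = {v \<in> D. L2.nrm M (fdiff v w) \<le> 1 / Suc n}" for n :: nat
  define d where "d n = Inf ((\<lambda>v. Ef v v) ` K n)" for n
  have lim': "(\<lambda>n. L2.nrm M (fdiff (u n) w)) \<longlonglongrightarrow> 0" using lim by (rule l2dist2_tendsto_iff[THEN iffD1])
  have Kex: "\<forall>\<^sub>F k in sequentially. u k \<in> K n" for n
  proof -
    have "0 < 1 / real (Suc n)" by simp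
    from order_tendstoD(2)[OF lim' this] show ?thesis
      by eventually_elim (simp add: K_def u)
  qed
  have Kne: "K n \<noteq> {}" for n using eventually_happens[OF Kex] by auto
  have bdd: "bdd_below ((\<lambda>v. Ef v v) ` K n)" for n
    by (rule bdd_belowI[of _ 0]) (auto simp: K_def pos)
  have d_le: "d n \<le> Ef v v" if "v \<in> K n" for n v
    unfolding d_def using that bdd by (intro cInf_lower) auto
  \<comment> \<open>Every ball \<open>K n\<close> contains \<open>u k\<close> for all large k, so
    the infimum over it is at most \<open>C k\<close>, and hence at most the limit
    \<open>c\<close>.\<close>
  have dc: "d n \<le> c" for n
  proof (rule tendsto_lowerbound[OF C(2)])
    show "\<forall>\<^sub>F k in sequentially. d n \<le> C k"
      using Kex[of n] by eventually_elim (use d_le C(1) order_trans in blast)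
  qed simp
  have Kmono: "K m \<subseteq> K n" if "n \<le> m" for n m
  proof
    fix v assume "v \<in> K m"
    moreover have "1 / real (Suc m) \<le> 1 / real (Suc n)" using that by (intro divide_left_mono) auto
    ultimately show "v \<in> K n" by (auto simp: K_def intro: order_trans)
  qed
  have "incseq d" unfolding d_def incseq_def
    using Kmono Kne bdd by (intro allI impI cInf_superset_mono) auto
  then obtain L where L: "d \<longlonglongrightarrow> L" using dc incseq_convergent[of d c] by blast
  have dL: "d n \<le> L" for n using L \<open>incseq d\<close> by (rule incseq_le[rotated])
  have Lc: "L \<le> c" using L dc by (intro LIMSEQ_le_const2) auto
  have "\<exists>v\<in>K n. Ef v v < d n + 1 / Suc n" for n
    using cInf_lessD[of "(\<lambda>v. Ef v v) ` K n" "d n + 1 / Suc n"] Kne by (auto simp: d_def)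
  then obtain v where v: "\<And>n. v n \<in> K n" "\<And>n. Ef (v n) (v n) < d n + 1 / Suc n" by metis
  have vD: "v n \<in> D" for n using v by (auto simp: K_def)
  \<comment> \<open>The ball is convex, so the midpoint \<open>?h\<close> has energy at least
    \<open>d n\<close>. The energy of the difference is twice the sum of the two energies minus four
    times that of \<open>?h\<close>, and both energies are within 1/(n+1) of infima that do not
    exceed \<open>L\<close>.\<close>
  have mid: "Ef (fdiff (v n) (v m)) (fdiff (v n) (v m)) \<le> 4 * (L - d n + 1 / Suc n)" if nm: "n \<le> m" for n m
  proof -
    let ?h = "\<lambda>x. (1/2) * v n x + (1/2) * v m x"
    have vm: "v m \<in> K n" using v Kmono nm by blast
    have h: "?h \<in> K n" 
    proof -
      have "fdiff ?h w = (\<lambda>x. (1/2) * fdiff (v n) w x + (1/2) * fdiff (v m) w x)"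
        by (simp add: fdiff_def fun_eq_iff field_simps)
      then have "L2.nrm M (fdiff ?h w) \<le> (1/2) * L2.nrm M (fdiff (v n) w) + (1/2) * L2.nrm M (fdiff (v m) w)"
        using L2.nrm_add[OF L2.scale_mem L2.scale_mem, OF L2.diff_mem[OF D_L2[OF vD] w] L2.diff_mem[OF D_L2[OF vD] w], of "1/2" n "1/2" m]
        unfolding L2.nrm_scale[OF L2.diff_mem[OF D_L2[OF vD] w]] by simp
      also have "\<dots> \<le> (1/2) * (1 / Suc n) + (1/2) * (1 / Suc n)"
        using v(1)[of n] vm by (intro add_mono mult_left_mono) (auto simp: K_def)
      also have "\<dots> = 1 / Suc n" by linarith
      finally show ?thesis using lin[OF vD vD, of "1/2" n "1/2" m] unfolding K_def by blast
    qed
    have a: "Ef ?h ?h = (Ef (v n) (v n) + 2 * Ef (v n) (v m) + Ef (v m) (v m)) / 4"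
      using expand[OF vD vD, of "1/2" n "1/2" m] by (simp add: power2_eq_square field_simps)
    have b: "Ef (fdiff (v n) (v m)) (fdiff (v n) (v m)) = Ef (v n) (v n) - 2 * Ef (v n) (v m) + Ef (v m) (v m)"
      using expand[OF vD vD, of 1 n "-1" m] by (simp add: fdiff_def)
    have "Ef (v m) (v m) < d m + 1 / Suc m" "Ef (v n) (v n) < d n + 1 / Suc n" using v by auto
    moreover have "d n \<le> Ef ?h ?h" using d_le h by blast
    moreover have "1 / real (Suc m) \<le> 1 / real (Suc n)" using nm by (intro divide_left_mono) auto
    moreover have "x \<le> 4 * (l - dn + i)"
      if "q < dm + j" "p < dn + i" "dn \<le> h" "j \<le> i" "h = (p + 2 * r + q) / 4"
        "x = p - 2 * r + q" "dm \<le> l" "dn \<le> l" for x q dm j p dn i h r l :: real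
      using that by (simp add: field_simps)
    ultimately show ?thesis using a b dL[of m] dL[of n] by blast
  qed
  have z: "(\<lambda>n. 4 * (L - d n + 1 / Suc n)) \<longlonglongrightarrow> 4 * (L - L + 0)"
    by (rule tendsto_mult[OF tendsto_const tendsto_add[OF tendsto_diff[OF tendsto_const L] lim_inverse_n'[THEN LIMSEQ_Suc]]])
  have cau: "form_cauchy Ef v" unfolding form_cauchy_def
  proof (intro allI impI)
    fix e :: real assume "e > 0"
    have z0: "(\<lambda>n. 4 * (L - d n + 1 / Suc n)) \<longlonglongrightarrow> 0" using z by simp
    obtain N where N: "\<And>n. n \<ge> N \<Longrightarrow> 4 * (L - d n + 1 / Suc n) < e"
      using order_tendstoD(2)[OF z0 \<open>e > 0\<close>] unfolding eventually_sequentially by blast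
    show "\<exists>N. \<forall>n\<ge>N. \<forall>m\<ge>N. Ef (fdiff (v n) (v m)) (fdiff (v n) (v m)) < e"
    proof (intro exI allI impI)
      fix n m assume nm: "n \<ge> N" "m \<ge> N"
      show "Ef (fdiff (v n) (v m)) (fdiff (v n) (v m)) < e"
      proof (cases "n \<le> m")
        case True then show ?thesis using le_less_trans[OF mid N[OF nm(1)]] by blast
      next
        case False
        then have "Ef (fdiff (v m) (v n)) (fdiff (v m) (v n)) < e" using le_less_trans[OF mid N[OF nm(2)]] by simp
        then show ?thesis using nrm_commute[OF vD vD, of n m] by (simp add: nrm_def)
      qed
    qed
  qed
  have "(\<lambda>n. L2.nrm M (fdiff (v n) w)) \<longlonglongrightarrow> 0"
  proof (rule tendsto_sandwich[OF _ _ tendsto_const lim_inverse_n'[THEN LIMSEQ_Suc]])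
    show "\<forall>\<^sub>F n in sequentially. 0 \<le> L2.nrm M (fdiff (v n) w)"
      by (intro always_eventually allI L2.nrm_nonneg L2.diff_mem D_L2 vD w)
    show "\<forall>\<^sub>F n in sequentially. L2.nrm M (fdiff (v n) w) \<le> 1 / real (Suc n)"
      using v(1) by (intro always_eventually allI) (auto simp: K_def)
  qed
  then have "(\<lambda>n. l2dist2 M (v n) w) \<longlonglongrightarrow> 0" by (rule l2dist2_tendsto_iff[THEN iffD2])
  note ap = approximatesI[of v, OF vD w this cau]
  show "w \<in> cD" by (rule ap(1))
  have l: "(\<lambda>n. Ef (v n) (v n)) \<longlonglongrightarrow> cE w w" by (rule closure_form_limit[OF ap(2) w ap(2) w])
  have "(\<lambda>n. d n + 1 / Suc n) \<longlonglongrightarrow> L + 0"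
    by (rule tendsto_add[OF L lim_inverse_n'[THEN LIMSEQ_Suc]])
  from LIMSEQ_le[OF l this] have "cE w w \<le> L + 0"
    using less_imp_le[OF v(2)] by blast
  then show "cE w w \<le> c" using Lc by simp
qed

text \<open>The contraction is required only approximately and only on \<open>D\<close>. Clipping is
  1-Lipschitz, so the approximants \<open>w n\<close> of the clipped \<open>v n\<close> converge in
  L2 to the clipped \<open>u\<close>, and their energies are bounded by a sequence tending to
  \<open>cE u u\<close>; \<open>closure_bounded_limit\<close> concludes.\<close>

theorem dirichlet_form_closure:
  assumes dense: "\<And>f e. f \<in> L2 M \<Longrightarrow> e > 0 \<Longrightarrow> \<exists>u\<in>D. l2dist2 M f u < e"
    and contr: "\<And>v e. v \<in> D \<Longrightarrow> e > 0 \<Longrightarrow>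
      \<exists>w\<in>D. l2dist2 M w (\<lambda>x. min 1 (max 0 (v x))) \<le> e \<and> Ef w w \<le> (1 + e) * Ef v v"
  shows "dirichlet_form M cD cE"
  unfolding dirichlet_form_def
proof (intro conjI ballI allI impI)
  show "cD \<subseteq> L2 M" using cD_L2 by blast
  show "\<exists>u\<in>cD. l2dist2 M f u < e" if "f \<in> L2 M" "e > 0" for f e
    using dense[OF that] D_cD by blast
  show "\<exists>w\<in>cD. (\<lambda>n. E1 M cE (fdiff (u n) w) (fdiff (u n) w)) \<longlonglongrightarrow> 0"
    if "(\<forall>n. u n \<in> cD) \<and> form_cauchy (E1 M cE) u" for u
    using that closure_complete by blast
next
  fix u assume u: "u \<in> cD"
  let ?T = "\<lambda>u x. min 1 (max 0 (u x :: real))"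
  obtain v where v: "u \<in> L2 M" "approximates M D Ef v u" "\<And>n. v n \<in> D" using closure_domE[OF u] by blast
  have T_L2: "?T f \<in> L2 M" if "f \<in> L2 M" for f
  proof -
    have "(?T f x)\<^sup>2 \<le> (f x)\<^sup>2" for x by (intro abs_le_square_iff[THEN iffD1]) auto
    then show ?thesis using that
      by (auto simp: L2_def intro!: Bochner_Integration.integrable_bound[of M "\<lambda>x. (f x)\<^sup>2"])
  qed
  have "\<exists>w\<in>D. l2dist2 M w (?T (v n)) \<le> 1 / Suc n \<and> Ef w w \<le> (1 + 1 / Suc n) * Ef (v n) (v n)" for n
    by (rule contr[OF v(3)]) simp
  then obtain w where w: "\<And>n. w n \<in> D" "\<And>n. l2dist2 M (w n) (?T (v n)) \<le> 1 / Suc n"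
      "\<And>n. Ef (w n) (w n) \<le> (1 + 1 / Suc n) * Ef (v n) (v n)" by metis
  have lim1: "(\<lambda>n. L2.nrm M (fdiff (w n) (?T (v n)))) \<longlonglongrightarrow> 0"
    by (rule l2dist2_tendsto_iff[THEN iffD1], rule tendsto_sandwich[OF _ _ tendsto_const lim_inverse_n'[THEN LIMSEQ_Suc]]) (use w(2) in auto)
  have lim2: "(\<lambda>n. L2.nrm M (fdiff (?T (v n)) (?T u))) \<longlonglongrightarrow> 0"
  proof (rule l2dist2_tendsto_iff[THEN iffD1], rule tendsto_sandwich[OF _ _ tendsto_const])
    show "(\<lambda>n. l2dist2 M (v n) u) \<longlonglongrightarrow> 0" using v by (simp add: approximates_def)
    have "l2dist2 M (?T (v n)) (?T u) \<le> l2dist2 M (v n) u" for n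
      unfolding l2dist2_def
    proof (rule integral_mono)
      show "integrable M (\<lambda>x. (?T (v n) x - ?T u x)\<^sup>2)"
        using L2.diff_mem[OF T_L2[OF D_L2[OF v(3)]] T_L2[OF v(1)], of n] by (simp add: L2_def fdiff_def)
      show "integrable M (\<lambda>x. (v n x - u x)\<^sup>2)"
        using L2.diff_mem[OF D_L2[OF v(3)] v(1), of n] by (simp add: L2_def fdiff_def)
      show "(?T (v n) x - ?T u x)\<^sup>2 \<le> (v n x - u x)\<^sup>2" for x
        by (intro abs_le_square_iff[THEN iffD1]) auto
    qed
    then show "\<forall>\<^sub>F n in sequentially. l2dist2 M (?T (v n)) (?T u) \<le> l2dist2 M (v n) u" by simp
  qed simp
  have "(\<lambda>n. l2dist2 M (w n) (?T u)) \<longlonglongrightarrow> 0"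
  proof (rule l2dist2_tendsto_iff[THEN iffD2], rule Lim_null_comparison)
    show "\<forall>\<^sub>F n in sequentially. norm (L2.nrm M (fdiff (w n) (?T u))) \<le>
        L2.nrm M (fdiff (w n) (?T (v n))) + L2.nrm M (fdiff (?T (v n)) (?T u))"
      using L2.nrm_triangle[OF D_L2[OF w(1)] T_L2[OF D_L2[OF v(3)]] T_L2[OF v(1)]] 
        L2.nrm_nonneg[OF L2.diff_mem[OF D_L2[OF w(1)] T_L2[OF v(1)]]] by (simp add: abs_of_nonneg)
    show "(\<lambda>n. L2.nrm M (fdiff (w n) (?T (v n))) + L2.nrm M (fdiff (?T (v n)) (?T u))) \<longlonglongrightarrow> 0"
      using tendsto_add[OF lim1 lim2] by simp
  qed
  moreover have "(\<lambda>n. (1 + 1 / Suc n) * Ef (v n) (v n)) \<longlonglongrightarrow> (1 + 0) * cE u u"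
    by (rule tendsto_mult[OF tendsto_add[OF tendsto_const lim_inverse_n'[THEN LIMSEQ_Suc]] closure_form_limit[OF v(2,1) v(2,1)]])
  ultimately have "?T u \<in> cD \<and> cE (?T u) (?T u) \<le> (1 + 0) * cE u u"
    using closure_bounded_limit[of w "?T u" "\<lambda>n. (1 + 1 / Suc n) * Ef (v n) (v n)" "(1 + 0) * cE u u", OF w(1) T_L2[OF v(1)] _ w(3)] by blast
  then show "?T u \<in> cD" "cE (?T u) (?T u) \<le> cE u u" by auto
qed (use cl.lin cl.sym cl.bil cl.pos in auto)

end

section \<open>Sums over lattice modes and the Gaussian measure\<close>

text \<open>For real families unconditional and absolute summability coincide, so sums over modes
  become integrals against counting measure; Fubini, dominated convergence and measurability are
  then available for them.\<close>

lemma summable_on_iff_integrable: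
  fixes f :: "'i \<Rightarrow> real"
  shows "f summable_on A \<longleftrightarrow> integrable (count_space A) f"
  by (rule trans[OF summable_on_iff_abs_summable_on_real abs_summable_equivalent[unfolded abs_summable_on_def]])

text \<open>Both sides default to 0 for a family that is not summable.\<close>

lemma infsum_eq_integral:
  fixes f :: "'i \<Rightarrow> real"
  shows "infsum f A = (\<integral>k. f k \<partial>count_space A)"
proof (cases "f summable_on A")
  case True
  then have "Infinite_Set_Sum.abs_summable_on f A"
    by (simp add: summable_on_iff_integrable abs_summable_on_def)
  then show ?thesis by (metis infsetsum_infsum infsetsum_def)
next
  case False
  then show ?thesis
    by (simp add: infsum_not_exists summable_on_iff_integrable not_integrable_integral_eq)
qed

lemma nn_integral_count_space_summable:
  fixes f :: "'i \<Rightarrow> real"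
  assumes "\<And>k. k \<in> A \<Longrightarrow> 0 \<le> f k"
  shows "f summable_on A \<longleftrightarrow> (\<integral>\<^sup>+k. ennreal (f k) \<partial>count_space A) < \<infinity>"
proof -
  have "(\<integral>\<^sup>+k. ennreal (norm (f k)) \<partial>count_space A) = (\<integral>\<^sup>+k. ennreal (f k) \<partial>count_space A)"
    using assms by (intro nn_integral_cong) auto
  then show ?thesis by (simp add: summable_on_iff_integrable integrable_iff_bounded)
qed

lemma summable_on_bound:
  fixes f g :: "'i \<Rightarrow> real"
  assumes "g summable_on A" "\<And>k. k \<in> A \<Longrightarrow> \<bar>f k\<bar> \<le> g k"
  shows "f summable_on A"
  using assms unfolding summable_on_iff_integrable
  by (elim Bochner_Integration.integrable_bound) (force simp: AE_count_space)+

lemma borel_measurable_count_space_pair: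
  fixes f :: "'i \<Rightarrow> 'a \<Rightarrow> real"
  assumes "countable A" "\<And>k. k \<in> A \<Longrightarrow> f k \<in> borel_measurable M"
  shows "(\<lambda>(x, k). f k x) \<in> borel_measurable (M \<Otimes>\<^sub>M count_space A)"
proof -
  have "(\<lambda>(k, x). f k x) \<in> borel_measurable (count_space A \<Otimes>\<^sub>M M)"
    by (rule measurable_pair_measure_countable1) (use assms in auto)
  from measurable_pair_swap[OF this] show ?thesis by (simp add: case_prod_beta)
qed

lemma infsum_measurable:
  fixes f :: "'i \<Rightarrow> 'a \<Rightarrow> real"
  assumes "countable A" "\<And>k. k \<in> A \<Longrightarrow> f k \<in> borel_measurable M"
  shows "(\<lambda>x. infsum (\<lambda>k. f k x) A) \<in> borel_measurable M"
proof -
  interpret sigma_finite_measure "count_space A"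
    by (rule sigma_finite_measure_count_space_countable) fact
  show ?thesis unfolding infsum_eq_integral
    by (rule borel_measurable_lebesgue_integral[OF borel_measurable_count_space_pair]) (use assms in auto)
qed

lemma summable_on_measurable:
  fixes f :: "'i \<Rightarrow> 'a \<Rightarrow> real"
  assumes "countable A" "\<And>k. k \<in> A \<Longrightarrow> f k \<in> borel_measurable M"
  shows "Measurable.pred M (\<lambda>x. (\<lambda>k. f k x) summable_on A)"
proof -
  interpret sigma_finite_measure "count_space A"
    by (rule sigma_finite_measure_count_space_countable) fact
  have [measurable]: "(\<lambda>(x, k). f k x) \<in> borel_measurable (M \<Otimes>\<^sub>M count_space A)"
    by (rule borel_measurable_count_space_pair) (use assms in auto)
  show ?thesis unfolding summable_on_iff_integrable integrable_iff_bounded by simp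
qed

lemma nn_integral_count_space_swap:
  fixes f :: "'i \<Rightarrow> 'a \<Rightarrow> real"
  assumes "countable A" "sigma_finite_measure M" "\<And>k. k \<in> A \<Longrightarrow> f k \<in> borel_measurable M"
  shows "(\<integral>\<^sup>+x. (\<integral>\<^sup>+k. ennreal (f k x) \<partial>count_space A) \<partial>M) = (\<integral>\<^sup>+k. (\<integral>\<^sup>+x. ennreal (f k x) \<partial>M) \<partial>count_space A)"
proof -
  interpret A: sigma_finite_measure "count_space A"
    by (rule sigma_finite_measure_count_space_countable) fact
  interpret M: sigma_finite_measure M by fact
  interpret pair_sigma_finite M "count_space A" ..
  have [measurable]: "(\<lambda>(x, k). f k x) \<in> borel_measurable (M \<Otimes>\<^sub>M count_space A)"
    by (rule borel_measurable_count_space_pair) (use assms in auto)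
  show ?thesis by (rule Fubini'[symmetric]) simp
qed

lemma summable_on_Int_powr:
  fixes s :: real assumes "s > 1"
  shows "(\<lambda>a::int. max 1 \<bar>real_of_int a\<bar> powr (-s)) summable_on UNIV"
proof -
  let ?f = "\<lambda>a::int. max 1 \<bar>real_of_int a\<bar> powr (-s)"
  have "summable (\<lambda>n::nat. real n powr (-s))" using assms by (simp add: summable_real_powr_iff)
  then have "summable (\<lambda>n::nat. max 1 (real n) powr (-s))"
  proof (rule summable_comparison_test_ev[rotated])
    show "\<forall>\<^sub>F n in sequentially. norm (max 1 (real n) powr (-s)) \<le> real n powr (-s)"
      by (rule eventually_sequentiallyI[of 1]) (simp add: max_def)
  qed
  then have n: "Infinite_Set_Sum.abs_summable_on (\<lambda>n::nat. max 1 (real n) powr (-s)) UNIV"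
    by (simp add: abs_summable_on_nat_iff')
  have "Infinite_Set_Sum.abs_summable_on ?f (range (\<lambda>n::nat. int n))"
    by (subst abs_summable_on_reindex_iff[symmetric]) (use n in \<open>auto simp: inj_on_def\<close>)
  moreover have "Infinite_Set_Sum.abs_summable_on ?f (range (\<lambda>n::nat. - int n))"
    by (subst abs_summable_on_reindex_iff[symmetric]) (use n in \<open>auto simp: inj_on_def\<close>)
  ultimately have "Infinite_Set_Sum.abs_summable_on ?f ((range (\<lambda>n::nat. int n) \<union> range (\<lambda>n::nat. - int n)))"
    by (rule abs_summable_on_union)
  also have "range (\<lambda>n::nat. int n) \<union> range (\<lambda>n::nat. - int n) = UNIV"
  proof -
    have "x \<in> range (\<lambda>n::nat. int n) \<union> range (\<lambda>n::nat. - int n)" for x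
      by (cases x rule: int_cases2) auto
    then show ?thesis by auto
  qed
  finally show ?thesis by (simp add: summable_on_iff_integrable abs_summable_on_def)
qed

text \<open>The product on the left separates the two components of \<open>k\<close>, which reduces
  lattice sums to one-dimensional ones; \<open>max 1\<close> keeps the axes in the estimate.\<close>

lemma lam_lower:
  assumes "k \<in> nz"
  shows "max 1 \<bar>real_of_int (fst k)\<bar> * max 1 \<bar>real_of_int (snd k)\<bar> \<le> lam k"
proof -
  obtain a b where k: "k = (a, b)" by fastforce
  have ab: "a \<noteq> 0 \<or> b \<noteq> 0" using assms k by (auto simp: nz_def)
  have sq: "\<bar>real_of_int c\<bar> \<le> (real_of_int c)\<^sup>2 \<and> (c \<noteq> 0 \<longrightarrow> 1 \<le> \<bar>real_of_int c\<bar>)" for c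
  proof (cases "c = 0")
    case False
    then have "1 \<le> \<bar>real_of_int c\<bar>" by linarith
    then have "\<bar>real_of_int c\<bar> * 1 \<le> \<bar>real_of_int c\<bar> * \<bar>real_of_int c\<bar>" by (intro mult_left_mono) auto
    then show ?thesis using \<open>1 \<le> \<bar>real_of_int c\<bar>\<close> by (simp add: power2_eq_square abs_mult[symmetric])
  qed simp
  have "max 1 \<bar>real_of_int a\<bar> * max 1 \<bar>real_of_int b\<bar> \<le> (real_of_int a)\<^sup>2 + (real_of_int b)\<^sup>2"
  proof (cases "a = 0 \<or> b = 0")
    case True
    then show ?thesis using sq[of a] sq[of b] ab by (auto simp: max_def)
  next
    case False
    have "0 \<le> (\<bar>real_of_int a\<bar> - \<bar>real_of_int b\<bar>)\<^sup>2" by simp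
    moreover have "0 \<le> \<bar>real_of_int a\<bar> * \<bar>real_of_int b\<bar>" by simp
    ultimately have "\<bar>real_of_int a\<bar> * \<bar>real_of_int b\<bar> \<le> (real_of_int a)\<^sup>2 + (real_of_int b)\<^sup>2"
      unfolding power2_diff power2_abs by linarith
    moreover have "max 1 \<bar>real_of_int a\<bar> = \<bar>real_of_int a\<bar>" "max 1 \<bar>real_of_int b\<bar> = \<bar>real_of_int b\<bar>"
      using sq[of a] sq[of b] False by auto
    ultimately show ?thesis by simp
  qed
  also have "\<dots> \<le> pi\<^sup>2 * ((real_of_int a)\<^sup>2 + (real_of_int b)\<^sup>2)"
  proof -
    have "1 \<le> pi" using pi_gt3 by simp
    then have "1 \<le> pi\<^sup>2" by (simp add: one_le_power)
    then have "1 * ((real_of_int a)\<^sup>2 + (real_of_int b)\<^sup>2) \<le> pi\<^sup>2 * ((real_of_int a)\<^sup>2 + (real_of_int b)\<^sup>2)"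
      by (intro mult_right_mono) auto
    then show ?thesis by simp
  qed
  finally show ?thesis by (simp add: k lam_def)
qed

lemma lam_ge_1: "k \<in> nz \<Longrightarrow> 1 \<le> lam k"
proof -
  assume k: "k \<in> nz"
  have "1 * 1 \<le> max 1 \<bar>real_of_int (fst k)\<bar> * max 1 \<bar>real_of_int (snd k)\<bar>"
    by (intro mult_mono) auto
  then show ?thesis using lam_lower[OF k] by simp
qed

lemma lam_pos: "k \<in> nz \<Longrightarrow> 0 < lam k"
  using lam_ge_1[of k] by simp

lemma lam_00[simp]: "lam (0, 0) = 0" by (simp add: lam_def)

lemma lam_nonneg[simp]: "0 \<le> lam k" by (simp add: lam_def)

lemma lam_summable:
  assumes "s > 1" shows "(\<lambda>k. lam k powr (-s)) summable_on nz"
proof (rule summable_on_bound)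
  let ?f = "\<lambda>a::int. max 1 \<bar>real_of_int a\<bar> powr (-s)"
  have f: "Infinite_Set_Sum.abs_summable_on ?f (UNIV)"
    using summable_on_Int_powr[OF assms] by (simp add: summable_on_iff_integrable abs_summable_on_def)
  have "Infinite_Set_Sum.abs_summable_on (\<lambda>(x,y). ?f x * ?f y) (UNIV \<times> UNIV)"
    by (rule abs_summable_on_product[OF _ _ f f]) auto
  then have "(\<lambda>(x,y). ?f x * ?f y) summable_on UNIV" by (simp add: summable_on_iff_integrable abs_summable_on_def)
  then show "(\<lambda>k. ?f (fst k) * ?f (snd k)) summable_on nz"
    unfolding case_prod_beta by (rule summable_on_subset_banach) simp
  fix k assume k: "k \<in> nz"
  let ?p = "max 1 \<bar>real_of_int (fst k)\<bar> * max 1 \<bar>real_of_int (snd k)\<bar>"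
  have "0 < ?p" by (intro mult_pos_pos) auto
  then have "lam k powr (-s) \<le> ?p powr (-s)"
    using lam_lower[OF k] assms by (intro powr_mono2') auto
  also have "\<dots> = ?f (fst k) * ?f (snd k)" by (rule powr_mult)
  finally show "\<bar>lam k powr (-s)\<bar> \<le> ?f (fst k) * ?f (snd k)" by simp
qed

section \<open>The Gaussian product measure and the resampling of one mode\<close>

definition gcomp :: "int \<times> int \<Rightarrow> real measure" where
  "gcomp k = (if k = (0,0) then return borel 0
     else density lborel (normal_density 0 (1 / sqrt (lam k))))"

lemma gff_eq: "gff = PiM UNIV gcomp"
  by (simp add: gff_def gcomp_def[abs_def])

lemma sets_gcomp[simp, measurable_cong]: "sets (gcomp k) = sets borel"
  by (simp add: gcomp_def)

lemma space_gcomp[simp]: "space (gcomp k) = UNIV"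
  by (simp add: gcomp_def)

lemma prob_space_gcomp: "prob_space (gcomp k)"
proof (cases "k = (0,0)")
  case True then show ?thesis by (simp add: gcomp_def prob_space_return)
next
  case False 
  then have "lam k > 0" by (simp add: lam_pos nz_def)
  then show ?thesis using False by (simp add: gcomp_def prob_space_normal_density)
qed

interpretation gcomp: prob_space "gcomp k" for k by (rule prob_space_gcomp)

interpretation gff: prob_space gff
  unfolding gff_eq by (intro prob_space_PiM prob_space_gcomp)

lemma sets_gff[measurable_cong]: "sets gff = sets (PiM UNIV (\<lambda>_. borel))"
  unfolding gff_eq by (intro sets_PiM_cong) auto

lemma space_gff[simp]: "space gff = UNIV"
  using sets_eq_imp_space_eq[OF sets_gff] by (simp add: space_PiM)

lemma coord_measurable[measurable]: "(\<lambda>z. z k) \<in> borel_measurable gff"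
  unfolding measurable_cong_sets[OF sets_gff refl] by measurable

lemma upd_measurable[measurable]: "(\<lambda>(w, x). w(k := x)) \<in> measurable (gff \<Otimes>\<^sub>M gcomp k) gff"
proof -
  have "(\<lambda>p. (fst p)(k := snd p)) \<in> measurable (gff \<Otimes>\<^sub>M gcomp k) (PiM UNIV (\<lambda>_. borel))"
  proof (rule measurable_fun_upd[where J=UNIV])
    show "fst \<in> measurable (gff \<Otimes>\<^sub>M gcomp k) (PiM UNIV (\<lambda>_. borel))"
      unfolding measurable_cong_sets[OF refl sets_gff, symmetric] by (rule measurable_fst)
    show "snd \<in> borel_measurable (gff \<Otimes>\<^sub>M gcomp k)"
      using measurable_snd[of gff "gcomp k"] by (simp add: measurable_cong_sets[OF refl sets_gcomp])
  qed auto
  then show ?thesis unfolding measurable_cong_sets[OF refl sets_gff] by (simp add: case_prod_beta)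
qed

lemma upd_measurable2[measurable]: "(\<lambda>w. w(k := x)) \<in> measurable gff gff"
proof -
  have "(\<lambda>w. (w, x)) \<in> measurable gff (gff \<Otimes>\<^sub>M gcomp k)" by measurable
  from measurable_comp[OF this upd_measurable] show ?thesis by (simp add: comp_def)
qed

interpretation pg: pair_prob_space gff "gcomp k" for k ..

text \<open>Replacing coordinate \<open>k\<close> by an independent draw from its own law does not
  change a product measure. This is the disintegration along the line in direction \<open>k\<close>,
  with \<open>w(k := x)\<close> in place of a splitting of the index set.\<close>

lemma gff_resample: "distr (gff \<Otimes>\<^sub>M gcomp k) gff (\<lambda>(w, x). w(k := x)) = gff"
proof -
  interpret gp: pair_prob_space "gcomp k" gff ..
  have a: "distr (gcomp k \<Otimes>\<^sub>M gff) gff (\<lambda>(x, X). X(k := x)) = gff"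
    using distr_pair_PiM_eq_PiM[of UNIV gcomp k] prob_space_gcomp by (simp add: gff_eq insert_UNIV)
  have [measurable]: "(\<lambda>(x, X). X(k := x)) \<in> measurable (gcomp k \<Otimes>\<^sub>M gff) gff"
    using measurable_comp[OF measurable_pair_swap'[of "gcomp k" gff] upd_measurable]
    by (simp add: comp_def case_prod_beta)
  have "distr (gff \<Otimes>\<^sub>M gcomp k) gff (\<lambda>(w, x). w(k := x)) 
    = distr (distr (gcomp k \<Otimes>\<^sub>M gff) (gff \<Otimes>\<^sub>M gcomp k) (\<lambda>(x, y). (y, x))) gff (\<lambda>(w, x). w(k := x))"
    using pg.distr_pair_swap[of k] by simp
  also have "\<dots> = distr (gcomp k \<Otimes>\<^sub>M gff) gff (\<lambda>(x, X). X(k := x))"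
    by (subst distr_distr) (measurable, simp add: comp_def case_prod_unfold)
  finally show ?thesis using a by simp
qed

lemma AE_resample:
  assumes "AE z in gff. P z" shows "AE w in gff. AE x in gcomp k. P (w(k := x))"
proof -
  have "AE z in distr (gff \<Otimes>\<^sub>M gcomp k) gff (\<lambda>(w, x). w(k := x)). P z"
    unfolding gff_resample by fact
  then have "AE p in gff \<Otimes>\<^sub>M gcomp k. P ((\<lambda>(w, x). w(k := x)) p)"
    by (rule AE_distrD[OF upd_measurable])
  from pg.AE_pair[OF this] show ?thesis by simp
qed

lemma integrable_resample:
  fixes f :: "coeffs \<Rightarrow> real"
  assumes [measurable]: "f \<in> borel_measurable gff"
  shows "integrable gff f \<longleftrightarrow> integrable (gff \<Otimes>\<^sub>M gcomp k) (\<lambda>p. f ((fst p)(k := snd p)))"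
proof -
  have "integrable gff f \<longleftrightarrow> integrable (distr (gff \<Otimes>\<^sub>M gcomp k) gff (\<lambda>(w, x). w(k := x))) f"
    by (simp add: gff_resample)
  also have "\<dots> \<longleftrightarrow> integrable (gff \<Otimes>\<^sub>M gcomp k) (\<lambda>p. f ((\<lambda>(w, x). w(k := x)) p))"
    by (rule integrable_distr_eq) measurable
  finally show ?thesis by (simp add: case_prod_beta)
qed

lemma integral_resample:
  fixes f :: "coeffs \<Rightarrow> real"
  assumes f: "integrable gff f"
  shows "(\<integral>z. f z \<partial>gff) = (\<integral>w. (\<integral>x. f (w(k := x)) \<partial>gcomp k) \<partial>gff)"
proof -
  have [measurable]: "f \<in> borel_measurable gff" using f by simp
  have "(\<integral>z. f z \<partial>gff) = (\<integral>z. f z \<partial>distr (gff \<Otimes>\<^sub>M gcomp k) gff (\<lambda>(w, x). w(k := x)))"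
    by (simp add: gff_resample)
  also have "\<dots> = (\<integral>p. f ((\<lambda>(w, x). w(k := x)) p) \<partial>(gff \<Otimes>\<^sub>M gcomp k))"
    by (rule integral_distr) measurable
  also have "\<dots> = (\<integral>w. (\<integral>x. f (w(k := x)) \<partial>gcomp k) \<partial>gff)"
    using f[unfolded integrable_resample[OF \<open>f \<in> borel_measurable gff\<close>, of k]]
    by (subst pg.integral_fst'[symmetric]) (auto simp: case_prod_beta)
  finally show ?thesis .
qed

lemma distr_coord: "distr gff (gcomp k) (\<lambda>z. z k) = gcomp k"
  unfolding gff_eq by (rule distr_PiM_component) (auto intro: prob_space_gcomp)

lemma nn_integral_coord:
  assumes "f \<in> borel_measurable borel"
  shows "(\<integral>\<^sup>+z. f (z k) \<partial>gff) = (\<integral>\<^sup>+x. f x \<partial>gcomp k)"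
proof -
  have "(\<integral>\<^sup>+x. f x \<partial>gcomp k) = (\<integral>\<^sup>+x. f x \<partial>distr gff (gcomp k) (\<lambda>z. z k))" by (simp add: distr_coord)
  also have "\<dots> = (\<integral>\<^sup>+z. f (z k) \<partial>gff)" 
    using assms by (intro nn_integral_distr) (auto simp: measurable_cong_sets[OF sets_gcomp refl] measurable_cong_sets[OF refl sets_gcomp])
  finally show ?thesis by simp
qed

lemma AE_gff_0: "AE z in gff. z (0,0) = 0"
proof -
  have "AE x in return borel (0::real). x = 0" by (subst AE_return) (auto simp: pred_def)
  moreover have "gcomp (0,0) = return borel 0" by (simp add: gcomp_def)
  ultimately have "AE x in gcomp (0,0). x = 0" by metis
  then have "AE x in distr gff (gcomp (0,0)) (\<lambda>z. z (0,0)). x = 0" by (subst distr_coord)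
  then show ?thesis by (rule AE_distrD[rotated]) (simp add: measurable_cong_sets[OF refl sets_gcomp])
qed

lemma gcomp_nz: "k \<in> nz \<Longrightarrow> gcomp k = density lborel (normal_density 0 (1 / sqrt (lam k)))"
  by (simp add: gcomp_def nz_def)

lemma nn_second_moment: "k \<in> nz \<Longrightarrow> (\<integral>\<^sup>+z. ennreal ((z k)\<^sup>2) \<partial>gff) = ennreal (1 / lam k)"
proof -
  assume k: "k \<in> nz"
  have p: "0 < 1 / sqrt (lam k)" using lam_pos[OF k] by simp
  have "(\<integral>\<^sup>+z. ennreal ((z k)\<^sup>2) \<partial>gff) = (\<integral>\<^sup>+x. ennreal (x\<^sup>2) \<partial>gcomp k)"
    by (rule nn_integral_coord) measurable
  also have "\<dots> = (\<integral>\<^sup>+x. ennreal (normal_density 0 (1 / sqrt (lam k)) x * (x - 0)^(2 * 1)) \<partial>lborel)"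
    unfolding gcomp_nz[OF k] by (subst nn_integral_density) (auto simp: ennreal_mult power2_eq_square)
  also have "\<dots> = ennreal (1 / lam k)"
  proof (subst nn_integral_eq_integral)
    show "integrable lborel (\<lambda>x. normal_density 0 (1 / sqrt (lam k)) x * (x - 0) ^ (2 * 1))"
      using normal_moment_even[OF p, of 0 1] by (rule integrable.intros)
    show "ennreal (\<integral>x. normal_density 0 (1 / sqrt (lam k)) x * (x - 0) ^ (2 * 1) \<partial>lborel) = ennreal (1 / lam k)"
      using integral_normal_moment_even[OF p, of 0 1] lam_pos[OF k] by (simp add: power_divide)
  qed auto
  finally show ?thesis .
qed

text \<open>The expected sum is the sum of \<open>lam k\<close> to the power -(s+1), finite since
  s+1 > 1. The cases s = 1 + s0, s = 1 and s = 1/2 show that almost every sample lies in E, lies in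
  V^-1, and is absolutely summable against 1/\<open>lam\<close>.\<close>

lemma AE_weighted_summable:
  assumes "s > 0" shows "AE z in gff. (\<lambda>k. lam k powr (-s) * (z k)\<^sup>2) summable_on nz"
proof -
  have sf: "sigma_finite_measure gff" ..
  have "(\<integral>\<^sup>+z. (\<integral>\<^sup>+k. ennreal (lam k powr (-s) * (z k)\<^sup>2) \<partial>count_space nz) \<partial>gff)
     = (\<integral>\<^sup>+k. (\<integral>\<^sup>+z. ennreal (lam k powr (-s) * (z k)\<^sup>2) \<partial>gff) \<partial>count_space nz)"
    by (rule nn_integral_count_space_swap[OF _ sf]) auto
  also have "\<dots> = (\<integral>\<^sup>+k. ennreal (lam k powr (-(s+1))) \<partial>count_space nz)"
  proof (rule nn_integral_cong)
    fix k assume "k \<in> space (count_space nz)"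
    then have k: "k \<in> nz" by simp
    have "(\<integral>\<^sup>+z. ennreal (lam k powr (-s) * (z k)\<^sup>2) \<partial>gff) = ennreal (lam k powr (-s)) * ennreal (1 / lam k)"
      by (simp add: ennreal_mult nn_integral_cmult nn_second_moment[OF k])
    also have "\<dots> = ennreal (lam k powr (-(s+1)))"
      using lam_pos[OF k] by (simp add: ennreal_mult[symmetric] powr_diff powr_minus_divide)
    finally show "(\<integral>\<^sup>+z. ennreal (lam k powr (-s) * (z k)\<^sup>2) \<partial>gff) = ennreal (lam k powr (-(s+1)))" .
  qed
  also have "\<dots> < \<infinity>"
    using lam_summable[of "s+1"] assms nn_integral_count_space_summable[of nz "\<lambda>k. lam k powr (-(s+1))"] by simp
  finally have fin: "(\<integral>\<^sup>+z. (\<integral>\<^sup>+k. ennreal (lam k powr (-s) * (z k)\<^sup>2) \<partial>count_space nz) \<partial>gff) \<noteq> \<infinity>" by simp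
  interpret A: sigma_finite_measure "count_space nz"
    by (rule sigma_finite_measure_count_space_countable) simp
  have [measurable]: "(\<lambda>(x, k). (\<lambda>k (z::coeffs). lam k powr (-s) * (z k)\<^sup>2) k x) \<in> borel_measurable (gff \<Otimes>\<^sub>M count_space nz)"
    by (rule borel_measurable_count_space_pair) auto
  have "AE z in gff. (\<integral>\<^sup>+k. ennreal (lam k powr (-s) * (z k)\<^sup>2) \<partial>count_space nz) \<noteq> \<infinity>"
    by (rule nn_integral_PInf_AE[OF _ fin]) measurable
  then show ?thesis
    by eventually_elim (simp add: nn_integral_count_space_summable top.not_eq_extremum)
qed

text \<open>With l the power -1/2 of \<open>lam k\<close>, the inequality 0 <= l (l - |z|)^2 bounds
  l^2 |z| by l^3 + l z^2. The first term is summable in dimension two, the second almost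
  surely.\<close>

lemma AE_abs_summable: "AE z in gff. (\<lambda>k. \<bar>z k\<bar> / lam k) summable_on nz"
  using AE_weighted_summable[of "1/2", simplified]
proof eventually_elim
  case (elim z)
  have "(\<lambda>k. lam k powr (-(3/2)) + lam k powr (-(1/2)) * (z k)\<^sup>2) summable_on nz"
    using lam_summable[of "3/2"] elim by (intro summable_on_add) auto
  then show ?case
  proof (rule summable_on_bound)
    fix k assume k: "k \<in> nz"
    define l where "l = lam k powr (-(1/2))"
    have l: "l > 0" using lam_pos[OF k] by (simp add: l_def)
    have l2: "l * l = 1 / lam k" "lam k powr (-(3/2)) = l * (l * l)"
      using lam_pos[OF k] powr_add[of "lam k" "-(1/2)" "-(1/2)"] powr_add[of "lam k" "-(1/2)" "-1"]
      by (auto simp: l_def powr_minus_divide)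
    have "0 \<le> l * (l - \<bar>z k\<bar>)\<^sup>2" using l by simp
    also have "\<dots> = l * (l * l) + l * (z k)\<^sup>2 - 2 * (l * l * \<bar>z k\<bar>)"
      by (simp add: power2_eq_square algebra_simps)
    finally have "2 * (l * l * \<bar>z k\<bar>) \<le> l * (l * l) + l * (z k)\<^sup>2" by simp
    moreover have "0 \<le> l * l * \<bar>z k\<bar>" using l by simp
    ultimately have "l * l * \<bar>z k\<bar> \<le> l * (l * l) + l * (z k)\<^sup>2" by linarith
    then show "\<bar>\<bar>z k\<bar> / lam k\<bar> \<le> lam k powr (-(3/2)) + lam k powr (-(1/2)) * (z k)\<^sup>2"
      using l2 lam_pos[OF k] unfolding l_def[symmetric] by simp
  qed
qed

section \<open>Smooth cylinder functions\<close>

text \<open>Exhibiting one set of bounded continuous functions that contains the partial derivatives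
  of its members controls all iterated derivatives of a member at once, without computing any of
  them.\<close>

definition smooth_fam :: "nat \<Rightarrow> ((nat \<Rightarrow> real) \<Rightarrow> real) set \<Rightarrow> bool" where
  "smooth_fam m A \<longleftrightarrow> (\<forall>a\<in>A. continuous_on UNIV a \<and> bounded (range a) \<and>
     (\<forall>i<m. \<exists>b\<in>A. \<forall>x. ((\<lambda>t. a (x(i := t))) has_real_derivative b x) (at (x i))))"

lemma smooth_fam_cont: "smooth_fam m A \<Longrightarrow> a \<in> A \<Longrightarrow> continuous_on UNIV a"
  and smooth_fam_bdd: "smooth_fam m A \<Longrightarrow> a \<in> A \<Longrightarrow> bounded (range a)"
  and smooth_fam_der: "smooth_fam m A \<Longrightarrow> a \<in> A \<Longrightarrow> i < m \<Longrightarrow>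
    \<exists>b\<in>A. \<forall>x. ((\<lambda>t. a (x(i := t))) has_real_derivative b x) (at (x i))"
  by (simp_all add: smooth_fam_def)

definition dep :: "nat \<Rightarrow> ((nat \<Rightarrow> real) \<Rightarrow> real) \<Rightarrow> bool" where
  "dep m f \<longleftrightarrow> (\<forall>x. f x = f (\<lambda>i. if i < m then x i else 0))"

lemma depD: "dep m f \<Longrightarrow> (\<And>i. i < m \<Longrightarrow> x i = y i) \<Longrightarrow> f x = f y"
proof -
  assume d: "dep m f" and xy: "\<And>i. i < m \<Longrightarrow> x i = y i"
  have "f x = f (\<lambda>i. if i < m then x i else 0)" using d unfolding dep_def by blast
  also have "(\<lambda>i. if i < m then x i else 0) = (\<lambda>i. if i < m then y i else 0)" using xy by auto
  also have "f \<dots> = f y" using d[unfolded dep_def, rule_format, of y] by (rule sym)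
  finally show ?thesis .
qed

lemma smooth_fam_pds:
  assumes A: "smooth_fam m A" "a \<in> A" "set is \<subseteq> {..<m}"
  shows "pds is a \<in> A"
  using assms(3)
proof (induction "is")
  case Nil then show ?case using A by simp
next
  case (Cons i "is")
  then have "pds is a \<in> A" "i < m" by auto
  then obtain b where b: "b \<in> A" "\<forall>x. ((\<lambda>t. pds is a (x(i := t))) has_real_derivative b x) (at (x i))"
    using smooth_fam_der[OF A(1)] by meson
  then have "pds (i # is) a = b" by (auto simp: fun_eq_iff DERIV_imp_deriv)
  then show ?case using b by simp
qed

lemma Cb_infI:
  assumes A: "smooth_fam m A" "a \<in> A" "dep m a" shows "Cb_inf m a"
  unfolding Cb_inf_def
proof (intro conjI allI impI)
  fix x show "a x = a (\<lambda>i. if i < m then x i else 0)" using A(3) unfolding dep_def by blast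
next
  fix "is" assume "set is \<subseteq> {..<m}"
  then have p: "pds is a \<in> A" using smooth_fam_pds A by blast
  then show "continuous_on UNIV (pds is a)" "bounded (range (pds is a))"
    using smooth_fam_cont[OF A(1)] smooth_fam_bdd[OF A(1)] by auto
  fix i x assume "i < m"
  then show "(\<lambda>t. pds is a (x(i := t))) differentiable at (x i)"
    using smooth_fam_der[OF A(1) p, of i] real_differentiable_def by blast
qed

lemma Cb_inf_cont: "Cb_inf m f \<Longrightarrow> set is \<subseteq> {..<m} \<Longrightarrow> continuous_on UNIV (pds is f)"
  unfolding Cb_inf_def by blast

lemma Cb_inf_bounded: "Cb_inf m f \<Longrightarrow> set is \<subseteq> {..<m} \<Longrightarrow> bounded (range (pds is f))"
  unfolding Cb_inf_def by blast

lemma Cb_inf_diff: "Cb_inf m f \<Longrightarrow> set is \<subseteq> {..<m} \<Longrightarrow> i < m \<Longrightarrow>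
    (\<lambda>t. pds is f (x(i := t))) differentiable (at (x i))"
  unfolding Cb_inf_def by blast

definition pds_fam :: "nat \<Rightarrow> ((nat \<Rightarrow> real) \<Rightarrow> real) \<Rightarrow> ((nat \<Rightarrow> real) \<Rightarrow> real) set" where
  "pds_fam m f = {pds is f | is. set is \<subseteq> {..<m}}"

lemma pds_fam_self: "f \<in> pds_fam m f"
  unfolding pds_fam_def by (rule CollectI, rule exI[of _ "[]"]) simp

lemma smooth_fam_Cb_inf: "Cb_inf m f \<Longrightarrow> smooth_fam m (pds_fam m f)"
  unfolding smooth_fam_def
proof (intro ballI conjI allI impI)
  fix a assume f: "Cb_inf m f" and "a \<in> pds_fam m f"
  then obtain "is" where a: "a = pds is f" "set is \<subseteq> {..<m}" by (auto simp: pds_fam_def)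
  show "continuous_on UNIV a" "bounded (range a)" using f a by (auto simp: Cb_inf_def)
  fix i assume i: "i < m"
  show "\<exists>b\<in>pds_fam m f. \<forall>x. ((\<lambda>t. a (x(i := t))) has_real_derivative b x) (at (x i))"
  proof (intro bexI allI)
    show "pds (i # is) f \<in> pds_fam m f" using a i unfolding pds_fam_def 
      by (intro CollectI exI[of _ "i # is"]) auto
    fix x 
    have "(\<lambda>t. pds is f (x(i := t))) differentiable at (x i)" using f a i by (auto simp: Cb_inf_def)
    then show "((\<lambda>t. a (x(i := t))) has_real_derivative pds (i # is) f x) (at (x i))"
      using DERIV_deriv_iff_real_differentiable a by simp
  qed
qed

lemma dep_pds: "Cb_inf m f \<Longrightarrow> a \<in> pds_fam m f \<Longrightarrow> dep m a"
proof -
  assume f: "Cb_inf m f" and "a \<in> pds_fam m f"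
  then obtain "is" where a: "a = pds is f" "set is \<subseteq> {..<m}" by (auto simp: pds_fam_def)
  have "dep m (pds is f)" using a(2)
  proof (induction "is")
    case Nil then show ?case using f by (simp add: dep_def Cb_inf_def)
  next
    case (Cons i "is")
    then have d: "dep m (pds is f)" and i: "i < m" by auto
    have "(\<lambda>t. pds is f (x(i := t))) = (\<lambda>t. pds is f ((\<lambda>i. if i < m then x i else 0)(i := t)))" for x
      by (rule ext, rule depD[OF d]) auto
    then show ?case using i by (simp add: dep_def)
  qed
  then show ?thesis using a by simp
qed

inductive_set alg :: "((nat \<Rightarrow> real) \<Rightarrow> real) set \<Rightarrow> ((nat \<Rightarrow> real) \<Rightarrow> real) set"
  for A where
  base: "a \<in> A \<Longrightarrow> a \<in> alg A"
| const: "(\<lambda>_. c) \<in> alg A"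
| add: "a \<in> alg A \<Longrightarrow> b \<in> alg A \<Longrightarrow> (\<lambda>x. a x + b x) \<in> alg A"
| mult: "a \<in> alg A \<Longrightarrow> b \<in> alg A \<Longrightarrow> (\<lambda>x. a x * b x) \<in> alg A"

lemma bounded_range_mult:
  fixes a b :: "'x \<Rightarrow> real"
  assumes "bounded (range a)" "bounded (range b)" shows "bounded (range (\<lambda>x. a x * b x))"
proof -
  obtain C where C: "\<And>x. \<bar>a x\<bar> \<le> C" using assms(1) unfolding bounded_iff by auto
  obtain D where D: "\<And>x. \<bar>b x\<bar> \<le> D" using assms(2) unfolding bounded_iff by auto
  have "\<bar>a x * b x\<bar> \<le> C * D" for x unfolding abs_mult
    by (intro mult_mono C D) (use C[of x] in auto)
  then show ?thesis unfolding bounded_iff by auto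
qed

text \<open>The Leibniz rule keeps the generated algebra stable under partial derivatives; hence
  sums and products of smooth bounded functions stay in the class.\<close>

lemma smooth_fam_alg:
  assumes A: "smooth_fam m A" shows "smooth_fam m (alg A)"
proof -
  have "continuous_on UNIV a \<and> bounded (range a) \<and>
     (\<forall>i<m. \<exists>b\<in>alg A. \<forall>x. ((\<lambda>t. a (x(i := t))) has_real_derivative b x) (at (x i)))" if "a \<in> alg A" for a
    using that
  proof induction
    case (base a)
    then have "\<exists>b\<in>alg A. \<forall>x. ((\<lambda>t. a (x(i := t))) has_real_derivative b x) (at (x i))" if "i < m" for i
      using smooth_fam_der[OF A _ that, of a] alg.base[of _ A] by meson
    then show ?case using smooth_fam_cont[OF A base] smooth_fam_bdd[OF A base] by blast
  next
    case (const c)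
    have "\<forall>x. ((\<lambda>t. c) has_real_derivative (\<lambda>_. 0) x) (at ((x::nat \<Rightarrow> real) i))" for i by simp
    then show ?case using alg.const[of 0 A] by (auto intro!: bexI[of _ "\<lambda>_. 0"])
  next
    case (add a b)
    show ?case
    proof (intro conjI allI impI)
      show "continuous_on UNIV (\<lambda>x. a x + b x)" using add by (intro continuous_intros) auto
      show "bounded (range (\<lambda>x. a x + b x))" using add bounded_plus_comp[of a UNIV b] by auto
      fix i assume "i < m"
      then obtain a' b' where ab: "a' \<in> alg A" "b' \<in> alg A"
        "\<And>x. ((\<lambda>t. a (x(i := t))) has_real_derivative a' x) (at (x i))"
        "\<And>x. ((\<lambda>t. b (x(i := t))) has_real_derivative b' x) (at (x i))" using add by meson
      show "\<exists>c\<in>alg A. \<forall>x. ((\<lambda>t. a (x(i := t)) + b (x(i := t))) has_real_derivative c x) (at (x i))"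
        by (rule bexI[of _ "\<lambda>x. a' x + b' x"]) (auto intro!: derivative_intros ab alg.add)
    qed
  next
    case (mult a b)
    show ?case
    proof (intro conjI allI impI)
      show "continuous_on UNIV (\<lambda>x. a x * b x)" using mult by (intro continuous_intros) auto
      show "bounded (range (\<lambda>x. a x * b x))" using mult bounded_range_mult by blast
      fix i assume "i < m"
      then obtain a' b' where ab: "a' \<in> alg A" "b' \<in> alg A"
        "\<And>x. ((\<lambda>t. a (x(i := t))) has_real_derivative a' x) (at (x i))"
        "\<And>x. ((\<lambda>t. b (x(i := t))) has_real_derivative b' x) (at (x i))" using mult by meson
      show "\<exists>c\<in>alg A. \<forall>x. ((\<lambda>t. a (x(i := t)) * b (x(i := t))) has_real_derivative c x) (at (x i))"
      proof (rule bexI[of _ "\<lambda>x. a' x * b x + b' x * a x"], rule allI)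
        fix x show "((\<lambda>t. a (x(i := t)) * b (x(i := t))) has_real_derivative a' x * b x + b' x * a x) (at (x i))"
          using DERIV_mult[OF ab(3)[of x] ab(4)[of x]] by simp
        show "(\<lambda>x. a' x * b x + b' x * a x) \<in> alg A" using ab mult by (intro alg.add alg.mult) auto
      qed
    qed
  qed
  then show ?thesis unfolding smooth_fam_def by (intro ballI)
qed

lemma smooth_fam_Un:
  assumes "smooth_fam m A" "smooth_fam m B" shows "smooth_fam m (A \<union> B)"
  unfolding smooth_fam_def
proof (intro ballI conjI allI impI)
  fix a assume a: "a \<in> A \<union> B"
  show "continuous_on UNIV a" "bounded (range a)"
    using a assms[THEN smooth_fam_cont, of a] assms[THEN smooth_fam_bdd, of a] by auto
  fix i assume "i < m"
  then show "\<exists>b\<in>A \<union> B. \<forall>x. ((\<lambda>t. a (x(i := t))) has_real_derivative b x) (at (x i))"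
    using a smooth_fam_der[OF assms(1), of a i] smooth_fam_der[OF assms(2), of a i] by blast
qed

text \<open>Derivatives in the added variables are 0, so the zero function has to belong to the
  family.\<close>

lemma smooth_fam_lift:
  assumes A: "smooth_fam m A" "\<And>a. a \<in> A \<Longrightarrow> dep m a"
  shows "smooth_fam (m + n) (insert (\<lambda>_. 0) A)"
  unfolding smooth_fam_def
proof (intro ballI conjI allI impI)
  fix a assume a: "a \<in> insert (\<lambda>_. 0) A"
  show "continuous_on UNIV a" "bounded (range a)"
    using a smooth_fam_cont[OF A(1), of a] smooth_fam_bdd[OF A(1), of a] by auto
  fix i assume "i < m + n"
  show "\<exists>b\<in>insert (\<lambda>_. 0) A. \<forall>x. ((\<lambda>t. a (x(i := t))) has_real_derivative b x) (at (x i))"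
  proof (cases "a \<in> A \<and> i < m")
    case True
    then obtain b where "b \<in> A" "\<forall>x. ((\<lambda>t. a (x(i := t))) has_real_derivative b x) (at (x i))"
      using smooth_fam_der[OF A(1), of a i] by blast
    then show ?thesis by (intro bexI[of _ b]) auto
  next
    case False
    have "(\<lambda>t. a (x(i := t))) = (\<lambda>_. a x)" for x
    proof (cases "a \<in> A")
      case True
      then show ?thesis using False by (intro ext depD[OF A(2)[OF True]]) auto
    qed (use a in auto)
    then show ?thesis by (intro bexI[of _ "\<lambda>_. 0"]) auto
  qed
qed

lemma smooth_fam_shift:
  assumes B: "smooth_fam n B"
  shows "smooth_fam (m + n) (insert (\<lambda>_. 0) ((\<lambda>b x. b (\<lambda>i. x (m + i))) ` B))" (is "smooth_fam _ ?B")
  unfolding smooth_fam_def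
proof (intro ballI conjI allI impI)
  fix a assume a: "a \<in> ?B"
  show "continuous_on UNIV a" "bounded (range a)"
  proof -
    show "continuous_on UNIV a"
    proof (cases "a = (\<lambda>_. 0)")
      case False
      then obtain b where b: "b \<in> B" "a = (\<lambda>x. b (\<lambda>i. x (m + i)))" using a by auto
      have "continuous_on UNIV (\<lambda>x::nat \<Rightarrow> real. (\<lambda>i. x (m + i)))"
        by (intro continuous_on_coordinatewise_then_product continuous_on_product_coordinates)
      then show ?thesis unfolding b(2)
        by (intro continuous_on_compose2[OF smooth_fam_cont[OF B b(1)]]) auto
    qed simp
    show "bounded (range a)"
    proof (cases "a = (\<lambda>_. 0)")
      case False
      then obtain b where b: "b \<in> B" "a = (\<lambda>x. b (\<lambda>i. x (m + i)))" using a by auto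
      then have "range a \<subseteq> range b" by auto
      then show ?thesis using smooth_fam_bdd[OF B b(1)] bounded_subset by blast
    qed auto
  qed
  fix i assume i: "i < m + n"
  show "\<exists>b\<in>?B. \<forall>x. ((\<lambda>t. a (x(i := t))) has_real_derivative b x) (at (x i))"
  proof (cases "a = (\<lambda>_. 0)")
    case True then show ?thesis by (intro bexI[of _ "\<lambda>_. 0"]) auto
  next
    case False
    then obtain b where b: "b \<in> B" "a = (\<lambda>x. b (\<lambda>i. x (m + i)))" using a by auto
    show ?thesis
    proof (cases "i < m")
      case True
      then have "(\<lambda>t. a (x(i := t))) = (\<lambda>_. a x)" for x unfolding b(2) by auto
      then show ?thesis by (intro bexI[of _ "\<lambda>_. 0"]) auto
    next
      case False
      define j where "j = i - m"
      have j: "i = m + j" "j < n" using False i by (auto simp: j_def)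
      obtain b' where b': "b' \<in> B" "\<And>x. ((\<lambda>t. b (x(j := t))) has_real_derivative b' x) (at (x j))"
        using smooth_fam_der[OF B b(1) j(2)] by blast
      have "(\<lambda>t. a (x(i := t))) = (\<lambda>t. b ((\<lambda>i. x (m + i))(j := t)))" for x
        unfolding b(2) j(1) by (intro ext arg_cong[of _ _ b]) auto
      then have "((\<lambda>t. a (x(i := t))) has_real_derivative b' (\<lambda>i. x (m + i))) (at (x i))" for x
        using b'(2)[of "\<lambda>i. x (m + i)"] j(1) by simp
      then show ?thesis using b'(1) by (intro bexI[of _ "\<lambda>x. b' (\<lambda>i. x (m + i))"]) auto
    qed
  qed
qed

section \<open>Cylinder functions as an algebra\<close>

definition ev :: "nat \<Rightarrow> (nat \<Rightarrow> coeffs) \<Rightarrow> coeffs \<Rightarrow> nat \<Rightarrow> real" where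
  "ev m l z = (\<lambda>i. if i < m then pairing (l i) z else 0)"

lemma FC_iff: "\<phi> \<in> FC s0 \<longleftrightarrow> (\<exists>m f l. Cb_inf m f \<and> (\<forall>i<m. l i \<in> Estar s0) \<and> \<phi> = (\<lambda>z. f (ev m l z)))"
  by (simp add: FC_def ev_def)

lemma FC_I: "smooth_fam m A \<Longrightarrow> f \<in> A \<Longrightarrow> dep m f \<Longrightarrow> (\<And>i. i < m \<Longrightarrow> l i \<in> Estar s0) \<Longrightarrow> (\<lambda>z. f (ev m l z)) \<in> FC s0"
  unfolding FC_iff using Cb_infI by blast

text \<open>Two cylinder functions become functions of the concatenated list of functionals, the
  second reading its arguments from position \<open>m\<close> on; the union of the two families then
  serves both.\<close>

lemma FC_common:
  assumes "\<phi> \<in> FC s0" "\<psi> \<in> FC s0"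
  obtains m A f g l where "smooth_fam m A" "f \<in> A" "g \<in> A" "dep m f" "dep m g"
    "\<forall>i<m. l i \<in> Estar s0" "\<phi> = (\<lambda>z. f (ev m l z))" "\<psi> = (\<lambda>z. g (ev m l z))"
proof -
  obtain m f l where f: "Cb_inf m f" "\<forall>i<m. l i \<in> Estar s0" "\<phi> = (\<lambda>z. f (ev m l z))"
    using assms(1) unfolding FC_iff by blast
  obtain n g l' where g: "Cb_inf n g" "\<forall>i<n. l' i \<in> Estar s0" "\<psi> = (\<lambda>z. g (ev n l' z))"
    using assms(2) unfolding FC_iff by blast
  define l'' where "l'' i = (if i < m then l i else l' (i - m))" for i
  define A where "A = insert (\<lambda>_. 0) (pds_fam m f) \<union> insert (\<lambda>_. 0) ((\<lambda>b x. b (\<lambda>i. x (m + i))) ` pds_fam n g)"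
  have df: "dep m f" using f(1) unfolding dep_def Cb_inf_def by blast
  have dg: "dep n g" using g(1) unfolding dep_def Cb_inf_def by blast
  show thesis
  proof (rule that)
    show "smooth_fam (m + n) A" unfolding A_def
      by (rule smooth_fam_Un[OF smooth_fam_lift[OF smooth_fam_Cb_inf[OF f(1)] dep_pds[OF f(1)]]
        smooth_fam_shift[OF smooth_fam_Cb_inf[OF g(1)]]])
    show "f \<in> A" "(\<lambda>x. g (\<lambda>i. x (m + i))) \<in> A" using pds_fam_self by (auto simp: A_def)
    show "dep (m + n) f" unfolding dep_def by (intro allI depD[OF df]) auto
    show "dep (m + n) (\<lambda>x. g (\<lambda>i. x (m + i)))" unfolding dep_def by (intro allI depD[OF dg]) auto
    show "\<forall>i<m + n. l'' i \<in> Estar s0" using f(2) g(2) by (auto simp: l''_def)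
    show "\<phi> = (\<lambda>z. f (ev (m + n) l'' z))" unfolding f(3) 
      by (intro ext depD[OF df]) (auto simp: ev_def l''_def)
    show "\<psi> = (\<lambda>z. (\<lambda>x. g (\<lambda>i. x (m + i))) (ev (m + n) l'' z))" unfolding g(3) 
      by (intro ext depD[OF dg]) (auto simp: ev_def l''_def)
  qed
qed

lemma FC_add: 
  assumes "\<phi> \<in> FC s0" "\<psi> \<in> FC s0" shows "(\<lambda>z. \<phi> z + \<psi> z) \<in> FC s0"
proof -
  obtain m A f g l where *: "smooth_fam m A" "f \<in> A" "g \<in> A" "dep m f" "dep m g"
    "\<forall>i<m. l i \<in> Estar s0" "\<phi> = (\<lambda>z. f (ev m l z))" "\<psi> = (\<lambda>z. g (ev m l z))"
    by (rule FC_common[OF assms]) (rule that, assumption+)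
  have "dep m (\<lambda>x. f x + g x)"
    unfolding dep_def by (intro allI arg_cong2[of _ _ _ _ "(+)"] depD[OF *(4)] depD[OF *(5)]) auto
  from FC_I[OF smooth_fam_alg[OF *(1)] alg.add[OF alg.base[OF *(2)] alg.base[OF *(3)]] this *(6)[rule_format]]
  show ?thesis unfolding *(7,8) .
qed

lemma FC_mult: 
  assumes "\<phi> \<in> FC s0" "\<psi> \<in> FC s0" shows "(\<lambda>z. \<phi> z * \<psi> z) \<in> FC s0"
proof -
  obtain m A f g l where *: "smooth_fam m A" "f \<in> A" "g \<in> A" "dep m f" "dep m g"
    "\<forall>i<m. l i \<in> Estar s0" "\<phi> = (\<lambda>z. f (ev m l z))" "\<psi> = (\<lambda>z. g (ev m l z))"
    by (rule FC_common[OF assms]) (rule that, assumption+)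
  have "dep m (\<lambda>x. f x * g x)"
    unfolding dep_def by (intro allI arg_cong2[of _ _ _ _ "(*)"] depD[OF *(4)] depD[OF *(5)]) auto
  from FC_I[OF smooth_fam_alg[OF *(1)] alg.mult[OF alg.base[OF *(2)] alg.base[OF *(3)]] this *(6)[rule_format]]
  show ?thesis unfolding *(7,8) .
qed

lemma FC_const: "(\<lambda>_. c) \<in> FC s0"
proof -
  have "smooth_fam 0 {}" by (simp add: smooth_fam_def)
  from FC_I[OF smooth_fam_alg[OF this] alg.const[of c], of "\<lambda>_ _. 0"] show ?thesis by (simp add: dep_def)
qed

lemma FC_lin: "\<phi> \<in> FC s0 \<Longrightarrow> \<psi> \<in> FC s0 \<Longrightarrow> (\<lambda>z. a * \<phi> z + b * \<psi> z) \<in> FC s0"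
  by (intro FC_add FC_mult FC_const)

lemma FC_poly: "\<phi> \<in> FC s0 \<Longrightarrow> (\<lambda>z. poly p (\<phi> z)) \<in> FC s0"
  by (induction p) (auto intro: FC_const FC_add FC_mult)

lemma FC_sum: "finite I \<Longrightarrow> (\<And>i. i \<in> I \<Longrightarrow> \<phi> i \<in> FC s0) \<Longrightarrow> (\<lambda>z. \<Sum>i\<in>I. \<phi> i z) \<in> FC s0"
  by (induction rule: finite_induct) (auto intro: FC_const FC_add)

lemma FC_prod: "finite I \<Longrightarrow> (\<And>i. i \<in> I \<Longrightarrow> \<phi> i \<in> FC s0) \<Longrightarrow> (\<lambda>z. \<Prod>i\<in>I. \<phi> i z) \<in> FC s0"
  by (induction rule: finite_induct) (auto intro: FC_const FC_mult)

lemma infsum_single: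
  fixes f :: "'i \<Rightarrow> real"
  assumes "\<And>j. j \<noteq> i \<Longrightarrow> j \<in> A \<Longrightarrow> f j = 0"
  shows "infsum f A = (if i \<in> A then f i else 0)"
proof -
  have "infsum f A = infsum f (A \<inter> {i})"
    using assms by (intro infsum_cong_neutral) auto
  then show ?thesis by (auto simp: Int_insert_right)
qed

definition unit :: "int \<times> int \<Rightarrow> coeffs" where "unit k = (\<lambda>j. if j = k then 1 else 0)"

lemma in_V_unit: "in_V \<alpha> (\<lambda>j. if j = k then c else 0)"
  unfolding in_V_def
  by (rule finite_nonzero_values_imp_summable_on, rule finite_subset[of _ "{k}"]) auto

text \<open>The functional is \<open>lam k\<close> times the unit vector (1 times it for the zero
  mode), because \<open>Qbar\<close> divides by \<open>lam k\<close>; its pairing is the coordinate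
  itself. The set \<open>B\<close> is the one-variable analogue of
  \<open>smooth_fam\<close>.\<close>

lemma FC_coord:
  fixes B :: "(real \<Rightarrow> real) set"
  assumes B: "\<And>g. g \<in> B \<Longrightarrow> bounded (range g) \<and> (\<exists>g'\<in>B. \<forall>x. (g has_real_derivative g' x) (at x))" "g \<in> B"
  shows "(\<lambda>z. g (z k)) \<in> FC s0"
proof -
  define l :: "nat \<Rightarrow> coeffs" where "l i = (\<lambda>j. if j = k then (if k = (0,0) then 1 else lam k) else 0)" for i
  have l: "l i \<in> Estar s0" for i unfolding l_def Estar_def using in_V_unit by blast
  have p: "pairing (l i) z = z k" for i z
  proof -
    have "pairing (l i) z = (if k \<in> UNIV then Qbar (l i) k * z k else 0)" unfolding pairing_def
      by (rule infsum_single) (auto simp: Qbar_def l_def)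
    then show ?thesis using lam_pos[of k] by (auto simp: Qbar_def l_def nz_def)
  qed
  have sf: "smooth_fam 1 ((\<lambda>g x. g (x 0)) ` B)"
    unfolding smooth_fam_def
  proof (intro ballI conjI allI impI)
    fix a assume "a \<in> (\<lambda>g (x::nat\<Rightarrow>real). g (x 0)) ` B"
    then obtain g where g: "g \<in> B" "a = (\<lambda>x. g (x 0))" by auto
    obtain g' where g': "g' \<in> B" "\<And>x. (g has_real_derivative g' x) (at x)" using B(1)[OF g(1)] by blast
    have "continuous_on UNIV g" using g'(2) by (intro continuous_at_imp_continuous_on) (auto intro: DERIV_isCont)
    then show "continuous_on UNIV a" unfolding g(2) 
      by (rule continuous_on_compose2) (auto intro: continuous_on_product_coordinates)
    have "range a \<subseteq> range g" unfolding g(2) by auto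
    then show "bounded (range a)" using B(1)[OF g(1)] bounded_subset by blast
    fix i :: nat assume "i < 1"
    then show "\<exists>b\<in>(\<lambda>g x. g (x 0)) ` B. \<forall>x. ((\<lambda>t. a (x(i := t))) has_real_derivative b x) (at (x i))"
      using g' g by (intro bexI[of _ "\<lambda>x. g' (x 0)"]) auto
  qed
  have "(\<lambda>z. (\<lambda>x. g (x 0)) (ev 1 l z)) \<in> FC s0"
    by (rule FC_I[OF sf]) (use B l in \<open>auto simp: dep_def\<close>)
  then show ?thesis by (simp add: ev_def p)
qed

section \<open>Gradients of cylinder functions\<close>

lemma powr_m1: "k \<in> nz \<Longrightarrow> lam k powr (-1) = 1 / lam k"
  using lam_pos[of k] by (simp add: powr_minus_divide)

lemma powr_neg_one_nonneg[simp]: "0 \<le> lam k powr a" by simp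

text \<open>The inequality between geometric and arithmetic mean for p |u k| and q |v k|, with p^2
  and q^2 the two weights. For a = s0 - 1 and b = -1 - s0 the exponent is -1: this is the duality
  between E and its dual.\<close>

lemma in_V_prod: 
  assumes "in_V a u" "in_V b v" shows "(\<lambda>k. lam k powr ((a+b)/2) * u k * v k) summable_on nz"
proof -
  have "(\<lambda>k. lam k powr a * (u k)\<^sup>2 + lam k powr b * (v k)\<^sup>2) summable_on nz"
    using assms unfolding in_V_def by (intro summable_on_add) auto
  then show ?thesis
  proof (rule summable_on_bound)
    fix k assume k: "k \<in> nz"
    define p q where "p = lam k powr (a/2)" and "q = lam k powr (b/2)"
    have pq: "lam k powr a = p\<^sup>2" "lam k powr b = q\<^sup>2" "lam k powr ((a+b)/2) = p * q" "p > 0" "q > 0"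
      using lam_pos[OF k] unfolding p_def q_def by (auto simp: powr_add[symmetric] power2_eq_square add_divide_distrib)
    have "0 \<le> (p * \<bar>u k\<bar> - q * \<bar>v k\<bar>)\<^sup>2" by simp
    then have "2 * ((p * \<bar>u k\<bar>) * (q * \<bar>v k\<bar>)) \<le> p\<^sup>2 * (u k)\<^sup>2 + q\<^sup>2 * (v k)\<^sup>2"
      unfolding power2_diff by (simp add: power_mult_distrib)
    moreover have "0 \<le> (p * \<bar>u k\<bar>) * (q * \<bar>v k\<bar>)" using pq by simp
    ultimately have "(p * \<bar>u k\<bar>) * (q * \<bar>v k\<bar>) \<le> p\<^sup>2 * (u k)\<^sup>2 + q\<^sup>2 * (v k)\<^sup>2" by linarith
    moreover have "\<bar>p * q * u k * v k\<bar> = (p * \<bar>u k\<bar>) * (q * \<bar>v k\<bar>)"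
      using pq by (simp add: abs_mult algebra_simps)
    ultimately show "\<bar>lam k powr ((a+b)/2) * u k * v k\<bar> \<le> lam k powr a * (u k)\<^sup>2 + lam k powr b * (v k)\<^sup>2"
      by (simp add: pq)
  qed
qed

lemma V_prod: "in_V \<alpha> u \<Longrightarrow> in_V \<alpha> v \<Longrightarrow> (\<lambda>k. lam k powr \<alpha> * u k * v k) summable_on nz"
  using in_V_prod[of \<alpha> u \<alpha> v] by simp

lemma V_lin:
  assumes "in_V \<alpha> u" "in_V \<alpha> v" shows "in_V \<alpha> (\<lambda>k. a * u k + b * v k)"
proof -
  have "(\<lambda>k. 2 * a\<^sup>2 * (lam k powr \<alpha> * (u k)\<^sup>2) + 2 * b\<^sup>2 * (lam k powr \<alpha> * (v k)\<^sup>2)) summable_on nz"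
    using assms unfolding in_V_def by (intro summable_on_add summable_on_cmult_right)
  then show ?thesis unfolding in_V_def
  proof (rule summable_on_bound)
    fix k
    have "(a * u k + b * v k)\<^sup>2 \<le> 2 * (a * u k)\<^sup>2 + 2 * (b * v k)\<^sup>2"
      using zero_le_power2[of "a * u k - b * v k"] by (simp add: power2_sum power2_diff)
    then have "lam k powr \<alpha> * (a * u k + b * v k)\<^sup>2 \<le> lam k powr \<alpha> * (2 * (a * u k)\<^sup>2 + 2 * (b * v k)\<^sup>2)"
      by (intro mult_left_mono) auto
    then show "\<bar>lam k powr \<alpha> * (a * u k + b * v k)\<^sup>2\<bar> \<le> 2 * a\<^sup>2 * (lam k powr \<alpha> * (u k)\<^sup>2) + 2 * b\<^sup>2 * (lam k powr \<alpha> * (v k)\<^sup>2)"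
      by (simp add: power_mult_distrib algebra_simps)
  qed
qed

lemma Vinner_lin:
  assumes u: "in_V \<alpha> u" and v: "in_V \<alpha> v" and w: "in_V \<alpha> w"
  shows "Vinner \<alpha> (\<lambda>k. a * u k + b * v k) w = a * Vinner \<alpha> u w + b * Vinner \<alpha> v w"
proof -
  have "(\<Sum>\<^sub>\<infinity>k\<in>nz. lam k powr \<alpha> * (a * u k + b * v k) * w k) = (\<Sum>\<^sub>\<infinity>k\<in>nz. a * (lam k powr \<alpha> * u k * w k) + b * (lam k powr \<alpha> * v k * w k))"
    by (rule infsum_cong) (simp add: algebra_simps)
  also have "\<dots> = a * (\<Sum>\<^sub>\<infinity>k\<in>nz. lam k powr \<alpha> * u k * w k) + b * (\<Sum>\<^sub>\<infinity>k\<in>nz. lam k powr \<alpha> * v k * w k)"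
    by (subst infsum_add) (use V_prod[OF u w] V_prod[OF v w] in \<open>simp_all add: infsum_cmult_right' summable_on_cmult_right\<close>)
  finally show ?thesis
    unfolding Vinner_def by (simp add: algebra_simps)
qed

lemma Vinner_unit: 
  "Vinner (-1) g (unit k) = (if k = (0,0) then g k else g k / lam k)"
proof -
  have "(\<Sum>\<^sub>\<infinity>j\<in>nz. lam j powr (-1) * g j * unit k j) = (if k \<in> nz then lam k powr (-1) * g k * unit k k else 0)"
    by (rule infsum_single) (auto simp: unit_def)
  then show ?thesis unfolding Vinner_def using powr_m1[of k] by (auto simp: unit_def nz_def)
qed

lemma unit_in_V: "in_V \<alpha> (unit k)" unfolding unit_def by (rule in_V_unit)

text \<open>\<open>grad\<close> is a description in terms of \<open>deriv\<close>, which has a value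
  even where no derivative exists. This predicate asks for genuine derivatives in all directions of
  V^-1, so that chain and sum rules apply.\<close>

definition has_grad :: "(coeffs \<Rightarrow> real) \<Rightarrow> coeffs \<Rightarrow> coeffs \<Rightarrow> bool" where
  "has_grad \<phi> z g \<longleftrightarrow> in_V (-1) g \<and> (\<forall>h. in_V (-1) h \<longrightarrow>
     ((\<lambda>t. \<phi> (\<lambda>k. z k + t * h k)) has_real_derivative Vinner (-1) g h) (at 0))"

text \<open>The description determines the gradient, since testing with the unit vectors recovers
  every coefficient.\<close>

lemma has_grad_grad:
  assumes "has_grad \<phi> z g" shows "grad \<phi> z = g"
  unfolding grad_def
proof (rule the_equality)
  have d: "dirderiv \<phi> z h = Vinner (-1) g h" if "in_V (-1) h" for h
    using assms that unfolding has_grad_def dirderiv_def by (intro DERIV_imp_deriv) auto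
  then show "in_V (-1) g \<and> (\<forall>h. in_V (-1) h \<longrightarrow> Vinner (-1) g h = dirderiv \<phi> z h)"
    using assms by (auto simp: has_grad_def)
  fix g' assume g': "in_V (-1) g' \<and> (\<forall>h. in_V (-1) h \<longrightarrow> Vinner (-1) g' h = dirderiv \<phi> z h)"
  show "g' = g"
  proof
    fix k
    have "Vinner (-1) g' (unit k) = Vinner (-1) g (unit k)" using g' d unit_in_V by metis
    then show "g' k = g k" unfolding Vinner_unit using lam_pos[of k] by (auto simp: nz_def split: if_splits)
  qed
qed

lemma has_grad_lin:
  assumes "has_grad \<phi> z g" "has_grad \<psi> z g'"
  shows "has_grad (\<lambda>z. a * \<phi> z + b * \<psi> z) z (\<lambda>k. a * g k + b * g' k)"
  unfolding has_grad_def
proof (intro conjI allI impI)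
  have v: "in_V (-1) g" "in_V (-1) g'" using assms by (auto simp: has_grad_def)
  then show "in_V (-1) (\<lambda>k. a * g k + b * g' k)" by (rule V_lin)
  fix h assume h: "in_V (-1) h"
  show "((\<lambda>t. a * \<phi> (\<lambda>k. z k + t * h k) + b * \<psi> (\<lambda>k. z k + t * h k)) has_real_derivative
     Vinner (-1) (\<lambda>k. a * g k + b * g' k) h) (at 0)"
    unfolding Vinner_lin[OF v h] using assms h unfolding has_grad_def
    by (intro DERIV_add DERIV_cmult) auto
qed

lemma has_grad_chain:
  assumes g: "has_grad \<phi> z g" and f: "(f has_real_derivative f') (at (\<phi> z))"
  shows "has_grad (\<lambda>z. f (\<phi> z)) z (\<lambda>k. f' * g k)"
  unfolding has_grad_def
proof (intro conjI allI impI)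
  have v: "in_V (-1) g" using assms by (auto simp: has_grad_def)
  then show "in_V (-1) (\<lambda>k. f' * g k)" using V_lin[OF v v, of f' 0] by simp
  fix h assume h: "in_V (-1) h"
  have "((\<lambda>t. f (\<phi> (\<lambda>k. z k + t * h k))) has_real_derivative f' * Vinner (-1) g h) (at 0)"
    using g h f unfolding has_grad_def by (intro DERIV_chain2[where f=f]) auto
  moreover have "f' * Vinner (-1) g h = Vinner (-1) (\<lambda>k. f' * g k) h"
    using Vinner_lin[OF v v h, of f' 0] by simp
  ultimately show "((\<lambda>t. f (\<phi> (\<lambda>k. z k + t * h k))) has_real_derivative Vinner (-1) (\<lambda>k. f' * g k) h) (at 0)" by simp
qed

lemma MVT_two_sided:
  fixes f f' :: "real \<Rightarrow> real"
  assumes "\<And>x. (f has_real_derivative f' x) (at x)"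
  shows "\<exists>\<tau>. \<bar>\<tau> - a\<bar> \<le> \<bar>h\<bar> \<and> f (a + h) - f a = h * f' \<tau>"
proof (cases h "0::real" rule: linorder_cases)
  case less
  then obtain \<tau> where "a + h < \<tau>" "\<tau> < a" "f a - f (a + h) = (a - (a + h)) * f' \<tau>"
    using MVT2[of "a + h" a f f'] assms by auto
  then show ?thesis by (intro exI[of _ \<tau>]) (auto simp: algebra_simps)
next
  case equal then show ?thesis by (intro exI[of _ a]) auto
next
  case greater
  then obtain \<tau> where "a < \<tau>" "\<tau> < a + h" "f (a + h) - f a = (a + h - a) * f' \<tau>"
    using MVT2[of a "a + h" f f'] assms by auto
  then show ?thesis by (intro exI[of _ \<tau>]) auto
qed

lemma tendsto_funI:
  fixes f :: "'a \<Rightarrow> 'i \<Rightarrow> 'b::topological_space"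
  assumes "\<And>i. ((\<lambda>t. f t i) \<longlongrightarrow> l i) F" shows "(f \<longlongrightarrow> l) F"
proof -
  have "limitin (product_topology (\<lambda>_. euclidean) UNIV) f l F"
    using assms by (subst limitin_componentwise) auto
  then show ?thesis by (simp add: euclidean_product_topology)
qed

text \<open>Chain rule along a line from continuous partial derivatives: the arguments are moved one
  at a time by induction on \<open>n\<close>, each move is an instance of the mean value theorem,
  and continuity of the partial derivative in the product topology gives the limit.\<close>

lemma smooth_chain:
  assumes f: "Cb_inf m f" and n: "n \<le> m"
  shows "((\<lambda>t. f (\<lambda>i. x i + (if i < n then t * y i else 0))) has_real_derivative (\<Sum>i<n. pds [i] f x * y i)) (at 0)"
  using n
proof (induction n)
  case 0 then show ?case by simp
next
  case (Suc n)
  let ?u = "\<lambda>n t i. x i + (if i < n then t * y i else 0)"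
  have nm: "n < m" using Suc by simp
  have der: "((\<lambda>t. f (u(n := t))) has_real_derivative pds [n] f (u(n := \<tau>))) (at \<tau>)" for u \<tau>
  proof -
    have "(\<lambda>t. pds [] f ((u(n := \<tau>))(n := t))) differentiable (at ((u(n := \<tau>)) n))"
      using f nm by (intro Cb_inf_diff) auto
    then show ?thesis using DERIV_deriv_iff_real_differentiable by simp
  qed
  have "\<exists>\<tau>. \<bar>\<tau> - x n\<bar> \<le> \<bar>t * y n\<bar> \<and> f ((?u n t)(n := x n + t * y n)) - f ((?u n t)(n := x n)) =
      t * y n * pds [n] f ((?u n t)(n := \<tau>))" for t
    using MVT_two_sided[of "\<lambda>s. f ((?u n t)(n := s))" "\<lambda>s. pds [n] f ((?u n t)(n := s))", OF der] .
  then obtain \<tau> where \<tau>: "\<And>t. \<bar>\<tau> t - x n\<bar> \<le> \<bar>t * y n\<bar>"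
    "\<And>t. f ((?u n t)(n := x n + t * y n)) - f ((?u n t)(n := x n)) = t * y n * pds [n] f ((?u n t)(n := \<tau> t))"
    by metis
  have e1: "(?u n t)(n := x n + t * y n) = ?u (Suc n) t" for t by auto
  have e2: "(?u n t)(n := x n) = ?u n t" for t by auto
  have diff: "f (?u (Suc n) t) - f (?u n t) = t * y n * pds [n] f ((?u n t)(n := \<tau> t))" for t
    using \<tau>(2)[of t] unfolding e1 e2 .
  have lim\<tau>: "(\<tau> \<longlongrightarrow> x n) (at 0)"
  proof -
    have "((\<lambda>t. \<tau> t - x n) \<longlongrightarrow> 0) (at 0)"
    proof (rule Lim_null_comparison)
      show "\<forall>\<^sub>F t in at 0. norm (\<tau> t - x n) \<le> \<bar>t * y n\<bar>" using \<tau>(1) by simp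
      show "((\<lambda>t. \<bar>t * y n\<bar>) \<longlongrightarrow> 0) (at 0)"
        by (auto intro!: tendsto_eq_intros)
    qed
    then show ?thesis by (simp add: LIM_zero_iff)
  qed
  have limu: "((\<lambda>t. (?u n t)(n := \<tau> t)) \<longlongrightarrow> x) (at 0)"
  proof (rule tendsto_funI)
    fix i
    show "((\<lambda>t. ((?u n t)(n := \<tau> t)) i) \<longlongrightarrow> x i) (at 0)"
    proof (cases "i = n")
      case True then show ?thesis using lim\<tau> by simp
    next
      case False
      have "((\<lambda>t. x i + (if i < n then t * y i else 0)) \<longlongrightarrow> x i) (at 0)"
        by (cases "i < n") (auto intro!: tendsto_eq_intros)
      then show ?thesis using False by simp
    qed
  qed
  have cont: "isCont (pds [n] f) x"
    using Cb_inf_cont[OF f, of "[n]"] nm by (simp add: continuous_on_eq_continuous_at)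
  have limp: "((\<lambda>t. pds [n] f ((?u n t)(n := \<tau> t))) \<longlongrightarrow> pds [n] f x) (at 0)"
    using isCont_tendsto_compose[OF cont limu] .
  have D: "((\<lambda>t. f (?u (Suc n) t) - f (?u n t)) has_real_derivative y n * pds [n] f x) (at 0)"
    unfolding DERIV_def
  proof (rule Lim_transform_eventually)
    show "((\<lambda>h. y n * pds [n] f ((?u n h)(n := \<tau> h))) \<longlongrightarrow> y n * pds [n] f x) (at 0)"
      by (intro tendsto_intros limp)
    show "\<forall>\<^sub>F h in at 0. y n * pds [n] f ((?u n h)(n := \<tau> h)) =
      (f (?u (Suc n) (0 + h)) - f (?u n (0 + h)) - (f (?u (Suc n) 0) - f (?u n 0))) / h"
      unfolding eventually_at_filter
    proof (rule always_eventually, intro allI impI)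
      fix h :: real assume h: "h \<noteq> 0"
      have "f (?u (Suc n) 0) - f (?u n 0) = 0" using diff[of 0] by (simp del: pds.simps)
      then show "y n * pds [n] f ((?u n h)(n := \<tau> h)) =
        (f (?u (Suc n) (0 + h)) - f (?u n (0 + h)) - (f (?u (Suc n) 0) - f (?u n 0))) / h"
        unfolding add_0 diff[of h] using h by (simp del: pds.simps)
    qed
  qed
  have "((\<lambda>t. f (?u n t) + (f (?u (Suc n) t) - f (?u n t))) has_real_derivative
      (\<Sum>i<n. pds [i] f x * y i) + y n * pds [n] f x) (at 0)"
    using Suc by (intro DERIV_add D) auto
  then show ?case by (simp add: mult.commute)
qed

text \<open>\<open>pairing\<close> is 0 by default when its series diverges. Since \<open>z\<close>
  may be an arbitrary coefficient family, the two situations must be told apart.\<close>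

definition psum :: "coeffs \<Rightarrow> coeffs \<Rightarrow> bool" where
  "psum l z \<longleftrightarrow> (\<lambda>k. Qbar l k * z k) summable_on UNIV"

lemma UNIV_nz: "UNIV = insert (0,0) nz" "(0,0) \<notin> nz" by (auto simp: nz_def)

lemma Qbar_nz: "k \<in> nz \<Longrightarrow> Qbar l k = l k / lam k" by (auto simp: Qbar_def nz_def)

lemma psum_iff: "psum l z \<longleftrightarrow> (\<lambda>k. lam k powr (-1) * l k * z k) summable_on nz"
proof -
  have "psum l z \<longleftrightarrow> (\<lambda>k. Qbar l k * z k) summable_on nz"
    unfolding psum_def UNIV_nz(1) by (rule summable_on_insert_iff)
  also have "\<dots> \<longleftrightarrow> (\<lambda>k. lam k powr (-1) * l k * z k) summable_on nz"
    by (intro summable_on_cong) (simp add: Qbar_nz powr_m1)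
  finally show ?thesis .
qed

lemma pairing_eq: "psum l z \<Longrightarrow> pairing l z = Vinner (-1) l z"
proof -
  assume p: "psum l z"
  have "pairing l z = Qbar l (0,0) * z (0,0) + (\<Sum>\<^sub>\<infinity>k\<in>nz. Qbar l k * z k)"
  proof -
    have s: "(\<lambda>k. Qbar l k * z k) summable_on nz"
      using p unfolding psum_def by (rule summable_on_subset_banach) simp
    have "pairing l z = infsum (\<lambda>k. Qbar l k * z k) (insert (0,0) nz)"
      unfolding pairing_def using UNIV_nz(1) by simp
    then show ?thesis using infsum_insert[OF s UNIV_nz(2)] by simp
  qed
  also have "(\<Sum>\<^sub>\<infinity>k\<in>nz. Qbar l k * z k) = (\<Sum>\<^sub>\<infinity>k\<in>nz. lam k powr (-1) * l k * z k)"
    by (intro infsum_cong) (simp add: Qbar_nz powr_m1)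
  finally show ?thesis by (simp add: Vinner_def Qbar_def)
qed

lemma pairing_no: "\<not> psum l z \<Longrightarrow> pairing l z = 0"
  unfolding pairing_def psum_def by (rule infsum_not_exists)

lemma psum_V: "in_V (-1) l \<Longrightarrow> in_V (-1) h \<Longrightarrow> psum l h"
  unfolding psum_iff by (rule V_prod)

text \<open>Adding a multiple of an element of V^-1 never changes whether the series converges.
  Where it diverges, the pairing is the constant 0 along the whole line, with derivative 0; so the
  formula covers every \<open>z\<close>.\<close>

lemma pairing_add:
  assumes l: "in_V (-1) l" and h: "in_V (-1) h"
  shows "pairing l (\<lambda>k. z k + t * h k) = pairing l z + t * (if psum l z then Vinner (-1) l h else 0)"
proof (cases "psum l z")
  case True
  have s: "(\<lambda>k. Qbar l k * z k) summable_on UNIV" "(\<lambda>k. t * (Qbar l k * h k)) summable_on UNIV"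
    using True psum_V[OF l h] unfolding psum_def by (auto intro: summable_on_cmult_right)
  have "pairing l (\<lambda>k. z k + t * h k) = (\<Sum>\<^sub>\<infinity>k. Qbar l k * z k + t * (Qbar l k * h k))"
    unfolding pairing_def by (intro infsum_cong) (simp add: algebra_simps)
  also have "\<dots> = pairing l z + t * pairing l h"
    unfolding pairing_def by (simp add: infsum_add[OF s] infsum_cmult_right')
  finally show ?thesis using True pairing_eq[OF psum_V[OF l h]] by simp
next
  case False
  have "\<not> psum l (\<lambda>k. z k + t * h k)"
  proof
    assume "psum l (\<lambda>k. z k + t * h k)"
    then have "(\<lambda>k. Qbar l k * (z k + t * h k) + (- t) * (Qbar l k * h k)) summable_on UNIV"
      using psum_V[OF l h] unfolding psum_def by (intro summable_on_add summable_on_cmult_right)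
    then show False using False unfolding psum_def by (simp add: algebra_simps)
  qed
  then show ?thesis using False by (simp add: pairing_no)
qed

lemma Estar_V: "s0 > 0 \<Longrightarrow> l \<in> Estar s0 \<Longrightarrow> in_V (-1) l"
  unfolding Estar_def in_V_def mem_Collect_eq
proof (erule summable_on_bound)
  fix k assume "s0 > 0" "k \<in> nz"
  then have "lam k powr (-1) \<le> lam k powr (s0 - 1)" using lam_ge_1[of k] by (intro powr_mono) auto
  then show "\<bar>lam k powr - 1 * (l k)\<^sup>2\<bar> \<le> lam k powr (s0 - 1) * (l k)\<^sup>2"
    using mult_right_mono[of "lam k powr (-1)" "lam k powr (s0 - 1)" "(l k)\<^sup>2"] by (simp del: powr_neg_one add: abs_mult)
qed

lemma psum_E: "l \<in> Estar s0 \<Longrightarrow> z \<in> Espace s0 \<Longrightarrow> psum l z"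
  unfolding psum_iff Estar_def Espace_def using in_V_prod[of "s0 - 1" l "-1-s0" z] by simp

lemma in_V_sum: "finite I \<Longrightarrow> (\<And>i. i \<in> I \<Longrightarrow> in_V (-1) (g i)) \<Longrightarrow> in_V (-1) (\<lambda>k. \<Sum>i\<in>I. c i * g i k)"
proof (induction rule: finite_induct)
  case empty show ?case by (simp add: in_V_def)
next
  case (insert x F) then show ?case using V_lin[of "-1" "g x" "\<lambda>k. \<Sum>i\<in>F. c i * g i k" "c x" 1] by simp
qed

lemma Vinner_sum: "finite I \<Longrightarrow> (\<And>i. i \<in> I \<Longrightarrow> in_V (-1) (g i)) \<Longrightarrow> in_V (-1) h \<Longrightarrow>
   Vinner (-1) (\<lambda>k. \<Sum>i\<in>I. c i * g i k) h = (\<Sum>i\<in>I. c i * Vinner (-1) (g i) h)"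
proof (induction rule: finite_induct)
  case empty show ?case by (simp add: Vinner_def)
next
  case (insert x F) 
  then show ?case using Vinner_lin[OF _ in_V_sum, of "g x" F g h "c x" 1 c] by simp
qed

text \<open>The representative of the derivative in V^-1 is a combination of the \<open>l i\<close>
  themselves, because a convergent pairing is the V^-1 inner product. Arguments with a divergent
  pairing do not contribute; on E there are none.\<close>

definition cgrad :: "nat \<Rightarrow> ((nat \<Rightarrow> real) \<Rightarrow> real) \<Rightarrow> (nat \<Rightarrow> coeffs) \<Rightarrow> coeffs \<Rightarrow> coeffs" where
  "cgrad m f l z = (\<lambda>k. \<Sum>i<m. (if psum (l i) z then pds [i] f (ev m l z) else 0) * l i k)"

lemma has_grad_cylinder:
  assumes f: "Cb_inf m f" and l: "\<And>i. i < m \<Longrightarrow> in_V (-1) (l i)"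
  shows "has_grad (\<lambda>z. f (ev m l z)) z (cgrad m f l z)"
  unfolding has_grad_def
proof (intro conjI allI impI)
  show "in_V (-1) (cgrad m f l z)" unfolding cgrad_def by (rule in_V_sum) (use l in auto)
  fix h assume h: "in_V (-1) h"
  let ?y = "\<lambda>i. if psum (l i) z then Vinner (-1) (l i) h else 0"
  have e: "ev m l (\<lambda>k. z k + t * h k) = (\<lambda>i. ev m l z i + (if i < m then t * ?y i else 0))" for t
    unfolding ev_def using pairing_add[OF l h] by auto
  have "((\<lambda>t. f (ev m l (\<lambda>k. z k + t * h k))) has_real_derivative (\<Sum>i<m. pds [i] f (ev m l z) * ?y i)) (at 0)"
    unfolding e by (rule smooth_chain[OF f]) simp
  also have "(\<Sum>i<m. pds [i] f (ev m l z) * ?y i) = Vinner (-1) (cgrad m f l z) h"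
    unfolding cgrad_def by (subst Vinner_sum) (use l h in \<open>auto intro!: sum.cong\<close>)
  finally show "((\<lambda>t. f (ev m l (\<lambda>k. z k + t * h k))) has_real_derivative Vinner (-1) (cgrad m f l z) h) (at 0)" .
qed

lemma psum_measurable[measurable]: "Measurable.pred gff (\<lambda>z. psum l z)"
  unfolding psum_def by (rule summable_on_measurable) auto

lemma pairing_measurable[measurable]: "(\<lambda>z. pairing l z) \<in> borel_measurable gff"
  unfolding pairing_def by (rule infsum_measurable) auto

lemma ev_measurable[measurable]: "(\<lambda>z. ev m l z) \<in> borel_measurable gff"
proof -
  have "(\<lambda>z. ev m l z) \<in> measurable gff (PiM UNIV (\<lambda>_. borel))"
    unfolding ev_def by (rule measurable_PiM_single') auto
  then show ?thesis unfolding measurable_cong_sets[OF refl sets_PiM_equal_borel] .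
qed

lemma smooth_measurable: "continuous_on UNIV f \<Longrightarrow> (\<lambda>z. f (ev m l z) :: real) \<in> borel_measurable gff"
  using borel_measurable_continuous_onI measurable_compose[OF ev_measurable] by blast

locale fc_setting = fixes s0 :: real assumes s0: "s0 > 0"
begin

lemma FC_E:
  assumes "\<phi> \<in> FC s0"
  obtains m f l where "Cb_inf m f" "\<forall>i<m. l i \<in> Estar s0" "\<forall>i<m. in_V (-1) (l i)" "\<phi> = (\<lambda>z. f (ev m l z))"
    "\<forall>z. grad \<phi> z = cgrad m f l z"
proof -
  obtain m f l where f: "Cb_inf m f" "\<forall>i<m. l i \<in> Estar s0" "\<phi> = (\<lambda>z. f (ev m l z))"
    using assms(1) unfolding FC_iff by blast
  have "in_V (-1) (l i)" if "i < m" for i using f(2) that Estar_V[OF s0] by blast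
  then show thesis using that[of m f l] f has_grad_grad[OF has_grad_cylinder[OF f(1), of l]] by blast
qed

lemma FC_has_grad: "\<phi> \<in> FC s0 \<Longrightarrow> has_grad \<phi> z (grad \<phi> z)"
  by (erule FC_E) (simp add: has_grad_cylinder)

lemma FC_measurable: "\<phi> \<in> FC s0 \<Longrightarrow> \<phi> \<in> borel_measurable gff"
proof -
  assume "\<phi> \<in> FC s0"
  then obtain m f l where f: "Cb_inf m f" "\<phi> = (\<lambda>z. f (ev m l z))" unfolding FC_iff by blast
  have "continuous_on UNIV (pds [] f)" using f(1) by (intro Cb_inf_cont) auto
  then show ?thesis unfolding f(2) using smooth_measurable by simp
qed

lemma FC_bounded: 
  assumes "\<phi> \<in> FC s0" obtains C where "\<And>z. \<bar>\<phi> z\<bar> \<le> C"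
proof -
  obtain m f l where f: "Cb_inf m f" "\<phi> = (\<lambda>z. f (ev m l z))" using assms unfolding FC_iff by blast
  have "bounded (range (pds [] f))" using f(1) by (intro Cb_inf_bounded) auto
  then obtain C where "\<And>x. \<bar>f x\<bar> \<le> C" unfolding bounded_iff by auto
  then show thesis using that[of C] f(2) by simp
qed

lemma grad_measurable: "\<phi> \<in> FC s0 \<Longrightarrow> (\<lambda>z. grad \<phi> z k) \<in> borel_measurable gff"
proof -
  assume "\<phi> \<in> FC s0"
  then obtain m f l where f: "Cb_inf m f" "\<forall>z. grad \<phi> z = cgrad m f l z" by (rule FC_E) (rule that, assumption+)
  have c: "continuous_on UNIV (pds [i] f)" if "i < m" for i
    using f(1) that by (intro Cb_inf_cont) auto
  show ?thesis unfolding f(2)[rule_format] cgrad_def using smooth_measurable[OF c] by measurable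
qed

text \<open>On E all pairings converge, so each gradient component is a sum of cylinder functions;
  outside E the default values can make the two differ. Applied twice, this provides the second
  derivatives for integration by parts.\<close>

lemma FC_deriv:
  assumes "\<phi> \<in> FC s0" 
  obtains \<psi> where "\<psi> \<in> FC s0" "\<And>z. z \<in> Espace s0 \<Longrightarrow> grad \<phi> z k = \<psi> z"
proof -
  obtain m f l where f: "Cb_inf m f" "\<forall>i<m. l i \<in> Estar s0" "\<forall>z. grad \<phi> z = cgrad m f l z"
    using assms by (rule FC_E) (rule that, assumption+)
  have "pds [i] f \<in> pds_fam m f" if "i < m" for i
    unfolding pds_fam_def using that by (intro CollectI exI[of _ "[i]"]) auto
  then have "(\<lambda>z. pds [i] f (ev m l z)) \<in> FC s0" if "i < m" for i
    using that f by (intro FC_I[OF smooth_fam_Cb_inf[OF f(1)]] dep_pds) auto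
  then have "(\<lambda>z. \<Sum>i<m. pds [i] f (ev m l z) * l i k) \<in> FC s0"
    by (intro FC_sum FC_mult FC_const) auto
  moreover have "grad \<phi> z k = (\<Sum>i<m. pds [i] f (ev m l z) * l i k)" if "z \<in> Espace s0" for z
    unfolding f(3)[rule_format] cgrad_def using psum_E f(2) that by (intro sum.cong) auto
  ultimately show thesis using that by blast
qed

text \<open>One majorant in V^-1 for all \<open>z\<close>; it later dominates the series of the
  energy density.\<close>

lemma grad_bound:
  assumes "\<phi> \<in> FC s0" 
  obtains L where "in_V (-1) L" "\<And>z k. \<bar>grad \<phi> z k\<bar> \<le> L k"
proof -
  obtain m f l where f: "Cb_inf m f" "\<forall>i<m. in_V (-1) (l i)" "\<forall>z. grad \<phi> z = cgrad m f l z"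
    using assms by (rule FC_E) (rule that, assumption+)
  have "\<exists>C\<ge>0. \<forall>x. \<bar>pds [i] f x\<bar> \<le> C" if "i < m" for i
  proof -
    have "set [i] \<subseteq> {..<m}" using that by auto
    then have "bounded (range (pds [i] f))" using f(1) unfolding Cb_inf_def by blast
    then obtain C where "\<And>x. \<bar>pds [i] f x\<bar> \<le> C" unfolding bounded_iff by auto
    moreover from this[of undefined] have "C \<ge> 0" by (rule order_trans[OF abs_ge_zero])
    ultimately show ?thesis by blast
  qed
  then obtain C where C: "\<And>i. i < m \<Longrightarrow> C i \<ge> 0" "\<And>i x. i < m \<Longrightarrow> \<bar>pds [i] f x\<bar> \<le> C i" by metis
  show thesis
  proof (rule that[of "\<lambda>k. \<Sum>i<m. C i * \<bar>l i k\<bar>"])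
    show "in_V (-1) (\<lambda>k. \<Sum>i<m. C i * \<bar>l i k\<bar>)"
      by (rule in_V_sum) (use f(2) in \<open>auto simp: in_V_def\<close>)
    fix z k
    have "\<bar>grad \<phi> z k\<bar> \<le> (\<Sum>i<m. \<bar>(if psum (l i) z then pds [i] f (ev m l z) else 0) * l i k\<bar>)"
      unfolding f(3)[rule_format] cgrad_def by (rule sum_abs)
    also have "\<dots> \<le> (\<Sum>i<m. C i * \<bar>l i k\<bar>)"
      unfolding abs_mult using C by (intro sum_mono mult_right_mono) auto
    finally show "\<bar>grad \<phi> z k\<bar> \<le> (\<Sum>i<m. C i * \<bar>l i k\<bar>)" .
  qed
qed

end

section \<open>Hermite polynomials of Gaussian sums\<close>

text \<open>Hermite polynomials with variance parameter \<open>c\<close>, that is c^(n/2) times the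
  standard one at x / sqrt c, but polynomial in \<open>c\<close>, so that c = 0 is allowed and gives
  x^n. The last branch is meaningful only for n = 4.\<close>

definition herm :: "nat \<Rightarrow> real \<Rightarrow> real \<Rightarrow> real" where
  "herm n c x = (if n = 0 then 1 else if n = 1 then x else if n = 2 then x^2 - c
     else if n = 3 then x^3 - 3 * c * x else x^4 - 6 * c * x^2 + 3 * c^2)"

lemma le4: "n \<le> 4 \<Longrightarrow> n \<in> {0, 1, 2, 3, 4::nat}"
  by auto

text \<open>The generating function exp (t x - t^2 c / 2) is multiplicative in the pair (c, x); for
  n <= 4 each case is a polynomial identity.\<close>

lemma herm_add:
  assumes "n \<le> 4"
  shows "herm n (c + d) (x + y) = (\<Sum>p\<le>n. (n choose p) * herm p c x * herm (n - p) d y)"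
proof -
  have s0: "{..0::nat} = {0}" and s1: "{..1::nat} = {0,1}" and s2: "{..2::nat} = {0,1,2}" 
    and s3: "{..3::nat} = {0,1,2,3}" and s4: "{..4::nat} = {0,1,2,3,4}" by auto
  have b: "(2 choose 1) = (2::nat)" "(3 choose 1) = (3::nat)" "(3 choose 2) = (3::nat)"
    "(4 choose 1) = (4::nat)" "(4 choose 2) = (6::nat)" "(4 choose 3) = (4::nat)"
    by (simp_all add: eval_nat_numeral)
  have h: "herm 0 c x = 1" "herm 1 c x = x" "herm 2 c x = x^2 - c" "herm 3 c x = x^3 - 3 * c * x"
    "herm 4 c x = x^4 - 6 * c * x^2 + 3 * c^2" for c x by (simp_all add: herm_def)
  consider "n = 0" | "n = 1" | "n = 2" | "n = 3" | "n = 4" using le4[OF assms] by auto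
  then show ?thesis
  proof cases
    case 1 then show ?thesis by (simp add: h)
  next
    case 2 show ?thesis unfolding 2 s1 by (simp add: herm_def)
  next
    case 3 show ?thesis unfolding 3 s2 using b by (simp add: herm_def power2_eq_square algebra_simps)
  next
    case 4 show ?thesis unfolding 4 s3 using b by (simp add: herm_def power2_eq_square power3_eq_cube algebra_simps)
  next
    case 5 show ?thesis unfolding 5 s4 using b by (simp add: herm_def power2_eq_square power3_eq_cube power4_eq_xxxx algebra_simps)
  qed
qed

lemma herm_scale: 
  assumes "n \<le> 4" shows "herm n (a^2 * c) (a * x) = a^n * herm n c x"
  using le4[OF assms] by (auto simp: herm_def power_mult_distrib algebra_simps power2_eq_square power3_eq_cube power4_eq_xxxx)

lemma gauss_moment:
  assumes k: "k \<in> nz"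
  shows "integrable (gcomp k) (\<lambda>x. x^n)" 
    and "even n \<Longrightarrow> (\<integral>x. x^n \<partial>gcomp k) = fact n / (2^(n div 2) * fact (n div 2)) * (1 / lam k)^(n div 2)"
    and "odd n \<Longrightarrow> (\<integral>x. x^n \<partial>gcomp k) = 0"
proof -
  define \<sigma> where "\<sigma> = 1 / sqrt (lam k)"
  have s: "\<sigma> > 0" "\<sigma>\<^sup>2 = 1 / lam k" using lam_pos[OF k] by (auto simp: \<sigma>_def power_divide)
  have g: "gcomp k = density lborel (normal_density 0 \<sigma>)" using gcomp_nz[OF k] by (simp add: \<sigma>_def)
  show "integrable (gcomp k) (\<lambda>x. x^n)" unfolding g
    using integrable_normal_moment[OF s(1), of 0 n] by (subst integrable_density) auto
  have i: "(\<integral>x. x^n \<partial>gcomp k) = (\<integral>x. normal_density 0 \<sigma> x * (x - 0)^n \<partial>lborel)" unfolding g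
    by (subst integral_density) auto
  show "(\<integral>x. x^n \<partial>gcomp k) = fact n / (2^(n div 2) * fact (n div 2)) * (1 / lam k)^(n div 2)" if e: "even n"
  proof -
    obtain j where j: "n = 2 * j" using e by blast
    show ?thesis unfolding i unfolding j integral_normal_moment_even[OF s(1)] using lam_pos[OF k]
      by (simp add: s(2) power_divide power_mult_distrib field_simps)
  qed
  show "(\<integral>x. x^n \<partial>gcomp k) = 0" if e: "odd n"
  proof -
    obtain j where j: "n = 2 * j + 1" using e by (blast elim: oddE)
    show ?thesis unfolding i unfolding j by (rule integral_normal_moment_odd[OF s(1)])
  qed
qed

text \<open>The product of two polynomials of degree at most 4 has degree at most 8, and the even
  Gaussian moments up to there are 1, 1, 3, 15, 105 times powers of the variance. Odd ones
  vanish.\<close>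

lemma gauss_deg8:
  assumes k: "k \<in> nz" and v: "v = 1 / lam k"
    and f: "\<And>x. f x = ca + cb*x + cc*x^2 + cd*x^3 + ce*x^4 + cf*x^5 + cg*x^6 + ch*x^7 + ci*x^8"
  shows "integrable (gcomp k) f \<and> (\<integral>x. f x \<partial>gcomp k) = ca + cc* v + 3*ce* v^2 + 15*cg* v^3 + 105*ci* v^4"
proof -
  have m: "(\<integral>x. x^2 \<partial>gcomp k) = v" "(\<integral>x. x^4 \<partial>gcomp k) = 3* v^2" 
    "(\<integral>x. x^6 \<partial>gcomp k) = 15* v^3" "(\<integral>x. x^8 \<partial>gcomp k) = 105* v^4"
    "(\<integral>x. x \<partial>gcomp k) = 0" "(\<integral>x. x^3 \<partial>gcomp k) = 0" "(\<integral>x. x^5 \<partial>gcomp k) = 0" "(\<integral>x. x^7 \<partial>gcomp k) = 0"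
    using gauss_moment(2)[OF k, of 2] gauss_moment(2)[OF k, of 4] gauss_moment(2)[OF k, of 6] gauss_moment(2)[OF k, of 8]
      gauss_moment(3)[OF k, of 1] gauss_moment(3)[OF k, of 3] gauss_moment(3)[OF k, of 5] gauss_moment(3)[OF k, of 7]
    by (simp_all add: v fact_numeral)
  have H: "has_bochner_integral (gcomp k) (\<lambda>x. c * x^n) (c * (\<integral>x. x^n \<partial>gcomp k))" for c n
    using gauss_moment(1)[OF k, of n] by (intro has_bochner_integral_mult_right has_bochner_integral_integrable)
  have f': "f = (\<lambda>x. ca * x^0 + cb*x^1 + cc*x^2 + cd*x^3 + ce*x^4 + cf*x^5 + cg*x^6 + ch*x^7 + ci*x^8)"
    using f by auto
  have "has_bochner_integral (gcomp k) f (ca * (\<integral>x. x^0 \<partial>gcomp k) + cb * (\<integral>x. x^1 \<partial>gcomp k)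
     + cc * (\<integral>x. x^2 \<partial>gcomp k) + cd * (\<integral>x. x^3 \<partial>gcomp k) + ce * (\<integral>x. x^4 \<partial>gcomp k)
     + cf * (\<integral>x. x^5 \<partial>gcomp k) + cg * (\<integral>x. x^6 \<partial>gcomp k) + ch * (\<integral>x. x^7 \<partial>gcomp k) + ci * (\<integral>x. x^8 \<partial>gcomp k))"
    unfolding f' by (intro has_bochner_integral_add H)
  then have "integrable (gcomp k) f" "(\<integral>x. f x \<partial>gcomp k) = ca * (\<integral>x. x^0 \<partial>gcomp k) + cb * (\<integral>x. x^1 \<partial>gcomp k)
     + cc * (\<integral>x. x^2 \<partial>gcomp k) + cd * (\<integral>x. x^3 \<partial>gcomp k) + ce * (\<integral>x. x^4 \<partial>gcomp k)
     + cf * (\<integral>x. x^5 \<partial>gcomp k) + cg * (\<integral>x. x^6 \<partial>gcomp k) + ch * (\<integral>x. x^7 \<partial>gcomp k) + ci * (\<integral>x. x^8 \<partial>gcomp k)"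
    by (auto simp: has_bochner_integral_iff)
  then show ?thesis using m gcomp.prob_space[of k] by simp
qed

text \<open>Orthogonality of Hermite polynomials. For each of the fifteen pairs with p <= q the
  coefficients of the expanded product are handed to the moment formula; the other pairs follow by
  commutativity.\<close>

lemma herm_gauss:
  assumes k: "k \<in> nz" and v: "v = 1 / lam k" and p: "p \<le> 4" and q: "q \<le> 4"
  shows "integrable (gcomp k) (\<lambda>x. herm p v x * herm q v x) \<and>
     (\<integral>x. herm p v x * herm q v x \<partial>gcomp k) = (if p = q then fact p * v^p else 0)"
proof -
  note alg = herm_def algebra_simps eval_nat_numeral
  have h00: "integrable (gcomp k) (\<lambda>x. herm 0 v x * herm 0 v x) \<and>
     (\<integral>x. herm 0 v x * herm 0 v x \<partial>gcomp k) = fact 0 * v^0"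
    using gauss_deg8[OF k v, where f = "\<lambda>x. herm 0 v x * herm 0 v x" and ca = "((1)* v^0)" and cb = "(0)" and cc = "(0)" and cd = "(0)" and ce = "(0)" and cf = "(0)" and cg = "(0)" and ch = "(0)" and ci = "(0)"]
    by (simp add: alg)
  have h01: "integrable (gcomp k) (\<lambda>x. herm 0 v x * herm 1 v x) \<and>
     (\<integral>x. herm 0 v x * herm 1 v x \<partial>gcomp k) = 0"
    using gauss_deg8[OF k v, where f = "\<lambda>x. herm 0 v x * herm 1 v x" and ca = "(0)" and cb = "((1)* v^0)" and cc = "(0)" and cd = "(0)" and ce = "(0)" and cf = "(0)" and cg = "(0)" and ch = "(0)" and ci = "(0)"]
    by (simp add: alg)
  have h02: "integrable (gcomp k) (\<lambda>x. herm 0 v x * herm 2 v x) \<and>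
     (\<integral>x. herm 0 v x * herm 2 v x \<partial>gcomp k) = 0"
    using gauss_deg8[OF k v, where f = "\<lambda>x. herm 0 v x * herm 2 v x" and ca = "((-1)* v^1)" and cb = "(0)" and cc = "((1)* v^0)" and cd = "(0)" and ce = "(0)" and cf = "(0)" and cg = "(0)" and ch = "(0)" and ci = "(0)"]
    by (simp add: alg)
  have h03: "integrable (gcomp k) (\<lambda>x. herm 0 v x * herm 3 v x) \<and>
     (\<integral>x. herm 0 v x * herm 3 v x \<partial>gcomp k) = 0"
    using gauss_deg8[OF k v, where f = "\<lambda>x. herm 0 v x * herm 3 v x" and ca = "(0)" and cb = "((-3)* v^1)" and cc = "(0)" and cd = "((1)* v^0)" and ce = "(0)" and cf = "(0)" and cg = "(0)" and ch = "(0)" and ci = "(0)"]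
    by (simp add: alg)
  have h04: "integrable (gcomp k) (\<lambda>x. herm 0 v x * herm 4 v x) \<and>
     (\<integral>x. herm 0 v x * herm 4 v x \<partial>gcomp k) = 0"
    using gauss_deg8[OF k v, where f = "\<lambda>x. herm 0 v x * herm 4 v x" and ca = "((3)* v^2)" and cb = "(0)" and cc = "((-6)* v^1)" and cd = "(0)" and ce = "((1)* v^0)" and cf = "(0)" and cg = "(0)" and ch = "(0)" and ci = "(0)"]
    by (simp add: alg)
  have h11: "integrable (gcomp k) (\<lambda>x. herm 1 v x * herm 1 v x) \<and>
     (\<integral>x. herm 1 v x * herm 1 v x \<partial>gcomp k) = fact 1 * v^1"
    using gauss_deg8[OF k v, where f = "\<lambda>x. herm 1 v x * herm 1 v x" and ca = "(0)" and cb = "(0)" and cc = "((1)* v^0)" and cd = "(0)" and ce = "(0)" and cf = "(0)" and cg = "(0)" and ch = "(0)" and ci = "(0)"]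
    by (simp add: alg)
  have h12: "integrable (gcomp k) (\<lambda>x. herm 1 v x * herm 2 v x) \<and>
     (\<integral>x. herm 1 v x * herm 2 v x \<partial>gcomp k) = 0"
    using gauss_deg8[OF k v, where f = "\<lambda>x. herm 1 v x * herm 2 v x" and ca = "(0)" and cb = "((-1)* v^1)" and cc = "(0)" and cd = "((1)* v^0)" and ce = "(0)" and cf = "(0)" and cg = "(0)" and ch = "(0)" and ci = "(0)"]
    by (simp add: alg)
  have h13: "integrable (gcomp k) (\<lambda>x. herm 1 v x * herm 3 v x) \<and>
     (\<integral>x. herm 1 v x * herm 3 v x \<partial>gcomp k) = 0"
    using gauss_deg8[OF k v, where f = "\<lambda>x. herm 1 v x * herm 3 v x" and ca = "(0)" and cb = "(0)" and cc = "((-3)* v^1)" and cd = "(0)" and ce = "((1)* v^0)" and cf = "(0)" and cg = "(0)" and ch = "(0)" and ci = "(0)"]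
    by (simp add: alg)
  have h14: "integrable (gcomp k) (\<lambda>x. herm 1 v x * herm 4 v x) \<and>
     (\<integral>x. herm 1 v x * herm 4 v x \<partial>gcomp k) = 0"
    using gauss_deg8[OF k v, where f = "\<lambda>x. herm 1 v x * herm 4 v x" and ca = "(0)" and cb = "((3)* v^2)" and cc = "(0)" and cd = "((-6)* v^1)" and ce = "(0)" and cf = "((1)* v^0)" and cg = "(0)" and ch = "(0)" and ci = "(0)"]
    by (simp add: alg)
  have h22: "integrable (gcomp k) (\<lambda>x. herm 2 v x * herm 2 v x) \<and>
     (\<integral>x. herm 2 v x * herm 2 v x \<partial>gcomp k) = fact 2 * v^2"
    using gauss_deg8[OF k v, where f = "\<lambda>x. herm 2 v x * herm 2 v x" and ca = "((1)* v^2)" and cb = "(0)" and cc = "((-2)* v^1)" and cd = "(0)" and ce = "((1)* v^0)" and cf = "(0)" and cg = "(0)" and ch = "(0)" and ci = "(0)"]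
    by (simp add: alg)
  have h23: "integrable (gcomp k) (\<lambda>x. herm 2 v x * herm 3 v x) \<and>
     (\<integral>x. herm 2 v x * herm 3 v x \<partial>gcomp k) = 0"
    using gauss_deg8[OF k v, where f = "\<lambda>x. herm 2 v x * herm 3 v x" and ca = "(0)" and cb = "((3)* v^2)" and cc = "(0)" and cd = "((-4)* v^1)" and ce = "(0)" and cf = "((1)* v^0)" and cg = "(0)" and ch = "(0)" and ci = "(0)"]
    by (simp add: alg)
  have h24: "integrable (gcomp k) (\<lambda>x. herm 2 v x * herm 4 v x) \<and>
     (\<integral>x. herm 2 v x * herm 4 v x \<partial>gcomp k) = 0"
    using gauss_deg8[OF k v, where f = "\<lambda>x. herm 2 v x * herm 4 v x" and ca = "((-3)* v^3)" and cb = "(0)" and cc = "((9)* v^2)" and cd = "(0)" and ce = "((-7)* v^1)" and cf = "(0)" and cg = "((1)* v^0)" and ch = "(0)" and ci = "(0)"]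
    by (simp add: alg)
  have h33: "integrable (gcomp k) (\<lambda>x. herm 3 v x * herm 3 v x) \<and>
     (\<integral>x. herm 3 v x * herm 3 v x \<partial>gcomp k) = fact 3 * v^3"
    using gauss_deg8[OF k v, where f = "\<lambda>x. herm 3 v x * herm 3 v x" and ca = "(0)" and cb = "(0)" and cc = "((9)* v^2)" and cd = "(0)" and ce = "((-6)* v^1)" and cf = "(0)" and cg = "((1)* v^0)" and ch = "(0)" and ci = "(0)"]
    by (simp add: alg)
  have h34: "integrable (gcomp k) (\<lambda>x. herm 3 v x * herm 4 v x) \<and>
     (\<integral>x. herm 3 v x * herm 4 v x \<partial>gcomp k) = 0"
    using gauss_deg8[OF k v, where f = "\<lambda>x. herm 3 v x * herm 4 v x" and ca = "(0)" and cb = "((-9)* v^3)" and cc = "(0)" and cd = "((21)* v^2)" and ce = "(0)" and cf = "((-9)* v^1)" and cg = "(0)" and ch = "((1)* v^0)" and ci = "(0)"]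
    by (simp add: alg)
  have h44: "integrable (gcomp k) (\<lambda>x. herm 4 v x * herm 4 v x) \<and>
     (\<integral>x. herm 4 v x * herm 4 v x \<partial>gcomp k) = fact 4 * v^4"
    using gauss_deg8[OF k v, where f = "\<lambda>x. herm 4 v x * herm 4 v x" and ca = "((9)* v^4)" and cb = "(0)" and cc = "((-36)* v^3)" and cd = "(0)" and ce = "((42)* v^2)" and cf = "(0)" and cg = "((-12)* v^1)" and ch = "(0)" and ci = "((1)* v^0)"]
    by (simp add: alg)
  consider "p = 0" | "p = 1" | "p = 2" | "p = 3" | "p = 4" using le4[OF p] by auto
  note pc = this
  consider "q = 0" | "q = 1" | "q = 2" | "q = 3" | "q = 4" using le4[OF q] by auto
  note qc = this
  note H = h00 h01 h02 h03 h04 h11 h12 h13 h14 h22 h23 h24 h33 h34 h44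
  show ?thesis
    by (cases rule: pc; cases rule: qc; hypsubst; use H in \<open>simp add: mult.commute\<close>)
qed

text \<open>A function that ignores coordinate \<open>k\<close> is independent of that coordinate;
  with \<open>gff_resample\<close> this is Fubini.\<close>

lemma gff_indep:
  fixes F :: "coeffs \<Rightarrow> real" and G :: "real \<Rightarrow> real"
  assumes F: "integrable gff F" and Fk: "\<And>w x. F (w(k := x)) = F w" and G: "integrable (gcomp k) G"
  shows "integrable gff (\<lambda>w. F w * G (w k))" 
    and "(\<integral>w. F w * G (w k) \<partial>gff) = (\<integral>w. F w \<partial>gff) * (\<integral>x. G x \<partial>gcomp k)"
proof -
  have [measurable]: "F \<in> borel_measurable gff" "G \<in> borel_measurable (gcomp k)" using F G by auto
  have G': "G \<in> borel_measurable borel" using G measurable_cong_sets[OF sets_gcomp refl] by (metis borel_measurable_integrable)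
  have m: "(\<lambda>w. F w * G (w k)) \<in> borel_measurable gff" using G' by measurable
  have "integrable (gff \<Otimes>\<^sub>M gcomp k) (\<lambda>p. F (fst p) * G (snd p))"
  proof (rule pg.Fubini_integrable)
    show "(\<lambda>p. F (fst p) * G (snd p)) \<in> borel_measurable (gff \<Otimes>\<^sub>M gcomp k)" by measurable
    have "(\<lambda>x. \<integral>y. norm (F (fst (x, y)) * G (snd (x, y))) \<partial>gcomp k) = (\<lambda>x. \<bar>F x\<bar> * (\<integral>y. \<bar>G y\<bar> \<partial>gcomp k))"
      by (simp add: abs_mult)
    then show "integrable gff (\<lambda>x. \<integral>y. norm (F (fst (x, y)) * G (snd (x, y))) \<partial>gcomp k)" using F by simp
    show "AE x in gff. integrable (gcomp k) (\<lambda>y. F (fst (x, y)) * G (snd (x, y)))" using G by simp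
  qed
  then show I: "integrable gff (\<lambda>w. F w * G (w k))"
    unfolding integrable_resample[OF m, of k] by (simp add: Fk)
  show "(\<integral>w. F w * G (w k) \<partial>gff) = (\<integral>w. F w \<partial>gff) * (\<integral>x. G x \<partial>gcomp k)"
    unfolding integral_resample[OF I, of k] by (simp add: Fk)
qed

text \<open>For \<open>K\<close> inside \<open>nz\<close> this is the covariance under
  \<open>gff\<close> of the linear functionals with coefficients \<open>a\<close> and
  \<open>b\<close> on \<open>K\<close>, the variance of mode \<open>k\<close> being 1 /
  \<open>lam k\<close>.\<close>

definition cov :: "(int \<times> int) set \<Rightarrow> coeffs \<Rightarrow> coeffs \<Rightarrow> real" where
  "cov K a b = (\<Sum>k\<in>K. a k * b k / lam k)"

definition lin :: "(int \<times> int) set \<Rightarrow> coeffs \<Rightarrow> coeffs \<Rightarrow> real" where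
  "lin K a w = (\<Sum>k\<in>K. a k * w k)"

text \<open>Wick's theorem for two Hermite polynomials; the induction adds one independent Gaussian
  coordinate at a time, using the addition formula for the Hermite polynomials.\<close>
lemma wick_pair:
  assumes "finite K" "K \<subseteq> nz" "i \<le> 4" "j \<le> 4"
  shows "integrable gff (\<lambda>w. herm i (cov K a a) (lin K a w) * herm j (cov K b b) (lin K b w)) \<and>
    (\<integral>w. herm i (cov K a a) (lin K a w) * herm j (cov K b b) (lin K b w) \<partial>gff)
      = (if i = j then fact i * (cov K a b)^i else 0)"
  using assms
proof (induction K arbitrary: i j rule: finite_induct)
  case empty
  have "herm i 0 0 = (if i = 0 then 1 else 0)" for i by (simp add: herm_def)
  then show ?case using gff.prob_space by (auto simp: cov_def lin_def)
next
  case (insert k K)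
  have k: "k \<in> nz" and K: "K \<subseteq> nz" using insert by auto
  define v where "v = 1 / lam k"
  let ?F = "\<lambda>p q w. herm p (cov K a a) (lin K a w) * herm q (cov K b b) (lin K b w)"
  let ?G = "\<lambda>p q x. herm p v x * herm q v x"
  let ?c = "\<lambda>p q. real (i choose p) * a k^(i-p) * (real (j choose q) * b k^(j-q))"
  have ex: "herm n (cov (insert k K) d d) (lin (insert k K) d w) =
     (\<Sum>p\<le>n. real (n choose p) * d k^(n-p) * (herm p (cov K d d) (lin K d w) * herm (n-p) v (w k)))" if "n \<le> 4" for n and d w :: coeffs
  proof -
    have "cov (insert k K) d d = cov K d d + (d k)\<^sup>2 * v" "lin (insert k K) d w = lin K d w + d k * w k"
      using insert by (auto simp: cov_def lin_def v_def power2_eq_square)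
    then have "herm n (cov (insert k K) d d) (lin (insert k K) d w) = 
       (\<Sum>p\<le>n. real (n choose p) * herm p (cov K d d) (lin K d w) * herm (n-p) ((d k)\<^sup>2 * v) (d k * w k))"
      using herm_add[OF that] by simp
    also have "\<dots> = (\<Sum>p\<le>n. real (n choose p) * d k^(n-p) * (herm p (cov K d d) (lin K d w) * herm (n-p) v (w k)))"
    proof (intro sum.cong refl)
      fix p
      have "n - p \<le> 4" using that by simp
      from herm_scale[OF this, of "d k" v "w k"]
      show "real (n choose p) * herm p (cov K d d) (lin K d w) * herm (n-p) ((d k)\<^sup>2 * v) (d k * w k) =
        real (n choose p) * d k^(n-p) * (herm p (cov K d d) (lin K d w) * herm (n-p) v (w k))" by simp
    qed
    finally show ?thesis .
  qed
  have prod: "herm i (cov (insert k K) a a) (lin (insert k K) a w) * herm j (cov (insert k K) b b) (lin (insert k K) b w)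
     = (\<Sum>p\<le>i. \<Sum>q\<le>j. ?c p q * (?F p q w * ?G (i-p) (j-q) (w k)))" for w
    unfolding ex[OF insert.prems(2)] ex[OF insert.prems(3)] sum_product
    by (intro sum.cong) (auto simp: algebra_simps)
  have lk: "lin K d (w(k := x)) = lin K d w" for d w x
    using insert unfolding lin_def by (intro sum.cong) auto
  have IH: "integrable gff (?F p q)" "(\<integral>w. ?F p q w \<partial>gff) = (if p = q then fact p * cov K a b^p else 0)"
    if "p \<le> i" "q \<le> j" for p q
    using insert.IH[OF K, of p q] insert.prems that by auto
  have HG: "integrable (gcomp k) (?G (i-p) (j-q))" 
    "(\<integral>x. ?G (i-p) (j-q) x \<partial>gcomp k) = (if i-p = j-q then fact (i-p) * v^(i-p) else 0)" for p q
    using herm_gauss[OF k v_def, of "i-p" "j-q"] insert.prems by auto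
  have ind: "integrable gff (\<lambda>w. ?F p q w * ?G (i-p) (j-q) (w k))"
    "(\<integral>w. ?F p q w * ?G (i-p) (j-q) (w k) \<partial>gff) = (if p = q then fact p * cov K a b^p else 0) * (if i-p = j-q then fact (i-p) * v^(i-p) else 0)"
    if "p \<le> i" "q \<le> j" for p q
    using gff_indep[OF IH(1)[OF that] _ HG(1)[of p q]] IH(2)[OF that] HG(2)[of p q] by (simp_all add: lk)
  have I: "integrable gff (\<lambda>w. \<Sum>p\<le>i. \<Sum>q\<le>j. ?c p q * (?F p q w * ?G (i-p) (j-q) (w k)))"
    by (intro Bochner_Integration.integrable_sum integrable_mult_right ind) auto
  have "(\<integral>w. (\<Sum>p\<le>i. \<Sum>q\<le>j. ?c p q * (?F p q w * ?G (i-p) (j-q) (w k))) \<partial>gff)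
     = (\<Sum>p\<le>i. \<integral>w. (\<Sum>q\<le>j. ?c p q * (?F p q w * ?G (i-p) (j-q) (w k))) \<partial>gff)"
    by (rule Bochner_Integration.integral_sum) 
      (intro Bochner_Integration.integrable_sum integrable_mult_right ind; simp)
  also have "\<dots> = (\<Sum>p\<le>i. \<Sum>q\<le>j. \<integral>w. ?c p q * (?F p q w * ?G (i-p) (j-q) (w k)) \<partial>gff)"
    by (rule sum.cong[OF refl], rule Bochner_Integration.integral_sum) (intro integrable_mult_right ind; simp)
  also have "\<dots> = (\<Sum>p\<le>i. \<Sum>q\<le>j. ?c p q * (\<integral>w. ?F p q w * ?G (i-p) (j-q) (w k) \<partial>gff))"
    by (simp only: integral_mult_right_zero)
  \<comment> \<open>p = q and i - p = j - q together force i = j, so only the diagonal survives, and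
    there the binomial theorem reassembles the covariance over the enlarged set.\<close>
  also have "\<dots> = (\<Sum>p\<le>i. \<Sum>q\<le>j. if q = p then (if i = j then ?c p p * (fact p * cov K a b^p * (fact (i-p) * v^(i-p))) else 0) else 0)"
    by (intro sum.cong refl, subst ind(2)) (auto)
  also have "\<dots> = (if i = j then fact i * (cov (insert k K) a b)^i else 0)"
  proof (cases "i = j")
    case True
    have "(\<Sum>p\<le>i. \<Sum>q\<le>i. if q = p then ?c p p * (fact p * cov K a b^p * (fact (i-p) * v^(i-p))) else 0)
      = (\<Sum>p\<le>i. ?c p p * (fact p * cov K a b^p * (fact (i-p) * v^(i-p))))"
      by (intro sum.cong refl) (simp add: sum.delta)
    also have "\<dots> = (\<Sum>p\<le>i. fact i * ((i choose p) * cov K a b^p * (a k * b k * v)^(i-p)))"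
    proof (intro sum.cong refl)
      fix p assume p: "p \<in> {..i}"
      have "real (fact p * fact (i-p) * (i choose p)) = real (fact i)"
        using binomial_fact_lemma[of p i] p by simp
      then have f: "fact i = real (i choose p) * fact p * fact (i-p)" by (simp add: mult_ac)
      show "?c p p * (fact p * cov K a b^p * (fact (i-p) * v^(i-p))) = fact i * ((i choose p) * cov K a b^p * (a k * b k * v)^(i-p))"
        unfolding f power_mult_distrib True[symmetric] by (simp only: mult_ac)
    qed
    also have "\<dots> = fact i * (cov K a b + a k * b k * v)^i"
      by (simp add: binomial_ring sum_distrib_left)
    also have "cov K a b + a k * b k * v = cov (insert k K) a b"
      using insert by (simp add: cov_def v_def)
    finally show ?thesis using True by simp
  qed (auto intro!: sum.neutral)
  finally show ?case unfolding prod using I by blast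
qed

section \<open>Fourier coefficients of the mollifier\<close>

text \<open>The profile of the mollifier: \<open>bump x\<close> is \<open>eta\<close> at 1 - |x|^2.
  \<open>eta1\<close> and \<open>eta2\<close> are its first two derivatives; their factor
  \<open>eta v\<close> makes them 0 for v <= 0, including v = 0.\<close>

definition eta :: "real \<Rightarrow> real" where "eta v = (if v > 0 then exp (- 1 / v) else 0)"
definition eta1 :: "real \<Rightarrow> real" where "eta1 v = eta v / v^2"
definition eta2 :: "real \<Rightarrow> real" where "eta2 v = eta v * (1 / v^4 - 2 / v^3)"

lemma exp_ge_pow: 
  fixes x :: real assumes "x \<ge> 0" shows "x^n / fact n \<le> exp x"
proof -
  have s: "(\<lambda>n. x^n /\<^sub>R fact n) sums exp x" by (rule exp_converges)
  have "x^n /\<^sub>R fact n \<le> (\<Sum>n. x^n /\<^sub>R fact n)"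
    using s assms sum_le_suminf[OF sums_summable[OF s], of "{n}"] by simp
  then show ?thesis using sums_unique[OF s] by (simp add: divide_inverse mult.commute)
qed

text \<open>One term of the exponential series, exp (1/v) >= v^-n / n!. It absorbs the negative
  powers of \<open>v\<close> in the derivatives, and the factorials 2, 6, 24 are the source of the
  constants in the bounds below.\<close>

lemma eta_le: "0 < v \<Longrightarrow> eta v \<le> fact n * v^n"
proof -
  assume v: "0 < v"
  have "(1/v)^n / fact n \<le> exp (1/v)" using v by (intro exp_ge_pow) auto
  then have "1 \<le> fact n * v^n * exp (1/v)" using v by (simp add: field_simps power_divide)
  then have "exp (-(1/v)) * 1 \<le> exp (-(1/v)) * (fact n * v^n * exp (1/v))" by (intro mult_left_mono) auto
  also have "\<dots> = fact n * v^n" by (simp add: exp_minus)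
  finally show ?thesis using v by (simp add: eta_def)
qed

lemma eta_nonneg: "0 \<le> eta v" by (simp add: eta_def)

lemma eta_neg: "v \<le> 0 \<Longrightarrow> eta v = 0" by (simp add: eta_def)

lemma DERIV_at_0_bound:
  fixes f :: "real \<Rightarrow> real"
  assumes "\<And>v. \<bar>f v\<bar> \<le> C * v\<^sup>2"
  shows "(f has_real_derivative 0) (at 0)"
  unfolding DERIV_def
proof (rule Lim_null_comparison)
  have C0: "f 0 = 0" using assms[of 0] by simp
  show "\<forall>\<^sub>F h in at 0. norm ((f (0 + h) - f 0) / h) \<le> C * \<bar>h\<bar>"
    unfolding eventually_at_filter
  proof (rule always_eventually, intro allI impI)
    fix h :: real assume "h \<noteq> 0"
    then have "\<bar>f h\<bar> / \<bar>h\<bar> \<le> C * \<bar>h\<bar>" using assms[of h] by (simp add: field_simps power2_eq_square abs_mult[symmetric])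
    then show "norm ((f (0 + h) - f 0) / h) \<le> C * \<bar>h\<bar>" using C0 by simp
  qed
  show "((\<lambda>h. C * \<bar>h\<bar>) \<longlongrightarrow> 0) (at 0)" by (auto intro!: tendsto_eq_intros)
qed

lemma eta_DERIV: "(eta has_real_derivative eta1 v) (at v)"
proof (cases v "0::real" rule: linorder_cases)
  case less
  have "(eta has_real_derivative 0) (at v)"
  proof (rule has_field_derivative_transform_within_open[of "\<lambda>_. 0" 0 v "{..<0}"])
  qed (use less in \<open>auto simp: eta_def\<close>)
  then show ?thesis using less by (simp add: eta1_def eta_def)
next
  case equal
  have "\<bar>eta v\<bar> \<le> 2 * v\<^sup>2" for v
    using eta_le[of v 2] eta_nonneg[of v] eta_neg[of v] by (cases "v > 0") (auto simp: fact_numeral)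
  from DERIV_at_0_bound[OF this] show ?thesis using equal by (simp add: eta1_def)
next
  case greater
  have "((\<lambda>v. exp (- 1 / v)) has_real_derivative exp (- 1 / v) / v^2) (at v)"
    using greater by (auto intro!: derivative_eq_intros simp: power2_eq_square)
  then have "(eta has_real_derivative exp (- 1 / v) / v^2) (at v)"
    by (rule has_field_derivative_transform_within_open[of _ _ v "{0<..}"]) (use greater in \<open>auto simp: eta_def\<close>)
  then show ?thesis using greater by (simp add: eta1_def eta_def)
qed

lemma eta1_DERIV: "(eta1 has_real_derivative eta2 v) (at v)"
proof (cases v "0::real" rule: linorder_cases)
  case less
  have "(eta1 has_real_derivative 0) (at v)"
  proof (rule has_field_derivative_transform_within_open[of "\<lambda>_. 0" 0 v "{..<0}"])
  qed (use less in \<open>auto simp: eta1_def eta_def\<close>)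
  then show ?thesis using less by (simp add: eta2_def eta_def)
next
  case equal
  have "\<bar>eta1 v\<bar> \<le> 24 * v\<^sup>2" for v
  proof (cases "v > 0")
    case True
    then have "eta v / v^2 \<le> 24 * v^4 / v^2"
      using eta_le[of v 4] by (intro divide_right_mono) (auto simp: fact_numeral)
    also have "\<dots> = 24 * v\<^sup>2" using True by (simp add: power2_eq_square power4_eq_xxxx)
    finally show ?thesis using eta_nonneg[of v] by (simp add: eta1_def)
  qed (simp add: eta1_def eta_def)
  from DERIV_at_0_bound[OF this] show ?thesis using equal by (simp add: eta2_def)
next
  case greater
  have "((\<lambda>v. exp (- 1 / v) / v^2) has_real_derivative exp (- 1 / v) * (1 / v^4 - 2 / v^3)) (at v)"
    using greater by (auto intro!: derivative_eq_intros simp: field_simps power2_eq_square power3_eq_cube power4_eq_xxxx)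
  then have "(eta1 has_real_derivative exp (- 1 / v) * (1 / v^4 - 2 / v^3)) (at v)"
    by (rule has_field_derivative_transform_within_open[of _ _ v "{0<..}"]) (use greater in \<open>auto simp: eta1_def eta_def\<close>)
  then show ?thesis using greater by (simp add: eta2_def eta_def)
qed

lemma eta1_bound: "\<bar>eta1 v\<bar> \<le> 2"
proof (cases "v > 0")
  case True
  then have "eta v / v^2 \<le> 2 * v^2 / v^2" using eta_le[of v 2] by (intro divide_right_mono) (auto simp: fact_numeral)
  then show ?thesis using True eta_nonneg[of v] by (simp add: eta1_def)
qed (simp add: eta1_def eta_def)

lemma eta2_bound: "\<bar>eta2 v\<bar> \<le> 36"
proof (cases "v > 0")
  case True
  have "eta v / v^4 \<le> 24 * v^4 / v^4" using True eta_le[of v 4] by (intro divide_right_mono) (auto simp: fact_numeral)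
  then have a: "eta v / v^4 \<le> 24" using True by simp
  have "eta v / v^3 \<le> 6 * v^3 / v^3" using True eta_le[of v 3] by (intro divide_right_mono) (auto simp: fact_numeral)
  then have b: "eta v / v^3 \<le> 6" using True by simp
  have c: "0 \<le> eta v / v^4" "0 \<le> eta v / v^3" using True eta_nonneg[of v] by auto
  have "eta2 v = eta v / v^4 - 2 * (eta v / v^3)" by (simp add: eta2_def right_diff_distrib)
  then show ?thesis using a b c by linarith
qed (simp add: eta2_def eta_def)

lemma bump_eta: "bump x = eta (1 - (norm x)\<^sup>2)"
proof -
  have "norm x < 1 \<longleftrightarrow> (norm x)\<^sup>2 < 1" using norm_ge_zero[of x] abs_square_less_1[of "norm x"] by simp
  then show ?thesis by (simp add: bump_def eta_def)
qed

text \<open>The mean value theorem on [0, 1] and on [-1, 0], then for the derivative between the two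
  points so found, which are less than 2 apart.\<close>

lemma MVT_second_difference:
  fixes g :: "real \<Rightarrow> real"
  assumes g: "\<And>t. (g has_real_derivative g' t) (at t)" and g': "\<And>t. (g' has_real_derivative g'' t) (at t)"
    and b: "\<And>t. \<bar>g'' t\<bar> \<le> C"
  shows "\<bar>g 1 + g (-1) - 2 * g 0\<bar> \<le> 2 * C"
proof -
  obtain a where a: "0 < a" "a < 1" "g 1 - g 0 = (1 - 0) * g' a" using MVT2[of 0 1 g g'] g by auto
  obtain c where c: "-1 < c" "c < 0" "g 0 - g (-1) = (0 - (-1)) * g' c" using MVT2[of "-1" 0 g g'] g by auto
  obtain d where d: "g' a - g' c = (a - c) * g'' d" using MVT2[of c a g' g''] g' a c by auto
  have "g 1 + g (-1) - 2 * g 0 = (a - c) * g'' d" using a c d by simp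
  moreover have "\<bar>(a - c) * g'' d\<bar> \<le> 2 * C" unfolding abs_mult
    using a c b[of d] by (intro mult_mono) auto
  ultimately show ?thesis by simp
qed

text \<open>Along the line u + t h the argument of \<open>eta\<close> is quadratic in t, with
  derivative at most 2 |h| wherever \<open>eta\<close> does not vanish. The second derivative of the
  composite is therefore bounded by 36 * 4 + 2 * 2 = 148 times |h|^2, and a second difference by
  twice that.\<close>

lemma bump_second_difference:
  "\<bar>bump (u + h) + bump (u - h) - 2 * bump u\<bar> \<le> 296 * (norm h)\<^sup>2"
proof -
  define q where "q t = 1 - ((norm u)\<^sup>2 + 2 * t * (u \<bullet> h) + t\<^sup>2 * (norm h)\<^sup>2)" for t
  define q' where "q' t = - (2 * (u \<bullet> h) + 2 * t * (norm h)\<^sup>2)" for t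
  have q: "q t = 1 - (norm (u + t *\<^sub>R h))\<^sup>2" for t
    unfolding q_def power2_norm_eq_inner
    by (simp add: inner_add_left inner_add_right inner_commute power2_eq_square algebra_simps)
  have dq: "(q has_real_derivative q' t) (at t)" for t
    unfolding q_def q'_def by (auto intro!: derivative_eq_intros)
  have dq': "(q' has_real_derivative (- 2 * (norm h)\<^sup>2)) (at t)" for t
    unfolding q'_def by (auto intro!: derivative_eq_intros)
  have q'b: "\<bar>q' t\<bar> \<le> 2 * norm h" if "q t > 0" for t
  proof -
    have "(norm (u + t *\<^sub>R h))\<^sup>2 \<le> 1\<^sup>2" using that q[of t] by simp
    then have n: "norm (u + t *\<^sub>R h) \<le> 1" by (rule power2_le_imp_le) simp
    have "q' t = - (2 * ((u + t *\<^sub>R h) \<bullet> h))"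
      by (simp add: q'_def inner_add_left power2_norm_eq_inner)
    moreover have "\<bar>(u + t *\<^sub>R h) \<bullet> h\<bar> \<le> norm (u + t *\<^sub>R h) * norm h" by (rule Cauchy_Schwarz_ineq2)
    moreover have "norm (u + t *\<^sub>R h) * norm h \<le> 1 * norm h" using n by (intro mult_right_mono) auto
    ultimately show ?thesis by simp
  qed
  have "\<bar>eta (q 1) + eta (q (-1)) - 2 * eta (q 0)\<bar> \<le> 2 * (148 * (norm h)\<^sup>2)"
  proof (rule MVT_second_difference)
    show "((\<lambda>t. eta (q t)) has_real_derivative eta1 (q t) * q' t) (at t)" for t
      by (rule DERIV_chain2[OF eta_DERIV dq])
    show "((\<lambda>t. eta1 (q t) * q' t) has_real_derivative (eta2 (q t) * q' t) * q' t + (- 2 * (norm h)\<^sup>2) * eta1 (q t)) (at t)" for t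
      by (rule DERIV_mult[OF DERIV_chain2[OF eta1_DERIV dq] dq'])
    fix t
    have "\<bar>eta2 (q t) * (q' t)\<^sup>2\<bar> \<le> 36 * (2 * norm h)\<^sup>2"
    proof (cases "q t > 0")
      case True
      have "(q' t)\<^sup>2 \<le> (2 * norm h)\<^sup>2" using power_mono[OF q'b[OF True], of 2] by simp
      then show ?thesis unfolding abs_mult using eta2_bound[of "q t"] by (intro mult_mono) auto
    qed (simp add: eta2_def eta_def)
    moreover have "\<bar>2 * (norm h)\<^sup>2 * eta1 (q t)\<bar> \<le> 2 * (norm h)\<^sup>2 * 2"
      unfolding abs_mult using eta1_bound[of "q t"] by (intro mult_mono) auto
    ultimately show "\<bar>(eta2 (q t) * q' t) * q' t + (- 2 * (norm h)\<^sup>2) * eta1 (q t)\<bar> \<le> 148 * (norm h)\<^sup>2"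
      by (simp add: power2_eq_square mult.assoc)
  qed
  then show ?thesis by (simp add: bump_eta q)
qed

lemma bump_continuous: "continuous_on A bump"
proof -
  have "continuous_on UNIV eta" using eta_DERIV
    by (intro continuous_at_imp_continuous_on) (auto intro: DERIV_isCont)
  then have "continuous_on A (\<lambda>x::real\<times>real. eta (1 - (norm x)\<^sup>2))"
    by (rule continuous_on_compose2) (auto intro!: continuous_intros)
  then show ?thesis by (simp add: bump_eta[abs_def])
qed

lemma bump_measurable[measurable]: "bump \<in> borel_measurable borel"
  using bump_continuous by (rule borel_measurable_continuous_onI)

lemma bump_nonneg: "0 \<le> bump x" by (simp add: bump_eta eta_nonneg)
lemma bump_le_1: "bump x \<le> 1" by (simp add: bump_eta eta_def)
lemma bump_support: "norm x \<ge> 1 \<Longrightarrow> bump x = 0" by (simp add: bump_def)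

lemma bounded_support_integrable:
  fixes f :: "real \<times> real \<Rightarrow> real"
  assumes [measurable]: "f \<in> borel_measurable borel" and b: "\<And>x. \<bar>f x\<bar> \<le> C" and s: "\<And>x. norm x > R \<Longrightarrow> f x = 0"
  shows "integrable lborel f"
proof (rule Bochner_Integration.integrable_bound)
  show "integrable lborel (\<lambda>x. indicator (cball (0::real\<times>real) R) x * C)"
    using emeasure_lborel_cball_finite[of "0::real\<times>real" R] by (intro integrable_mult_left integrable_real_indicator) auto
  show "AE x in lborel. norm (f x) \<le> norm (indicator (cball 0 R) x * C)"
    using b s order_trans[OF b abs_ge_self] by (intro AE_I2) (auto simp: indicator_def not_le)
qed simp

lemma bump_integrable: "integrable lborel bump"
  by (rule bounded_support_integrable[of _ 1 1]) (auto simp: bump_nonneg bump_le_1 bump_support)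

lemma bump_integral_pos: "0 < (\<integral>y. bump y \<partial>lborel)"
proof -
  \<comment> \<open>On the ball of radius 1/2 the exponent -1 / (1 - |x|^2) is at least -2.\<close>
  have "0 < exp (-2) * measure lborel (ball (0::real\<times>real) (1/2))"
    using content_ball_pos[of "1/2" "0::real\<times>real"] by (simp add: measure_def)
  also have "\<dots> = (\<integral>y. indicator (ball (0::real\<times>real) (1/2)) y * exp (-2) \<partial>lborel)"
    by simp
  also have "\<dots> \<le> (\<integral>y. bump y \<partial>lborel)"
  proof (rule integral_mono[OF _ bump_integrable])
    show "integrable lborel (\<lambda>y. indicator (ball (0::real\<times>real) (1/2)) y * exp (-2::real))"
      using emeasure_lborel_ball_finite[of "0::real\<times>real" "1/2"]
      by (intro integrable_mult_left integrable_real_indicator) auto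
    fix x :: "real \<times> real"
    show "indicator (ball (0::real\<times>real) (1/2)) x * exp (-2) \<le> bump x"
    proof (cases "norm x < 1/2")
      case True
      have "(norm x)\<^sup>2 \<le> (1/2)\<^sup>2" using True by (intro power_mono) auto
      then have "1/2 \<le> 1 - (norm x)\<^sup>2" by (simp add: power2_eq_square)
      then have "- 2 \<le> - 1 / (1 - (norm x)\<^sup>2)" by (simp add: field_simps)
      then show ?thesis using True by (simp add: bump_def)
    qed (simp add: bump_nonneg)
  qed
  finally show ?thesis .
qed

lemma rho_nonneg: "0 \<le> rho x" using bump_integral_pos bump_nonneg by (simp add: rho_def)
lemma rho_measurable[measurable]: "rho \<in> borel_measurable borel" unfolding rho_def[abs_def] by measurable
lemma rho_integrable: "integrable lborel rho" unfolding rho_def[abs_def] using bump_integrable by simp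
lemma rho_integral: "(\<integral>y. rho y \<partial>lborel) = 1" unfolding rho_def using bump_integral_pos by simp

section \<open>Decay of the Fourier transform and diagonal action on the basis\<close>

definition dot :: "real \<times> real \<Rightarrow> real \<times> real \<Rightarrow> real" where
  "dot \<xi> u = fst \<xi> * fst u + snd \<xi> * snd u"

lemma dot_inner: "dot \<xi> u = \<xi> \<bullet> u" by (simp add: dot_def inner_prod_def)

lemma dot_measurable[measurable]: "dot \<xi> \<in> borel_measurable borel"
proof -
  have "dot \<xi> = (\<lambda>u. \<xi> \<bullet> u)" by (simp add: dot_inner fun_eq_iff)
  then show ?thesis by simp
qed

text \<open>The Fourier transform of \<open>rho\<close>; it is real because \<open>rho\<close> is
  even, and only the cosine part remains.\<close>

definition rhat :: "real \<times> real \<Rightarrow> real" where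
  "rhat \<xi> = (\<integral>u. rho u * cos (2 * pi * dot \<xi> u) \<partial>lborel)"

lemma rho_mult_integrable:
  assumes [measurable]: "g \<in> borel_measurable borel" and b: "\<And>u. \<bar>g u\<bar> \<le> 1"
  shows "integrable lborel (\<lambda>u. rho u * g u)"
proof (rule Bochner_Integration.integrable_bound[OF rho_integrable])
  show "AE x in lborel. norm (rho x * g x) \<le> norm (rho x)"
    using b rho_nonneg mult_left_le[of "\<bar>g _\<bar>" "rho _"] by (intro AE_I2) (auto simp: abs_mult)
qed simp

lemma rhat_bound: "\<bar>rhat \<xi>\<bar> \<le> 1"
proof -
  have i: "integrable lborel (\<lambda>u. rho u * cos (2 * pi * dot \<xi> u))" by (rule rho_mult_integrable) auto
  have "\<bar>rhat \<xi>\<bar> \<le> (\<integral>u. \<bar>rho u * cos (2 * pi * dot \<xi> u)\<bar> \<partial>lborel)"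
    unfolding rhat_def by (rule integral_abs_bound)
  also have "\<dots> \<le> (\<integral>u. rho u \<partial>lborel)"
    using rho_nonneg mult_left_le[of "\<bar>cos (2 * pi * dot \<xi> _)\<bar>" "rho _"] 
    by (intro integral_mono integrable_abs i rho_integrable) (auto simp: abs_mult)
  finally show ?thesis by (simp add: rho_integral)
qed

lemma lborel_integral_shift:
  fixes f :: "real \<times> real \<Rightarrow> real"
  assumes [measurable]: "f \<in> borel_measurable borel"
  shows "(\<integral>x. f (h + x) \<partial>lborel) = (\<integral>x. f x \<partial>lborel)"
proof -
  have "(\<integral>x. f x \<partial>lborel) = (\<integral>x. f x \<partial>distr lborel borel ((+) h))"
    by (simp add: lborel_distr_plus)
  also have "\<dots> = (\<integral>x. f (h + x) \<partial>lborel)" by (rule integral_distr) measurable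
  finally show ?thesis by simp
qed

text \<open>Shifting by half a period in the direction \<open>\<xi>\<close> turns the Fourier coefficient into one of a
  second difference; this replaces integration by parts.\<close>
lemma rhat_decay: obtains C where "C \<ge> 0" "\<And>\<xi>. \<xi> \<noteq> 0 \<Longrightarrow> \<bar>rhat \<xi>\<bar> \<le> C / (norm \<xi>)\<^sup>2"
proof -
  define Z where "Z = (\<integral>y. bump y \<partial>lborel)"
  have Z: "Z > 0" using bump_integral_pos by (simp add: Z_def)
  define V where "V = measure lborel (cball (0::real\<times>real) 2)"
  have V: "V \<ge> 0" by (simp add: V_def)
  \<comment> \<open>The 1 serves the small frequencies, those with |h| > 1 below, where the trivial
    bound 1 is enough. The other term is the second-difference constant times the area of the ball
    of radius 2, which contains the supports of \<open>rho\<close> and of both shifts when |h| <=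
    1.\<close>
  define C where "C = 1 + 296 / Z * V"
  have C: "C \<ge> 1" using Z V by (simp add: C_def)
  have "\<bar>rhat \<xi>\<bar> \<le> C / (norm \<xi>)\<^sup>2" if \<xi>: "\<xi> \<noteq> 0" for \<xi>
  proof -
    have n: "norm \<xi> > 0" using \<xi> by simp
    define h where "h = (1 / (2 * (norm \<xi>)\<^sup>2)) *\<^sub>R \<xi>"
    have dh: "dot \<xi> h = 1/2" using n by (simp add: h_def dot_inner power2_norm_eq_inner)
    have nh: "norm h = 1 / (2 * norm \<xi>)" using n by (simp add: h_def power2_eq_square)
    define c where "c u = cos (2 * pi * dot \<xi> u)" for u
    have [measurable]: "c \<in> borel_measurable borel" unfolding c_def[abs_def] by measurable
    have cb: "\<bar>c u\<bar> \<le> 1" for u by (simp add: c_def)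
    have c1: "c (h + u) = - c u" for u
    proof -
      have "2 * pi * dot \<xi> (h + u) = 2 * pi * dot \<xi> u + pi" using dh by (simp add: dot_inner inner_add_right algebra_simps)
      then show ?thesis by (simp add: c_def)
    qed
    have c2: "c (u - h) = - c u" for u
      using c1[of "- h + u"] by simp
    show ?thesis
    proof (cases "norm h \<le> 1")
      case False
      then have "norm \<xi> \<le> 1" using nh n by (simp add: field_simps)
      then have "1 \<le> 1 / (norm \<xi>)\<^sup>2" using n by (simp add: power_le_one)
      also have "\<dots> \<le> C / (norm \<xi>)\<^sup>2" using C by (intro divide_right_mono) auto
      finally show ?thesis using rhat_bound[of \<xi>] by linarith
    next
      case True
      have e: "rhat \<xi> = (\<integral>u. rho u * c u \<partial>lborel)" by (simp add: rhat_def c_def)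
      have i0: "integrable lborel (\<lambda>u. rho u * c u)" by (rule rho_mult_integrable) (auto simp: cb)
      have iS: "integrable lborel (\<lambda>u. rho (s + u) * c u)" if "norm s \<le> 1" for s
      proof (rule bounded_support_integrable[of _ "1/Z" 2])
        show "\<bar>rho (s + x) * c x\<bar> \<le> 1 / Z" for x
          using bump_le_1[of "s + x"] bump_nonneg[of "s + x"] cb[of x] Z mult_mono[of "bump (s + x)" 1 "\<bar>c x\<bar>" 1]
          by (simp add: rho_def Z_def[symmetric] abs_mult divide_right_mono)
        show "rho (s + x) * c x = 0" if "norm x > 2" for x
        proof -
          have "norm x \<le> norm (s + x) + norm s" using norm_triangle_ineq4[of "s + x" s] by simp
          then have "norm (s + x) \<ge> 1" using that \<open>norm s \<le> 1\<close> by linarith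
          then show ?thesis by (simp add: rho_def bump_support)
        qed
      qed simp
      have "(\<integral>u. rho (- h + u) * c u \<partial>lborel) = (\<integral>u. (\<lambda>u. rho (- h + u) * c u) (h + u) \<partial>lborel)"
        by (rule lborel_integral_shift[symmetric]) simp
      also have "\<dots> = (\<integral>u. - (rho u * c u) \<partial>lborel)" by (simp add: c1)
      finally have m: "(\<integral>u. rho (- h + u) * c u \<partial>lborel) = - rhat \<xi>" by (simp only: e Bochner_Integration.integral_minus)
      have "(\<integral>u. rho (h + u) * c u \<partial>lborel) = (\<integral>u. (\<lambda>u. rho (h + u) * c u) (- h + u) \<partial>lborel)"
        by (rule lborel_integral_shift[symmetric]) simp
      also have "\<dots> = (\<integral>u. - (rho u * c u) \<partial>lborel)" by (simp add: c2)
      finally have p: "(\<integral>u. rho (h + u) * c u \<partial>lborel) = - rhat \<xi>" by (simp only: e Bochner_Integration.integral_minus)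
      have hn: "norm (- h) \<le> 1" using True by simp
      \<comment> \<open>Each of the two shifted integrals is - \<open>rhat \<xi>\<close>, and the
        middle term of the second difference contributes - 2 \<open>rhat \<xi>\<close>.\<close>
      have "- 4 * rhat \<xi> = (\<integral>u. (rho (h + u) * c u + rho (- h + u) * c u) - 2 * (rho u * c u) \<partial>lborel)"
        using i0 iS[OF True] iS[OF hn] m p e by simp
      also have "\<bar>\<dots>\<bar> \<le> (\<integral>u. indicator (cball (0::real\<times>real) 2) u * (296 * (norm h)\<^sup>2 / Z) \<partial>lborel)"
      proof (rule order_trans[OF integral_abs_bound integral_mono])
        show "integrable lborel (\<lambda>u. \<bar>(rho (h + u) * c u + rho (- h + u) * c u) - 2 * (rho u * c u)\<bar>)"
          using i0 iS[OF True] iS[OF hn] by (intro integrable_abs Bochner_Integration.integrable_diff Bochner_Integration.integrable_add integrable_mult_right)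
        show "integrable lborel (\<lambda>u. indicator (cball (0::real\<times>real) 2) u * (296 * (norm h)\<^sup>2 / Z))"
          using emeasure_lborel_cball_finite[of "0::real\<times>real" 2] by (intro integrable_mult_left integrable_real_indicator) auto
        fix u :: "real \<times> real"
        have "(rho (h + u) * c u + rho (- h + u) * c u) - 2 * (rho u * c u) = (bump (u + h) + bump (u - h) - 2 * bump u) / Z * c u"
          using Z by (simp add: rho_def Z_def[symmetric] field_simps)
        then have "\<bar>(rho (h + u) * c u + rho (- h + u) * c u) - 2 * (rho u * c u)\<bar> \<le> \<bar>bump (u + h) + bump (u - h) - 2 * bump u\<bar> / Z * 1"
          using Z cb[of u] by (simp add: abs_mult divide_right_mono mult_left_le)
        also have "\<dots> \<le> indicator (cball (0::real\<times>real) 2) u * (296 * (norm h)\<^sup>2 / Z)"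
        proof (cases "norm u \<le> 2")
          case True then show ?thesis using bump_second_difference[of u h] Z by (simp add: divide_right_mono)
        next
          case False
          have "norm u \<le> norm (u + h) + norm h" using norm_triangle_ineq4[of "u + h" h] by simp
          moreover have "norm u \<le> norm (u - h) + norm h" using norm_triangle_ineq[of "u - h" h] by simp
          ultimately have "norm (u + h) \<ge> 1" "norm (u - h) \<ge> 1" "norm u \<ge> 1" using False True by linarith+
          then show ?thesis using False by (simp add: bump_support)
        qed
        finally show "\<bar>(rho (h + u) * c u + rho (- h + u) * c u) - 2 * (rho u * c u)\<bar> \<le> indicator (cball (0::real\<times>real) 2) u * (296 * (norm h)\<^sup>2 / Z)" .
      qed
      also have "\<dots> = 296 / Z * V * (norm h)\<^sup>2" by (simp add: V_def)
      finally have "4 * \<bar>rhat \<xi>\<bar> \<le> 296 / Z * V * (norm h)\<^sup>2" by (simp add: abs_mult)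
      moreover have "0 \<le> 296 / Z * V" using Z V by simp
      ultimately have "\<bar>rhat \<xi>\<bar> \<le> 296 / Z * V * (1 / (norm \<xi>)\<^sup>2)"
        unfolding nh by (simp add: power_divide power_mult_distrib)
      also have "\<dots> \<le> C * (1 / (norm \<xi>)\<^sup>2)" by (intro mult_right_mono) (auto simp: C_def)
      finally show ?thesis by simp
    qed
  qed
  then show thesis using that[of C] C by simp
qed

lemma rhat_tendsto: "((\<lambda>\<epsilon>. rhat (\<epsilon> *\<^sub>R \<xi>)) \<longlongrightarrow> 1) (at_right 0)"
proof (rule tendsto_at_right_sequentially[of 0 1])
  fix S :: "nat \<Rightarrow> real" assume S: "S \<longlonglongrightarrow> 0"
  have "(\<lambda>n. \<integral>u. rho u * cos (2 * pi * dot (S n *\<^sub>R \<xi>) u) \<partial>lborel) \<longlonglongrightarrow> (\<integral>u. rho u * cos (2 * pi * 0) \<partial>lborel)"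
  proof (rule integral_dominated_convergence[where w=rho])
    show "AE u in lborel. (\<lambda>n. rho u * cos (2 * pi * dot (S n *\<^sub>R \<xi>) u)) \<longlonglongrightarrow> rho u * cos (2 * pi * 0)"
    proof (rule AE_I2)
      fix u
      have "(\<lambda>n. S n * (\<xi> \<bullet> u)) \<longlonglongrightarrow> 0 * (\<xi> \<bullet> u)" by (intro tendsto_mult S tendsto_const)
      then have "(\<lambda>n. dot (S n *\<^sub>R \<xi>) u) \<longlonglongrightarrow> 0" by (simp add: dot_inner)
      then show "(\<lambda>n. rho u * cos (2 * pi * dot (S n *\<^sub>R \<xi>) u)) \<longlonglongrightarrow> rho u * cos (2 * pi * 0)"
        by (intro tendsto_intros)
    qed
    show "AE u in lborel. norm (rho u * cos (2 * pi * dot (S n *\<^sub>R \<xi>) u)) \<le> rho u" for n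
      using rho_nonneg mult_left_le[of "\<bar>cos _\<bar>" "rho _"] by (intro AE_I2) (auto simp: abs_mult)
  qed (auto simp: rho_integrable)
  then show "(\<lambda>n. rhat (S n *\<^sub>R \<xi>)) \<longlonglongrightarrow> 1" by (simp add: rhat_def rho_integral)
qed simp

definition freq :: "int \<times> int \<Rightarrow> real \<times> real" where
  "freq k = (real_of_int (fst k), real_of_int (snd k))"

lemma lam_freq: "lam k = pi\<^sup>2 * (norm (freq k))\<^sup>2"
  by (simp add: lam_def freq_def norm_prod_def)

text \<open>The multiplier by which convolution with \<open>rho_eps \<epsilon>\<close> acts on mode
  \<open>k\<close>.\<close>

definition rr :: "real \<Rightarrow> int \<times> int \<Rightarrow> real" where "rr \<epsilon> k = rhat (\<epsilon> *\<^sub>R freq k)"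

lemma rr_bound: "\<bar>rr \<epsilon> k\<bar> \<le> 1" unfolding rr_def by (rule rhat_bound)

lemma rr_tendsto: "((\<lambda>\<epsilon>. rr \<epsilon> k) \<longlongrightarrow> 1) (at_right 0)" unfolding rr_def by (rule rhat_tendsto)

lemma rr_decay: 
  assumes "\<epsilon> > 0" obtains D where "D \<ge> 0" "\<And>k. k \<in> nz \<Longrightarrow> \<bar>rr \<epsilon> k\<bar> \<le> D / lam k"
proof -
  obtain C where C: "C \<ge> 0" "\<And>\<xi>. \<xi> \<noteq> 0 \<Longrightarrow> \<bar>rhat \<xi>\<bar> \<le> C / (norm \<xi>)\<^sup>2" using rhat_decay by blast
  show thesis
  proof (rule that[of "C * pi\<^sup>2 / \<epsilon>\<^sup>2"])
    show "0 \<le> C * pi\<^sup>2 / \<epsilon>\<^sup>2" using C by simp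
    fix k assume k: "k \<in> nz"
    have "freq k \<noteq> 0" using k by (auto simp: nz_def freq_def prod_eq_iff)
    then have "\<bar>rhat (\<epsilon> *\<^sub>R freq k)\<bar> \<le> C / (norm (\<epsilon> *\<^sub>R freq k))\<^sup>2" using C(2)[of "\<epsilon> *\<^sub>R freq k"] assms by simp
    also have "\<dots> = C * pi\<^sup>2 / \<epsilon>\<^sup>2 / lam k" using assms by (simp add: lam_freq power_mult_distrib)
    finally show "\<bar>rr \<epsilon> k\<bar> \<le> C * pi\<^sup>2 / \<epsilon>\<^sup>2 / lam k" by (simp add: rr_def)
  qed
qed

lemma rr_uminus: "rr \<epsilon> (- k) = rr \<epsilon> k"
proof -
  have "dot (\<epsilon> *\<^sub>R freq (- k)) u = - dot (\<epsilon> *\<^sub>R freq k) u" for u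
    by (simp add: dot_def freq_def)
  then show ?thesis by (simp add: rr_def rhat_def)
qed

lemma rr_0: "rr \<epsilon> (0,0) = 1"
  by (simp add: rr_def rhat_def dot_def freq_def rho_integral)

lemma rho_even: "rho (- u) = rho u" by (simp add: rho_def bump_def)

lemma rho_odd_integral: "(\<integral>u. rho u * sin (dot \<xi> u) \<partial>lborel) = 0"
proof -
  have "(\<integral>u. rho u * sin (dot \<xi> u) \<partial>lborel) = (\<integral>u. rho (-u) * sin (dot \<xi> (-u)) \<partial>lborel)"
  proof -
    have "lborel = distr lborel borel (uminus :: real \<times> real \<Rightarrow> real \<times> real)"
    proof -
      have "lborel = density (distr lborel borel (\<lambda>x::real\<times>real. 0 + (-1) *\<^sub>R x)) (\<lambda>_. ennreal (\<bar>-1\<bar> ^ DIM(real\<times>real)))"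
        using lborel_affine[of "-1" "0::real\<times>real"] by simp
      then show ?thesis by (simp add: density_1)
    qed
    then have "(\<integral>u. rho u * sin (dot \<xi> u) \<partial>lborel) = (\<integral>u. rho u * sin (dot \<xi> u) \<partial>distr lborel borel uminus)"
      by simp
    also have "\<dots> = (\<integral>u. rho (-u) * sin (dot \<xi> (-u)) \<partial>lborel)" by (rule integral_distr) measurable
    finally show ?thesis .
  qed
  also have "\<dots> = (\<integral>u. - (rho u * sin (dot \<xi> u)) \<partial>lborel)"
    by (simp add: rho_even dot_inner)
  finally show ?thesis by simp
qed

lemma rho_eps_integral:
  assumes e: "\<epsilon> > 0" and [measurable]: "g \<in> borel_measurable borel"
  shows "(\<integral>y. rho_eps \<epsilon> y * g y \<partial>lborel) = (\<integral>u. rho u * g (\<epsilon> *\<^sub>R u) \<partial>lborel)"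
proof -
  have [measurable]: "rho_eps \<epsilon> \<in> borel_measurable borel" unfolding rho_eps_def[abs_def] by measurable
  define A where "A = distr lborel borel (\<lambda>x::real\<times>real. 0 + \<epsilon> *\<^sub>R x)"
  have A: "lborel = density A (\<lambda>_. ennreal (\<bar>\<epsilon>\<bar> ^ DIM(real\<times>real)))"
    unfolding A_def using e by (intro lborel_affine) simp
  have [measurable]: "(\<lambda>y. rho_eps \<epsilon> y * g y) \<in> borel_measurable A" by (simp add: A_def)
  have "(\<integral>y. rho_eps \<epsilon> y * g y \<partial>lborel) = (\<integral>y. rho_eps \<epsilon> y * g y \<partial>density A (\<lambda>_. ennreal (\<bar>\<epsilon>\<bar> ^ DIM(real\<times>real))))"
    using A by simp
  also have "\<dots> = (\<integral>y. \<bar>\<epsilon>\<bar> ^ DIM(real\<times>real) *\<^sub>R (rho_eps \<epsilon> y * g y) \<partial>A)"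
    by (rule integral_density) (simp_all add: A_def)
  also have "\<dots> = (\<integral>u. \<bar>\<epsilon>\<bar> ^ DIM(real\<times>real) *\<^sub>R (rho_eps \<epsilon> (0 + \<epsilon> *\<^sub>R u) * g (0 + \<epsilon> *\<^sub>R u)) \<partial>lborel)"
    unfolding A_def by (rule integral_distr) measurable
  also have "\<dots> = (\<integral>u. \<epsilon>\<^sup>2 * (rho_eps \<epsilon> (\<epsilon> *\<^sub>R u) * g (\<epsilon> *\<^sub>R u)) \<partial>lborel)"
    using e by (simp add: power2_eq_square)
  also have "\<dots> = (\<integral>u. rho u * g (\<epsilon> *\<^sub>R u) \<partial>lborel)" using e by (simp add: rho_eps_def)
  finally show ?thesis .
qed

lemma ebasis_alt: "ebasis k x = (if k = (0,0) then 1 else if 0 < fst k \<or> (fst k = 0 \<and> 0 < snd k)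
   then sqrt 2 * cos (2 * pi * dot (freq k) x) else sqrt 2 * sin (2 * pi * dot (freq k) x))"
  by (simp add: ebasis_def Let_def dot_def freq_def)

lemma ebasis_measurable[measurable]: "ebasis k \<in> borel_measurable borel"
  unfolding ebasis_alt[abs_def] by measurable

text \<open>Convolution is diagonal on cosines and sines: the angle subtraction formulas split the
  integrand into a cosine part, which gives \<open>rr\<close>, and a sine part, which is odd and
  integrates to 0.\<close>

lemma conv_e_eq:
  assumes e: "\<epsilon> > 0" shows "conv_e \<epsilon> k x = rr \<epsilon> k * ebasis k x"
proof -
  have "conv_e \<epsilon> k x = (\<integral>u. rho u * ebasis k (x - \<epsilon> *\<^sub>R u) \<partial>lborel)"
    unfolding conv_e_def by (rule rho_eps_integral[OF e]) measurable
  also have "\<dots> = rr \<epsilon> k * ebasis k x"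
  proof (cases "k = (0,0)")
    case True then show ?thesis by (simp add: ebasis_def rr_0 rho_integral)
  next
    case False
    define \<theta> where "\<theta> = 2 * pi * dot (freq k) x"
    define s where "s u = sin (dot ((2 * pi * \<epsilon>) *\<^sub>R freq k) u)" for u
    define c where "c u = cos (2 * pi * dot (\<epsilon> *\<^sub>R freq k) u)" for u
    have [measurable]: "s \<in> borel_measurable borel" "c \<in> borel_measurable borel" 
      unfolding s_def[abs_def] c_def[abs_def] by measurable
    have arg: "2 * pi * dot (freq k) (x - \<epsilon> *\<^sub>R u) = \<theta> - 2 * pi * dot (\<epsilon> *\<^sub>R freq k) u"
      and arg2: "2 * pi * dot (\<epsilon> *\<^sub>R freq k) u = dot ((2 * pi * \<epsilon>) *\<^sub>R freq k) u" for u
      by (simp_all add: \<theta>_def dot_inner inner_diff_right algebra_simps)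
    have cos': "cos (2 * pi * dot (freq k) (x - \<epsilon> *\<^sub>R u)) = cos \<theta> * c u + sin \<theta> * s u"
      and sin': "sin (2 * pi * dot (freq k) (x - \<epsilon> *\<^sub>R u)) = sin \<theta> * c u - cos \<theta> * s u" for u
      unfolding arg by (simp_all add: cos_diff sin_diff s_def c_def arg2)
    have isn: "integrable lborel (\<lambda>u. rho u * s u)" and ic: "integrable lborel (\<lambda>u. rho u * c u)"
      by (rule rho_mult_integrable; simp add: s_def c_def)+
    have Is: "(\<integral>u. rho u * s u \<partial>lborel) = 0" unfolding s_def by (rule rho_odd_integral)
    have Ic: "(\<integral>u. rho u * c u \<partial>lborel) = rr \<epsilon> k" by (simp add: rr_def rhat_def c_def)
    have lin: "(\<integral>u. rho u * (a * c u + b * s u) \<partial>lborel) = a * rr \<epsilon> k" for a b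
    proof -
      have "(\<integral>u. rho u * (a * c u + b * s u) \<partial>lborel) = (\<integral>u. a * (rho u * c u) + b * (rho u * s u) \<partial>lborel)"
        by (simp add: algebra_simps)
      also have "\<dots> = a * (\<integral>u. rho u * c u \<partial>lborel) + b * (\<integral>u. rho u * s u \<partial>lborel)"
        using isn ic by simp
      finally show ?thesis using Is Ic by simp
    qed
    show ?thesis
    proof (cases "0 < fst k \<or> (fst k = 0 \<and> 0 < snd k)")
      case True
      then have eb: "ebasis k y = sqrt 2 * cos (2 * pi * dot (freq k) y)" for y using False by (simp add: ebasis_alt)
      have "(\<integral>u. rho u * ebasis k (x - \<epsilon> *\<^sub>R u) \<partial>lborel) = (\<integral>u. rho u * ((sqrt 2 * cos \<theta>) * c u + (sqrt 2 * sin \<theta>) * s u) \<partial>lborel)"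
        unfolding eb cos' by (simp add: algebra_simps)
      then show ?thesis unfolding lin by (simp add: eb \<theta>_def)
    next
      case False': False
      then have eb: "ebasis k y = sqrt 2 * sin (2 * pi * dot (freq k) y)" for y using False by (auto simp: ebasis_alt)
      have "(\<integral>u. rho u * ebasis k (x - \<epsilon> *\<^sub>R u) \<partial>lborel) = (\<integral>u. rho u * ((sqrt 2 * sin \<theta>) * c u + (- sqrt 2 * cos \<theta>) * s u) \<partial>lborel)"
        unfolding eb sin' by (simp add: algebra_simps)
      then show ?thesis unfolding lin by (simp add: eb \<theta>_def)
    qed
  qed
  finally show ?thesis .
qed

section \<open>Second moments of truncated Wick powers\<close>

definition Q2 :: "(real \<times> real) measure" where
  "Q2 = restrict_space lborel ({0..1} \<times> {0..1})"

lemma unit_square_measurable[measurable]: "{0..1} \<times> {0..1} \<in> sets (borel :: (real\<times>real) measure)"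
  by (intro borel_closed closed_Times) auto

lemma Q2_integral: "(LINT x : {0..1} \<times> {0..1} | lborel. f x) = (\<integral>x. f x \<partial>Q2)" for f :: "real \<times> real \<Rightarrow> real"
  unfolding Q2_def set_lebesgue_integral_def by (rule integral_restrict_space[symmetric]) simp

lemma Q2_measurable: "f \<in> measurable borel N \<Longrightarrow> f \<in> measurable Q2 N"
  unfolding Q2_def by (rule measurable_restrict_space1) simp

lemma emeasure_square: "emeasure lborel ({0..1} \<times> {0..1} :: (real\<times>real) set) = 1"
proof -
  have "emeasure (lborel \<Otimes>\<^sub>M lborel) ({0..1} \<times> {0..1} :: (real\<times>real) set) = emeasure lborel {0..1::real} * emeasure lborel {0..1::real}"
    by (rule lborel.emeasure_pair_measure_Times) auto
  then show ?thesis by (simp add: lborel_prod)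
qed

lemma prob_space_Q2: "prob_space Q2"
proof
  show "emeasure Q2 (space Q2) = 1"
    unfolding Q2_def by (simp add: space_restrict_space emeasure_restrict_space emeasure_square)
qed

interpretation Q2: prob_space Q2 by (rule prob_space_Q2)
interpretation QQ: pair_prob_space Q2 Q2 ..
interpretation QQg: pair_prob_space "Q2 \<Otimes>\<^sub>M Q2" gff ..

section \<open>Trigonometric sums over symmetric sets of modes\<close>

definition cis_mode :: "int \<times> int \<Rightarrow> real \<times> real \<Rightarrow> complex" where
  "cis_mode k x = cis (2 * pi * dot (freq k) x)"

lemma cis_measurable[measurable]: "cis \<in> borel_measurable borel"
  by (rule borel_measurable_continuous_onI, rule continuous_on_cis[OF continuous_on_id])

lemma cis_mode_measurable[measurable]: "cis_mode k \<in> borel_measurable borel"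
  unfolding cis_mode_def[abs_def] by measurable

lemma cis_mode_add: "cis_mode k x * cis_mode l x = cis_mode (k + l) x"
  by (simp add: cis_mode_def cis_mult dot_def freq_def algebra_simps)

lemma norm_cis_mode[simp]: "norm (cis_mode k x) = 1" by (simp add: cis_mode_def)

lemma integral_cis:
  "(\<integral>t. indicator {0..1} t *\<^sub>R cis (2 * pi * real_of_int m * t) \<partial>lborel) = (if m = 0 then 1 else 0)"
proof (cases "m = 0")
  case True then show ?thesis by (simp)
next
  case False
  define c where "c = 2 * pi * \<i> * of_int m"
  have c: "c \<noteq> 0" using False by (simp add: c_def)
  have e: "cis (2 * pi * real_of_int m * t) = exp (c * of_real t)" for t
    by (simp add: cis_conv_exp c_def mult_ac)
  have "(\<integral>t. indicator {0..1} t *\<^sub>R exp (c * of_real t) \<partial>lborel) = exp (c * of_real 1) / c - exp (c * of_real 0) / c"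
  proof (rule integral_FTC_Icc)
    fix t :: real
    have "((\<lambda>z. exp (c * z) / c) has_field_derivative exp (c * of_real t)) (at (of_real t))"
      using c by (auto intro!: derivative_eq_intros)
    then show "((\<lambda>t. exp (c * of_real t) / c) has_vector_derivative exp (c * of_real t)) (at t within {0..1})"
      by (rule has_vector_derivative_real_field)
  qed (auto intro!: continuous_intros)
  also have "exp (c * of_real 1) = 1"
    by (simp add: c_def exp_eq_1)
  finally show ?thesis using False by (simp add: e)
qed

lemma integral_cis_mode: "(\<integral>x. cis_mode k x \<partial>Q2) = (if k = 0 then 1 else 0)"
proof -
  let ?f = "\<lambda>m t. indicator {0..1} t *\<^sub>R cis (2 * pi * real_of_int m * t)"
  have fi: "integrable lborel (?f m)" for m
  proof (rule Bochner_Integration.integrable_bound)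
    show "integrable lborel (\<lambda>t. indicator {0..1::real} t :: real)" by (rule integrable_real_indicator) auto
    show "AE t in lborel. norm (?f m t) \<le> norm (indicator {0..1::real} t :: real)" by (rule AE_I2) simp
    have "(\<lambda>t. cis (2 * pi * real_of_int m * t)) \<in> borel_measurable lborel"
      by (rule measurable_compose[OF _ cis_measurable]) simp
    then show "?f m \<in> borel_measurable lborel" by (intro borel_measurable_scaleR borel_measurable_indicator) auto
  qed
  have [measurable]: "(\<lambda>t. ?f m t) \<in> borel_measurable lborel" for m using fi[of m] by (rule borel_measurable_integrable)
  have ms: "{0..1} \<times> {0..1} \<inter> space lborel \<in> sets (lborel :: (real\<times>real) measure)" by simp
  have "(\<integral>x. cis_mode k x \<partial>Q2) = (\<integral>x. indicator ({0..1} \<times> {0..1}) x *\<^sub>R cis_mode k x \<partial>lborel)"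
    unfolding Q2_def by (rule integral_restrict_space) simp
  also have "\<dots> = (\<integral>p. ?f (fst k) (fst p) * ?f (snd k) (snd p) \<partial>(lborel \<Otimes>\<^sub>M lborel))"
    unfolding lborel_prod
    by (intro Bochner_Integration.integral_cong)
      (auto simp: cis_mode_def dot_def freq_def cis_mult indicator_def algebra_simps split: prod.splits)
  also have "\<dots> = (\<integral>x. (\<integral>y. ?f (fst k) x * ?f (snd k) y \<partial>lborel) \<partial>lborel)"
  proof (subst lborel_pair.integral_fst'[symmetric])
    show "integrable (lborel \<Otimes>\<^sub>M lborel) (\<lambda>p. ?f (fst k) (fst p) * ?f (snd k) (snd p))"
    proof (rule lborel_pair.Fubini_integrable)
      show "(\<lambda>p. ?f (fst k) (fst p) * ?f (snd k) (snd p)) \<in> borel_measurable (lborel \<Otimes>\<^sub>M lborel)" by measurable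
      have "(\<lambda>x. \<integral>y. norm (?f (fst k) (fst (x, y)) * ?f (snd k) (snd (x, y))) \<partial>lborel)
        = (\<lambda>x. indicator {0..1} x * (\<integral>y. indicator {0..1::real} y \<partial>lborel))"
        by (simp add: norm_mult)
      then show "integrable lborel (\<lambda>x. \<integral>y. norm (?f (fst k) (fst (x, y)) * ?f (snd k) (snd (x, y))) \<partial>lborel)"
        by simp
      show "AE x in lborel. integrable lborel (\<lambda>y. ?f (fst k) (fst (x, y)) * ?f (snd k) (snd (x, y)))"
        using fi[of "snd k"] by (intro AE_I2) (simp only: fst_conv snd_conv integrable_mult_right)
    qed
  qed simp
  also have "\<dots> = (\<integral>x. ?f (fst k) x \<partial>lborel) * (\<integral>y. ?f (snd k) y \<partial>lborel)"
    by (simp only: integral_mult_right_zero integral_mult_left_zero)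
  also have "\<dots> = (if k = 0 then 1 else 0)" unfolding integral_cis by (simp add: prod_eq_iff zero_prod_def)
  finally show ?thesis .
qed

lemma uminus_nz: "- k \<in> nz \<longleftrightarrow> k \<in> nz" by (cases k) (auto simp: nz_def)

lemma lam_uminus[simp]: "lam (- k) = lam k" by (simp add: lam_def)

lemma dot_uminus_freq: "dot (freq (- k)) x = - dot (freq k) x" by (simp add: dot_def freq_def)

lemma dot_diff: "dot \<xi> (x - y) = dot \<xi> x - dot \<xi> y" by (simp add: dot_inner inner_diff_right)

text \<open>\<open>ebasis\<close> puts a cosine at one of k, -k and a sine of the same frequency at
  the other, so the two products add up to a function of x - y alone.\<close>

lemma ebasis_pair:
  assumes "k \<in> nz"
  shows "ebasis k x * ebasis k y + ebasis (-k) x * ebasis (-k) y = 2 * cos (2 * pi * dot (freq k) (x - y))"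
proof -
  define a b where "a = 2 * pi * dot (freq k) x" and "b = 2 * pi * dot (freq k) y"
  have c: "cos (2 * pi * dot (freq k) (x - y)) = cos a * cos b + sin a * sin b"
    unfolding dot_diff a_def b_def by (simp add: right_diff_distrib cos_diff)
  have nk: "2 * pi * dot (freq (-k)) x = - a" "2 * pi * dot (freq (-k)) y = - b" by (simp_all add: a_def b_def dot_uminus_freq)
  have nz: "k \<noteq> (0,0)" "- k \<noteq> (0,0)" using assms uminus_nz[of k] by (auto simp: nz_def)
  define P where "P = (0 < fst k \<or> (fst k = 0 \<and> 0 < snd k))"
  have P': "(0 < fst (-k) \<or> (fst (-k) = 0 \<and> 0 < snd (-k))) \<longleftrightarrow> \<not> P"
    using nz by (cases k) (auto simp: P_def)
  have e: "ebasis k z = (if P then sqrt 2 * cos (2 * pi * dot (freq k) z) else sqrt 2 * sin (2 * pi * dot (freq k) z))" for z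
    using nz unfolding ebasis_alt P_def[symmetric] by simp
  have e': "ebasis (-k) z = (if P then sqrt 2 * sin (2 * pi * dot (freq (-k)) z) else sqrt 2 * cos (2 * pi * dot (freq (-k)) z))" for z
    using nz unfolding ebasis_alt P' by simp
  have s2: "sqrt 2 * p * (sqrt 2 * q) = 2 * (p * q)" for p q :: real by simp
  show ?thesis unfolding e e' nk a_def[symmetric] b_def[symmetric] c by (cases P) (simp_all add: s2)
qed

lemma ebasis_bound: "\<bar>ebasis k x\<bar> \<le> sqrt 2"
proof -
  have "sqrt 2 * \<bar>cos t\<bar> \<le> sqrt 2 * 1" "sqrt 2 * \<bar>sin t\<bar> \<le> sqrt 2 * 1" for t :: real
    by (intro mult_left_mono; simp)+
  moreover have "1 \<le> sqrt (2::real)" by simp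
  ultimately show ?thesis unfolding ebasis_alt by (auto simp: abs_mult)
qed

definition evenc :: "coeffs \<Rightarrow> bool" where "evenc a \<longleftrightarrow> (\<forall>k. a (- k) = a k)"

lemma evencD: "evenc a \<Longrightarrow> a (- k) = a k" unfolding evenc_def by blast

text \<open>Modes k and -k are kept or dropped together: with even multipliers the covariance of the
  truncated field is then a function of x - y, and its variance is constant in x.\<close>

definition symK :: "(int \<times> int) set \<Rightarrow> bool" where
  "symK K \<longleftrightarrow> finite K \<and> K \<subseteq> nz \<and> (\<forall>k\<in>K. - k \<in> K)"

lemma symK_reindex: "symK K \<Longrightarrow> (\<Sum>k\<in>K. f (- k)) = (\<Sum>k\<in>K. f k)" for f :: "int \<times> int \<Rightarrow> 'b::comm_monoid_add"
  by (rule sum.reindex_bij_witness[of _ uminus uminus]) (auto simp: symK_def)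

lemma sum_ebasis:
  fixes c :: coeffs
  assumes K: "symK K" and c: "evenc c"
  shows "(\<Sum>k\<in>K. c k * (ebasis k x * ebasis k y)) = (\<Sum>k\<in>K. c k * cos (2 * pi * dot (freq k) (x - y)))"
proof -
  have "2 * (\<Sum>k\<in>K. c k * (ebasis k x * ebasis k y)) = (\<Sum>k\<in>K. c k * (ebasis k x * ebasis k y)) + (\<Sum>k\<in>K. c (-k) * (ebasis (-k) x * ebasis (-k) y))"
    using symK_reindex[OF K, of "\<lambda>k. c k * (ebasis k x * ebasis k y)"] by simp
  also have "\<dots> = (\<Sum>k\<in>K. c k * (ebasis k x * ebasis k y + ebasis (-k) x * ebasis (-k) y))"
    by (simp add: sum.distrib[symmetric] evencD[OF c] algebra_simps)
  also have "\<dots> = (\<Sum>k\<in>K. c k * (2 * cos (2 * pi * dot (freq k) (x - y))))"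
    using K by (intro sum.cong refl, subst ebasis_pair) (auto simp: symK_def)
  also have "\<dots> = 2 * (\<Sum>k\<in>K. c k * cos (2 * pi * dot (freq k) (x - y)))"
    by (simp add: sum_distrib_left mult_ac)
  finally show ?thesis by simp
qed

lemma sum_cos_cis:
  fixes c :: coeffs
  assumes K: "symK K" and c: "evenc c"
  shows "complex_of_real (\<Sum>k\<in>K. c k * cos (2 * pi * dot (freq k) (x - y))) =
    (\<Sum>k\<in>K. of_real (c k) * (cis_mode k x * cis_mode (- k) y))"
proof (rule complex_eqI)
  have m: "cis_mode k x * cis_mode (- k) y = cis (2 * pi * dot (freq k) (x - y))" for k
    by (simp add: cis_mode_def cis_mult dot_uminus_freq dot_diff algebra_simps)
  show "Re (complex_of_real (\<Sum>k\<in>K. c k * cos (2 * pi * dot (freq k) (x - y)))) = Re (\<Sum>k\<in>K. of_real (c k) * (cis_mode k x * cis_mode (- k) y))"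
    unfolding m by simp
  have "(\<Sum>k\<in>K. c k * sin (2 * pi * dot (freq k) (x - y))) = (\<Sum>k\<in>K. c (-k) * sin (2 * pi * dot (freq (-k)) (x - y)))"
    using symK_reindex[OF K, of "\<lambda>k. c k * sin (2 * pi * dot (freq k) (x - y))"] by simp
  also have "\<dots> = - (\<Sum>k\<in>K. c k * sin (2 * pi * dot (freq k) (x - y)))"
    by (simp add: evencD[OF c] dot_uminus_freq sum_negf)
  finally have "(\<Sum>k\<in>K. c k * sin (2 * pi * dot (freq k) (x - y))) = 0" by simp
  then show "Im (complex_of_real (\<Sum>k\<in>K. c k * cos (2 * pi * dot (freq k) (x - y)))) = Im (\<Sum>k\<in>K. of_real (c k) * (cis_mode k x * cis_mode (- k) y))"
    unfolding m by simp
qed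

type_synonym quad = "(int \<times> int) \<times> (int \<times> int) \<times> (int \<times> int) \<times> (int \<times> int)"

definition quad_prod :: "(int \<times> int \<Rightarrow> 'b::comm_monoid_mult) \<Rightarrow> quad \<Rightarrow> 'b" where
  "quad_prod f p = f (fst p) * (f (fst (snd p)) * (f (fst (snd (snd p))) * f (snd (snd (snd p)))))"

definition quad_sum :: "quad \<Rightarrow> int \<times> int" where
  "quad_sum p = fst p + (fst (snd p) + (fst (snd (snd p)) + snd (snd (snd p))))"

definition quads :: "(int \<times> int) set \<Rightarrow> quad set" where
  "quads K = {p \<in> K \<times> K \<times> K \<times> K. quad_sum p = 0}"

lemma sum_pow4: 
  fixes f :: "int \<times> int \<Rightarrow> 'b::comm_semiring_1"
  shows "(\<Sum>k\<in>K. f k)^4 = (\<Sum>p\<in>K \<times> K \<times> K \<times> K. quad_prod f p)"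
proof -
  have "(\<Sum>k\<in>K. f k)^4 = (\<Sum>k\<in>K. f k) * ((\<Sum>k\<in>K. f k) * ((\<Sum>k\<in>K. f k) * (\<Sum>k\<in>K. f k)))"
    by (simp add: eval_nat_numeral mult_ac)
  also have "\<dots> = (\<Sum>p\<in>K \<times> K \<times> K \<times> K. quad_prod f p)"
    unfolding sum_product sum.cartesian_product quad_prod_def by (simp add: case_prod_beta)
  finally show ?thesis .
qed

lemma quad_prod_mult: "quad_prod (\<lambda>k. f k * g k) p = quad_prod f p * quad_prod g p"
  by (simp add: quad_prod_def mult_ac)

lemma quad_prod_cis: "quad_prod (\<lambda>k. cis_mode k x) p = cis_mode (quad_sum p) x"
  "quad_prod (\<lambda>k. cis_mode (- k) x) p = cis_mode (- quad_sum p) x"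
  by (simp_all add: quad_prod_def quad_sum_def cis_mode_add)

text \<open>The fourth power is expanded into complex exponentials, whose products are again
  exponentials; integrating over both points keeps exactly the quadruples with vanishing total
  frequency.\<close>

lemma integral_cos4:
  fixes c :: coeffs
  assumes K: "symK K" and c: "evenc c"
  shows "(\<integral>p. (\<Sum>k\<in>K. c k * cos (2 * pi * dot (freq k) (fst p - snd p)))^4 \<partial>(Q2 \<Otimes>\<^sub>M Q2)) = (\<Sum>p\<in>quads K. quad_prod c p)"
proof -
  let ?K4 = "K \<times> K \<times> K \<times> K"
  have fin: "finite ?K4" using K by (auto simp: symK_def)
  let ?u = "\<lambda>n z. cis_mode n (fst z) * cis_mode (- n) (snd z)"
  have mm[measurable]: "cis_mode n \<in> borel_measurable Q2" for n by (rule Q2_measurable) measurable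
  have ui: "integrable (Q2 \<Otimes>\<^sub>M Q2) (?u n)" for n
    by (rule QQ.P.integrable_const_bound[of _ 1]) (auto simp: norm_mult)
  have U: "(\<integral>z. ?u n z \<partial>(Q2 \<Otimes>\<^sub>M Q2)) = (if n = 0 then 1 else 0)" for n
  proof -
    have "(\<integral>z. ?u n z \<partial>(Q2 \<Otimes>\<^sub>M Q2)) = (\<integral>x. (\<integral>y. cis_mode n x * cis_mode (- n) y \<partial>Q2) \<partial>Q2)"
      using QQ.integral_fst'[OF ui[of n]] by simp
    also have "\<dots> = (\<integral>x. cis_mode n x \<partial>Q2) * (\<integral>y. cis_mode (-n) y \<partial>Q2)"
      by (simp only: integral_mult_right_zero integral_mult_left_zero)
    finally show ?thesis by (simp add: integral_cis_mode)
  qed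
  have pt: "complex_of_real ((\<Sum>k\<in>K. c k * cos (2 * pi * dot (freq k) (fst z - snd z)))^4) =
    (\<Sum>p\<in>?K4. of_real (quad_prod c p) * ?u (quad_sum p) z)" for z
  proof -
    have q: "quad_prod (\<lambda>k. complex_of_real (c k)) p = of_real (quad_prod c p)" for p
      by (simp add: quad_prod_def)
    have "complex_of_real ((\<Sum>k\<in>K. c k * cos (2 * pi * dot (freq k) (fst z - snd z)))^4) =
      (complex_of_real (\<Sum>k\<in>K. c k * cos (2 * pi * dot (freq k) (fst z - snd z))))^4"
      by (rule of_real_power)
    also have "\<dots> = (\<Sum>k\<in>K. of_real (c k) * (cis_mode k (fst z) * cis_mode (- k) (snd z)))^4"
      by (simp only: sum_cos_cis[OF K c])
    also have "\<dots> = (\<Sum>p\<in>?K4. of_real (quad_prod c p) * ?u (quad_sum p) z)"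
      by (simp only: sum_pow4 quad_prod_mult quad_prod_cis q)
    finally show ?thesis .
  qed
  have "complex_of_real (\<integral>z. (\<Sum>k\<in>K. c k * cos (2 * pi * dot (freq k) (fst z - snd z)))^4 \<partial>(Q2 \<Otimes>\<^sub>M Q2)) =
     (\<integral>z. complex_of_real ((\<Sum>k\<in>K. c k * cos (2 * pi * dot (freq k) (fst z - snd z)))^4) \<partial>(Q2 \<Otimes>\<^sub>M Q2))"
    by (rule integral_complex_of_real[symmetric])
  also have "\<dots> = (\<integral>z. (\<Sum>p\<in>?K4. of_real (quad_prod c p) * ?u (quad_sum p) z) \<partial>(Q2 \<Otimes>\<^sub>M Q2))"
    by (simp only: pt)
  also have "\<dots> = (\<Sum>p\<in>?K4. (\<integral>z. of_real (quad_prod c p) * ?u (quad_sum p) z \<partial>(Q2 \<Otimes>\<^sub>M Q2)))"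
    by (rule Bochner_Integration.integral_sum) (intro integrable_mult_right ui)
  also have "\<dots> = (\<Sum>p\<in>?K4. if quad_sum p = 0 then of_real (quad_prod c p) else 0)"
    unfolding integral_mult_right_zero U by (intro sum.cong) auto
  also have "\<dots> = (\<Sum>p\<in>quads K. of_real (quad_prod c p))"
    unfolding quads_def using fin by (simp add: sum.inter_filter)
  also have "\<dots> = complex_of_real (\<Sum>p\<in>quads K. quad_prod c p)" by simp
  finally show ?thesis by (simp only: of_real_eq_iff)
qed

section \<open>The truncated interaction and its L2 distances\<close>

definition Wf :: "(int \<times> int) set \<Rightarrow> coeffs \<Rightarrow> coeffs \<Rightarrow> real \<times> real \<Rightarrow> real" where
  "Wf K a \<phi> x = (1/4) * herm 4 (cov K a a) (lin K (\<lambda>k. a k * ebasis k x) \<phi>)"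

definition Nf :: "(int \<times> int) set \<Rightarrow> coeffs \<Rightarrow> coeffs \<Rightarrow> real" where
  "Nf K a \<phi> = (\<integral>x. Wf K a \<phi> x \<partial>Q2)"

lemma cov_ebasis:
  assumes K: "symK K" and a: "evenc a" and b: "evenc b"
  shows "cov K (\<lambda>k. a k * ebasis k x) (\<lambda>k. b k * ebasis k y) = (\<Sum>k\<in>K. (a k * b k / lam k) * cos (2 * pi * dot (freq k) (x - y)))"
proof -
  have "cov K (\<lambda>k. a k * ebasis k x) (\<lambda>k. b k * ebasis k y) = (\<Sum>k\<in>K. (a k * b k / lam k) * (ebasis k x * ebasis k y))"
    unfolding cov_def by (intro sum.cong) auto
  also have "\<dots> = (\<Sum>k\<in>K. (a k * b k / lam k) * cos (2 * pi * dot (freq k) (x - y)))"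
    by (rule sum_ebasis[OF K]) (simp add: evenc_def evencD[OF a] evencD[OF b])
  finally show ?thesis .
qed

lemma cov_ebasis_diag:
  assumes K: "symK K" and a: "evenc a"
  shows "cov K (\<lambda>k. a k * ebasis k x) (\<lambda>k. a k * ebasis k x) = cov K a a"
  unfolding cov_ebasis[OF K a a] by (simp add: cov_def dot_def)

text \<open>The factor 3/2 is 4! / 16, from Wick's theorem and the two factors 1/4.\<close>

lemma Wf_pair:
  assumes K: "symK K" and a: "evenc a" and b: "evenc b"
  shows "integrable gff (\<lambda>\<phi>. Wf K a \<phi> x * Wf K b \<phi> y)"
    "(\<integral>\<phi>. Wf K a \<phi> x * Wf K b \<phi> y \<partial>gff) = (3/2) * (\<Sum>k\<in>K. (a k * b k / lam k) * cos (2 * pi * dot (freq k) (x - y)))^4"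
proof -
  have K': "finite K" "K \<subseteq> nz" using K by (auto simp: symK_def)
  note w = wick_pair[OF K', of 4 4 "\<lambda>k. a k * ebasis k x" "\<lambda>k. b k * ebasis k y", unfolded cov_ebasis_diag[OF K a] cov_ebasis_diag[OF K b] cov_ebasis[OF K a b]]
  have e: "Wf K a \<phi> x * Wf K b \<phi> y = (1/16) * (herm 4 (cov K a a) (lin K (\<lambda>k. a k * ebasis k x) \<phi>) * herm 4 (cov K b b) (lin K (\<lambda>k. b k * ebasis k y) \<phi>))" for \<phi>
    by (simp add: Wf_def)
  show "integrable gff (\<lambda>\<phi>. Wf K a \<phi> x * Wf K b \<phi> y)" unfolding e using w by simp
  show "(\<integral>\<phi>. Wf K a \<phi> x * Wf K b \<phi> y \<partial>gff) = (3/2) * (\<Sum>k\<in>K. (a k * b k / lam k) * cos (2 * pi * dot (freq k) (x - y)))^4"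
    unfolding e integral_mult_right_zero using w by (simp add: fact_numeral)
qed

lemma Wf_measurable2[measurable]: "(\<lambda>(\<phi>, x). Wf K a \<phi> x) \<in> borel_measurable (gff \<Otimes>\<^sub>M Q2)"
proof -
  have [measurable]: "ebasis k \<in> borel_measurable Q2" for k by (rule Q2_measurable) measurable
  show ?thesis unfolding Wf_def lin_def herm_def by measurable
qed

lemma Nf_measurable[measurable]: "Nf K a \<in> borel_measurable gff"
  unfolding Nf_def[abs_def] by (rule Q2.borel_measurable_lebesgue_integral) measurable

text \<open>Fubini over the field and two points of the square, followed by
  \<open>integral_cos4\<close>. Integrability comes from |A B| <= (A^2 + B^2) / 2 and the diagonal
  case of \<open>Wf_pair\<close>, whence the constant \<open>C\<close> with 3/4 = (1/2)
  (3/2).\<close>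

lemma Nf_pair:
  assumes K: "symK K" and a: "evenc a" and b: "evenc b"
  shows "integrable gff (\<lambda>\<phi>. Nf K a \<phi> * Nf K b \<phi>)"
    "(\<integral>\<phi>. Nf K a \<phi> * Nf K b \<phi> \<partial>gff) = (3/2) * (\<Sum>p\<in>quads K. quad_prod (\<lambda>k. 1 / lam k) p * quad_prod a p * quad_prod b p)"
proof -
  let ?f = "\<lambda>z \<phi>. Wf K a \<phi> (fst z) * Wf K b \<phi> (snd z)"
  define C where "C = (3/4) * (\<Sum>k\<in>K. \<bar>a k * a k / lam k\<bar>)^4 + (3/4) * (\<Sum>k\<in>K. \<bar>b k * b k / lam k\<bar>)^4"
  have sq: "(\<integral>\<phi>. Wf K d \<phi> x * Wf K d \<phi> x \<partial>gff) \<le> (3/2) * (\<Sum>k\<in>K. \<bar>d k * d k / lam k\<bar>)^4"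
    if d: "evenc d" for d x
  proof -
    have "\<bar>\<Sum>k\<in>K. (d k * d k / lam k) * cos (2 * pi * dot (freq k) (x - x))\<bar> \<le> (\<Sum>k\<in>K. \<bar>d k * d k / lam k\<bar>)"
      by (rule order_trans[OF sum_abs]) (simp add: dot_def)
    then have "\<bar>\<Sum>k\<in>K. (d k * d k / lam k) * cos (2 * pi * dot (freq k) (x - x))\<bar>^4 \<le> (\<Sum>k\<in>K. \<bar>d k * d k / lam k\<bar>)^4"
      by (rule power_mono) simp
    then show ?thesis unfolding Wf_pair(2)[OF K d d] by (simp add: power_even_abs)
  qed
  have m1[measurable]: "(\<lambda>z. ?f (fst z) (snd z)) \<in> borel_measurable ((Q2 \<Otimes>\<^sub>M Q2) \<Otimes>\<^sub>M gff)"
  proof -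
    have "(\<lambda>z. (snd z, fst (fst z))) \<in> measurable ((Q2 \<Otimes>\<^sub>M Q2) \<Otimes>\<^sub>M gff) (gff \<Otimes>\<^sub>M Q2)"
      "(\<lambda>z. (snd z, snd (fst z))) \<in> measurable ((Q2 \<Otimes>\<^sub>M Q2) \<Otimes>\<^sub>M gff) (gff \<Otimes>\<^sub>M Q2)" by measurable
    from measurable_compose[OF this(1) Wf_measurable2[of K a]] measurable_compose[OF this(2) Wf_measurable2[of K b]]
    show ?thesis by simp
  qed
  have bnd: "(\<integral>\<phi>. norm (?f z \<phi>) \<partial>gff) \<le> C" for z
  proof -
    have "(\<integral>\<phi>. norm (?f z \<phi>) \<partial>gff) \<le> (\<integral>\<phi>. (1/2) * (Wf K a \<phi> (fst z) * Wf K a \<phi> (fst z)) + (1/2) * (Wf K b \<phi> (snd z) * Wf K b \<phi> (snd z)) \<partial>gff)"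
    proof (rule integral_mono)
      show "integrable gff (\<lambda>\<phi>. norm (?f z \<phi>))" by (intro integrable_norm Wf_pair(1)[OF K a b])
      show "integrable gff (\<lambda>\<phi>. (1/2) * (Wf K a \<phi> (fst z) * Wf K a \<phi> (fst z)) + (1/2) * (Wf K b \<phi> (snd z) * Wf K b \<phi> (snd z)))"
        by (intro Bochner_Integration.integrable_add integrable_mult_right Wf_pair(1)[OF K a a] Wf_pair(1)[OF K b b])
      fix \<phi>
      have "0 \<le> (\<bar>Wf K a \<phi> (fst z)\<bar> - \<bar>Wf K b \<phi> (snd z)\<bar>)\<^sup>2" by simp
      then show "norm (?f z \<phi>) \<le> (1/2) * (Wf K a \<phi> (fst z) * Wf K a \<phi> (fst z)) + (1/2) * (Wf K b \<phi> (snd z) * Wf K b \<phi> (snd z))"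
        unfolding power2_diff power2_abs by (simp add: abs_mult power2_eq_square)
    qed
    also have "\<dots> = (1/2) * (\<integral>\<phi>. Wf K a \<phi> (fst z) * Wf K a \<phi> (fst z) \<partial>gff) + (1/2) * (\<integral>\<phi>. Wf K b \<phi> (snd z) * Wf K b \<phi> (snd z) \<partial>gff)"
      using Wf_pair(1)[OF K a a] Wf_pair(1)[OF K b b]
      by (subst Bochner_Integration.integral_add) (auto simp only: integral_mult_right_zero integrable_mult_right)
    also have "\<dots> \<le> C" using sq[OF a, of "fst z"] sq[OF b, of "snd z"] by (simp add: C_def)
    finally show ?thesis .
  qed
  have I: "integrable ((Q2 \<Otimes>\<^sub>M Q2) \<Otimes>\<^sub>M gff) (\<lambda>z. ?f (fst z) (snd z))"
  proof (rule QQg.Fubini_integrable[OF m1])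
    show "AE x in Q2 \<Otimes>\<^sub>M Q2. integrable gff (\<lambda>y. ?f (fst (x, y)) (snd (x, y)))"
      using Wf_pair(1)[OF K a b] by simp
    show "integrable (Q2 \<Otimes>\<^sub>M Q2) (\<lambda>x. \<integral>y. norm (?f (fst (x, y)) (snd (x, y))) \<partial>gff)"
    proof (rule QQ.P.integrable_const_bound[of _ C])
      show "AE x in Q2 \<Otimes>\<^sub>M Q2. norm (\<integral>y. norm (?f (fst (x, y)) (snd (x, y))) \<partial>gff) \<le> C"
        using bnd by (intro AE_I2) (simp add: abs_of_nonneg)
      show "(\<lambda>x. \<integral>y. norm (?f (fst (x, y)) (snd (x, y))) \<partial>gff) \<in> borel_measurable (Q2 \<Otimes>\<^sub>M Q2)"
        using m1 by (intro gff.borel_measurable_lebesgue_integral) (simp add: case_prod_beta)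
    qed
  qed
  have I': "integrable ((Q2 \<Otimes>\<^sub>M Q2) \<Otimes>\<^sub>M gff) (\<lambda>(z, \<phi>). ?f z \<phi>)"
    using I by (simp only: case_prod_unfold)
  have eq: "AE \<phi> in gff. integrable (Q2 \<Otimes>\<^sub>M Q2) (\<lambda>z. ?f z \<phi>)"
    by (rule QQg.AE_integrable_snd[OF I'])
  have eq2: "AE \<phi> in gff. (\<integral>z. ?f z \<phi> \<partial>(Q2 \<Otimes>\<^sub>M Q2)) = Nf K a \<phi> * Nf K b \<phi>"
    using eq
  proof eventually_elim
    case (elim \<phi>)
    have "(\<integral>z. ?f z \<phi> \<partial>(Q2 \<Otimes>\<^sub>M Q2)) = (\<integral>x. (\<integral>y. Wf K a \<phi> x * Wf K b \<phi> y \<partial>Q2) \<partial>Q2)"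
      using QQ.integral_fst'[OF elim] by simp
    then show ?case unfolding Nf_def by (simp only: integral_mult_right_zero integral_mult_left_zero)
  qed
  have I2: "integrable gff (\<lambda>\<phi>. \<integral>z. ?f z \<phi> \<partial>(Q2 \<Otimes>\<^sub>M Q2))"
    by (rule QQg.integrable_snd[OF I'])
  show "integrable gff (\<lambda>\<phi>. Nf K a \<phi> * Nf K b \<phi>)"
    by (rule integrable_cong_AE_imp[OF I2 _ eq2]) measurable
  have "(\<integral>\<phi>. Nf K a \<phi> * Nf K b \<phi> \<partial>gff) = (\<integral>\<phi>. (\<integral>z. ?f z \<phi> \<partial>(Q2 \<Otimes>\<^sub>M Q2)) \<partial>gff)"
    using eq2 I2 by (intro integral_cong_AE) auto
  also have "\<dots> = (\<integral>z. (\<integral>\<phi>. ?f z \<phi> \<partial>gff) \<partial>(Q2 \<Otimes>\<^sub>M Q2))"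
    by (rule QQg.Fubini_integral[OF I'])
  also have "\<dots> = (3/2) * (\<integral>z. (\<Sum>k\<in>K. (a k * b k / lam k) * cos (2 * pi * dot (freq k) (fst z - snd z)))^4 \<partial>(Q2 \<Otimes>\<^sub>M Q2))"
    unfolding Wf_pair(2)[OF K a b] by (rule integral_mult_right_zero)
  also have "\<dots> = (3/2) * (\<Sum>p\<in>quads K. quad_prod (\<lambda>k. a k * b k / lam k) p)"
    by (subst integral_cos4[OF K]) (simp_all add: evenc_def evencD[OF a] evencD[OF b])
  also have "(\<lambda>p. quad_prod (\<lambda>k. a k * b k / lam k) p) = (\<lambda>p. quad_prod (\<lambda>k. 1 / lam k) p * quad_prod a p * quad_prod b p)"
    by (simp add: quad_prod_def mult_ac)
  finally show "(\<integral>\<phi>. Nf K a \<phi> * Nf K b \<phi> \<partial>gff) = (3/2) * (\<Sum>p\<in>quads K. quad_prod (\<lambda>k. 1 / lam k) p * quad_prod a p * quad_prod b p)" .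
qed

text \<open>All three second moments are sums over the same quadruples with the same weights, so
  they combine into a square for each quadruple.\<close>

lemma Nf_diff:
  assumes K: "symK K" and a: "evenc a" and b: "evenc b"
  shows "integrable gff (\<lambda>\<phi>. (Nf K a \<phi> - Nf K b \<phi>)\<^sup>2)"
    "(\<integral>\<phi>. (Nf K a \<phi> - Nf K b \<phi>)\<^sup>2 \<partial>gff) = (3/2) * (\<Sum>p\<in>quads K. quad_prod (\<lambda>k. 1 / lam k) p * (quad_prod a p - quad_prod b p)\<^sup>2)"
proof -
  have e: "(Nf K a \<phi> - Nf K b \<phi>)\<^sup>2 = Nf K a \<phi> * Nf K a \<phi> - 2 * (Nf K a \<phi> * Nf K b \<phi>) + Nf K b \<phi> * Nf K b \<phi>" for \<phi>
    by (simp add: power2_eq_square algebra_simps)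
  note I = Nf_pair(1)[OF K a a] Nf_pair(1)[OF K a b] Nf_pair(1)[OF K b b]
  show "integrable gff (\<lambda>\<phi>. (Nf K a \<phi> - Nf K b \<phi>)\<^sup>2)" unfolding e
    by (intro Bochner_Integration.integrable_add Bochner_Integration.integrable_diff integrable_mult_right I)
  have "(\<integral>\<phi>. (Nf K a \<phi> - Nf K b \<phi>)\<^sup>2 \<partial>gff) = (\<integral>\<phi>. Nf K a \<phi> * Nf K a \<phi> \<partial>gff) - 2 * (\<integral>\<phi>. Nf K a \<phi> * Nf K b \<phi> \<partial>gff) + (\<integral>\<phi>. Nf K b \<phi> * Nf K b \<phi> \<partial>gff)"
    unfolding e using I by simp
  also have "\<dots> = (3/2) * (\<Sum>p\<in>quads K. quad_prod (\<lambda>k. 1 / lam k) p * (quad_prod a p - quad_prod b p)\<^sup>2)"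
    unfolding Nf_pair(2)[OF K a a] Nf_pair(2)[OF K a b] Nf_pair(2)[OF K b b]
    by (simp add: sum_subtractf sum.distrib sum_distrib_left power2_eq_square algebra_simps)
  finally show "(\<integral>\<phi>. (Nf K a \<phi> - Nf K b \<phi>)\<^sup>2 \<partial>gff) = (3/2) * (\<Sum>p\<in>quads K. quad_prod (\<lambda>k. 1 / lam k) p * (quad_prod a p - quad_prod b p)\<^sup>2)" .
qed

section \<open>The interaction as an almost sure limit\<close>

definition Kn :: "nat \<Rightarrow> (int \<times> int) set" where
  "Kn n = {k \<in> nz. \<bar>fst k\<bar> \<le> int n \<and> \<bar>snd k\<bar> \<le> int n}"

lemma finite_Kn[simp]: "finite (Kn n)"
proof (rule finite_subset)
  show "Kn n \<subseteq> {- int n..int n} \<times> {- int n..int n}" by (auto simp: Kn_def abs_le_iff)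
qed simp

lemma Kn_nz: "Kn n \<subseteq> nz" by (auto simp: Kn_def)

lemma symK_Kn: "symK (Kn n)"
  unfolding symK_def by (intro conjI finite_Kn Kn_nz) (auto simp: Kn_def uminus_nz)

lemma Kn_mono: "m \<le> n \<Longrightarrow> Kn m \<subseteq> Kn n" by (auto simp: Kn_def)

lemma filterlim_Kn: "filterlim Kn (finite_subsets_at_top nz) sequentially"
  unfolding filterlim_finite_subsets_at_top
proof (intro allI impI)
  fix X assume X: "finite X \<and> X \<subseteq> nz"
  define N where "N = (\<Sum>k\<in>X. nat \<bar>fst k\<bar> + nat \<bar>snd k\<bar>)"
  have "X \<subseteq> Kn n" if "n \<ge> N" for n
  proof
    fix k assume k: "k \<in> X"
    have "nat \<bar>fst k\<bar> + nat \<bar>snd k\<bar> \<le> N" unfolding N_def using X k by (intro member_le_sum) auto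
    then show "k \<in> Kn n" using X k that by (auto simp: Kn_def)
  qed
  then show "\<forall>\<^sub>F y in sequentially. finite (Kn y) \<and> X \<subseteq> Kn y \<and> Kn y \<subseteq> nz"
    using Kn_nz unfolding eventually_sequentially by (intro exI[of _ N]) simp
qed

lemma sum_Kn_tendsto:
  fixes f :: "int \<times> int \<Rightarrow> real"
  assumes "f summable_on nz" shows "(\<lambda>n. \<Sum>k\<in>Kn n. f k) \<longlonglongrightarrow> infsum f nz"
proof -
  have "(f has_sum infsum f nz) nz" using assms by (rule has_sum_infsum)
  then have "(sum f \<longlongrightarrow> infsum f nz) (finite_subsets_at_top nz)" unfolding has_sum_def .
  from filterlim_compose[OF this filterlim_Kn] show ?thesis .
qed

lemma inv_lam_summable: "n \<ge> 2 \<Longrightarrow> (\<lambda>k. 1 / lam k ^ n) summable_on nz"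
proof -
  assume n: "n \<ge> 2"
  have "(\<lambda>k. lam k powr (-(real n))) summable_on nz" using n by (intro lam_summable) simp
  then show ?thesis by (rule summable_on_cong[THEN iffD1, rotated])
    (use lam_pos in \<open>simp add: powr_minus_divide powr_realpow\<close>)
qed

definition wt :: "quad \<Rightarrow> real" where "wt p = quad_prod (\<lambda>k. 1 / lam k) p"

text \<open>\<open>d\<close> is the product of three copies of its cube root, which are at least the
  cube roots of \<open>a\<close>, \<open>b\<close> and \<open>c\<close>.\<close>

lemma inv_four_bound:
  fixes a b c d :: real
  assumes "a > 0" "b > 0" "c > 0" "d > 0" "d \<ge> a" "d \<ge> b" "d \<ge> c"
  shows "1 / (a * b * c * d) \<le> a powr (-4/3) * (b powr (-4/3) * c powr (-4/3))"
proof -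
  let ?q = "1/3 :: real"
  have "a powr ?q * (b powr ?q * c powr ?q) \<le> d powr ?q * (d powr ?q * d powr ?q)"
    using assms by (intro mult_mono powr_mono2) auto
  also have "\<dots> = d" using assms by (simp add: powr_add[symmetric])
  finally have le: "a powr ?q * (b powr ?q * c powr ?q) \<le> d" .
  have p: "0 < a powr ?q * (b powr ?q * c powr ?q)" using assms by simp
  have e: "x powr (-4/3) = 1 / (x * x powr ?q)" if "x > 0" for x :: real
    using that powr_mult_base[of x ?q] powr_minus_divide[of x "4/3"] by simp
  have "1 / (a * b * c * d) \<le> 1 / (a * b * c * (a powr ?q * (b powr ?q * c powr ?q)))"
    using assms le p by (intro divide_left_mono mult_left_mono mult_pos_pos) auto
  also have "\<dots> = a powr (-4/3) * (b powr (-4/3) * c powr (-4/3))"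
    unfolding e[OF assms(1)] e[OF assms(2)] e[OF assms(3)] by (simp add: mult_ac)
  finally show ?thesis .
qed

lemma summable_on_cube: 
  fixes f :: "int \<times> int \<Rightarrow> real"
  assumes "f summable_on nz"
  shows "(\<lambda>p. f (fst p) * (f (fst (snd p)) * f (snd (snd p)))) summable_on nz \<times> nz \<times> nz"
proof -
  have f: "Infinite_Set_Sum.abs_summable_on f nz" using assms by (simp add: summable_on_iff_integrable abs_summable_on_def)
  have f2: "Infinite_Set_Sum.abs_summable_on (\<lambda>(x,y). f x * f y) (nz \<times> nz)"
    by (rule abs_summable_on_product[OF _ _ f f]) auto
  have "Infinite_Set_Sum.abs_summable_on (\<lambda>(x,p). f x * (\<lambda>(x,y). f x * f y) p) (nz \<times> (nz \<times> nz))"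
    by (rule abs_summable_on_product[OF _ _ f f2]) auto
  then show ?thesis by (simp add: summable_on_iff_integrable abs_summable_on_def case_prod_unfold)
qed

text \<open>If \<open>k\<^sub>4\<close> carries the largest eigenvalue, then \<open>\<Prod>\<lambda>\<^sub>i\<^sup>-\<^sup>1 \<le> (\<lambda>\<^sub>1\<lambda>\<^sub>2\<lambda>\<^sub>3)\<^sup>-\<^sup>4\<^sup>/\<^sup>3\<close>, and \<open>k\<^sub>4\<close> is determined
  by the other three frequencies.\<close>
lemma wt_summable: "wt summable_on quads nz"
proof -
  let ?f = "\<lambda>k. lam k powr (-4/3)"
  let ?h = "\<lambda>p. ?f (fst p) * (?f (fst (snd p)) * ?f (snd (snd p)))"
  have f: "?f summable_on nz" using lam_summable[of "4/3"] by simp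
  have s: "(\<lambda>p. ?h (g p)) summable_on quads nz"
    if g: "inj_on g (quads nz)" "g ` quads nz \<subseteq> nz \<times> nz \<times> nz" for g
  proof -
    have "?h summable_on g ` quads nz" by (rule summable_on_subset_banach[OF summable_on_cube[OF f] g(2)])
    then show ?thesis using summable_on_reindex[OF g(1), of ?h] by (simp add: o_def)
  qed
  let ?g1 = "\<lambda>p::quad. (fst (snd p), fst (snd (snd p)), snd (snd (snd p)))"
  let ?g2 = "\<lambda>p::quad. (fst p, fst (snd (snd p)), snd (snd (snd p)))"
  let ?g3 = "\<lambda>p::quad. (fst p, fst (snd p), snd (snd (snd p)))"
  let ?g4 = "\<lambda>p::quad. (fst p, fst (snd p), fst (snd (snd p)))"
  \<comment> \<open>The four maps forget one frequency each and are injective because the total is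
    0. Which frequency is the largest depends on the quadruple, so all four majorants are
    added.\<close>
  have "(\<lambda>p. (?h (?g1 p) + ?h (?g2 p)) + (?h (?g3 p) + ?h (?g4 p))) summable_on quads nz"
    by (intro summable_on_add s) (auto simp: inj_on_def quads_def quad_sum_def add_eq_0_iff)
  then show ?thesis
  proof (rule summable_on_bound)
    fix p assume p: "p \<in> quads nz"
    obtain a b c d where abcd: "p = (a, b, c, d)" by (metis surj_pair)
    have l: "lam a > 0" "lam b > 0" "lam c > 0" "lam d > 0" using p lam_pos by (auto simp: quads_def abcd)
    have w: "wt p = 1 / (lam a * lam b * lam c * lam d)" by (simp add: wt_def quad_prod_def abcd mult_ac)
    have w0: "0 \<le> wt p" unfolding w using l by simp
    have h0: "0 \<le> ?h q" for q by simp
    have "wt p \<le> ?h (?g1 p) \<or> wt p \<le> ?h (?g2 p) \<or> wt p \<le> ?h (?g3 p) \<or> wt p \<le> ?h (?g4 p)"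
    proof -
      consider "lam d \<ge> lam a" "lam d \<ge> lam b" "lam d \<ge> lam c" | "lam c \<ge> lam a" "lam c \<ge> lam b" "lam c \<ge> lam d"
        | "lam b \<ge> lam a" "lam b \<ge> lam c" "lam b \<ge> lam d" | "lam a \<ge> lam b" "lam a \<ge> lam c" "lam a \<ge> lam d" by linarith
      then show ?thesis
      proof cases
        case 1 then show ?thesis using inv_four_bound[OF l(1) l(2) l(3) l(4)] w abcd by simp
      next
        case 2 then show ?thesis using inv_four_bound[OF l(1) l(2) l(4) l(3)] w abcd by (simp add: mult_ac)
      next
        case 3 then show ?thesis using inv_four_bound[OF l(1) l(3) l(4) l(2)] w abcd by (simp add: mult_ac)
      next
        case 4 then show ?thesis using inv_four_bound[OF l(2) l(3) l(4) l(1)] w abcd by (simp add: mult_ac)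
      qed
    qed
    then show "\<bar>wt p\<bar> \<le> (?h (?g1 p) + ?h (?g2 p)) + (?h (?g3 p) + ?h (?g4 p))"
      using w0 h0[of "?g1 p"] h0[of "?g2 p"] h0[of "?g3 p"] h0[of "?g4 p"] by linarith
  qed
qed

lemma wt_nonneg: "0 \<le> wt p" by (simp add: wt_def quad_prod_def)

section \<open>The mollified interaction with all modes present\<close>

definition decay :: "coeffs \<Rightarrow> bool" where
  "decay r \<longleftrightarrow> evenc r \<and> (\<forall>k. \<bar>r k\<bar> \<le> 1) \<and> (\<exists>D\<ge>0. \<forall>k\<in>nz. \<bar>r k\<bar> \<le> D / lam k)"

lemma decay_le_1: "decay r \<Longrightarrow> \<bar>r k\<bar> \<le> 1" unfolding decay_def by blast

lemma decay_rr: "\<epsilon> > 0 \<Longrightarrow> decay (rr \<epsilon>)"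
proof -
  assume e: "\<epsilon> > 0"
  obtain D where "D \<ge> 0" "\<And>k. k \<in> nz \<Longrightarrow> \<bar>rr \<epsilon> k\<bar> \<le> D / lam k" using rr_decay[OF e] by blast
  then show ?thesis unfolding decay_def evenc_def using rr_uminus rr_bound by blast
qed

text \<open>Together with multipliers bounded by a constant over \<open>lam k\<close>, this makes
  the mollified field an absolutely convergent series, uniformly in the point. The pointwise
  statements about the interaction are made for such families, which are almost all.\<close>

definition goodphi :: "coeffs \<Rightarrow> bool" where
  "goodphi \<phi> \<longleftrightarrow> (\<lambda>k. \<bar>\<phi> k\<bar> / lam k) summable_on nz"

definition Xf :: "coeffs \<Rightarrow> coeffs \<Rightarrow> real \<times> real \<Rightarrow> real" where
  "Xf r \<phi> x = (\<Sum>\<^sub>\<infinity>k\<in>nz. r k * ebasis k x * \<phi> k)"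

definition Cr :: "coeffs \<Rightarrow> real" where
  "Cr r = (\<Sum>\<^sub>\<infinity>k\<in>nz. r k * r k / lam k)"

definition Ninf :: "coeffs \<Rightarrow> coeffs \<Rightarrow> real" where
  "Ninf r \<phi> = (\<integral>x. (1/4) * herm 4 (Cr r) (Xf r \<phi> x) \<partial>Q2)"

text \<open>The weighted squared distance of the fourfold products of multipliers from 1, the value
  without mollification. It measures in L2 how far \<open>Ninf r\<close> is from the limit
  interaction.\<close>

definition Tr :: "coeffs \<Rightarrow> real" where
  "Tr r = (\<Sum>\<^sub>\<infinity>p\<in>quads nz. wt p * (quad_prod r p - 1)\<^sup>2)"

lemma AE_good: "AE \<phi> in gff. goodphi \<phi>" unfolding goodphi_def by (rule AE_abs_summable)

lemma ebasis_Q2[measurable]: "ebasis k \<in> borel_measurable Q2" by (rule Q2_measurable) measurable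

lemma Xf_measurable: "(\<lambda>(\<phi>, x). Xf r \<phi> x) \<in> borel_measurable (gff \<Otimes>\<^sub>M Q2)"
proof -
  have "(\<lambda>p. \<Sum>\<^sub>\<infinity>k\<in>nz. r k * ebasis k (snd p) * (fst p) k) \<in> borel_measurable (gff \<Otimes>\<^sub>M Q2)"
    by (rule infsum_measurable) (simp, measurable)
  then show ?thesis by (simp add: Xf_def case_prod_unfold)
qed

lemma Xf_measurable1[measurable]: "Xf r \<phi> \<in> borel_measurable Q2"
proof -
  have "(\<lambda>x. \<Sum>\<^sub>\<infinity>k\<in>nz. r k * ebasis k x * \<phi> k) \<in> borel_measurable Q2"
    by (rule infsum_measurable) (simp, measurable)
  then show ?thesis by (simp add: Xf_def[abs_def])
qed

lemma Xf_measurable2[measurable]: "(\<lambda>\<phi>. Xf r \<phi> x) \<in> borel_measurable gff"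
  unfolding Xf_def by (rule infsum_measurable) auto

lemma herm_measurable[measurable]: "herm n c \<in> borel_measurable borel"
  unfolding herm_def by measurable

lemma Ninf_measurable[measurable]: "Ninf r \<in> borel_measurable gff"
proof -
  have "(\<lambda>p. (1/4) * herm 4 (Cr r) ((\<lambda>(\<phi>, x). Xf r \<phi> x) p)) \<in> borel_measurable (gff \<Otimes>\<^sub>M Q2)"
    using measurable_compose[OF Xf_measurable herm_measurable] by simp
  then show ?thesis unfolding Ninf_def[abs_def]
    by (intro Q2.borel_measurable_lebesgue_integral) (simp add: case_prod_unfold)
qed

context
  fixes r assumes r: "decay r"
begin

lemma term_bound:
  obtains D where "D \<ge> 0" "\<And>k x \<phi>. k \<in> nz \<Longrightarrow> \<bar>r k * ebasis k x * \<phi> k\<bar> \<le> D * (\<bar>\<phi> k\<bar> / lam k)"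
proof -
  obtain D where D: "D \<ge> 0" "\<And>k. k \<in> nz \<Longrightarrow> \<bar>r k\<bar> \<le> D / lam k" using r unfolding decay_def by blast
  show thesis
  proof (rule that[of "D * sqrt 2"])
    fix k x and \<phi> :: coeffs assume k: "k \<in> nz"
    have "\<bar>r k * ebasis k x * \<phi> k\<bar> \<le> (D / lam k) * sqrt 2 * \<bar>\<phi> k\<bar>"
      unfolding abs_mult using D k ebasis_bound[of k x] lam_pos[OF k] by (intro mult_mono) auto
    then show "\<bar>r k * ebasis k x * \<phi> k\<bar> \<le> D * sqrt 2 * (\<bar>\<phi> k\<bar> / lam k)" by (simp add: mult_ac)
  qed (use D in simp)
qed

lemma Xf_summable: "goodphi \<phi> \<Longrightarrow> (\<lambda>k. r k * ebasis k x * \<phi> k) summable_on nz"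
proof -
  assume g: "goodphi \<phi>"
  obtain D where D: "D \<ge> 0" "\<And>k x \<phi>. k \<in> nz \<Longrightarrow> \<bar>r k * ebasis k x * \<phi> k\<bar> \<le> D * (\<bar>\<phi> k\<bar> / lam k)" using term_bound by blast
  have "(\<lambda>k. D * (\<bar>\<phi> k\<bar> / lam k)) summable_on nz" using g unfolding goodphi_def by (rule summable_on_cmult_right)
  then show ?thesis by (rule summable_on_bound) (use D in auto)
qed

lemma lin_tendsto: "goodphi \<phi> \<Longrightarrow> (\<lambda>n. lin (Kn n) (\<lambda>k. r k * ebasis k x) \<phi>) \<longlonglongrightarrow> Xf r \<phi> x"
  unfolding lin_def Xf_def by (rule sum_Kn_tendsto[OF Xf_summable])

lemma lin_bound:
  assumes g: "goodphi \<phi>" obtains B where "\<forall>n x. \<bar>lin (Kn n) (\<lambda>k. r k * ebasis k x) \<phi>\<bar> \<le> B" "\<forall>x. \<bar>Xf r \<phi> x\<bar> \<le> B"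
proof -
  obtain D where D: "D \<ge> 0" "\<And>k x \<phi>. k \<in> nz \<Longrightarrow> \<bar>r k * ebasis k x * \<phi> k\<bar> \<le> D * (\<bar>\<phi> k\<bar> / lam k)" using term_bound by blast
  define B where "B = (\<Sum>\<^sub>\<infinity>k\<in>nz. D * (\<bar>\<phi> k\<bar> / lam k))"
  have s: "(\<lambda>k. D * (\<bar>\<phi> k\<bar> / lam k)) summable_on nz" using g unfolding goodphi_def by (rule summable_on_cmult_right)
  have b: "\<bar>lin (Kn n) (\<lambda>k. r k * ebasis k x) \<phi>\<bar> \<le> B" for n x
  proof -
    have "\<bar>lin (Kn n) (\<lambda>k. r k * ebasis k x) \<phi>\<bar> \<le> (\<Sum>k\<in>Kn n. \<bar>r k * ebasis k x * \<phi> k\<bar>)"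
      unfolding lin_def by (rule sum_abs)
    also have "\<dots> \<le> (\<Sum>k\<in>Kn n. D * (\<bar>\<phi> k\<bar> / lam k))" using D(2) Kn_nz by (intro sum_mono) blast
    also have "\<dots> \<le> B" unfolding B_def using D(1) Kn_nz by (intro finite_sum_le_infsum[OF s]) auto
    finally show ?thesis .
  qed
  moreover have "\<bar>Xf r \<phi> x\<bar> \<le> B" for x
    using tendsto_rabs[OF lin_tendsto[OF g, of x]] by (rule LIMSEQ_le_const2) (use b in auto)
  ultimately show thesis by (intro that[of B]) auto
qed

lemma Cr_summable: "(\<lambda>k. r k * r k / lam k) summable_on nz"
proof -
  obtain D where D: "D \<ge> 0" "\<And>k. k \<in> nz \<Longrightarrow> \<bar>r k\<bar> \<le> D / lam k" using r unfolding decay_def by blast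
  have "(\<lambda>k. D * (1 / lam k ^ 2)) summable_on nz" by (intro summable_on_cmult_right inv_lam_summable) simp
  then show ?thesis
  proof (rule summable_on_bound)
    fix k assume k: "k \<in> nz"
    have "\<bar>r k\<bar> * \<bar>r k\<bar> \<le> (D / lam k) * 1" using D(1) D(2)[OF k] decay_le_1[OF r] lam_pos[OF k] by (intro mult_mono) auto
    then have "\<bar>r k * r k\<bar> / lam k \<le> (D / lam k) * 1 / lam k" unfolding abs_mult using lam_pos[OF k] by (intro divide_right_mono) auto
    then show "\<bar>r k * r k / lam k\<bar> \<le> D * (1 / lam k ^ 2)" using lam_pos[OF k] by (simp add: power2_eq_square)
  qed
qed

lemma cov_tendsto: "(\<lambda>n. cov (Kn n) r r) \<longlonglongrightarrow> Cr r"
  unfolding cov_def Cr_def by (rule sum_Kn_tendsto[OF Cr_summable])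

lemma cov_nonneg: "0 \<le> cov (Kn n) r r" unfolding cov_def by (intro sum_nonneg) auto

lemma cov_le: "cov (Kn n) r r \<le> Cr r"
  unfolding cov_def Cr_def using Kn_nz by (intro finite_sum_le_infsum[OF Cr_summable]) auto

lemma herm4_bound:
  assumes "0 \<le> c" "c \<le> C" "\<bar>y\<bar> \<le> B" shows "\<bar>herm 4 c y\<bar> \<le> B^4 + 6 * C * B^2 + 3 * C^2"
proof -
  have y2: "y^2 \<le> B^2" using power_mono[OF assms(3), of 2] by simp
  have y4: "y^4 \<le> B^4" using power_mono[OF assms(3), of 4] by (simp add: power_even_abs)
  have h1: "c * y^2 \<le> C * B^2" using assms y2 by (intro mult_mono) auto
  have h2: "c^2 \<le> C^2" using assms by (intro power_mono) auto
  have h3: "0 \<le> c * y^2" "0 \<le> y^4" "0 \<le> c^2" using assms by auto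
  have gen: "\<bar>s - 6 * p + 3 * t\<bar> \<le> S + 6 * P + 3 * T"
    if "p \<le> P" "t \<le> T" "0 \<le> p" "0 \<le> s" "0 \<le> t" "s \<le> S" for p t s P S T :: real
    using that by linarith
  have "herm 4 c y = y^4 - 6 * (c * y^2) + 3 * c^2" by (simp add: herm_def)
  then show ?thesis using gen[OF h1 h2 h3 y4] by (simp only: mult.assoc)
qed

text \<open>Dominated convergence in the point of the square: the field and its partial sums are
  bounded uniformly there, and the truncated variances stay below \<open>Cr r\<close>.\<close>

lemma Nf_tendsto:
  assumes g: "goodphi \<phi>" shows "(\<lambda>n. Nf (Kn n) r \<phi>) \<longlonglongrightarrow> Ninf r \<phi>"
proof -
  obtain B where B: "\<forall>n x. \<bar>lin (Kn n) (\<lambda>k. r k * ebasis k x) \<phi>\<bar> \<le> B" "\<forall>x. \<bar>Xf r \<phi> x\<bar> \<le> B"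
    by (rule lin_bound[OF g])
  show ?thesis unfolding Nf_def Wf_def Ninf_def
  proof (rule integral_dominated_convergence[where w="\<lambda>_. B^4 + 6 * Cr r * B^2 + 3 * (Cr r)^2"])
    show "AE x in Q2. (\<lambda>n. (1/4) * herm 4 (cov (Kn n) r r) (lin (Kn n) (\<lambda>k. r k * ebasis k x) \<phi>)) \<longlonglongrightarrow> (1/4) * herm 4 (Cr r) (Xf r \<phi> x)"
      unfolding herm_def by (intro AE_I2) (simp, intro tendsto_intros cov_tendsto lin_tendsto[OF g], simp)
    show "AE x in Q2. norm ((1/4) * herm 4 (cov (Kn n) r r) (lin (Kn n) (\<lambda>k. r k * ebasis k x) \<phi>)) \<le> B^4 + 6 * Cr r * B^2 + 3 * (Cr r)^2" for n
    proof (rule AE_I2)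
      fix x
      have "\<bar>herm 4 (cov (Kn n) r r) (lin (Kn n) (\<lambda>k. r k * ebasis k x) \<phi>)\<bar> \<le> B^4 + 6 * Cr r * B^2 + 3 * (Cr r)^2"
        by (rule herm4_bound[OF cov_nonneg cov_le B(1)[rule_format]])
      then show "norm ((1/4) * herm 4 (cov (Kn n) r r) (lin (Kn n) (\<lambda>k. r k * ebasis k x) \<phi>)) \<le> B^4 + 6 * Cr r * B^2 + 3 * (Cr r)^2"
        by (simp add: abs_mult)
    qed
    show "(\<lambda>x. (1/4) * herm 4 (cov (Kn n) r r) (lin (Kn n) (\<lambda>k. r k * ebasis k x) \<phi>)) \<in> borel_measurable Q2" for n
      unfolding lin_def herm_def by measurable
    show "(\<lambda>x. (1/4) * herm 4 (Cr r) (Xf r \<phi> x)) \<in> borel_measurable Q2"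
      by (intro borel_measurable_times borel_measurable_const measurable_compose[OF Xf_measurable1 herm_measurable])
  qed simp
qed

lemma quad_prod_le_1: "\<bar>quad_prod r p\<bar> \<le> 1"
proof -
  note decay_le_1[OF r]
  then show ?thesis unfolding quad_prod_def abs_mult by (intro mult_le_one mult_nonneg_nonneg) auto
qed

lemma Tr_summable: "(\<lambda>p. wt p * (quad_prod r p - 1)\<^sup>2) summable_on quads nz"
proof -
  have "(\<lambda>p. wt p * 4) summable_on quads nz" using wt_summable by (rule summable_on_cmult_left)
  then show ?thesis
  proof (rule summable_on_bound)
    fix p
    have "\<bar>quad_prod r p - 1\<bar> \<le> 2" using quad_prod_le_1[of p] by linarith
    then have "(quad_prod r p - 1)\<^sup>2 \<le> 2\<^sup>2" using power_mono[of "\<bar>quad_prod r p - 1\<bar>" 2 2] by simp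
    then show "\<bar>wt p * (quad_prod r p - 1)\<^sup>2\<bar> \<le> wt p * 4" using wt_nonneg[of p] by (simp add: abs_mult mult_left_mono)
  qed
qed

lemma Tr_nonneg: "0 \<le> Tr r" unfolding Tr_def by (intro infsum_nonneg) (simp add: wt_nonneg)

text \<open>The partial sums are Cauchy in L2 with second moment \<open>cov (Kn n) r r\<close>;
  Fatou identifies their L2 limit with the pointwise limit \<open>Xf\<close>, and the norms converge
  along.\<close>

lemma Xf_second_moment: "(\<integral>\<phi>. (Xf r \<phi> x)\<^sup>2 \<partial>gff) = Cr r"
proof -
  \<comment> \<open>Extending the coefficients by 0 lets two different truncations be written over
    one common set of modes, as \<open>wick_pair\<close> asks.\<close>
  let ?a = "\<lambda>n k. if k \<in> Kn n then r k * ebasis k x else 0"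
  let ?X = "\<lambda>n \<phi>. lin (Kn n) (\<lambda>k. r k * ebasis k x) \<phi>"
  have ev: "evenc r" using r by (simp add: decay_def)
  have Xm: "?X n \<phi> = lin (Kn m) (?a n) \<phi>" if "n \<le> m" for n m \<phi>
    unfolding lin_def using Kn_mono[OF that]
    by (intro sum.mono_neutral_cong_left) auto
  have cm: "cov (Kn m) (?a n) (?a n') = cov (Kn (min n n')) r r" if "n \<le> m" "n' \<le> m" for n n' m
  proof -
    have "cov (Kn m) (?a n) (?a n') = cov (Kn (min n n')) (\<lambda>k. r k * ebasis k x) (\<lambda>k. r k * ebasis k x)"
      unfolding cov_def using that Kn_mono[of "min n n'" m] Kn_mono[of n n'] Kn_mono[of n' n]
      by (intro sum.mono_neutral_cong_right) (auto simp: min_def split: if_splits)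
    then show ?thesis using cov_ebasis_diag[OF symK_Kn ev] by simp
  qed
  have XX: "integrable gff (\<lambda>\<phi>. ?X n \<phi> * ?X m \<phi>) \<and> (\<integral>\<phi>. ?X n \<phi> * ?X m \<phi> \<partial>gff) = cov (Kn (min n m)) r r" for n m
  proof -
    define l where "l = max n m"
    have l: "n \<le> l" "m \<le> l" by (auto simp: l_def)
    have h1: "herm 1 c y = y" for c y by (simp add: herm_def)
    show ?thesis unfolding Xm[OF l(1)] Xm[OF l(2)]
      using wick_pair[of "Kn l" 1 1 "?a n" "?a m"] Kn_nz cm[OF l] unfolding h1 by simp
  qed
  have XL2: "?X n \<in> L2 gff" for n
    using XX[of n n] unfolding L2_def by (auto simp: power2_eq_square lin_def)
  have d2: "integrable gff (\<lambda>\<phi>. (?X m \<phi> - ?X n \<phi>)\<^sup>2)" "(\<integral>\<phi>. (?X m \<phi> - ?X n \<phi>)\<^sup>2 \<partial>gff) \<le> Cr r - cov (Kn n) r r" if "n \<le> m" for n m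
  proof -
    have e: "(?X m \<phi> - ?X n \<phi>)\<^sup>2 = ?X m \<phi> * ?X m \<phi> - 2 * (?X m \<phi> * ?X n \<phi>) + ?X n \<phi> * ?X n \<phi>" for \<phi>
      by (simp add: power2_eq_square algebra_simps)
    show "integrable gff (\<lambda>\<phi>. (?X m \<phi> - ?X n \<phi>)\<^sup>2)" unfolding e
      using XX by (intro Bochner_Integration.integrable_add Bochner_Integration.integrable_diff integrable_mult_right) auto
    have "(\<integral>\<phi>. (?X m \<phi> - ?X n \<phi>)\<^sup>2 \<partial>gff) = (\<integral>\<phi>. ?X m \<phi> * ?X m \<phi> \<partial>gff) - 2 * (\<integral>\<phi>. ?X m \<phi> * ?X n \<phi> \<partial>gff) + (\<integral>\<phi>. ?X n \<phi> * ?X n \<phi> \<partial>gff)"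
      unfolding e using XX[of m m] XX[of m n] XX[of n n] by simp
    also have "\<dots> = cov (Kn m) r r - cov (Kn n) r r"
      using XX[of m m] XX[of m n] XX[of n n] that by (simp add: min_absorb2)
    finally show "(\<integral>\<phi>. (?X m \<phi> - ?X n \<phi>)\<^sup>2 \<partial>gff) \<le> Cr r - cov (Kn n) r r" using cov_le[of m] by simp
  qed
  have fat: "(\<integral>\<^sup>+\<phi>. ennreal ((Xf r \<phi> x - ?X n \<phi>)\<^sup>2) \<partial>gff) \<le> ennreal (Cr r - cov (Kn n) r r)" for n
  proof -
    have "(\<integral>\<^sup>+\<phi>. ennreal ((Xf r \<phi> x - ?X n \<phi>)\<^sup>2) \<partial>gff) = (\<integral>\<^sup>+\<phi>. liminf (\<lambda>m. ennreal ((?X m \<phi> - ?X n \<phi>)\<^sup>2)) \<partial>gff)"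
    proof (rule nn_integral_cong_AE, use AE_good in eventually_elim)
      case (elim \<phi>)
      have "(\<lambda>m. ennreal ((?X m \<phi> - ?X n \<phi>)\<^sup>2)) \<longlonglongrightarrow> ennreal ((Xf r \<phi> x - ?X n \<phi>)\<^sup>2)"
        by (intro tendsto_ennrealI tendsto_power tendsto_diff lin_tendsto[OF elim] tendsto_const)
      from lim_imp_Liminf[OF _ this] show ?case by simp
    qed
    also have "\<dots> \<le> liminf (\<lambda>m. \<integral>\<^sup>+\<phi>. ennreal ((?X m \<phi> - ?X n \<phi>)\<^sup>2) \<partial>gff)"
      by (rule nn_integral_liminf) (simp add: lin_def)
    also have "\<dots> \<le> liminf (\<lambda>m. ennreal (Cr r - cov (Kn n) r r))"
    proof (rule Liminf_mono, rule eventually_sequentiallyI)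
      fix m assume "m \<ge> n"
      from d2[OF this] show "(\<integral>\<^sup>+\<phi>. ennreal ((?X m \<phi> - ?X n \<phi>)\<^sup>2) \<partial>gff) \<le> ennreal (Cr r - cov (Kn n) r r)"
        by (subst nn_integral_eq_integral) (auto intro: ennreal_leI)
    qed
    finally show ?thesis by (simp add: Liminf_const)
  qed
  have intd: "integrable gff (\<lambda>\<phi>. (Xf r \<phi> x - ?X n \<phi>)\<^sup>2)" for n
  proof (rule integrableI_bounded)
    show "(\<lambda>\<phi>. (Xf r \<phi> x - ?X n \<phi>)\<^sup>2) \<in> borel_measurable gff" unfolding lin_def by measurable
    show "(\<integral>\<^sup>+\<phi>. ennreal (norm ((Xf r \<phi> x - ?X n \<phi>)\<^sup>2)) \<partial>gff) < \<infinity>"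
      using le_less_trans[OF fat[of n]] by simp
  qed
  have "fdiff (\<lambda>\<phi>. Xf r \<phi> x) (?X n) \<in> L2 gff" for n
    unfolding L2_def fdiff_def using intd[of n] by (auto simp: lin_def)
  from L2.add_mem[OF this[of 0] XL2[of 0]] have Xi: "(\<lambda>\<phi>. Xf r \<phi> x) \<in> L2 gff" by (simp add: fdiff_def)
  have l2: "l2dist2 gff (\<lambda>\<phi>. Xf r \<phi> x) (?X n) \<le> Cr r - cov (Kn n) r r" for n
  proof -
    have "ennreal (l2dist2 gff (\<lambda>\<phi>. Xf r \<phi> x) (?X n)) \<le> ennreal (Cr r - cov (Kn n) r r)"
      using fat[of n] nn_integral_eq_integral[OF intd[of n]] by (simp add: l2dist2_def)
    then show ?thesis using cov_le[of n] by simp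
  qed
  have "(\<lambda>n. l2dist2 gff (?X n) (\<lambda>\<phi>. Xf r \<phi> x)) \<longlonglongrightarrow> 0"
  proof (rule tendsto_sandwich[OF _ _ tendsto_const])
    show "(\<lambda>n. Cr r - cov (Kn n) r r) \<longlonglongrightarrow> 0" using tendsto_diff[OF tendsto_const cov_tendsto, of "Cr r"] by simp
    show "\<forall>\<^sub>F n in sequentially. l2dist2 gff (?X n) (\<lambda>\<phi>. Xf r \<phi> x) \<le> Cr r - cov (Kn n) r r"
      using l2 by (intro always_eventually allI) (simp add: l2dist2_def power2_commute)
  qed simp
  then have nr: "(\<lambda>n. L2.nrm gff (fdiff (?X n) (\<lambda>\<phi>. Xf r \<phi> x))) \<longlonglongrightarrow> 0" by (rule l2dist2_tendsto_iff[THEN iffD1])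
  have "(\<lambda>n. L2.nrm gff (?X n)) \<longlonglongrightarrow> L2.nrm gff (\<lambda>\<phi>. Xf r \<phi> x)"
  proof (rule LIM_zero_cancel, rule Lim_null_comparison[OF always_eventually nr], rule allI)
    fix n show "norm (L2.nrm gff (?X n) - L2.nrm gff (\<lambda>\<phi>. Xf r \<phi> x)) \<le> L2.nrm gff (fdiff (?X n) (\<lambda>\<phi>. Xf r \<phi> x))"
      using L2.nrm_le_add_diff[OF XL2[of n] Xi] L2.nrm_le_add_diff[OF Xi XL2[of n]] L2.nrm_commute[OF Xi XL2[of n]] by (simp add: abs_le_iff)
  qed
  from tendsto_power[OF this, of 2] have "(\<lambda>n. L2ip gff (?X n) (?X n)) \<longlonglongrightarrow> L2ip gff (\<lambda>\<phi>. Xf r \<phi> x) (\<lambda>\<phi>. Xf r \<phi> x)"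
    by (simp add: L2.nrm_sq[OF XL2] L2.nrm_sq[OF Xi])
  moreover have "L2ip gff (?X n) (?X n) = cov (Kn n) r r" for n using XX[of n n] by (simp add: L2ip_def)
  ultimately have "L2ip gff (\<lambda>\<phi>. Xf r \<phi> x) (\<lambda>\<phi>. Xf r \<phi> x) = Cr r" using LIMSEQ_unique[OF _ cov_tendsto] by simp
  then show ?thesis by (simp add: L2ip_def power2_eq_square)
qed

lemma goodphi_upd: "goodphi \<phi> \<Longrightarrow> goodphi (\<phi>(k := t))"
proof -
  assume g: "goodphi \<phi>"
  have "(\<lambda>j. if j = k then \<bar>t\<bar> / lam k else 0) summable_on nz"
    by (rule finite_nonzero_values_imp_summable_on, rule finite_subset[of _ "{k}"]) auto
  from summable_on_add[OF g[unfolded goodphi_def] this]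
  have "(\<lambda>j. \<bar>\<phi> j\<bar> / lam j + (if j = k then \<bar>t\<bar> / lam k else 0)) summable_on nz" .
  then show ?thesis unfolding goodphi_def by (rule summable_on_bound) auto
qed

lemma Xf_upd:
  assumes g: "goodphi \<phi>" and k: "k \<in> nz"
  shows "Xf r (\<phi>(k := t)) x = Xf r (\<phi>(k := 0)) x + t * (r k * ebasis k x)"
proof -
  have s: "(\<lambda>j. if j = k then t * (r k * ebasis k x) else 0) summable_on nz"
    by (rule finite_nonzero_values_imp_summable_on, rule finite_subset[of _ "{k}"]) auto
  have "Xf r (\<phi>(k := t)) x = (\<Sum>\<^sub>\<infinity>j\<in>nz. r j * ebasis j x * (\<phi>(k := 0)) j + (if j = k then t * (r k * ebasis k x) else 0))"
    unfolding Xf_def by (intro infsum_cong) auto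
  also have "\<dots> = Xf r (\<phi>(k := 0)) x + (\<Sum>\<^sub>\<infinity>j\<in>nz. if j = k then t * (r k * ebasis k x) else 0)"
    unfolding Xf_def by (rule infsum_add[OF Xf_summable[OF goodphi_upd[OF g]] s])
  also have "(\<Sum>\<^sub>\<infinity>j\<in>nz. if j = k then t * (r k * ebasis k x) else 0) = t * (r k * ebasis k x)"
    using infsum_single[of k nz "\<lambda>j. if j = k then t * (r k * ebasis k x) else 0"] k by simp
  finally show ?thesis .
qed

text \<open>The addition formula is applied with second variance 0, where \<open>herm n 0 y\<close>
  is y^n: expanding around the field without mode \<open>k\<close> gives a polynomial in
  \<open>t\<close> whose coefficients are integrals over the square.\<close>

lemma Ninf_poly:
  assumes g: "goodphi \<phi>" and k: "k \<in> nz"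
  obtains c where "\<And>t. Ninf r (\<phi>(k := t)) = (\<Sum>i\<le>(4::nat). c i * t ^ i)"
proof -
  obtain B where B': "\<forall>n x. \<bar>lin (Kn n) (\<lambda>j. r j * ebasis j x) (\<phi>(k := 0))\<bar> \<le> B" "\<forall>x. \<bar>Xf r (\<phi>(k := 0)) x\<bar> \<le> B"
    by (rule lin_bound[OF goodphi_upd[OF g]])
  note B = B'(2)[rule_format]
  let ?X = "Xf r (\<phi>(k := 0))"
  let ?g = "\<lambda>p x. herm p (Cr r) (?X x) * (r k * ebasis k x) ^ (4 - p)"
  have h0: "herm n 0 y = y ^ n" if "n \<le> 4" for n y using le4[OF that] by (auto simp: herm_def)
  have B0: "B \<ge> 0" using B[of undefined] by linarith
  have C0: "Cr r \<ge> 0" unfolding Cr_def by (intro infsum_nonneg) auto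
  have gi: "integrable Q2 (?g p)" if p: "p \<le> 4" for p
  proof -
    \<comment> \<open>The sum of the separate bounds for degrees 0 to 4, so that one constant serves
      every \<open>p\<close>.\<close>
    define H where "H = (1 + B + (B^2 + Cr r)) + (B^3 + 3 * Cr r * B) + (B^4 + 6 * Cr r * B^2 + 3 * (Cr r)^2)"
    have hb: "\<bar>herm p (Cr r) (?X x)\<bar> \<le> H" for x
    proof -
      have b: "\<bar>?X x\<bar> \<le> B" "\<bar>?X x\<bar>^2 \<le> B^2" "\<bar>?X x\<bar>^3 \<le> B^3" "\<bar>?X x\<bar>^4 \<le> B^4" 
        using B[of x] power_mono[OF B[of x], of 2] power_mono[OF B[of x], of 3] power_mono[OF B[of x], of 4] by simp_all
      have pos: "0 \<le> B^2" "0 \<le> B^3" "0 \<le> B^4" "0 \<le> Cr r * B" "0 \<le> Cr r * B^2" "0 \<le> (Cr r)^2" using B0 C0 by auto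
      have m1: "\<bar>Cr r * ?X x\<bar> \<le> Cr r * B" unfolding abs_mult using C0 b by (simp add: mult_left_mono)
      have "\<bar>herm 0 (Cr r) (?X x)\<bar> \<le> 1" "\<bar>herm 1 (Cr r) (?X x)\<bar> \<le> B" using b by (auto simp: herm_def)
      moreover have "\<bar>herm 2 (Cr r) (?X x)\<bar> \<le> B^2 + Cr r"
        using b(2) C0 abs_triangle_ineq4[of "(?X x)^2" "Cr r"] by (simp add: herm_def power_abs)
      moreover have "\<bar>herm 3 (Cr r) (?X x)\<bar> \<le> B^3 + 3 * Cr r * B"
        using b(3) m1 abs_triangle_ineq4[of "(?X x)^3" "3 * Cr r * ?X x"] by (simp add: herm_def power_abs abs_mult)
      moreover have "\<bar>herm 4 (Cr r) (?X x)\<bar> \<le> B^4 + 6 * Cr r * B^2 + 3 * (Cr r)^2" 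
        using herm4_bound[OF C0 order_refl b(1)] .
      ultimately show ?thesis using le4[OF p] pos B0 C0 unfolding H_def by (elim insertE emptyE) (simp only:; linarith)+
    qed
    have eb: "\<bar>(r k * ebasis k x) ^ (4 - p)\<bar> \<le> (sqrt 2)^(4-p)" for x
    proof -
      have "\<bar>r k * ebasis k x\<bar> \<le> 1 * sqrt 2" unfolding abs_mult using decay_le_1[OF r, of k] ebasis_bound[of k x] by (intro mult_mono) auto
      from power_mono[OF this, of "4 - p"] show ?thesis by (simp add: power_abs)
    qed
    show ?thesis
    proof (rule Q2.integrable_const_bound[of _ "H * (sqrt 2)^(4-p)"])
      show "AE x in Q2. norm (?g p x) \<le> H * (sqrt 2)^(4-p)"
        unfolding real_norm_def abs_mult using hb eb order_trans[OF abs_ge_zero hb] by (intro AE_I2 mult_mono) auto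
      show "?g p \<in> borel_measurable Q2" by measurable
    qed
  qed
  have ex: "(1/4) * herm 4 (Cr r) (Xf r (\<phi>(k := t)) x) = (\<Sum>p\<le>4. ((1/4) * real (4 choose p) * t ^ (4 - p)) * ?g p x)" for t x
  proof -
    have "herm 4 (Cr r + 0) (?X x + t * (r k * ebasis k x)) = 
      (\<Sum>p\<le>4. (4 choose p) * herm p (Cr r) (?X x) * herm (4 - p) 0 (t * (r k * ebasis k x)))"
      by (rule herm_add) simp
    also have "\<dots> = (\<Sum>p\<le>4. real (4 choose p) * t ^ (4 - p) * ?g p x)"
      by (intro sum.cong refl) (simp add: h0 power_mult_distrib mult_ac)
    finally have hh: "herm 4 (Cr r) (?X x + t * (r k * ebasis k x)) = (\<Sum>p\<le>4. real (4 choose p) * t ^ (4 - p) * ?g p x)"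
      by (simp only: add_0_right)
    show ?thesis unfolding Xf_upd[OF g k, of t x] hh sum_distrib_left by (simp only: mult.assoc)
  qed
  show thesis
  proof (rule that[of "\<lambda>i. (1/4) * real (4 choose (4 - i)) * (\<integral>x. ?g (4 - i) x \<partial>Q2)"])
    fix t
    have "Ninf r (\<phi>(k := t)) = (\<Sum>p\<le>4. \<integral>x. ((1/4) * real (4 choose p) * t ^ (4 - p)) * ?g p x \<partial>Q2)"
      unfolding Ninf_def ex by (rule Bochner_Integration.integral_sum) (intro integrable_mult_right gi, simp)
    also have "\<dots> = (\<Sum>p\<le>4. ((1/4) * real (4 choose p) * t ^ (4 - p)) * (\<integral>x. ?g p x \<partial>Q2))"
      by (simp only: integral_mult_right_zero)
    also have "\<dots> = (\<Sum>i\<le>4. ((1/4) * real (4 choose (4 - i)) * t ^ (4 - (4 - i))) * (\<integral>x. ?g (4 - i) x \<partial>Q2))"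
      by (rule sum.reindex_bij_witness[of _ "\<lambda>i. 4 - i" "\<lambda>i. 4 - i"]) auto
    also have "\<dots> = (\<Sum>i\<le>4. (1/4) * real (4 choose (4 - i)) * (\<integral>x. ?g (4 - i) x \<partial>Q2) * t ^ i)"
      by (intro sum.cong refl) (simp add: mult_ac)
    finally show "Ninf r (\<phi>(k := t)) = (\<Sum>i\<le>4. (1/4) * real (4 choose (4 - i)) * (\<integral>x. ?g (4 - i) x \<partial>Q2) * t ^ i)" .
  qed
qed

end

text \<open>Comparing both products of multipliers with 1 costs a factor 2, and 2 times 3/2 is 3.
  The bound is uniform over the finite truncations, and Fatou passes to all modes.\<close>

lemma Ninf_diff_bound:
  assumes r: "decay r" and s: "decay s"
  shows "(\<integral>\<^sup>+\<phi>. ennreal ((Ninf r \<phi> - Ninf s \<phi>)\<^sup>2) \<partial>gff) \<le> ennreal (3 * (Tr r + Tr s))"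
proof -
  have ev: "evenc r" "evenc s" using r s by (auto simp: decay_def)
  have fin: "(\<integral>\<phi>. (Nf (Kn n) r \<phi> - Nf (Kn n) s \<phi>)\<^sup>2 \<partial>gff) \<le> 3 * (Tr r + Tr s)" for n
  proof -
    have qs: "quads (Kn n) \<subseteq> quads nz" using Kn_nz by (auto simp: quads_def)
    have qf: "finite (quads (Kn n))" unfolding quads_def by simp
    have "(\<integral>\<phi>. (Nf (Kn n) r \<phi> - Nf (Kn n) s \<phi>)\<^sup>2 \<partial>gff) = (3/2) * (\<Sum>p\<in>quads (Kn n). wt p * (quad_prod r p - quad_prod s p)\<^sup>2)"
      using Nf_diff(2)[OF symK_Kn ev] by (simp add: wt_def)
    also have "\<dots> \<le> (3/2) * (\<Sum>p\<in>quads (Kn n). 2 * (wt p * (quad_prod r p - 1)\<^sup>2) + 2 * (wt p * (quad_prod s p - 1)\<^sup>2))"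
    proof (intro mult_left_mono sum_mono)
      fix p
      have "0 \<le> ((quad_prod r p - 1) + (quad_prod s p - 1))\<^sup>2" by simp
      then have "(quad_prod r p - quad_prod s p)\<^sup>2 \<le> 2 * (quad_prod r p - 1)\<^sup>2 + 2 * (quad_prod s p - 1)\<^sup>2"
        by (simp add: power2_eq_square algebra_simps)
      then have "wt p * (quad_prod r p - quad_prod s p)\<^sup>2 \<le> wt p * (2 * (quad_prod r p - 1)\<^sup>2 + 2 * (quad_prod s p - 1)\<^sup>2)"
        using wt_nonneg by (rule mult_left_mono)
      then show "wt p * (quad_prod r p - quad_prod s p)\<^sup>2 \<le> 2 * (wt p * (quad_prod r p - 1)\<^sup>2) + 2 * (wt p * (quad_prod s p - 1)\<^sup>2)"
        by (simp add: algebra_simps)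
    qed simp
    also have "\<dots> = 3 * ((\<Sum>p\<in>quads (Kn n). wt p * (quad_prod r p - 1)\<^sup>2) + (\<Sum>p\<in>quads (Kn n). wt p * (quad_prod s p - 1)\<^sup>2))"
      by (simp add: sum.distrib sum_distrib_left[symmetric])
    also have "\<dots> \<le> 3 * (Tr r + Tr s)"
      unfolding Tr_def using qs qf wt_nonneg
      by (intro mult_left_mono add_mono finite_sum_le_infsum Tr_summable r s) auto
    finally show ?thesis .
  qed
  have "(\<integral>\<^sup>+\<phi>. ennreal ((Ninf r \<phi> - Ninf s \<phi>)\<^sup>2) \<partial>gff) = (\<integral>\<^sup>+\<phi>. liminf (\<lambda>n. ennreal ((Nf (Kn n) r \<phi> - Nf (Kn n) s \<phi>)\<^sup>2)) \<partial>gff)"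
  proof (rule nn_integral_cong_AE, use AE_good in eventually_elim)
    case (elim \<phi>)
    have "(\<lambda>n. ennreal ((Nf (Kn n) r \<phi> - Nf (Kn n) s \<phi>)\<^sup>2)) \<longlonglongrightarrow> ennreal ((Ninf r \<phi> - Ninf s \<phi>)\<^sup>2)"
      by (intro tendsto_ennrealI tendsto_power tendsto_diff Nf_tendsto r s elim)
    from lim_imp_Liminf[OF _ this] show ?case by simp
  qed
  also have "\<dots> \<le> liminf (\<lambda>n. \<integral>\<^sup>+\<phi>. ennreal ((Nf (Kn n) r \<phi> - Nf (Kn n) s \<phi>)\<^sup>2) \<partial>gff)"
    by (rule nn_integral_liminf) simp
  also have "\<dots> \<le> liminf (\<lambda>n. ennreal (3 * (Tr r + Tr s)))"
    using fin Nf_diff(1)[OF symK_Kn ev]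
    by (intro Liminf_mono always_eventually allI, subst nn_integral_eq_integral) (auto intro: ennreal_leI)
  finally show ?thesis by (simp add: Liminf_const)
qed

text \<open>Dominated convergence over quadruples: every multiplier tends to 1, and 4
  \<open>wt\<close> dominates because products of multipliers lie in [-1, 1].\<close>

lemma Tr_tendsto: "((\<lambda>\<epsilon>. Tr (rr \<epsilon>)) \<longlongrightarrow> 0) (at_right 0)"
proof (rule tendsto_at_right_sequentially[of 0 1])
  fix S :: "nat \<Rightarrow> real" assume S: "S \<longlonglongrightarrow> 0" "\<And>n. 0 < S n"
  have S': "filterlim S (at_right 0) sequentially"
    using S by (intro tendsto_imp_filterlim_at_right) auto
  have "(\<lambda>n. \<integral>p. wt p * (quad_prod (rr (S n)) p - 1)\<^sup>2 \<partial>count_space (quads nz)) \<longlonglongrightarrow> (\<integral>p. 0 \<partial>count_space (quads nz))"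
  proof (rule integral_dominated_convergence[where w="\<lambda>p. wt p * 4"])
    show "integrable (count_space (quads nz)) (\<lambda>p. wt p * 4)"
      using wt_summable by (simp add: summable_on_iff_integrable)
    show "AE p in count_space (quads nz). (\<lambda>n. wt p * (quad_prod (rr (S n)) p - 1)\<^sup>2) \<longlonglongrightarrow> 0"
    proof (rule AE_I2)
      fix p
      have "(\<lambda>n. rr (S n) k) \<longlonglongrightarrow> 1" for k using filterlim_compose[OF rr_tendsto S'] .
      then have "(\<lambda>n. wt p * (quad_prod (rr (S n)) p - 1)\<^sup>2) \<longlonglongrightarrow> wt p * (1 * (1 * (1 * 1)) - 1)\<^sup>2"
        unfolding quad_prod_def by (intro tendsto_intros) auto
      then show "(\<lambda>n. wt p * (quad_prod (rr (S n)) p - 1)\<^sup>2) \<longlonglongrightarrow> 0" by simp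
    qed
    show "AE p in count_space (quads nz). norm (wt p * (quad_prod (rr (S n)) p - 1)\<^sup>2) \<le> wt p * 4" for n
    proof (rule AE_I2)
      fix p
      have "\<bar>quad_prod (rr (S n)) p - 1\<bar> \<le> 2" using quad_prod_le_1[OF decay_rr[OF S(2)], of n p] by linarith
      then have "(quad_prod (rr (S n)) p - 1)\<^sup>2 \<le> 2\<^sup>2" using power_mono[of "\<bar>quad_prod (rr (S n)) p - 1\<bar>" 2 2] by simp
      then show "norm (wt p * (quad_prod (rr (S n)) p - 1)\<^sup>2) \<le> wt p * 4" using wt_nonneg[of p] by (simp add: abs_mult mult_left_mono)
    qed
  qed auto
  then show "(\<lambda>n. Tr (rr (S n))) \<longlonglongrightarrow> 0" by (simp add: Tr_def infsum_eq_integral)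
qed simp

section \<open>The limit interaction\<close>

lemma moll_eq:
  assumes e: "\<epsilon> > 0" and g: "goodphi \<phi>" shows "moll \<epsilon> \<phi> x = \<phi> (0,0) + Xf (rr \<epsilon>) \<phi> x"
proof -
  have "moll \<epsilon> \<phi> x = infsum (\<lambda>k. rr \<epsilon> k * ebasis k x * \<phi> k) (insert (0,0) nz)"
    unfolding moll_def UNIV_nz(1)[symmetric] by (intro infsum_cong) (simp add: conv_e_eq[OF e] mult_ac)
  also have "\<dots> = rr \<epsilon> (0,0) * ebasis (0,0) x * \<phi> (0,0) + Xf (rr \<epsilon>) \<phi> x"
    unfolding Xf_def by (rule infsum_insert[OF Xf_summable[OF decay_rr[OF e] g] UNIV_nz(2)])
  finally show ?thesis by (simp add: rr_0 ebasis_def)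
qed

text \<open>The zero mode vanishes almost surely, and the variance of the mollified field is the
  same at every point, so the Wick constant does not depend on \<open>x\<close>.\<close>

lemma c_eps_eq:
  assumes e: "\<epsilon> > 0" shows "c_eps \<epsilon> x = Cr (rr \<epsilon>)"
proof -
  have [measurable]: "(\<lambda>\<phi>. moll \<epsilon> \<phi> x) \<in> borel_measurable gff" unfolding moll_def by (rule infsum_measurable) auto
  have "c_eps \<epsilon> x = (\<integral>\<phi>. (Xf (rr \<epsilon>) \<phi> x)\<^sup>2 \<partial>gff)" unfolding c_eps_def
  proof (rule integral_cong_AE)
    show "AE \<phi> in gff. (moll \<epsilon> \<phi> x)\<^sup>2 = (Xf (rr \<epsilon>) \<phi> x)\<^sup>2"
      using AE_good AE_gff_0 by eventually_elim (simp add: moll_eq[OF e])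
  qed measurable
  then show ?thesis using Xf_second_moment[OF decay_rr[OF e]] by simp
qed

text \<open>Rescaling turns c^2 P_4 (m / sqrt c) into \<open>herm 4 c m\<close>. The cancellation
  uses c > 0, which \<open>Cr_pos_eventually\<close> supplies for small \<epsilon>.\<close>

lemma N_eps_eq:
  assumes e: "\<epsilon> > 0" and c: "Cr (rr \<epsilon>) > 0" and g: "goodphi \<phi>" and z: "\<phi> (0,0) = 0"
  shows "N_eps \<epsilon> \<phi> = Ninf (rr \<epsilon>) \<phi>"
proof -
  have h: "C\<^sup>2 * hermite4 (m / sqrt C) = herm 4 C m" if "C > 0" for C m :: real
  proof -
    have a: "(m / sqrt C)\<^sup>2 = m\<^sup>2 / C" using that by (simp add: power_divide)
    have b: "(m / sqrt C)^4 = (m\<^sup>2 / C)\<^sup>2" unfolding a[symmetric] by simp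
    show ?thesis unfolding hermite4_def a b herm_def using that
      by (simp add: power2_eq_square power4_eq_xxxx field_simps)
  qed
  have "N_eps \<epsilon> \<phi> = (\<integral>x. (1/4) * wick4_eps \<epsilon> \<phi> x * ebasis (0,0) x \<partial>Q2)"
    unfolding N_eps_def by (rule Q2_integral)
  also have "\<dots> = Ninf (rr \<epsilon>) \<phi>"
    unfolding Ninf_def wick4_eps_def c_eps_eq[OF e] h[OF c] moll_eq[OF e g] z by (simp add: ebasis_def)
  finally show ?thesis .
qed

text \<open>The single mode (1,0) already makes the variance positive, as its multiplier tends to
  1.\<close>

lemma Cr_pos_eventually: "\<forall>\<^sub>F \<epsilon> in at_right 0. \<epsilon> > 0 \<and> Cr (rr \<epsilon>) > 0"
proof -
  have "\<forall>\<^sub>F \<epsilon> in at_right 0. rr \<epsilon> (1,0) > 1/2" by (rule order_tendstoD(1)[OF rr_tendsto]) simp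
  moreover have "\<forall>\<^sub>F \<epsilon> in at_right (0::real). \<epsilon> > 0" by (simp add: eventually_at_right_less)
  ultimately show ?thesis
  proof eventually_elim
    case (elim \<epsilon>)
    have k: "(1,0) \<in> nz" by (simp add: nz_def)
    have "0 < rr \<epsilon> (1,0) * rr \<epsilon> (1,0) / lam (1,0)" using elim lam_pos[OF k] by simp
    also have "\<dots> = (\<Sum>k\<in>{(1,0)}. rr \<epsilon> k * rr \<epsilon> k / lam k)" by simp
    also have "\<dots> \<le> Cr (rr \<epsilon>)" unfolding Cr_def
      using k by (intro finite_sum_le_infsum[OF Cr_summable[OF decay_rr]]) (use elim in auto)
    finally show ?case using elim by simp
  qed
qed

definition e_seq :: "nat \<Rightarrow> real" where "e_seq n = 1 / Suc n"

lemma e_seq: "e_seq n > 0" "filterlim e_seq (at_right 0) sequentially"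
proof -
  show "e_seq n > 0" by (simp add: e_seq_def)
  have "e_seq \<longlonglongrightarrow> 0" unfolding e_seq_def[abs_def] by (rule lim_inverse_n'[THEN LIMSEQ_Suc])
  then show "filterlim e_seq (at_right 0) sequentially"
    by (intro tendsto_imp_filterlim_at_right) (auto simp: e_seq_def)
qed

text \<open>The bound on differences makes the interactions Cauchy in L2 along a sequence of
  mollifications, and comparison with that sequence extends the convergence to all
  \<epsilon>.\<close>

lemma Wick_limit_exists:
  obtains N where "N \<in> borel_measurable gff"
    "((\<lambda>\<epsilon>. \<integral>\<^sup>+\<phi>. ennreal ((Ninf (rr \<epsilon>) \<phi> - N \<phi>)\<^sup>2) \<partial>gff) \<longlongrightarrow> 0) (at_right 0)"
proof -
  define R where "R n = rr (e_seq n)" for n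
  have dR: "decay (R n)" for n unfolding R_def by (rule decay_rr[OF e_seq(1)])
  have TR: "(\<lambda>n. Tr (R n)) \<longlonglongrightarrow> 0" unfolding R_def by (rule filterlim_compose[OF Tr_tendsto e_seq(2)])
  have int2: "integrable gff (\<lambda>\<phi>. (Ninf r \<phi> - Ninf s \<phi>)\<^sup>2)" "(\<integral>\<phi>. (Ninf r \<phi> - Ninf s \<phi>)\<^sup>2 \<partial>gff) \<le> 3 * (Tr r + Tr s)"
    if "decay r" "decay s" for r s
  proof -
    show i: "integrable gff (\<lambda>\<phi>. (Ninf r \<phi> - Ninf s \<phi>)\<^sup>2)"
      by (rule integrableI_bounded) (use le_less_trans[OF Ninf_diff_bound[OF that]] in auto)
    have "ennreal (\<integral>\<phi>. (Ninf r \<phi> - Ninf s \<phi>)\<^sup>2 \<partial>gff) \<le> ennreal (3 * (Tr r + Tr s))"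
      using Ninf_diff_bound[OF that] nn_integral_eq_integral[OF i] by simp
    moreover have "0 \<le> 3 * (Tr r + Tr s)" using Tr_nonneg[OF that(1)] Tr_nonneg[OF that(2)] by simp
    ultimately show "(\<integral>\<phi>. (Ninf r \<phi> - Ninf s \<phi>)\<^sup>2 \<partial>gff) \<le> 3 * (Tr r + Tr s)"
      by (simp only: ennreal_le_iff)
  qed
  \<comment> \<open>Square integrability has been established for differences of \<open>Ninf\<close>
    only, so one fixed term is subtracted before completeness is used and added back in
    \<open>N\<close>.\<close>
  define u where "u n \<phi> = Ninf (R n) \<phi> - Ninf (R 0) \<phi>" for n \<phi>
  have uL2: "u n \<in> L2 gff" for n using int2(1)[OF dR dR] by (simp add: L2_def u_def[abs_def])
  have ud: "l2dist2 gff (u n) (u m) \<le> 3 * (Tr (R n) + Tr (R m))" for n m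
    using int2(2)[OF dR dR] by (simp add: l2dist2_def u_def)
  obtain w where w: "w \<in> L2 gff" "(\<lambda>n. l2dist2 gff (u n) w) \<longlonglongrightarrow> 0"
  proof (rule L2_complete[OF uL2])
    fix e :: real assume "e > 0"
    then have "e/6 > 0" by simp
    from order_tendstoD(2)[OF TR this] obtain N where N: "\<And>n. n \<ge> N \<Longrightarrow> Tr (R n) < e/6"
      unfolding eventually_sequentially by blast
    show "\<exists>N. \<forall>n\<ge>N. \<forall>m\<ge>N. l2dist2 gff (u n) (u m) < e"
    proof (intro exI allI impI)
      fix n m assume "N \<le> n" "N \<le> m"
      then show "l2dist2 gff (u n) (u m) < e" using ud[of n m] N[of n] N[of m] by simp
    qed
  qed
  define N where "N \<phi> = w \<phi> + Ninf (R 0) \<phi>" for \<phi>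
  have [measurable]: "w \<in> borel_measurable gff" using w by (simp add: L2_def)
  have Nm[measurable]: "N \<in> borel_measurable gff" unfolding N_def[abs_def] by measurable
  \<comment> \<open>The square of a sum is at most twice the sum of the squares: 2 times 3 gives the
    6, and the terms with \<open>R n\<close> and \<open>u n\<close> vanish as n grows.\<close>
  have bd: "(\<integral>\<^sup>+\<phi>. ennreal ((Ninf r \<phi> - N \<phi>)\<^sup>2) \<partial>gff) \<le> ennreal (6 * Tr r)" if r: "decay r" for r
  proof (rule LIMSEQ_le_const)
    show "(\<lambda>n. ennreal (6 * (Tr r + Tr (R n)) + 2 * l2dist2 gff (u n) w)) \<longlonglongrightarrow> ennreal (6 * Tr r)"
    proof (rule tendsto_ennrealI)
      have "(\<lambda>n. 6 * (Tr r + Tr (R n)) + 2 * l2dist2 gff (u n) w) \<longlonglongrightarrow> 6 * (Tr r + 0) + 2 * 0"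
        by (intro tendsto_intros TR w)
      then show "(\<lambda>n. 6 * (Tr r + Tr (R n)) + 2 * l2dist2 gff (u n) w) \<longlonglongrightarrow> 6 * Tr r" by simp
    qed
    have "(\<integral>\<^sup>+\<phi>. ennreal ((Ninf r \<phi> - N \<phi>)\<^sup>2) \<partial>gff) \<le> ennreal (6 * (Tr r + Tr (R n)) + 2 * l2dist2 gff (u n) w)" for n
    proof -
      have uw: "integrable gff (\<lambda>\<phi>. (u n \<phi> - w \<phi>)\<^sup>2)" using L2.diff_mem[OF uL2[of n] w(1)] by (simp add: L2_def fdiff_def)
      have "(\<integral>\<^sup>+\<phi>. ennreal ((Ninf r \<phi> - N \<phi>)\<^sup>2) \<partial>gff) \<le> (\<integral>\<^sup>+\<phi>. ennreal (2 * (Ninf r \<phi> - Ninf (R n) \<phi>)\<^sup>2 + 2 * (u n \<phi> - w \<phi>)\<^sup>2) \<partial>gff)"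
      proof (intro nn_integral_mono ennreal_leI)
        fix \<phi>
        have "0 \<le> ((Ninf r \<phi> - Ninf (R n) \<phi>) - (u n \<phi> - w \<phi>))\<^sup>2" by simp
        then show "(Ninf r \<phi> - N \<phi>)\<^sup>2 \<le> 2 * (Ninf r \<phi> - Ninf (R n) \<phi>)\<^sup>2 + 2 * (u n \<phi> - w \<phi>)\<^sup>2"
          by (simp add: N_def u_def power2_eq_square algebra_simps)
      qed
      also have "\<dots> = ennreal (2 * (\<integral>\<phi>. (Ninf r \<phi> - Ninf (R n) \<phi>)\<^sup>2 \<partial>gff) + 2 * (\<integral>\<phi>. (u n \<phi> - w \<phi>)\<^sup>2 \<partial>gff))"
        using int2(1)[OF r dR, of n] uw by (subst nn_integral_eq_integral) auto
      also have "\<dots> \<le> ennreal (6 * (Tr r + Tr (R n)) + 2 * l2dist2 gff (u n) w)"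
        using int2(2)[OF r dR, of n] by (intro ennreal_leI) (simp add: l2dist2_def)
      finally show ?thesis .
    qed
    then show "\<exists>M. \<forall>n\<ge>M. (\<integral>\<^sup>+\<phi>. ennreal ((Ninf r \<phi> - N \<phi>)\<^sup>2) \<partial>gff) \<le> ennreal (6 * (Tr r + Tr (R n)) + 2 * l2dist2 gff (u n) w)" by blast
  qed
  have "((\<lambda>\<epsilon>. \<integral>\<^sup>+\<phi>. ennreal ((Ninf (rr \<epsilon>) \<phi> - N \<phi>)\<^sup>2) \<partial>gff) \<longlongrightarrow> 0) (at_right 0)"
  proof (rule tendsto_sandwich[OF _ _ tendsto_const])
    show "((\<lambda>\<epsilon>. ennreal (6 * Tr (rr \<epsilon>))) \<longlongrightarrow> 0) (at_right 0)"
      using tendsto_ennrealI[OF tendsto_mult[OF tendsto_const[of 6] Tr_tendsto]] by simp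
    have "\<forall>\<^sub>F \<epsilon> in at_right (0::real). \<epsilon> > 0" by (simp add: eventually_at_right_less)
    then show "\<forall>\<^sub>F \<epsilon> in at_right 0. (\<integral>\<^sup>+\<phi>. ennreal ((Ninf (rr \<epsilon>) \<phi> - N \<phi>)\<^sup>2) \<partial>gff) \<le> ennreal (6 * Tr (rr \<epsilon>))"
      by eventually_elim (rule bd[OF decay_rr])
  qed simp
  then show thesis using that Nm by blast
qed

lemma Ninf_N_eps: "\<forall>\<^sub>F \<epsilon> in at_right 0. 
    (\<integral>\<^sup>+\<phi>. ennreal ((N_eps \<epsilon> \<phi> - N \<phi>)\<^sup>2) \<partial>gff) = (\<integral>\<^sup>+\<phi>. ennreal ((Ninf (rr \<epsilon>) \<phi> - N \<phi>)\<^sup>2) \<partial>gff)"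
  using Cr_pos_eventually
proof eventually_elim
  case (elim \<epsilon>)
  show ?case
    by (rule nn_integral_cong_AE) (use AE_good AE_gff_0 in \<open>eventually_elim, simp add: N_eps_eq elim\<close>)
qed

text \<open>\<open>Nphi\<close> is a \<open>SOME\<close>; the limit just constructed shows that the
  description can be satisfied, since for small \<epsilon> \<open>N_eps\<close> agrees with
  \<open>Ninf\<close> almost everywhere.\<close>

lemma Nphi_spec: "Nphi \<in> borel_measurable gff"
  "((\<lambda>\<epsilon>. \<integral>\<^sup>+\<phi>. ennreal ((N_eps \<epsilon> \<phi> - Nphi \<phi>)\<^sup>2) \<partial>gff) \<longlongrightarrow> 0) (at_right 0)"
proof -
  let ?P = "\<lambda>N. N \<in> borel_measurable gff \<and> ((\<lambda>\<epsilon>. \<integral>\<^sup>+ \<phi>. ennreal ((N_eps \<epsilon> \<phi> - N \<phi>)\<^sup>2) \<partial>gff) \<longlongrightarrow> 0) (at_right 0)"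
  obtain N where N: "N \<in> borel_measurable gff"
    "((\<lambda>\<epsilon>. \<integral>\<^sup>+\<phi>. ennreal ((Ninf (rr \<epsilon>) \<phi> - N \<phi>)\<^sup>2) \<partial>gff) \<longlongrightarrow> 0) (at_right 0)" by (rule Wick_limit_exists)
  have "?P N" using N(1) tendsto_cong[OF Ninf_N_eps[of N]] N(2) by simp
  then have "?P Nphi" unfolding Nphi_def by (rule someI[of ?P])
  then show "Nphi \<in> borel_measurable gff"
    "((\<lambda>\<epsilon>. \<integral>\<^sup>+\<phi>. ennreal ((N_eps \<epsilon> \<phi> - Nphi \<phi>)\<^sup>2) \<partial>gff) \<longlongrightarrow> 0) (at_right 0)" by blast+
qed

text \<open>The squared errors tend to 0 in L1, so a subsequence of them tends to 0 almost
  surely.\<close>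

lemma Nphi_AE_limit:
  obtains R where "\<And>n. decay (R n)" "AE \<phi> in gff. (\<lambda>n. Ninf (R n) \<phi>) \<longlonglongrightarrow> Nphi \<phi>"
proof -
  note [measurable] = Nphi_spec(1)
  have "((\<lambda>\<epsilon>. \<integral>\<^sup>+\<phi>. ennreal ((Ninf (rr \<epsilon>) \<phi> - Nphi \<phi>)\<^sup>2) \<partial>gff) \<longlongrightarrow> 0) (at_right 0)"
    using tendsto_cong[OF Ninf_N_eps[of Nphi]] Nphi_spec(2) by simp
  from filterlim_compose[OF this e_seq(2)]
  have l: "(\<lambda>n. \<integral>\<^sup>+\<phi>. ennreal ((Ninf (rr (e_seq n)) \<phi> - Nphi \<phi>)\<^sup>2) \<partial>gff) \<longlonglongrightarrow> 0" .
  have "\<forall>\<^sub>F n in sequentially. (\<integral>\<^sup>+\<phi>. ennreal ((Ninf (rr (e_seq n)) \<phi> - Nphi \<phi>)\<^sup>2) \<partial>gff) < 1"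
    by (rule order_tendstoD(2)[OF l]) simp
  \<comment> \<open>The integrals may be infinite for early indices, so only indices past
    \<open>n0\<close> are used; there the squared errors are integrable.\<close>
  then obtain n0 where n0: "\<And>n. n \<ge> n0 \<Longrightarrow> (\<integral>\<^sup>+\<phi>. ennreal ((Ninf (rr (e_seq n)) \<phi> - Nphi \<phi>)\<^sup>2) \<partial>gff) < 1"
    unfolding eventually_sequentially by blast
  define v where "v n \<phi> = (Ninf (rr (e_seq (n + n0))) \<phi> - Nphi \<phi>)\<^sup>2" for n \<phi>
  have vi: "integrable gff (v n)" for n unfolding v_def[abs_def]
    by (rule integrableI_bounded) (use less_trans[OF n0[of "n + n0"], of \<infinity>] in auto)
  have "(\<lambda>n. \<integral>\<phi>. norm (v n \<phi>) \<partial>gff) \<longlonglongrightarrow> 0"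
  proof -
    have "(\<lambda>n. ennreal (\<integral>\<phi>. norm (v n \<phi>) \<partial>gff)) = (\<lambda>n. \<integral>\<^sup>+\<phi>. ennreal ((Ninf (rr (e_seq (n + n0))) \<phi> - Nphi \<phi>)\<^sup>2) \<partial>gff)"
      using vi by (intro ext, subst nn_integral_eq_integral[symmetric]) (auto simp: v_def[abs_def])
    then have "(\<lambda>n. ennreal (\<integral>\<phi>. norm (v n \<phi>) \<partial>gff)) \<longlonglongrightarrow> ennreal 0" using LIMSEQ_ignore_initial_segment[OF l, of n0] by simp
    then show ?thesis by (subst (asm) tendsto_ennreal_iff) auto
  qed
  from tendsto_L1_AE_subseq[OF vi this] obtain s where s: "strict_mono s" "AE \<phi> in gff. (\<lambda>n. v (s n) \<phi>) \<longlonglongrightarrow> 0" by blast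
  show thesis
  proof (rule that[of "\<lambda>n. rr (e_seq (s n + n0))"])
    show "decay (rr (e_seq (s n + n0)))" for n by (rule decay_rr[OF e_seq(1)])
    show "AE \<phi> in gff. (\<lambda>n. Ninf (rr (e_seq (s n + n0))) \<phi>) \<longlonglongrightarrow> Nphi \<phi>"
      using s(2)
    proof eventually_elim
      case (elim \<phi>)
      from tendsto_real_sqrt[OF elim] have "(\<lambda>n. \<bar>Ninf (rr (e_seq (s n + n0))) \<phi> - Nphi \<phi>\<bar>) \<longlonglongrightarrow> 0" by (simp add: v_def)
      then have "(\<lambda>n. Ninf (rr (e_seq (s n + n0))) \<phi> - Nphi \<phi>) \<longlonglongrightarrow> 0" by (rule tendsto_rabs_zero_cancel)
      then show ?case by (rule LIM_zero_cancel)
    qed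
  qed
qed

section \<open>Integration by parts\<close>

text \<open>Lagrange basis polynomials for the nodes 0, 1, 2, 3, 4.\<close>

definition lagp :: "nat \<Rightarrow> real poly" where
  "lagp i = (if i = 0 then smult (1/24) ([:-1,1:] * [:-2,1:] * [:-3,1:] * [:-4,1:])
    else if i = 1 then smult (-1/6) ([:0,1:] * [:-2,1:] * [:-3,1:] * [:-4,1:])
    else if i = 2 then smult (1/4) ([:0,1:] * [:-1,1:] * [:-3,1:] * [:-4,1:])
    else if i = 3 then smult (-1/6) ([:0,1:] * [:-1,1:] * [:-2,1:] * [:-4,1:])
    else smult (1/24) ([:0,1:] * [:-1,1:] * [:-2,1:] * [:-3,1:]))"

lemma poly_lagp:
  "poly (lagp 0) y = (y - 1) * (y - 2) * (y - 3) * (y - 4) / 24"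
  "poly (lagp (Suc 0)) y = - (y * (y - 2) * (y - 3) * (y - 4) / 6)"
  "poly (lagp 2) y = y * (y - 1) * (y - 3) * (y - 4) / 4"
  "poly (lagp 3) y = - (y * (y - 1) * (y - 2) * (y - 4) / 6)"
  "poly (lagp 4) y = y * (y - 1) * (y - 2) * (y - 3) / 24"
  by (simp_all add: lagp_def field_simps)

lemma sum_le4: "(\<Sum>i\<le>(4::nat). f i) = f 0 + f (Suc 0) + f 2 + f 3 + f 4" for f :: "nat \<Rightarrow> real"
  by (simp add: eval_nat_numeral)

lemma lagrange_monomial:
  assumes "m \<le> 4" shows "(s + y)^m = (\<Sum>i\<le>4. (s + real i)^m * poly (lagp i) y)"
proof -
  have "m \<in> {0,1,2,3,4}" using le4[OF assms] .
  then show ?thesis unfolding sum_le4 poly_lagp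
    by (elim insertE emptyE) (simp only:; simp add: field_simps eval_nat_numeral; algebra?)+
qed

text \<open>Interpolation at the nodes s, ..., s+4. The shift \<open>s\<close> is left free because
  convergence is at first known only at almost every point, and the integers form a null
  set.\<close>

lemma lagrange_shift:
  assumes "\<And>t. f t = (\<Sum>m\<le>(4::nat). c m * t ^ m)"
  shows "f (s + y) = (\<Sum>i\<le>4. f (s + real i) * poly (lagp i) y)"
proof -
  have "f (s + y) = (\<Sum>m\<le>4. c m * (\<Sum>i\<le>4. (s + real i)^m * poly (lagp i) y))"
    unfolding assms by (intro sum.cong refl) (simp add: lagrange_monomial)
  also have "\<dots> = (\<Sum>i\<le>4. \<Sum>m\<le>4. c m * ((s + real i)^m * poly (lagp i) y))"
    unfolding sum_distrib_left by (rule sum.swap)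
  also have "\<dots> = (\<Sum>i\<le>4. f (s + real i) * poly (lagp i) y)"
    unfolding assms sum_distrib_right by (simp only: mult.assoc)
  finally show ?thesis .
qed

lemma AE_lborel_ex: 
  fixes P :: "real \<Rightarrow> bool"
  assumes "AE x in lborel. P x" shows "\<exists>x. P x"
proof -
  have "ae_filter (lborel :: real measure) \<noteq> bot" by (simp add: ae_filter_eq_bot_iff)
  from eventually_happens'[OF this assms] show ?thesis .
qed

lemma AE_gcomp_lborel: "k \<in> nz \<Longrightarrow> (AE x in gcomp k. P x) \<longleftrightarrow> (AE x in lborel. P x)"
  unfolding gcomp_nz using lam_pos[of k]
  by (subst AE_density) (auto simp: normal_density_pos)

lemma upd_measurable3[measurable]: "(\<lambda>x. w(k := x)) \<in> measurable borel gff"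
proof -
  have "(\<lambda>x. (w, x)) \<in> measurable borel (gff \<Otimes>\<^sub>M gcomp k)" by measurable
  from measurable_comp[OF this upd_measurable] show ?thesis by (simp add: comp_def)
qed

section \<open>The interaction along one mode\<close>

locale wick_seq =
  fixes R :: "nat \<Rightarrow> coeffs" and k :: "int \<times> int"
  assumes R: "\<And>n. decay (R n)" and lim: "AE \<phi> in gff. (\<lambda>n. Ninf (R n) \<phi>) \<longlonglongrightarrow> Nphi \<phi>"
    and k: "k \<in> nz"
begin

text \<open>The quartic is recorded by its values at the nodes rather than by its coefficients:
  these are limits of measurable functions, and they do not involve coordinate
  \<open>k\<close>.\<close>

definition Lv :: "nat \<Rightarrow> coeffs \<Rightarrow> real" where
  "Lv i w = lim (\<lambda>n. Ninf (R n) (w(k := real i)))"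

definition Pp :: "coeffs \<Rightarrow> real poly" where
  "Pp w = (\<Sum>i\<le>4. smult (Lv i w) (lagp i))"

lemma Lv_measurable[measurable]: "Lv i \<in> borel_measurable gff"
  unfolding Lv_def[abs_def] by measurable

lemma Lv_upd: "Lv i (w(k := x)) = Lv i w" by (simp add: Lv_def)

lemma Pp_upd: "Pp (w(k := x)) = Pp w" by (simp add: Pp_def Lv_upd)

lemma poly_Pp: "poly (Pp w) x = (\<Sum>i\<le>4. Lv i w * poly (lagp i) x)"
  by (simp add: Pp_def poly_sum)

lemma poly_pderiv_Pp: "poly (pderiv (Pp w)) x = (\<Sum>i\<le>4. Lv i w * poly (pderiv (lagp i)) x)"
proof -
  have "pderiv (Pp w) = (\<Sum>i\<le>4. smult (Lv i w) (pderiv (lagp i)))"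
    unfolding Pp_def by (simp add: eval_nat_numeral pderiv_smult pderiv_add)
  then show ?thesis by (simp add: poly_sum)
qed

text \<open>For almost every \<open>w\<close> the quartics converge at almost every point of the
  line; intersecting five translates gives a point s with convergence at s, ..., s+4. Interpolation
  spreads this to the whole line, in particular to the nodes used in \<open>Lv\<close>.\<close>

lemma Nphi_polynomial: "AE w in gff. AE x in gcomp k. Nphi (w(k := x)) = poly (Pp w) x"
  using AE_resample[OF lim, of k] AE_good
proof eventually_elim
  case (elim w)
  define f where "f n x = Ninf (R n) (w(k := x))" for n x
  have poly4: "\<exists>c. \<forall>t. f n t = (\<Sum>m\<le>(4::nat). c m * t ^ m)" for n
  proof (rule Ninf_poly[OF R[of n] elim(2) k])
    fix c assume "\<And>t. Ninf (R n) (w(k := t)) = (\<Sum>m\<le>(4::nat). c m * t ^ m)"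
    then show ?thesis unfolding f_def by (intro exI[of _ c] allI)
  qed
  have fm[measurable]: "f n \<in> borel_measurable borel" for n
  proof -
    obtain c where "\<forall>t. f n t = (\<Sum>m\<le>(4::nat). c m * t ^ m)" using poly4 by blast
    then have "f n = (\<lambda>t. \<Sum>m\<le>(4::nat). c m * t ^ m)" by auto
    then show ?thesis by simp
  qed
  have shift: "f n (s + y) = (\<Sum>i\<le>4. f n (s + real i) * poly (lagp i) y)" for n s y
  proof -
    obtain c where "\<forall>t. f n t = (\<Sum>m\<le>(4::nat). c m * t ^ m)" using poly4 by blast
    then show ?thesis by (intro lagrange_shift[of _ c]) (erule spec)
  qed
  have AEc: "AE x in lborel. (\<lambda>n. f n x) \<longlonglongrightarrow> Nphi (w(k := x))"
    using elim(1) unfolding AE_gcomp_lborel[OF k] f_def .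
  then have AEc': "AE x in lborel. convergent (\<lambda>n. f n x)" by eventually_elim (auto simp: convergent_def)
  have pr: "Measurable.pred borel (\<lambda>x. convergent (\<lambda>n. f n x))" unfolding Cauchy_convergent_iff[symmetric] pred_def by (rule sets_Collect_Cauchy[OF fm])
  have tr: "AE x in lborel. convergent (\<lambda>n. f n (x + real i))" for i
    using AE_borel_affine[OF _ pr AEc', of 1 "real i"] by (simp add: add.commute)
  have "AE x in lborel. \<forall>i\<in>{..4::nat}. convergent (\<lambda>n. f n (x + real i))"
    by (rule AE_finite_allI) (auto simp: tr)
  then obtain s where s: "\<forall>i\<in>{..4::nat}. convergent (\<lambda>n. f n (s + real i))" using AE_lborel_ex by blast
  have conv: "convergent (\<lambda>n. f n x)" for x
  proof -
    have "convergent (\<lambda>n. \<Sum>i\<le>4. f n (s + real i) * poly (lagp i) (x - s))"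
      using s by (intro convergent_sum convergent_mult convergent_const) auto
    then show ?thesis using shift[of _ s "x - s"] by simp
  qed
  have L: "(\<lambda>n. f n (real i)) \<longlonglongrightarrow> Lv i w" for i
    using conv[of "real i"] unfolding Lv_def f_def by (rule convergent_LIMSEQ_iff[THEN iffD1])
  have P: "(\<lambda>n. f n x) \<longlonglongrightarrow> poly (Pp w) x" for x
  proof -
    have "(\<lambda>n. \<Sum>i\<le>4. f n (real i) * poly (lagp i) x) \<longlonglongrightarrow> poly (Pp w) x"
      unfolding poly_Pp by (intro tendsto_sum tendsto_mult L tendsto_const)
    then show ?thesis using shift[of _ 0 x] by simp
  qed
  show ?case unfolding AE_gcomp_lborel[OF k]
    using AEc by eventually_elim (rule LIMSEQ_unique[OF _ P])
qed

end

text \<open>The integrand is the derivative of u v (1 - x^2/r^2) exp (-p) n, and the quadratic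
  factor makes this product vanish at both ends of the interval.\<close>

lemma ibp_line:
  fixes u u1 v v1 :: "real \<Rightarrow> real" and p :: "real poly"
  assumes u: "\<And>x. (u has_real_derivative u1 x) (at x)" and v: "\<And>x. (v has_real_derivative v1 x) (at x)"
    and c1: "continuous_on UNIV u1" and c2: "continuous_on UNIV v1" and l: "l > 0" and r: "r > 0"
  defines "n \<equiv> normal_density 0 (1 / sqrt l)"
  shows "(\<integral>x. indicator {-r..r} x *\<^sub>R ((u1 x * v x * (1 - x^2/r^2)
      + u x * (v1 x * (1 - x^2/r^2) - v x * (2 * x / r^2) - v x * (1 - x^2/r^2) * (l * x + poly (pderiv p) x)))
      * (exp (- poly p x) * n x)) \<partial>lborel) = 0"
proof -
  have cu: "continuous_on UNIV u" "continuous_on UNIV v"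
    using u v by (auto intro!: continuous_at_imp_continuous_on DERIV_isCont)
  have s2: "(1 / sqrt l)\<^sup>2 = 1 / l" using l by (simp add: power_divide)
  have n: "n x = sqrt l / sqrt (2 * pi) * exp (- (l * x^2 / 2))" for x
    unfolding n_def normal_density_def s2 using l by (simp add: real_sqrt_divide)
  have dn: "(n has_real_derivative (- (l * x) * n x)) (at x)" for x
  proof -
    define c where "c = sqrt l / sqrt (2 * pi)"
    have n': "n x = c * exp (- (l * x^2 / 2))" for x unfolding n c_def ..
    show ?thesis unfolding n'[abs_def] by (auto intro!: derivative_eq_intros)
  qed
  have cn: "continuous_on UNIV n" using dn by (auto intro!: continuous_at_imp_continuous_on DERIV_isCont)
  have de: "((\<lambda>x. exp (- poly p x)) has_real_derivative (- poly (pderiv p) x * exp (- poly p x))) (at x)" for x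
    by (auto intro!: derivative_eq_intros poly_DERIV)
  let ?G = "\<lambda>x. u x * v x * (1 - x^2/r^2) * (exp (- poly p x) * n x)"
  let ?g = "\<lambda>x. (u1 x * v x * (1 - x^2/r^2)
      + u x * (v1 x * (1 - x^2/r^2) - v x * (2 * x / r^2) - v x * (1 - x^2/r^2) * (l * x + poly (pderiv p) x)))
      * (exp (- poly p x) * n x)"
  have dh: "((\<lambda>x. 1 - x^2/r^2) has_real_derivative (- (2 * x / r^2))) (at x)" for x
    using r by (auto intro!: derivative_eq_intros simp: field_simps power_numeral_reduce)
  have dG: "(?G has_real_derivative ?g x) (at x)" for x
  proof -
    have "((\<lambda>x. u x * v x) has_real_derivative u1 x * v x + v1 x * u x) (at x)" by (rule DERIV_mult[OF u v])
    from DERIV_mult[OF this dh[of x]]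
    have a: "((\<lambda>x. u x * v x * (1 - x^2/r^2)) has_real_derivative (u1 x * v x + v1 x * u x) * (1 - x^2/r^2) + (- (2 * x / r^2)) * (u x * v x)) (at x)" .
    have "((\<lambda>x. exp (- poly p x) * n x) has_real_derivative (- poly (pderiv p) x * exp (- poly p x)) * n x + (- (l * x) * n x) * exp (- poly p x)) (at x)"
      by (rule DERIV_mult[OF de dn])
    from DERIV_mult[OF a this]
    have d: "(?G has_real_derivative ((u1 x * v x + v1 x * u x) * (1 - x^2/r^2) + (- (2 * x / r^2)) * (u x * v x)) * (exp (- poly p x) * n x)
      + ((- poly (pderiv p) x * exp (- poly p x)) * n x + (- (l * x) * n x) * exp (- poly p x)) * (u x * v x * (1 - x^2/r^2))) (at x)" .
    obtain e e' where e: "1 - x^2/r^2 = e" "2 * x / r^2 = e'" by blast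
    show ?thesis by (rule DERIV_cong[OF d], unfold e) (simp add: algebra_simps)
  qed
  have "(\<integral>x. indicator {-r..r} x *\<^sub>R ?g x \<partial>lborel) = ?G r - ?G (-r)"
  proof (rule integral_FTC_Icc)
    show "-r \<le> r" using r by simp
    show "(?G has_vector_derivative ?g x) (at x within {-r..r})" for x
      using dG[of x] has_real_derivative_iff_has_vector_derivative has_vector_derivative_at_within by blast
    show "continuous_on {-r..r} ?g"
      by (intro continuous_intros continuous_on_subset[OF cu(1)] continuous_on_subset[OF cu(2)] continuous_on_subset[OF cn]
          continuous_on_subset[OF c1] continuous_on_subset[OF c2]) (use r in auto)
  qed
  also have "\<dots> = 0" using r by simp
  finally show ?thesis .
qed

text \<open>If \<open>exp (- N)\<close> were not integrable, its Bochner integral would be \<open>0\<close> and, since \<open>x / 0 = 0\<close>,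
  \<open>\<nu>\<close> the null measure. Only the finiteness of \<open>\<nu>\<close> is used below, so both cases are treated alike.\<close>
definition wgt :: "coeffs \<Rightarrow> real" where
  "wgt \<phi> = exp (- Nphi \<phi>) / (\<integral>\<psi>. exp (- Nphi \<psi>) \<partial>gff)"

lemma nu_eq: "nu = density gff (\<lambda>\<phi>. ennreal (wgt \<phi>))"
  by (simp add: nu_def wgt_def)

lemma wgt_measurable[measurable]: "wgt \<in> borel_measurable gff"
  using Nphi_spec(1) unfolding wgt_def[abs_def] by measurable

lemma wgt_nonneg: "0 \<le> wgt \<phi>"
  unfolding wgt_def by (intro divide_nonneg_nonneg integral_nonneg) auto

lemma wgt_integrable: "integrable gff wgt"
proof (cases "integrable gff (\<lambda>\<psi>. exp (- Nphi \<psi>))")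
  case True then show ?thesis unfolding wgt_def[abs_def] by simp
next
  case False then show ?thesis unfolding wgt_def[abs_def] by (simp add: not_integrable_integral_eq)
qed

lemma sets_nu[measurable_cong, simp]: "sets nu = sets gff" by (simp add: nu_eq)
lemma space_nu[simp]: "space nu = UNIV" by (simp add: nu_eq)

interpretation nu: finite_measure nu
proof
  have "emeasure nu (space nu) = (\<integral>\<^sup>+\<phi>. ennreal (wgt \<phi>) \<partial>gff)"
    unfolding nu_eq using sets.top[of gff] by (simp add: emeasure_density)
  also have "\<dots> < \<infinity>" using wgt_integrable wgt_nonneg by (simp add: integrable_iff_bounded)
  finally show "emeasure nu (space nu) \<noteq> \<infinity>" by simp
qed

lemma AE_nu: "AE z in gff. P z \<Longrightarrow> AE z in nu. P z"
  unfolding nu_eq by (subst AE_density) auto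

lemma bounded_integrable_nu:
  fixes F :: "coeffs \<Rightarrow> real"
  assumes "F \<in> borel_measurable gff" "\<And>z. \<bar>F z\<bar> \<le> C" shows "integrable nu F"
  using assms by (intro nu.integrable_const_bound[of _ C]) (auto simp: measurable_cong_sets[OF sets_nu refl])

lemma nu_integral:
  fixes F :: "coeffs \<Rightarrow> real"
  assumes m[measurable]: "F \<in> borel_measurable gff" and b: "\<And>z. \<bar>F z\<bar> \<le> C"
  shows "(\<integral>z. F z \<partial>nu) = (\<integral>w. (\<integral>x. wgt (w(k := x)) * F (w(k := x)) \<partial>gcomp k) \<partial>gff)"
proof -
  have "(\<integral>z. F z \<partial>nu) = (\<integral>z. wgt z *\<^sub>R F z \<partial>gff)"
    unfolding nu_eq by (rule integral_density) (auto simp: wgt_nonneg)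
  moreover have "integrable gff (\<lambda>z. wgt z * F z)"
  proof (rule Bochner_Integration.integrable_bound)
    show "integrable gff (\<lambda>z. C * wgt z)" using wgt_integrable by simp
    show "AE z in gff. norm (wgt z * F z) \<le> norm (C * wgt z)"
    proof (rule AE_I2)
      fix z
      have "\<bar>wgt z\<bar> * \<bar>F z\<bar> \<le> \<bar>wgt z\<bar> * C" using b by (rule mult_left_mono) simp
      also have "\<dots> \<le> \<bar>C * wgt z\<bar>" by (simp add: abs_mult mult.commute mult_right_mono)
      finally show "norm (wgt z * F z) \<le> norm (C * wgt z)" by (simp add: abs_mult)
    qed
  qed measurable
  ultimately show ?thesis using integral_resample[of "\<lambda>z. wgt z * F z" k] by simp
qed

section \<open>Integration by parts for the interacting measure\<close>

context fc_setting
begin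

lemma Espace_upd: "z \<in> Espace s0 \<Longrightarrow> z(k := x) \<in> Espace s0"
proof -
  assume z: "z \<in> Espace s0"
  have "(\<lambda>j. if j = k then lam k powr (-1-s0) * x\<^sup>2 else 0) summable_on nz"
    by (rule finite_nonzero_values_imp_summable_on, rule finite_subset[of _ "{k}"]) auto
  from summable_on_add[OF z[unfolded Espace_def in_V_def mem_Collect_eq] this]
  show ?thesis unfolding Espace_def in_V_def mem_Collect_eq
    by (rule summable_on_bound) auto
qed

lemma AE_Espace: "AE z in gff. z \<in> Espace s0"
  using AE_weighted_summable[of "1 + s0"] s0 by (simp add: Espace_def in_V_def)

text \<open>The unit vector of mode \<open>k\<close> has V^-1 inner product
  \<open>g k / lam k\<close> with \<open>g\<close>, so the ordinary derivative in coordinate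
  \<open>k\<close> is the gradient component divided by \<open>lam k\<close>.\<close>

lemma line_deriv:
  assumes \<phi>: "\<phi> \<in> FC s0" and k: "k \<in> nz"
  shows "((\<lambda>x. \<phi> (z(k := x))) has_real_derivative grad \<phi> (z(k := x)) k / lam k) (at x)"
proof -
  have "((\<lambda>t. \<phi> (\<lambda>j. (z(k := x)) j + t * unit k j)) has_real_derivative Vinner (-1) (grad \<phi> (z(k := x))) (unit k)) (at 0)"
    using FC_has_grad[OF \<phi>, of "z(k := x)"] unit_in_V unfolding has_grad_def by blast
  moreover have "(\<lambda>j. (z(k := x)) j + t * unit k j) = z(k := x + t)" for t by (auto simp: unit_def)
  ultimately have "((\<lambda>t. \<phi> (z(k := x + t))) has_real_derivative grad \<phi> (z(k := x)) k / lam k) (at 0)"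
    using k by (auto simp: Vinner_unit nz_def)
  then show ?thesis using DERIV_shift[of "\<lambda>x. \<phi> (z(k := x))" _ 0 x] by (simp add: add.commute)
qed

lemma line_continuous: "\<phi> \<in> FC s0 \<Longrightarrow> k \<in> nz \<Longrightarrow> continuous_on UNIV (\<lambda>x. \<phi> (z(k := x)))"
  using line_deriv by (intro continuous_at_imp_continuous_on) (blast intro: DERIV_isCont)

lemma FC_deriv_ex: "\<phi> \<in> FC s0 \<Longrightarrow> \<exists>\<psi>\<in>FC s0. \<forall>z\<in>Espace s0. grad \<phi> z k = \<psi> z"
  by (erule FC_deriv[of _ k]) blast

lemma grad_comp_bound: "\<phi> \<in> FC s0 \<Longrightarrow> \<exists>C. \<forall>z. \<bar>grad \<phi> z k\<bar> \<le> C"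
  by (erule grad_bound) blast

lemma FC_bound_ex: "\<phi> \<in> FC s0 \<Longrightarrow> \<exists>C. \<forall>z. \<bar>\<phi> z\<bar> \<le> C"
  by (erule FC_bounded) blast

end

locale ibp_setting = fc_setting s0 + wick_seq R k for s0 R k
begin

text \<open>Besides \<open>z k\<close> itself the node values of the quartic are bounded by
  \<open>r\<close>. They do not depend on \<open>z k\<close>, so along a line in direction
  \<open>k\<close> this second factor is constant and is not differentiated.\<close>

definition cut :: "real \<Rightarrow> coeffs \<Rightarrow> real" where
  "cut r z = indicator {-r..r} (z k) * (if \<forall>i\<le>4. \<bar>Lv i z\<bar> \<le> r then 1 else 0)"

definition chi :: "real \<Rightarrow> coeffs \<Rightarrow> real" where
  "chi r z = cut r z * (1 - (z k)^2 / r^2)"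

lemma cut_measurable[measurable]: "cut r \<in> borel_measurable gff"
  unfolding cut_def[abs_def] by measurable

lemma chi_measurable[measurable]: "chi r \<in> borel_measurable gff"
  unfolding chi_def[abs_def] by measurable

lemma cut_01: "0 \<le> cut r z" "cut r z \<le> 1" by (auto simp: cut_def indicator_def)

lemma chi_01: assumes "r > 0" shows "0 \<le> chi r z" "chi r z \<le> 1"
proof -
  have "0 \<le> 1 - (z k)^2 / r^2 \<and> 1 - (z k)^2 / r^2 \<le> 1" if "cut r z \<noteq> 0"
  proof -
    have "\<bar>z k\<bar> \<le> r" using that by (auto simp: cut_def indicator_def split: if_splits)
    from power_mono[OF this, of 2] show ?thesis using assms by simp
  qed
  then show "0 \<le> chi r z" "chi r z \<le> 1" using cut_01[of r z] unfolding chi_def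
    by (cases "cut r z = 0"; simp add: mult_le_one)+
qed

lemma chi_tendsto: "(\<lambda>n. chi (real (Suc n)) z) \<longlonglongrightarrow> 1"
proof -
  define M where "M = \<bar>z k\<bar> + (\<Sum>i\<le>(4::nat). \<bar>Lv i z\<bar>)"
  have M: "\<bar>z k\<bar> \<le> M" "\<And>i. i \<le> 4 \<Longrightarrow> \<bar>Lv i z\<bar> \<le> M"
  proof -
    have "0 \<le> (\<Sum>i\<le>(4::nat). \<bar>Lv i z\<bar>)" by (intro sum_nonneg) auto
    then show "\<bar>z k\<bar> \<le> M" by (simp add: M_def)
    fix i :: nat assume "i \<le> 4"
    then have "\<bar>Lv i z\<bar> \<le> (\<Sum>i\<le>(4::nat). \<bar>Lv i z\<bar>)" by (intro member_le_sum) auto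
    then show "\<bar>Lv i z\<bar> \<le> M" by (simp add: M_def)
  qed
  have "(\<lambda>n. 1 - (z k)^2 * (1 / real (Suc n)) ^ 2) \<longlonglongrightarrow> 1 - (z k)^2 * 0^2"
    by (intro tendsto_intros lim_inverse_n'[THEN LIMSEQ_Suc])
  then have l: "(\<lambda>n. 1 - (z k)^2 * (1 / real (Suc n)) ^ 2) \<longlonglongrightarrow> 1" by simp
  show ?thesis
  proof (rule Lim_transform_eventually[OF l])
    have "\<forall>\<^sub>F n in sequentially. real (Suc n) \<ge> M"
      unfolding eventually_sequentially 
    proof (intro exI[of _ "nat \<lceil>M\<rceil>"] allI impI)
      fix n assume "nat \<lceil>M\<rceil> \<le> n"
      then have "real_of_int \<lceil>M\<rceil> \<le> real n" by linarith
      then show "M \<le> real (Suc n)" using le_of_int_ceiling[of M] by linarith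
    qed
    then show "\<forall>\<^sub>F n in sequentially. 1 - (z k)^2 * (1 / real (Suc n)) ^ 2 = chi (real (Suc n)) z"
    proof eventually_elim
      case (elim n)
      have "cut (real (Suc n)) z = 1"
      proof -
        have "z k \<in> {- real (Suc n)..real (Suc n)}" using M(1) elim by (auto simp: abs_le_iff)
        moreover have "\<forall>i\<le>4. \<bar>Lv i z\<bar> \<le> real (Suc n)" using M(2) elim by (auto intro: order_trans)
        ultimately show ?thesis unfolding cut_def by simp
      qed
      then show ?case unfolding chi_def by (simp add: power_divide)
    qed
  qed
qed

text \<open>What remains after moving the derivative off the other factor: \<open>\<psi>1\<close>
  and \<open>\<psi>2\<close> stand for the first and second gradient component of the test function,
  and \<open>lam k * z k + poly (pderiv (Pp z)) (z k)\<close> is minus the logarithmic derivative of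
  the density along mode \<open>k\<close>. The factors \<open>lam k\<close> convert ordinary
  derivatives into gradient components.\<close>

definition Bf :: "real \<Rightarrow> (coeffs \<Rightarrow> real) \<Rightarrow> (coeffs \<Rightarrow> real) \<Rightarrow> coeffs \<Rightarrow> real" where
  "Bf r \<psi>1 \<psi>2 z = - cut r z * (\<psi>2 z * (1 - (z k)^2/r^2) - lam k * \<psi>1 z * (2 * z k / r^2)
     - lam k * \<psi>1 z * (1 - (z k)^2/r^2) * (lam k * z k + poly (pderiv (Pp z)) (z k)))"

lemma pderiv_lagp_bound: "\<exists>M\<ge>0. \<forall>i\<le>4. \<forall>x\<in>{-r..r}. \<bar>poly (pderiv (lagp i)) x\<bar> \<le> M"
proof -
  have "\<exists>M. \<forall>x\<in>{-r..r}. \<bar>poly (pderiv (lagp i)) x\<bar> \<le> M" for i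
  proof -
    have "bounded (poly (pderiv (lagp i)) ` {-r..r})"
      by (intro compact_imp_bounded compact_continuous_image continuous_intros) auto
    then show ?thesis unfolding bounded_iff by auto
  qed
  then obtain M where M: "\<And>i. \<forall>x\<in>{-r..r}. \<bar>poly (pderiv (lagp i)) x\<bar> \<le> M i" by metis
  have "\<bar>poly (pderiv (lagp i)) x\<bar> \<le> (\<Sum>i\<le>(4::nat). \<bar>M i\<bar>)" if "i \<le> 4" "x \<in> {-r..r}" for i x
  proof -
    have "\<bar>poly (pderiv (lagp i)) x\<bar> \<le> \<bar>M i\<bar>" using M[of i] that(2) by force
    also have "\<dots> \<le> (\<Sum>i\<le>(4::nat). \<bar>M i\<bar>)" using that(1) by (intro member_le_sum) auto
    finally show ?thesis .
  qed
  then show ?thesis by (intro exI[of _ "\<Sum>i\<le>(4::nat). \<bar>M i\<bar>"]) (auto intro: sum_nonneg)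
qed

lemma Bf_props:
  assumes r: "r > 0" and \<psi>: "\<psi>1 \<in> FC s0" "\<psi>2 \<in> FC s0"
  shows "Bf r \<psi>1 \<psi>2 \<in> borel_measurable gff" "\<exists>C. \<forall>z. \<bar>Bf r \<psi>1 \<psi>2 z\<bar> \<le> C"
proof -
  note [measurable] = FC_measurable[OF \<psi>(1)] FC_measurable[OF \<psi>(2)]
  have "(\<lambda>z. poly (pderiv (lagp i)) (z k)) \<in> borel_measurable gff" for i
    by (rule measurable_compose[OF coord_measurable borel_measurable_continuous_onI]) (intro continuous_intros)
  then have [measurable]: "(\<lambda>z. poly (pderiv (Pp z)) (z k)) \<in> borel_measurable gff"
    unfolding poly_pderiv_Pp by measurable
  show "Bf r \<psi>1 \<psi>2 \<in> borel_measurable gff" unfolding Bf_def[abs_def] by measurable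
  obtain C1 where C1: "\<forall>z. \<bar>\<psi>1 z\<bar> \<le> C1" using FC_bound_ex[OF \<psi>(1)] by blast
  obtain C2 where C2: "\<forall>z. \<bar>\<psi>2 z\<bar> \<le> C2" using FC_bound_ex[OF \<psi>(2)] by blast
  obtain M where M: "M \<ge> 0" "\<forall>i\<le>4. \<forall>x\<in>{-r..r}. \<bar>poly (pderiv (lagp i)) x\<bar> \<le> M" using pderiv_lagp_bound by blast
  have l: "lam k > 0" by (rule lam_pos[OF k])
  \<comment> \<open>One summand for each of the three terms; 5 is the number of nodes, each
    contributing a value at most \<open>r\<close> times a derivative at most
    \<open>M\<close>.\<close>
  define C where "C = C2 * 1 + lam k * C1 * (2 * r / r^2) + lam k * C1 * 1 * (lam k * r + 5 * (r * M))"
  have C12: "0 \<le> C1" "0 \<le> C2" using C1 C2 by (meson abs_ge_zero order_trans)+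
  have C0: "0 \<le> C" unfolding C_def using C12 l r M by (intro add_nonneg_nonneg mult_nonneg_nonneg) auto
  have "\<bar>Bf r \<psi>1 \<psi>2 z\<bar> \<le> C" for z
  proof (cases "cut r z = 0")
    case True then show ?thesis using C0 by (simp add: Bf_def)
  next
    case False
    then have zk: "\<bar>z k\<bar> \<le> r" "z k \<in> {-r..r}" and L: "\<forall>i\<le>4. \<bar>Lv i z\<bar> \<le> r"
      by (auto simp: cut_def indicator_def split: if_splits)
    have e: "\<bar>1 - (z k)^2/r^2\<bar> \<le> 1" using power_mono[OF zk(1), of 2] r by simp
    have p: "\<bar>poly (pderiv (Pp z)) (z k)\<bar> \<le> 5 * (r * M)"
    proof -
      have "\<bar>poly (pderiv (Pp z)) (z k)\<bar> \<le> (\<Sum>i\<le>(4::nat). \<bar>Lv i z * poly (pderiv (lagp i)) (z k)\<bar>)"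
        unfolding poly_pderiv_Pp by (rule sum_abs)
      also have "\<dots> \<le> (\<Sum>i\<le>(4::nat). r * M)"
        unfolding abs_mult using L M zk r by (intro sum_mono mult_mono) auto
      finally show ?thesis by simp
    qed
    have q: "\<bar>lam k * z k + poly (pderiv (Pp z)) (z k)\<bar> \<le> lam k * r + 5 * (r * M)"
      using p zk(1) l abs_triangle_ineq[of "lam k * z k" "poly (pderiv (Pp z)) (z k)"] mult_left_mono[OF zk(1) less_imp_le[OF l]]
      unfolding abs_mult abs_of_pos[OF l] by linarith
    have t1: "\<bar>\<psi>2 z * (1 - (z k)^2/r^2)\<bar> \<le> C2 * 1" unfolding abs_mult using C2 C12 e by (intro mult_mono) auto
    have t2: "\<bar>lam k * \<psi>1 z * (2 * z k / r^2)\<bar> \<le> lam k * C1 * (2 * r / r^2)"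
      unfolding abs_mult using C1 C12 l r zk by (intro mult_mono) (auto simp: abs_mult divide_right_mono)
    have t3: "\<bar>lam k * \<psi>1 z * (1 - (z k)^2/r^2) * (lam k * z k + poly (pderiv (Pp z)) (z k))\<bar> \<le> lam k * C1 * 1 * (lam k * r + 5 * (r * M))"
      unfolding abs_mult using C1 C12 l r M q e by (intro mult_mono) (auto intro!: mult_nonneg_nonneg)
    have "\<bar>Bf r \<psi>1 \<psi>2 z\<bar> = \<bar>cut r z\<bar> * \<bar>\<psi>2 z * (1 - (z k)^2/r^2) - lam k * \<psi>1 z * (2 * z k / r^2)
     - lam k * \<psi>1 z * (1 - (z k)^2/r^2) * (lam k * z k + poly (pderiv (Pp z)) (z k))\<bar>"
      by (simp only: Bf_def abs_mult abs_minus_cancel)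
    also have "\<dots> \<le> 1 * C"
    proof (rule mult_mono)
      show "\<bar>cut r z\<bar> \<le> 1" using cut_01[of r z] by simp
      show "\<bar>\<psi>2 z * (1 - (z k)^2/r^2) - lam k * \<psi>1 z * (2 * z k / r^2)
        - lam k * \<psi>1 z * (1 - (z k)^2/r^2) * (lam k * z k + poly (pderiv (Pp z)) (z k))\<bar> \<le> C"
        using t1 t2 t3 unfolding C_def by linarith
    qed (use C0 in auto)
    finally show ?thesis by simp
  qed
  then show "\<exists>C. \<forall>z. \<bar>Bf r \<psi>1 \<psi>2 z\<bar> \<le> C" by blast
qed

text \<open>\<open>B\<close> is bounded and does not depend on \<open>\<phi>\<close>, so the left
  side is a continuous functional of \<open>\<phi>\<close> in L2. It arises by disintegrating
  \<open>nu\<close> along mode \<open>k\<close> and applying \<open>ibp_line\<close> on almost every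
  line.\<close>

lemma ibp_nu:
  assumes \<psi>: "\<psi> \<in> FC s0" and r: "r > 0"
  obtains B where "B \<in> borel_measurable gff" "\<exists>C. \<forall>z. \<bar>B z\<bar> \<le> C"
    "\<forall>\<phi>\<in>FC s0. (\<integral>z. grad \<phi> z k * grad \<psi> z k * chi r z \<partial>nu) = (\<integral>z. \<phi> z * B z \<partial>nu)"
proof -
  obtain \<psi>1 where p1: "\<psi>1 \<in> FC s0" "\<forall>z\<in>Espace s0. grad \<psi> z k = \<psi>1 z" using FC_deriv_ex[OF \<psi>, of k] by blast
  obtain \<psi>2 where p2: "\<psi>2 \<in> FC s0" "\<forall>z\<in>Espace s0. grad \<psi>1 z k = \<psi>2 z" using FC_deriv_ex[OF p1(1), of k] by blast
  note B = Bf_props[OF r p1(1) p2(1)]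
  obtain CB where CB: "\<forall>z. \<bar>Bf r \<psi>1 \<psi>2 z\<bar> \<le> CB" using B(2) by blast
  have l: "lam k > 0" by (rule lam_pos[OF k])
  define cc where "cc = 1 / (\<integral>\<psi>. exp (- Nphi \<psi>) \<partial>gff)"
  have "(\<integral>z. grad \<phi> z k * grad \<psi> z k * chi r z \<partial>nu) = (\<integral>z. \<phi> z * Bf r \<psi>1 \<psi>2 z \<partial>nu)" if \<phi>: "\<phi> \<in> FC s0" for \<phi>
  proof -
    obtain \<phi>1 where f1: "\<phi>1 \<in> FC s0" "\<forall>z\<in>Espace s0. grad \<phi> z k = \<phi>1 z" using FC_deriv_ex[OF \<phi>, of k] by blast
    note [measurable] = FC_measurable[OF \<phi>] grad_measurable[OF \<phi>, of k] grad_measurable[OF \<psi>, of k] B(1)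
      FC_measurable[OF f1(1)] FC_measurable[OF p1(1)] FC_measurable[OF p2(1)]
    obtain C0 where C0: "\<forall>z. \<bar>\<phi> z\<bar> \<le> C0" using FC_bound_ex[OF \<phi>] by blast
    obtain C1 where C1: "\<forall>z. \<bar>grad \<phi> z k\<bar> \<le> C1" using grad_comp_bound[OF \<phi>] by blast
    obtain C2 where C2: "\<forall>z. \<bar>grad \<psi> z k\<bar> \<le> C2" using grad_comp_bound[OF \<psi>] by blast
    let ?A = "\<lambda>z. grad \<phi> z k * grad \<psi> z k * chi r z" and ?B = "\<lambda>z. \<phi> z * Bf r \<psi>1 \<psi>2 z"
    have bA: "\<bar>?A z\<bar> \<le> C1 * C2 * 1" for z
      unfolding abs_mult using C1 C2 chi_01[OF r, of z] order_trans[OF abs_ge_zero C1[rule_format, of z]] order_trans[OF abs_ge_zero C2[rule_format, of z]] 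
      by (intro mult_mono) auto
    have bB: "\<bar>?B z\<bar> \<le> C0 * CB" for z
      unfolding abs_mult using C0 CB order_trans[OF abs_ge_zero C0[rule_format, of z]] by (intro mult_mono) auto
    have iA: "integrable nu ?A" by (rule bounded_integrable_nu[OF _ bA]) measurable
    have iB: "integrable nu ?B" by (rule bounded_integrable_nu[OF _ bB]) measurable
    have "(\<integral>z. ?A z - ?B z \<partial>nu) = (\<integral>w. (\<integral>x. wgt (w(k := x)) * (?A (w(k := x)) - ?B (w(k := x))) \<partial>gcomp k) \<partial>gff)"
    proof (rule nu_integral)
      show "\<bar>?A z - ?B z\<bar> \<le> C1 * C2 * 1 + C0 * CB" for z
        using bA[of z] bB[of z] abs_triangle_ineq4[of "?A z" "?B z"] by linarith
    qed measurable
    also have "\<dots> = (\<integral>w. 0 \<partial>gff)"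
    proof (rule integral_cong_AE)
      show "AE w in gff. (\<integral>x. wgt (w(k := x)) * (?A (w(k := x)) - ?B (w(k := x))) \<partial>gcomp k) = 0"
        using Nphi_polynomial AE_Espace
      proof eventually_elim
        case (elim w)
        \<comment> \<open>The part of the cutoff that is constant on the line; it factors out of the
          one-dimensional integral.\<close>
        define q where "q = (if \<forall>i\<le>4. \<bar>Lv i w\<bar> \<le> r then 1 else 0 :: real)"
        define u where "u x = \<phi> (w(k := x))" for x
        define u1 where "u1 x = \<phi>1 (w(k := x)) / lam k" for x
        define v where "v x = \<psi>1 (w(k := x))" for x
        define v1 where "v1 x = \<psi>2 (w(k := x)) / lam k" for x
        have Ew: "w(k := x) \<in> Espace s0" for x by (rule Espace_upd[OF elim(2)])
        have du: "(u has_real_derivative u1 x) (at x)" for x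
          using line_deriv[OF \<phi> k, of w x] f1(2) Ew unfolding u_def[abs_def] u1_def by simp
        have dv: "(v has_real_derivative v1 x) (at x)" for x
          using line_deriv[OF p1(1) k, of w x] p2(2) Ew unfolding v_def[abs_def] v1_def by simp
        have cu1: "continuous_on UNIV u1" unfolding u1_def[abs_def] by (intro continuous_intros line_continuous f1 k) (use l in auto)
        have cv1: "continuous_on UNIV v1" unfolding v1_def[abs_def] by (intro continuous_intros line_continuous p2 k) (use l in auto)
        let ?n = "normal_density 0 (1 / sqrt (lam k))"
        let ?e = "\<lambda>x. 1 - x^2/r^2"
        let ?g = "\<lambda>x. u1 x * v x * ?e x + u x * (v1 x * ?e x - v x * (2 * x / r^2) - v x * ?e x * (lam k * x + poly (pderiv (Pp w)) x))"
        have pt: "?A (w(k := x)) - ?B (w(k := x)) = lam k * q * (indicator {-r..r} x * ?g x)" for x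
        proof -
          have c: "cut r (w(k := x)) = indicator {-r..r} x * q" unfolding cut_def q_def Lv_upd by simp
          have a: "grad \<phi> (w(k := x)) k = lam k * u1 x" "grad \<psi> (w(k := x)) k = v x"
            using f1(2) p1(2) Ew l by (auto simp: u1_def v_def)
          have b: "\<psi>2 (w(k := x)) = lam k * v1 x" "\<psi>1 (w(k := x)) = v x" "\<phi> (w(k := x)) = u x"
            using l by (auto simp: v1_def v_def u_def)
          obtain e e' where e: "1 - x^2/r^2 = e" "2 * x / r^2 = e'" by blast
          show ?thesis unfolding chi_def Bf_def c a b Pp_upd fun_upd_same e by (simp add: algebra_simps)
        qed
        have [measurable]: "u \<in> borel_measurable borel" "v \<in> borel_measurable borel" "u1 \<in> borel_measurable borel" "v1 \<in> borel_measurable borel"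
          using du dv cu1 cv1 by (auto intro!: borel_measurable_continuous_onI continuous_at_imp_continuous_on DERIV_isCont)
        have [measurable]: "poly p \<in> borel_measurable borel" for p :: "real poly"
          by (intro borel_measurable_continuous_onI continuous_intros)
        have [measurable]: "(\<lambda>x. wgt (w(k := x)) * (?A (w(k := x)) - ?B (w(k := x)))) \<in> borel_measurable borel"
          by (rule measurable_compose[OF upd_measurable3[of w k], of "\<lambda>z. wgt z * (?A z - ?B z)"]) measurable
        have mm: "(\<lambda>x. indicator {-r..r} x * (?g x * exp (- poly (Pp w) x))) \<in> borel_measurable borel" by measurable
        have "(\<integral>x. wgt (w(k := x)) * (?A (w(k := x)) - ?B (w(k := x))) \<partial>gcomp k) =
           (\<integral>x. (cc * lam k * q) * (indicator {-r..r} x * (?g x * exp (- poly (Pp w) x))) \<partial>gcomp k)"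
        proof (rule integral_cong_AE)
          show "AE x in gcomp k. wgt (w(k := x)) * (?A (w(k := x)) - ?B (w(k := x))) = (cc * lam k * q) * (indicator {-r..r} x * (?g x * exp (- poly (Pp w) x)))"
            using elim(1)
          proof eventually_elim
            case (elim x)
            have "wgt (w(k := x)) = cc * exp (- poly (Pp w) x)" using elim by (simp add: wgt_def cc_def)
            then show ?case unfolding pt by (simp only: mult_ac)
          qed
        qed (simp_all only: measurable_cong_sets[OF sets_gcomp refl], measurable)
        also have "\<dots> = (cc * lam k * q) * (\<integral>x. indicator {-r..r} x * (?g x * exp (- poly (Pp w) x)) \<partial>gcomp k)"
          by (rule integral_mult_right_zero)
        also have "(\<integral>x. indicator {-r..r} x * (?g x * exp (- poly (Pp w) x)) \<partial>gcomp k) =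
            (\<integral>x. ?n x *\<^sub>R (indicator {-r..r} x * (?g x * exp (- poly (Pp w) x))) \<partial>lborel)"
          unfolding gcomp_nz[OF k] by (rule integral_density) (use mm in simp_all)
        also have "\<dots> = (\<integral>x. indicator {-r..r} x *\<^sub>R (?g x * (exp (- poly (Pp w) x) * ?n x)) \<partial>lborel)"
          by (simp only: real_scaleR_def mult_ac)
        also have "\<dots> = 0" by (rule ibp_line[OF du dv cu1 cv1 l r])
        finally show ?case by (simp only: mult_zero_right)
      qed
      have "(\<lambda>p. wgt ((fst p)(k := snd p)) * (?A ((fst p)(k := snd p)) - ?B ((fst p)(k := snd p)))) \<in> borel_measurable (gff \<Otimes>\<^sub>M gcomp k)"
      proof -
        have "(\<lambda>z. wgt z * (?A z - ?B z)) \<in> borel_measurable gff" by measurable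
        from measurable_compose[OF upd_measurable this, of k] show ?thesis by (simp only: case_prod_unfold)
      qed
      then show "(\<lambda>w. \<integral>x. wgt (w(k := x)) * (?A (w(k := x)) - ?B (w(k := x))) \<partial>gcomp k) \<in> borel_measurable gff"
        by (intro gcomp.borel_measurable_lebesgue_integral) (simp only: case_prod_unfold)
    qed simp
    finally have "(\<integral>z. ?A z - ?B z \<partial>nu) = 0" by simp
    then show ?thesis using Bochner_Integration.integral_diff[OF iA iB] by simp
  qed
  then show thesis using that[of "Bf r \<psi>1 \<psi>2"] B by blast
qed

end

lemma countable_nz[simp]: "countable nz" by simp

section \<open>Closability and the Markov property\<close>

lemma abs_infsum_le:
  fixes f g :: "'i \<Rightarrow> real"
  assumes "g summable_on A" "\<And>k. k \<in> A \<Longrightarrow> \<bar>f k\<bar> \<le> g k"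
  shows "\<bar>infsum f A\<bar> \<le> infsum g A"
proof -
  have f: "f summable_on A" by (rule summable_on_bound[OF assms])
  have "infsum f A \<le> infsum g A"
  proof (rule infsum_mono[OF f assms(1)])
    fix k assume "k \<in> A" from assms(2)[OF this] show "f k \<le> g k" by linarith
  qed
  moreover have "infsum (\<lambda>k. - f k) A \<le> infsum g A"
  proof (rule infsum_mono[OF _ assms(1)])
    show "(\<lambda>k. - f k) summable_on A" using f by (rule summable_on_uminus[THEN iffD2])
    fix k assume "k \<in> A" from assms(2)[OF this] show "- f k \<le> g k" by linarith
  qed
  ultimately show ?thesis by (simp add: infsum_uminus)
qed

lemma in_V_Pi0: "in_V \<alpha> g \<Longrightarrow> in_V \<alpha> (Pi0 g)"
  unfolding in_V_def by (subst summable_on_cong[of _ _ "\<lambda>k. lam k powr \<alpha> * (g k)\<^sup>2"]) (auto simp: Pi0_def nz_def)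

text \<open>The energy density, or carre du champ. Since the inner product is diagonal, projecting
  one argument off the zero mode removes that mode from the whole expression.\<close>

definition Gam :: "(coeffs \<Rightarrow> real) \<Rightarrow> (coeffs \<Rightarrow> real) \<Rightarrow> coeffs \<Rightarrow> real" where
  "Gam \<phi> \<psi> z = Vinner (-1) (Pi0 (grad \<phi> z)) (grad \<psi> z)"

lemma Gam_eq: "Gam \<phi> \<psi> z = (\<Sum>\<^sub>\<infinity>k\<in>nz. lam k powr (-1) * grad \<phi> z k * grad \<psi> z k)"
proof -
  have "(\<Sum>\<^sub>\<infinity>k\<in>nz. lam k powr (-1) * Pi0 (grad \<phi> z) k * grad \<psi> z k) = (\<Sum>\<^sub>\<infinity>k\<in>nz. lam k powr (-1) * grad \<phi> z k * grad \<psi> z k)"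
    by (rule infsum_cong) (auto simp: Pi0_def nz_def)
  then show ?thesis by (simp add: Gam_def Vinner_def Pi0_def)
qed

lemma Eform_Gam: "Eform \<phi> \<psi> = (1/2) * (\<integral>z. Gam \<phi> \<psi> z \<partial>nu)"
  by (simp add: Eform_def Gam_def)

lemma Gam_sym: "Gam \<phi> \<psi> z = Gam \<psi> \<phi> z"
  unfolding Gam_eq by (rule infsum_cong) (simp add: mult_ac)

lemma Gam_nonneg: "0 \<le> Gam \<phi> \<phi> z"
  unfolding Gam_eq by (rule infsum_nonneg) (simp add: mult.assoc)

context fc_setting
begin

lemma grad_V: "\<phi> \<in> FC s0 \<Longrightarrow> in_V (-1) (grad \<phi> z)"
  using FC_has_grad has_grad_def by blast

lemma grad_lin:
  assumes "\<phi> \<in> FC s0" "\<psi> \<in> FC s0"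
  shows "grad (\<lambda>z. a * \<phi> z + b * \<psi> z) z = (\<lambda>k. a * grad \<phi> z k + b * grad \<psi> z k)"
  by (rule has_grad_grad[OF has_grad_lin[OF FC_has_grad[OF assms(1)] FC_has_grad[OF assms(2)]]])

lemma grad_fdiff:
  assumes "\<phi> \<in> FC s0" "\<psi> \<in> FC s0"
  shows "grad (fdiff \<phi> \<psi>) z k = grad \<phi> z k - grad \<psi> z k"
  using grad_lin[OF assms, of 1 "-1" z] by (simp add: fdiff_def)

lemma grad_poly:
  assumes "\<phi> \<in> FC s0"
  shows "grad (\<lambda>z. poly p (\<phi> z)) z = (\<lambda>k. poly (pderiv p) (\<phi> z) * grad \<phi> z k)"
  by (rule has_grad_grad[OF has_grad_chain[OF FC_has_grad[OF assms] poly_DERIV]])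

lemma Gam_summable: "\<phi> \<in> FC s0 \<Longrightarrow> \<psi> \<in> FC s0 \<Longrightarrow> (\<lambda>k. lam k powr (-1) * grad \<phi> z k * grad \<psi> z k) summable_on nz"
  by (intro V_prod grad_V)

lemma Gam_measurable:
  assumes "\<phi> \<in> FC s0" "\<psi> \<in> FC s0" shows "Gam \<phi> \<psi> \<in> borel_measurable gff"
proof -
  note [measurable] = grad_measurable[OF assms(1)] grad_measurable[OF assms(2)]
  show ?thesis unfolding Gam_eq[abs_def] by (rule infsum_measurable) (simp, measurable)
qed

lemma Gam_bounded:
  assumes "\<phi> \<in> FC s0" "\<psi> \<in> FC s0"
  shows "\<exists>C. \<forall>z. \<bar>Gam \<phi> \<psi> z\<bar> \<le> C"
proof -
  obtain L where L: "in_V (-1) L" "\<And>z k. \<bar>grad \<phi> z k\<bar> \<le> L k" by (rule grad_bound[OF assms(1)]) fast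
  obtain L' where L': "in_V (-1) L'" "\<And>z k. \<bar>grad \<psi> z k\<bar> \<le> L' k" by (rule grad_bound[OF assms(2)]) fast
  have "\<bar>Gam \<phi> \<psi> z\<bar> \<le> (\<Sum>\<^sub>\<infinity>k\<in>nz. lam k powr (-1) * L k * L' k)" for z
    unfolding Gam_eq
  proof (rule abs_infsum_le[OF V_prod[OF L(1) L'(1)]])
    fix k
    have "0 \<le> L k" using L(2)[where k=k] abs_ge_zero order_trans by blast
    then show "\<bar>lam k powr (-1) * grad \<phi> z k * grad \<psi> z k\<bar> \<le> lam k powr (-1) * L k * L' k"
      unfolding abs_mult using L(2)[of z k] L'(2)[of z k] by (intro mult_mono) auto
  qed
  then show ?thesis by blast
qed

lemma Gam_integrable: "\<phi> \<in> FC s0 \<Longrightarrow> \<psi> \<in> FC s0 \<Longrightarrow> integrable nu (Gam \<phi> \<psi>)"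
proof -
  assume a: "\<phi> \<in> FC s0" "\<psi> \<in> FC s0"
  obtain C where "\<forall>z. \<bar>Gam \<phi> \<psi> z\<bar> \<le> C" using Gam_bounded[OF a] by blast
  then show ?thesis by (intro bounded_integrable_nu[OF Gam_measurable[OF a], of C]) simp
qed

lemma Gam_lin:
  assumes "\<phi> \<in> FC s0" "\<psi> \<in> FC s0" "\<xi> \<in> FC s0"
  shows "Gam (\<lambda>z. a * \<phi> z + b * \<psi> z) \<xi> z = a * Gam \<phi> \<xi> z + b * Gam \<psi> \<xi> z"
proof -
  have "Pi0 (\<lambda>k. a * grad \<phi> z k + b * grad \<psi> z k) = (\<lambda>k. a * Pi0 (grad \<phi> z) k + b * Pi0 (grad \<psi> z) k)"
    by (auto simp: Pi0_def)
  then show ?thesis unfolding Gam_def grad_lin[OF assms(1,2)]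
    by (simp add: Vinner_lin in_V_Pi0 grad_V assms)
qed

lemma sum_le_Gam:
  assumes "\<phi> \<in> FC s0" "finite K" "K \<subseteq> nz"
  shows "(\<Sum>k\<in>K. lam k powr (-1) * (grad \<phi> z k)\<^sup>2) \<le> Gam \<phi> \<phi> z"
  unfolding Gam_eq using finite_sum_le_infsum[OF Gam_summable[OF assms(1,1)] assms(2,3), of z]
  by (simp add: power2_eq_square mult.assoc)

lemma FC_L2: "\<phi> \<in> FC s0 \<Longrightarrow> \<phi> \<in> L2 nu"
proof -
  assume \<phi>: "\<phi> \<in> FC s0"
  note [measurable] = FC_measurable[OF \<phi>]
  obtain C where C: "\<forall>z. \<bar>\<phi> z\<bar> \<le> C" using FC_bound_ex[OF \<phi>] by blast
  have "integrable nu (\<lambda>z. (\<phi> z)\<^sup>2)"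
  proof (rule bounded_integrable_nu[of _ "C\<^sup>2"])
    show "\<bar>(\<phi> z)\<^sup>2\<bar> \<le> C\<^sup>2" for z using power_mono[OF C[rule_format, of z], of 2] by simp
  qed measurable
  then show ?thesis using FC_measurable[OF \<phi>] by (simp add: L2_def measurable_cong_sets[OF sets_nu refl])
qed

lemma pos_form_FC: "pos_form (FC s0) Eform"
proof
  fix u v w a b assume u: "u \<in> FC s0" and v: "v \<in> FC s0" and w: "w \<in> FC s0"
  show "Eform (\<lambda>x. a * u x + b * v x) w = a * Eform u w + b * Eform v w"
    unfolding Eform_Gam Gam_lin[OF u v w] using Gam_integrable[OF u w] Gam_integrable[OF v w]
    by (simp add: algebra_simps)
next
  fix u v a b assume u: "u \<in> FC s0" and v: "v \<in> FC s0" 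
  show "(\<lambda>x. a * u x + b * v x) \<in> FC s0" by (rule FC_lin[OF u v])
  show "Eform u v = Eform v u" unfolding Eform_Gam Gam_sym[of u v, abs_def] by (simp only: Gam_sym[of u v])
  show "0 \<le> Eform u u" unfolding Eform_Gam by (simp add: Gam_nonneg integral_nonneg)
qed

text \<open>What closability uses about the measure: for mode \<open>k\<close>, weights between 0
  and 1 tending to 1, for each of which the weighted derivative has a bounded adjoint. From here on
  the interaction enters closability only through this.\<close>

definition cutoff :: "int \<times> int \<Rightarrow> (nat \<Rightarrow> coeffs \<Rightarrow> real) \<Rightarrow> bool" where
  "cutoff k X \<longleftrightarrow> (\<forall>i. X i \<in> borel_measurable gff) \<and> (\<forall>i z. 0 \<le> X i z \<and> X i z \<le> 1) \<and> (\<forall>z. (\<lambda>i. X i z) \<longlonglongrightarrow> 1) \<and>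
    (\<forall>i. \<forall>\<psi>\<in>FC s0. \<exists>B. B \<in> borel_measurable gff \<and> (\<exists>C. \<forall>z. \<bar>B z\<bar> \<le> C) \<and>
      (\<forall>\<phi>\<in>FC s0. (\<integral>z. grad \<phi> z k * grad \<psi> z k * X i z \<partial>nu) = (\<integral>z. \<phi> z * B z \<partial>nu)))"

lemma cutoff_ex: assumes k: "k \<in> nz" shows "\<exists>X. cutoff k X"
proof -
  obtain R where R: "\<And>n. decay (R n)" "AE \<phi> in gff. (\<lambda>n. Ninf (R n) \<phi>) \<longlonglongrightarrow> Nphi \<phi>" by (rule Nphi_AE_limit) fast
  interpret ibp_setting s0 R k
    by unfold_locales (use R k in auto)
  have "cutoff k (\<lambda>i. chi (real (Suc i)))"
    unfolding cutoff_def
  proof (intro conjI allI ballI)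
    fix i and \<psi> assume \<psi>: "\<psi> \<in> FC s0"
    show "\<exists>B. B \<in> borel_measurable gff \<and> (\<exists>C. \<forall>z. \<bar>B z\<bar> \<le> C) \<and>
      (\<forall>\<phi>\<in>FC s0. (\<integral>z. grad \<phi> z k * grad \<psi> z k * chi (real (Suc i)) z \<partial>nu) = (\<integral>z. \<phi> z * B z \<partial>nu))"
      by (rule ibp_nu[OF \<psi>, of "real (Suc i)"]) (simp, rule exI, intro conjI, assumption+)
  qed (use chi_measurable chi_01 chi_tendsto in auto)
  then show ?thesis by blast
qed

definition cf :: "int \<times> int \<Rightarrow> nat \<Rightarrow> coeffs \<Rightarrow> real" where "cf k = (SOME X. cutoff k X)"

lemma cf: assumes "k \<in> nz" shows "cf k i \<in> borel_measurable gff" "0 \<le> cf k i z" "cf k i z \<le> 1"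
    "(\<lambda>i. cf k i z) \<longlonglongrightarrow> 1" and cf_ibp: "\<psi> \<in> FC s0 \<Longrightarrow> \<exists>B. B \<in> borel_measurable gff \<and> (\<exists>C. \<forall>z. \<bar>B z\<bar> \<le> C) \<and>
      (\<forall>\<phi>\<in>FC s0. (\<integral>z. grad \<phi> z k * grad \<psi> z k * cf k i z \<partial>nu) = (\<integral>z. \<phi> z * B z \<partial>nu))"
  proof -
  have "cutoff k (cf k)" unfolding cf_def by (rule someI_ex[OF cutoff_ex[OF assms]])
  note c = this[unfolded cutoff_def]
  show "cf k i \<in> borel_measurable gff" "0 \<le> cf k i z" "cf k i z \<le> 1" "(\<lambda>i. cf k i z) \<longlonglongrightarrow> 1"
    using c by simp_all
  show "\<exists>B. B \<in> borel_measurable gff \<and> (\<exists>C. \<forall>z. \<bar>B z\<bar> \<le> C) \<and>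
      (\<forall>\<phi>\<in>FC s0. (\<integral>z. grad \<phi> z k * grad \<psi> z k * cf k i z \<partial>nu) = (\<integral>z. \<phi> z * B z \<partial>nu))" if "\<psi> \<in> FC s0"
    using c that by simp
qed

lemma bounded_L2:
  assumes m: "B \<in> borel_measurable gff" and C: "\<forall>z. \<bar>B z\<bar> \<le> C" shows "B \<in> L2 nu"
proof -
  have "integrable nu (\<lambda>z. (B z)\<^sup>2)"
  proof (rule bounded_integrable_nu[of _ "C\<^sup>2"])
    show "\<bar>(B z)\<^sup>2\<bar> \<le> C\<^sup>2" for z using power_mono[OF C[rule_format, of z], of 2] by simp
  qed (use m in measurable)
  then show ?thesis using m by (simp add: L2_def measurable_cong_sets[OF sets_nu refl])
qed

text \<open>The integral is the L2 inner product of \<open>u m\<close> with the bounded adjoint, so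
  Cauchy-Schwarz applies.\<close>

lemma cf_int_tendsto_0:
  assumes k: "k \<in> nz" and \<psi>: "\<psi> \<in> FC s0" and u: "\<And>m. u m \<in> FC s0" and lim: "(\<lambda>m. l2dist2 nu (u m) (\<lambda>_. 0)) \<longlonglongrightarrow> 0"
  shows "(\<lambda>m. \<integral>z. grad \<psi> z k * grad (u m) z k * cf k i z \<partial>nu) \<longlonglongrightarrow> 0"
proof -
  obtain B C where B: "B \<in> borel_measurable gff" "\<forall>z. \<bar>B z\<bar> \<le> C"
     "\<forall>\<phi>\<in>FC s0. (\<integral>z. grad \<phi> z k * grad \<psi> z k * cf k i z \<partial>nu) = (\<integral>z. \<phi> z * B z \<partial>nu)"
    using cf_ibp[OF k \<psi>, of i] by fast
  have eq: "(\<integral>z. grad \<psi> z k * grad (u m) z k * cf k i z \<partial>nu) = L2ip nu (u m) B" for m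
    using B(3) u[of m] unfolding L2ip_def by (simp add: mult.commute[of "grad \<psi> _ k"])
  have nr: "L2.nrm nu (u m) = sqrt (l2dist2 nu (u m) (\<lambda>_. 0))" for m
    unfolding l2dist2_nrm by (simp add: fdiff_def)
  have "(\<lambda>m. L2.nrm nu (u m)) \<longlonglongrightarrow> sqrt 0" unfolding nr by (rule tendsto_real_sqrt[OF lim])
  then have "(\<lambda>m. L2.nrm nu (u m) * L2.nrm nu B) \<longlonglongrightarrow> 0" by (auto intro: tendsto_mult_left_zero)
  then show ?thesis unfolding eq
  proof (rule Lim_null_comparison[rotated])
    show "\<forall>\<^sub>F m in sequentially. norm (L2ip nu (u m) B) \<le> L2.nrm nu (u m) * L2.nrm nu B"
      using L2.abs_le_nrm[OF FC_L2[OF u] bounded_L2[OF B(1,2)]] by simp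
  qed
qed

text \<open>On finitely many modes and under the cutoffs, |Dv|^2 <= |D(v - u m)|^2 + 2 Dv . D(u m).
  The first term is controlled by the energy of the difference, the mixed one tends to 0 because
  \<open>u m\<close> does in L2; then the cutoffs and the restriction on modes are removed by
  dominated convergence. The choice v = u n yields closability.\<close>

lemma energy_le:
  assumes v: "v \<in> FC s0" and u: "\<And>m. u m \<in> FC s0" and lim: "(\<lambda>m. l2dist2 nu (u m) (\<lambda>_. 0)) \<longlonglongrightarrow> 0"
    and e: "\<And>m. m \<ge> N \<Longrightarrow> Eform (fdiff v (u m)) (fdiff v (u m)) \<le> e"
  shows "Eform v v \<le> e"
proof -
  define S where "S i j w z = (\<Sum>k\<in>Kn j. lam k powr (-1) * (grad v z k * grad w z k * cf k i z))" for i j w z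
  define S' where "S' j z = (\<Sum>k\<in>Kn j. lam k powr (-1) * (grad v z k)\<^sup>2)" for j z
  note kn = subsetD[OF Kn_nz]
  obtain C where C: "\<forall>z. \<bar>Gam v v z\<bar> \<le> C" using Gam_bounded[OF v v] by blast
  have int: "integrable nu (\<lambda>z. grad v z k * grad w z k * cf k i z)" if w: "w \<in> FC s0" and k: "k \<in> nz" for w k i
  proof -
    note [measurable] = grad_measurable[OF v, of k] grad_measurable[OF w, of k] cf(1)[OF k]
    obtain C1 where C1: "\<forall>z. \<bar>grad v z k\<bar> \<le> C1" using grad_comp_bound[OF v] by blast
    obtain C2 where C2: "\<forall>z. \<bar>grad w z k\<bar> \<le> C2" using grad_comp_bound[OF w] by blast
    show ?thesis
    proof (rule bounded_integrable_nu[of _ "C1 * C2 * 1"])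
      fix z
      have "0 \<le> C1" "0 \<le> C2" using C1 C2 abs_ge_zero order_trans by blast+
      then show "\<bar>grad v z k * grad w z k * cf k i z\<bar> \<le> C1 * C2 * 1"
        unfolding abs_mult using C1 C2 cf(2,3)[OF k, of i z] by (intro mult_mono) auto
    qed measurable
  qed
  have intS: "integrable nu (S i j w)" if w: "w \<in> FC s0" for i j w
    unfolding S_def[abs_def]
    by (intro Bochner_Integration.integrable_sum integrable_mult_right int[OF w] kn)
  have S0: "0 \<le> S i j v z" for i j z unfolding S_def using cf(2) kn by (intro sum_nonneg) auto
  have SS': "S i j v z \<le> S' j z" for i j z
    unfolding S_def S'_def
  proof (intro sum_mono mult_left_mono)
    fix k assume "k \<in> Kn j"
    then have "grad v z k * grad v z k * cf k i z \<le> grad v z k * grad v z k * 1"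
      using cf(3) kn by (intro mult_left_mono) auto
    then show "grad v z k * grad v z k * cf k i z \<le> (grad v z k)\<^sup>2" by (simp add: power2_eq_square)
  qed simp
  have S'G: "S' j z \<le> Gam v v z" for j z unfolding S'_def by (rule sum_le_Gam[OF v finite_Kn Kn_nz])
  have S'0: "0 \<le> S' j z" for j z unfolding S'_def by (intro sum_nonneg) auto
  \<comment> \<open>The 2 compensates the factor 1/2 in \<open>Eform\<close>.\<close>
  have key: "(\<integral>z. S i j v z \<partial>nu) \<le> 2 * e" for i j
  proof -
    have t0: "(\<lambda>m. \<integral>z. S i j (u m) z \<partial>nu) \<longlonglongrightarrow> 0"
    proof -
      have "(\<integral>z. S i j (u m) z \<partial>nu) = (\<Sum>k\<in>Kn j. lam k powr (-1) * (\<integral>z. grad v z k * grad (u m) z k * cf k i z \<partial>nu))" for m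
        unfolding S_def using int[OF u] kn by (subst Bochner_Integration.integral_sum) auto
      moreover have "(\<lambda>m. \<Sum>k\<in>Kn j. lam k powr (-1) * (\<integral>z. grad v z k * grad (u m) z k * cf k i z \<partial>nu)) \<longlonglongrightarrow> 0"
        by (intro tendsto_null_sum tendsto_mult_right_zero cf_int_tendsto_0 kn v u lim)
      ultimately show ?thesis by simp
    qed
    have "(\<integral>z. S i j v z \<partial>nu) \<le> 2 * e + 2 * (\<integral>z. S i j (u m) z \<partial>nu)" if m: "m \<ge> N" for m
    proof -
      let ?d = "fdiff v (u m)"
      have d: "?d \<in> FC s0" using FC_lin[OF v u[of m], of 1 "-1"] by (simp add: fdiff_def)
      have "S i j v z \<le> Gam ?d ?d z + 2 * S i j (u m) z" for z
      proof -
        have "S i j v z - 2 * S i j (u m) z = (\<Sum>k\<in>Kn j. lam k powr (-1) * ((grad v z k * grad v z k - 2 * (grad v z k * grad (u m) z k)) * cf k i z))"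
          unfolding S_def sum_distrib_left sum_subtractf[symmetric] by (intro sum.cong refl) (simp add: algebra_simps)
        also have "\<dots> \<le> (\<Sum>k\<in>Kn j. lam k powr (-1) * (grad ?d z k)\<^sup>2)"
        proof (intro sum_mono mult_left_mono)
          fix k assume k: "k \<in> Kn j"
          have "grad v z k * grad v z k - 2 * (grad v z k * grad (u m) z k) \<le> (grad ?d z k)\<^sup>2"
            unfolding grad_fdiff[OF v u] by (simp add: power2_eq_square algebra_simps)
          then have "(grad v z k * grad v z k - 2 * (grad v z k * grad (u m) z k)) * cf k i z \<le> (grad ?d z k)\<^sup>2 * cf k i z"
            using cf(2) kn[OF k] by (intro mult_right_mono)
          also have "\<dots> \<le> (grad ?d z k)\<^sup>2 * 1" using cf(3) kn[OF k] by (intro mult_left_mono) auto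
          finally show "(grad v z k * grad v z k - 2 * (grad v z k * grad (u m) z k)) * cf k i z \<le> (grad ?d z k)\<^sup>2" by simp
        qed simp
        also have "\<dots> \<le> Gam ?d ?d z" by (rule sum_le_Gam[OF d finite_Kn Kn_nz])
        finally show ?thesis by linarith
      qed
      then have "(\<integral>z. S i j v z \<partial>nu) \<le> (\<integral>z. Gam ?d ?d z + 2 * S i j (u m) z \<partial>nu)"
        by (intro integral_mono intS v u Bochner_Integration.integrable_add Gam_integrable d integrable_mult_right)
      also have "\<dots> = (\<integral>z. Gam ?d ?d z \<partial>nu) + 2 * (\<integral>z. S i j (u m) z \<partial>nu)"
        using Gam_integrable[OF d d] intS[OF u] by simp
      also have "(\<integral>z. Gam ?d ?d z \<partial>nu) \<le> 2 * e" using e[OF m] unfolding Eform_Gam by simp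
      finally show ?thesis by simp
    qed
    then have "\<forall>m\<ge>N. (\<integral>z. S i j v z \<partial>nu) \<le> 2 * e + 2 * (\<integral>z. S i j (u m) z \<partial>nu)" by blast
    moreover have "(\<lambda>m. 2 * e + 2 * (\<integral>z. S i j (u m) z \<partial>nu)) \<longlonglongrightarrow> 2 * e + 2 * 0"
      by (intro tendsto_intros t0)
    ultimately show ?thesis using LIMSEQ_le_const[of "\<lambda>m. 2 * e + 2 * (\<integral>z. S i j (u m) z \<partial>nu)" "2 * e + 2 * 0" "\<integral>z. S i j v z \<partial>nu"] by auto
  qed
  have mS: "S i j v \<in> borel_measurable nu" for i j using intS[OF v] by (rule borel_measurable_integrable)
  have mS': "S' j \<in> borel_measurable nu" for j
  proof -
    note [measurable] = grad_measurable[OF v]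
    have "S' j \<in> borel_measurable gff" unfolding S'_def[abs_def] by measurable
    then show ?thesis by (simp add: measurable_cong_sets[OF sets_nu refl])
  qed
  have S'le: "(\<integral>z. S' j z \<partial>nu) \<le> 2 * e" for j
  proof -
    have "(\<lambda>i. \<integral>z. S i j v z \<partial>nu) \<longlonglongrightarrow> (\<integral>z. S' j z \<partial>nu)"
    proof (rule integral_dominated_convergence[of "S' j" nu "\<lambda>i. S i j v" "\<lambda>_. C"])
      show "AE z in nu. (\<lambda>i. S i j v z) \<longlonglongrightarrow> S' j z"
      proof (rule AE_I2)
        fix z
        have "(\<lambda>i. S i j v z) \<longlonglongrightarrow> (\<Sum>k\<in>Kn j. lam k powr (-1) * (grad v z k * grad v z k * 1))"
          unfolding S_def by (intro tendsto_intros cf(4) kn)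
        then show "(\<lambda>i. S i j v z) \<longlonglongrightarrow> S' j z" by (simp add: S'_def power2_eq_square)
      qed
      show "AE z in nu. norm (S i j v z) \<le> C" for i
      proof (rule AE_I2)
        fix z show "norm (S i j v z) \<le> C" using S0[of i j z] SS'[of i j z] S'G[of j z] C[rule_format, of z] by simp
      qed
    qed (simp_all add: mS mS')
    then show ?thesis by (rule LIMSEQ_le_const2) (use key in auto)
  qed
  have "(\<lambda>j. \<integral>z. S' j z \<partial>nu) \<longlonglongrightarrow> (\<integral>z. Gam v v z \<partial>nu)"
  proof (rule integral_dominated_convergence[of "Gam v v" nu "S'" "\<lambda>_. C"])
    show "AE z in nu. (\<lambda>j. S' j z) \<longlonglongrightarrow> Gam v v z"
    proof (rule AE_I2)
      fix z show "(\<lambda>j. S' j z) \<longlonglongrightarrow> Gam v v z"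
        using sum_Kn_tendsto[OF Gam_summable[OF v v, of z]] unfolding S'_def Gam_eq by (simp add: power2_eq_square mult.assoc)
    qed
    show "AE z in nu. norm (S' j z) \<le> C" for j
    proof (rule AE_I2)
      fix z show "norm (S' j z) \<le> C" using S'0[of j z] S'G[of j z] C[rule_format, of z] by simp
    qed
  qed (simp_all add: mS' borel_measurable_integrable[OF Gam_integrable[OF v v]])
  then have "(\<integral>z. Gam v v z \<partial>nu) \<le> 2 * e" by (rule LIMSEQ_le_const2) (use S'le in auto)
  then show ?thesis unfolding Eform_Gam by simp
qed

lemma closable_FC: "closable_form nu (FC s0) Eform"
  unfolding closable_form_def
proof (intro conjI allI impI)
  show "FC s0 \<subseteq> L2 nu" using FC_L2 by blast
  interpret pos_form "FC s0" Eform by (rule pos_form_FC)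
  fix u :: "nat \<Rightarrow> coeffs \<Rightarrow> real"
  assume u: "(\<forall>n. u n \<in> FC s0) \<and> (\<lambda>n. l2dist2 nu (u n) (\<lambda>_. 0)) \<longlonglongrightarrow> 0 \<and> form_cauchy Eform u"
  show "(\<lambda>n. Eform (u n) (u n)) \<longlonglongrightarrow> 0"
  proof (rule LIMSEQ_I)
    fix e :: real assume "e > 0"
    then have "\<exists>N. \<forall>n\<ge>N. \<forall>m\<ge>N. Eform (fdiff (u n) (u m)) (fdiff (u n) (u m)) < e / 2"
      using u half_gt_zero[of e] unfolding form_cauchy_def by blast
    then obtain N where N: "\<forall>n\<ge>N. \<forall>m\<ge>N. Eform (fdiff (u n) (u m)) (fdiff (u n) (u m)) < e / 2" by blast
    have "norm (Eform (u n) (u n) - 0) < e" if "n \<ge> N" for n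
    proof -
      have "Eform (u n) (u n) \<le> e / 2"
        by (rule energy_le[where u = u and N = N]) (use u N that in \<open>auto intro: less_imp_le\<close>)
      then show ?thesis using pos[of "u n"] u \<open>e > 0\<close> by simp
    qed
    then show "\<exists>N. \<forall>n\<ge>N. norm (Eform (u n) (u n) - 0) < e" by blast
  qed
qed

lemma closable_pos_form_FC: "closable_pos_form (FC s0) Eform nu"
  using pos_form_FC closable_FC by (simp add: closable_pos_form_def closable_pos_form_axioms_def)

section \<open>Polynomials of cylinder functions and the unit contraction\<close>

lemma energy_poly_le:
  assumes v: "v \<in> FC s0" and p: "\<And>z. \<bar>poly (pderiv p) (v z)\<bar> \<le> c"
  shows "Eform (\<lambda>z. poly p (v z)) (\<lambda>z. poly p (v z)) \<le> c\<^sup>2 * Eform v v"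
proof -
  let ?w = "\<lambda>z. poly p (v z)"
  have w: "?w \<in> FC s0" by (rule FC_poly[OF v])
  have "Gam ?w ?w z \<le> c\<^sup>2 * Gam v v z" for z
  proof -
    have "Gam ?w ?w z = (poly (pderiv p) (v z))\<^sup>2 * Gam v v z"
      unfolding Gam_eq grad_poly[OF v] infsum_cmult_right'[symmetric]
      by (rule infsum_cong) (simp add: power2_eq_square mult_ac)
    also have "\<dots> \<le> c\<^sup>2 * Gam v v z"
      using power_mono[OF p[of z], of 2] by (intro mult_right_mono Gam_nonneg) simp
    finally show ?thesis .
  qed
  then have "(\<integral>z. Gam ?w ?w z \<partial>nu) \<le> (\<integral>z. c\<^sup>2 * Gam v v z \<partial>nu)"
    by (intro integral_mono Gam_integrable w v integrable_mult_right)
  then show ?thesis unfolding Eform_Gam by simp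
qed

end

text \<open>The derivative is approximated by Weierstrass and integrated from 0 with the value
  \<open>f 0\<close>; the error of the function is then at most \<open>M\<close> times that of the
  derivative.\<close>

lemma poly_approx_C1:
  fixes f f' :: "real \<Rightarrow> real"
  assumes f: "\<And>x. (f has_real_derivative f' x) (at x)" and c: "continuous_on UNIV f'" and e: "e > 0" and M: "M > 0"
  obtains p :: "real poly" where "\<forall>x\<in>{-M..M}. \<bar>poly p x - f x\<bar> \<le> e * M" "\<forall>x\<in>{-M..M}. \<bar>poly (pderiv p) x - f' x\<bar> \<le> e"
proof -
  obtain g where g: "real_polynomial_function g" "\<And>x. x \<in> {-M..M} \<Longrightarrow> \<bar>f' x - g x\<bar> < e"
    using Stone_Weierstrass_real_polynomial_function[OF compact_Icc continuous_on_subset[OF c subset_UNIV, of "{-M..M}"] e] by blast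
  obtain a n where a: "g = (\<lambda>x. \<Sum>i\<le>n. a i * x ^ i)" using g(1) unfolding real_polynomial_function_iff_sum by blast
  define p where "p = [:f 0:] + (\<Sum>i\<le>n. monom (a i / real (Suc i)) (Suc i))"
  have "pderiv p = (\<Sum>i\<le>n. monom (a i) i)"
    unfolding p_def pderiv_add higher_pderiv_sum[where n = 1, simplified] by (simp add: pderiv_monom del: of_nat_Suc)
  then have g': "poly (pderiv p) = g" unfolding a by (simp add: poly_sum poly_monom fun_eq_iff)
  have p0: "poly p 0 = f 0" by (simp add: p_def poly_sum poly_monom)
  have d: "\<bar>poly (pderiv p) x - f' x\<bar> \<le> e" if "x \<in> {-M..M}" for x
    using g(2)[OF that] unfolding g' by (simp add: abs_minus_commute)
  have "\<bar>poly p x - f x\<bar> \<le> e * M" if x: "x \<in> {-M..M}" for x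
  proof -
    have "norm ((poly p x - f x) - (poly p 0 - f 0)) \<le> e * norm (x - 0)"
    proof (rule field_differentiable_bound[of "{-M..M}"])
      show "((\<lambda>x. poly p x - f x) has_field_derivative (poly (pderiv p) x - f' x)) (at x within {-M..M})" for x
        by (rule DERIV_subset[OF DERIV_diff[OF poly_DERIV f]]) simp
    qed (use d x M in auto)
    also have "\<dots> \<le> e * M" using x e by (intro mult_left_mono) auto
    finally show ?thesis using p0 by simp
  qed
  then show thesis using that[of p] d by blast
qed

lemma sqrt_shift_bound:
  fixes x d :: real assumes "d \<ge> 0" shows "\<bar>x\<bar> \<le> sqrt (x\<^sup>2 + d\<^sup>2)" "sqrt (x\<^sup>2 + d\<^sup>2) \<le> \<bar>x\<bar> + d"
proof -
  show "\<bar>x\<bar> \<le> sqrt (x\<^sup>2 + d\<^sup>2)" by (rule real_le_rsqrt) simp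
  show "sqrt (x\<^sup>2 + d\<^sup>2) \<le> \<bar>x\<bar> + d"
    by (rule real_le_lsqrt) (use assms in \<open>auto simp: power2_sum\<close>)
qed

text \<open>Clipping to [0,1] is (|x| - |x - 1| + 1) / 2; here both absolute values |y| are smoothed
  to sqrt (y^2 + d^2). The derivative is half the difference of two numbers in [-1, 1], hence
  bounded by 1.\<close>

definition sclip :: "real \<Rightarrow> real \<Rightarrow> real" where
  "sclip d x = (sqrt (x\<^sup>2 + d\<^sup>2) - sqrt ((x - 1)\<^sup>2 + d\<^sup>2) + 1) / 2"

definition sclip' :: "real \<Rightarrow> real \<Rightarrow> real" where
  "sclip' d x = (x / sqrt (x\<^sup>2 + d\<^sup>2) - (x - 1) / sqrt ((x - 1)\<^sup>2 + d\<^sup>2)) / 2"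

lemma sclip_deriv: assumes d: "d > 0" shows "(sclip d has_real_derivative sclip' d x) (at x)"
proof -
  have p: "x\<^sup>2 + d\<^sup>2 > 0" for x by (rule add_nonneg_pos) (use d in auto)
  have s: "((\<lambda>x. sqrt ((x - c)\<^sup>2 + d\<^sup>2)) has_real_derivative (x - c) / sqrt ((x - c)\<^sup>2 + d\<^sup>2)) (at x)" for x c
  proof -
    have q: "((\<lambda>x. (x - c)\<^sup>2 + d\<^sup>2) has_real_derivative 2 * (x - c)) (at x)"
      by (rule derivative_eq_intros refl | simp)+
    have "((\<lambda>x. sqrt ((x - c)\<^sup>2 + d\<^sup>2)) has_real_derivative inverse (sqrt ((x - c)\<^sup>2 + d\<^sup>2)) / 2 * (2 * (x - c))) (at x)"
      by (rule DERIV_chain2[where f = sqrt, OF DERIV_real_sqrt[OF p[of "x - c"]] q])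
    moreover have "inverse r / 2 * (2 * y) = y / r" for r y :: real by (cases "r = 0") (simp_all add: field_simps)
    ultimately show ?thesis by (simp only:)
  qed
  note s' = s[of 1] and s = s[of 0, unfolded diff_zero]
  have "((\<lambda>x. (sqrt (x\<^sup>2 + d\<^sup>2) - sqrt ((x - 1)\<^sup>2 + d\<^sup>2) + 1) / 2) has_real_derivative
      (x / sqrt (x\<^sup>2 + d\<^sup>2) - (x - 1) / sqrt ((x - 1)\<^sup>2 + d\<^sup>2) + 0) / 2) (at x)"
    by (rule DERIV_cdivide, rule DERIV_add, rule DERIV_diff, rule s, rule s', rule DERIV_const)
  then show ?thesis unfolding sclip_def[abs_def] sclip'_def add_0_right .
qed

lemma sclip'_bound: "\<bar>sclip' d x\<bar> \<le> 1"
proof -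
  have "\<bar>x / sqrt (x\<^sup>2 + d\<^sup>2)\<bar> \<le> 1" for x
  proof -
    have "\<bar>x\<bar> \<le> sqrt (x\<^sup>2 + d\<^sup>2)" by (rule real_le_rsqrt) simp
    moreover have "0 \<le> sqrt (x\<^sup>2 + d\<^sup>2)" by simp
    ultimately have "\<bar>x\<bar> / sqrt (x\<^sup>2 + d\<^sup>2) \<le> 1" unfolding divide_le_eq_1 by linarith
    then show ?thesis by simp
  qed
  moreover have "\<bar>p\<bar> \<le> 1 \<Longrightarrow> \<bar>q\<bar> \<le> 1 \<Longrightarrow> \<bar>(p - q) / 2\<bar> \<le> 1" for p q :: real by (auto simp: abs_le_iff)
  ultimately show ?thesis unfolding sclip'_def by blast
qed

lemma sclip'_cont: "d > 0 \<Longrightarrow> continuous_on UNIV (sclip' d)"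
  unfolding sclip'_def[abs_def] by (intro continuous_intros) (auto simp: sum_power2_eq_zero_iff)

lemma sclip_close: assumes "d \<ge> 0" shows "\<bar>sclip d x - min 1 (max 0 x)\<bar> \<le> d"
proof -
  have "min 1 (max 0 x) = (\<bar>x\<bar> - \<bar>x - 1\<bar> + 1) / 2" by (auto simp: min_def max_def abs_if)
  moreover have "m = (p - q + 1) / 2 \<Longrightarrow> p \<le> a \<Longrightarrow> a \<le> p + d \<Longrightarrow> q \<le> b \<Longrightarrow> b \<le> q + d \<Longrightarrow> \<bar>(a - b + 1) / 2 - m\<bar> \<le> d"
    for m p q a b :: real using assms by (auto simp: abs_le_iff field_simps)
  ultimately show ?thesis unfolding sclip_def using sqrt_shift_bound[OF assms] by blast
qed

context fc_setting
begin

text \<open>A cylinder function is bounded, so a polynomial close to the smoothed clipping on its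
  range, with derivative at most 1 + h there, composes with it inside the algebra and nearly
  contracts the energy.\<close>

lemma contraction_FC:
  assumes v: "v \<in> FC s0" and e: "e > 0"
  shows "\<exists>w\<in>FC s0. l2dist2 nu w (\<lambda>x. min 1 (max 0 (v x))) \<le> e \<and> Eform w w \<le> (1 + e) * Eform v v"
proof -
  obtain C where C: "\<forall>z. \<bar>v z\<bar> \<le> C" using FC_bound_ex[OF v] by blast
  define M where "M = max 1 C"
  have M: "M > 0" "v z \<in> {-M..M}" for z using C[rule_format, of z] by (auto simp: M_def abs_le_iff)
  define m where "m = measure nu (space nu) + 1"
  have m: "m > 0" unfolding m_def by (simp add: add_nonneg_pos)
  \<comment> \<open>Chosen so that a uniform error 2 d integrates to at most (2 d)^2 m = e. The 1
    added in \<open>m\<close> keeps it positive when \<open>nu\<close> is the null measure.\<close>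
  define d where "d = sqrt (e / m) / 2"
  have d: "d > 0" unfolding d_def using e m by simp
  have d2: "(2 * d)\<^sup>2 * m = e" unfolding d_def using e m by simp
  \<comment> \<open>h <= 1 and h <= e/3 give (1 + h)^2 <= 1 + 3 h <= 1 + e; h <= d/M makes the
    polynomial uniformly d-close to \<open>sclip d\<close>.\<close>
  define h where "h = min 1 (min (e / 3) (d / M))"
  have h: "h > 0" "h \<le> 1" "h \<le> e / 3" "h \<le> d / M"
  proof -
    show "h > 0" unfolding h_def using e d M(1) by simp
    show "h \<le> 1" unfolding h_def by (rule min.cobounded1)
    show "h \<le> e / 3" unfolding h_def by (rule min.coboundedI2[OF min.cobounded1])
    show "h \<le> d / M" unfolding h_def by (rule min.coboundedI2[OF min.cobounded2])
  qed
  have hM: "h * M \<le> d" using h(4) M(1) by (simp add: pos_le_divide_eq)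
  obtain p where p: "\<forall>x\<in>{-M..M}. \<bar>poly p x - sclip d x\<bar> \<le> h * M" "\<forall>x\<in>{-M..M}. \<bar>poly (pderiv p) x - sclip' d x\<bar> \<le> h"
    by (rule poly_approx_C1[OF sclip_deriv[OF d] sclip'_cont[OF d] h(1) M(1)])
  let ?w = "\<lambda>z. poly p (v z)"
  have w: "?w \<in> FC s0" by (rule FC_poly[OF v])
  interpret pos_form "FC s0" Eform by (rule pos_form_FC)
  have "\<bar>poly (pderiv p) (v z)\<bar> \<le> 1 + h" for z
    using p(2)[rule_format, OF M(2)[of z]] sclip'_bound[of d "v z"] by linarith
  from energy_poly_le[OF v this] have "Eform ?w ?w \<le> (1 + h)\<^sup>2 * Eform v v" .
  also have "\<dots> \<le> (1 + e) * Eform v v"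
  proof (rule mult_right_mono[OF _ pos[OF v]])
    have "h * h \<le> 1 * h" using h by (intro mult_right_mono) auto
    then show "(1 + h)\<^sup>2 \<le> 1 + e" using h(3) by (simp add: power2_eq_square algebra_simps)
  qed
  finally have E: "Eform ?w ?w \<le> (1 + e) * Eform v v" .
  have cl: "(?w z - min 1 (max 0 (v z)))\<^sup>2 \<le> (2 * d)\<^sup>2" for z
  proof -
    have "\<bar>?w z - min 1 (max 0 (v z))\<bar> \<le> 2 * d"
      using p(1)[rule_format, OF M(2)[of z]] hM sclip_close[OF less_imp_le[OF d], of "v z"] by linarith
    from power_mono[OF this abs_ge_zero, of 2] show ?thesis by simp
  qed
  note [measurable] = FC_measurable[OF v] FC_measurable[OF w]
  have "l2dist2 nu ?w (\<lambda>x. min 1 (max 0 (v x))) \<le> (\<integral>z. (2 * d)\<^sup>2 \<partial>nu)"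
    unfolding l2dist2_def
  proof (rule integral_mono)
    show "integrable nu (\<lambda>z. (?w z - min 1 (max 0 (v z)))\<^sup>2)"
      by (rule bounded_integrable_nu[of _ "(2 * d)\<^sup>2"]) (measurable, simp only: cl abs_power2)
  qed (rule cl | simp)+
  also have "\<dots> \<le> (2 * d)\<^sup>2 * m" by (simp add: m_def algebra_simps)
  finally show ?thesis using E w d2 by blast
qed

end

section \<open>Density of cylinder functions in L2\<close>

definition sgm :: "real \<Rightarrow> real" where "sgm x = 1 / (1 + exp (- x))"

lemma sgm_01: "0 < sgm x" "sgm x < 1"
  unfolding sgm_def using exp_gt_zero[of "- x"] by (auto simp: divide_less_eq add_pos_pos)

text \<open>The derivative of the logistic function is a polynomial in the function itself, so the
  polynomials in it form a family closed under differentiation, as \<open>FC_coord\<close> requires.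
  Being injective and step-like under scaling, it serves both to separate points and to approximate
  half-lines.\<close>

lemma sgm_deriv: "(sgm has_real_derivative sgm x * (1 - sgm x)) (at x)"
proof -
  have p: "1 + exp (- x) \<noteq> 0" using exp_gt_zero[of "- x"] by linarith
  have "(sgm has_real_derivative (exp (- x) / (1 + exp (- x))\<^sup>2)) (at x)"
    unfolding sgm_def[abs_def] using p by (auto intro!: derivative_eq_intros simp: power2_eq_square divide_simps)
  moreover have "sgm x * (1 - sgm x) = exp (- x) / (1 + exp (- x))\<^sup>2"
    unfolding sgm_def using p by (simp add: power2_eq_square divide_simps)
  ultimately show ?thesis by simp
qed

lemma sgm_inj: "sgm x = sgm y \<Longrightarrow> x = y"
  unfolding sgm_def using exp_gt_zero[of "- x"] exp_gt_zero[of "- y"] by (simp add: divide_simps)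

lemma sgm_at_top: "(sgm \<longlongrightarrow> 1) at_top"
proof -
  have "((\<lambda>x::real. 1 / (1 + exp (- x))) \<longlongrightarrow> 1 / (1 + 0)) at_top"
    by (intro tendsto_intros filterlim_compose[OF exp_at_bot filterlim_uminus_at_bot_at_top]) simp
  then show ?thesis unfolding sgm_def[abs_def] by simp
qed

lemma sgm_at_bot: "(sgm \<longlongrightarrow> 0) at_bot"
proof -
  have "sgm x = 1 - sgm (- x)" for x
    unfolding sgm_def using exp_gt_zero[of x] add_pos_pos[OF exp_gt_zero[of x] zero_less_one] by (simp add: exp_minus divide_simps)
  then have "sgm = (\<lambda>x. 1 - sgm (- x))" by blast
  moreover have "((\<lambda>x. 1 - sgm (- x)) \<longlongrightarrow> 1 - 1) at_bot"
    by (intro tendsto_diff tendsto_const filterlim_compose[OF sgm_at_top filterlim_uminus_at_top_at_bot])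
  ultimately show ?thesis by simp
qed

text \<open>The slope n^2 outruns the shift n for x > a, while the shift alone sends the value at x
  = a to 0; the limit is the indicator of the open half-line.\<close>

lemma sgm_step: "(\<lambda>n. sgm (real n ^ 2 * (x - a) - real n)) \<longlonglongrightarrow> (if a < x then 1 else 0)"
proof (cases "a < x")
  case True
  then have d: "x - a > 0" by simp
  have "filterlim (\<lambda>n. real n * (real n * (x - a) - 1)) at_top sequentially"
  proof (rule filterlim_at_top_mult_at_top[OF filterlim_real_sequentially])
    have "filterlim (\<lambda>n. (x - a) * real n) at_top sequentially"
      by (rule filterlim_tendsto_pos_mult_at_top[OF tendsto_const d filterlim_real_sequentially])
    from filterlim_tendsto_add_at_top[OF tendsto_const this, of "-1"]
    show "filterlim (\<lambda>n. real n * (x - a) - 1) at_top sequentially" by (simp add: mult.commute)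
  qed
  then have "filterlim (\<lambda>n. real n ^ 2 * (x - a) - real n) at_top sequentially"
    by (simp add: power2_eq_square algebra_simps)
  from filterlim_compose[OF sgm_at_top this] True show ?thesis by simp
next
  case False
  have "filterlim (\<lambda>n. real n ^ 2 * (x - a) - real n) at_bot sequentially"
  proof (rule filterlim_at_bot_mono)
    show "filterlim (\<lambda>n. - real n) at_bot sequentially"
      by (rule filterlim_compose[OF filterlim_uminus_at_bot_at_top filterlim_real_sequentially])
    show "\<forall>\<^sub>F n in sequentially. real n ^ 2 * (x - a) - real n \<le> - real n"
      using False by (intro always_eventually allI) (simp add: mult_nonneg_nonpos)
  qed
  from filterlim_compose[OF sgm_at_bot this] False show ?thesis by simp
qed

context fc_setting
begin

lemma FC_sgm: "(\<lambda>z. sgm (a * z k + b)) \<in> FC s0"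
proof -
  define B where "B = {\<lambda>x. poly p (sgm (a * x + b)) | p. True}"
  have B: "bounded (range g) \<and> (\<exists>g'\<in>B. \<forall>x. (g has_real_derivative g' x) (at x))" if gB: "g \<in> B" for g
  proof -
    obtain p where g: "g = (\<lambda>x. poly p (sgm (a * x + b)))" using gB unfolding B_def by blast
    have "bounded (poly p ` {0..1})" by (intro compact_imp_bounded compact_continuous_image continuous_intros) auto
    moreover have "range g \<subseteq> poly p ` {0..1}" unfolding g using sgm_01 by (auto intro!: imageI simp: less_imp_le)
    ultimately have "bounded (range g)" by (rule bounded_subset)
    moreover have "(g has_real_derivative poly (smult a (pderiv p * [:0,1,-1:])) (sgm (a * x + b))) (at x)" for x
    proof -
      have l: "((\<lambda>x. a * x + b) has_real_derivative a) (at x)" by (auto intro!: derivative_eq_intros)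
      have "((\<lambda>x. sgm (a * x + b)) has_real_derivative (sgm (a * x + b) * (1 - sgm (a * x + b))) * a) (at x)"
        by (rule DERIV_chain2[OF sgm_deriv l])
      from DERIV_chain2[OF poly_DERIV this] show ?thesis unfolding g by (rule DERIV_cong) (simp add: algebra_simps)
    qed
    moreover have "(\<lambda>x. poly (smult a (pderiv p * [:0,1,-1:])) (sgm (a * x + b))) \<in> B" unfolding B_def by blast
    ultimately show ?thesis by (intro conjI bexI[of _ "\<lambda>x. poly (smult a (pderiv p * [:0,1,-1:])) (sgm (a * x + b))"] allI)
  qed
  have "(\<lambda>x. sgm (a * x + b)) \<in> B" unfolding B_def by (rule CollectI, rule exI[of _ "[:0,1:]"]) simp
  from FC_coord[OF B this] show ?thesis .
qed

text \<open>The L2 closure of the cylinder functions, to be shown to contain all of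
  \<open>L2 nu\<close>.\<close>

definition Dcl :: "(coeffs \<Rightarrow> real) set" where
  "Dcl = {f \<in> L2 nu. \<forall>e>0. \<exists>u\<in>FC s0. L2.nrm nu (fdiff f u) < e}"

lemma Dcl_FC: "u \<in> FC s0 \<Longrightarrow> u \<in> Dcl"
  unfolding Dcl_def using FC_L2 by (auto intro!: bexI[of _ u] simp: L2.nrm_def fdiff_def L2ip_def)

lemma Dcl_lin: assumes f: "f \<in> Dcl" and g: "g \<in> Dcl" shows "(\<lambda>x. a * f x + b * g x) \<in> Dcl"
proof -
  have fL: "f \<in> L2 nu" and gL: "g \<in> L2 nu" using f g by (auto simp: Dcl_def)
  have "\<exists>u\<in>FC s0. L2.nrm nu (fdiff (\<lambda>x. a * f x + b * g x) u) < e" if e: "e > 0" for e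
  proof -
    define d where "d = e / (\<bar>a\<bar> + \<bar>b\<bar> + 1)"
    have d: "d > 0" unfolding d_def using e by (simp add: add_nonneg_pos)
    obtain u v where u: "u \<in> FC s0" "L2.nrm nu (fdiff f u) < d" and v: "v \<in> FC s0" "L2.nrm nu (fdiff g v) < d"
      using f g d unfolding Dcl_def by blast
    have du: "fdiff f u \<in> L2 nu" by (rule L2.diff_mem[OF fL FC_L2[OF u(1)]])
    have dv: "fdiff g v \<in> L2 nu" by (rule L2.diff_mem[OF gL FC_L2[OF v(1)]])
    have "L2.nrm nu (fdiff (\<lambda>x. a * f x + b * g x) (\<lambda>x. a * u x + b * v x)) = L2.nrm nu (\<lambda>x. a * fdiff f u x + b * fdiff g v x)"
      unfolding fdiff_lin ..
    also have "\<dots> \<le> L2.nrm nu (\<lambda>x. a * fdiff f u x) + L2.nrm nu (\<lambda>x. b * fdiff g v x)"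
      by (rule L2.nrm_add[OF L2.scale_mem[OF du] L2.scale_mem[OF dv]])
    also have "\<dots> \<le> \<bar>a\<bar> * d + \<bar>b\<bar> * d"
      unfolding L2.nrm_scale[OF du] L2.nrm_scale[OF dv] using u(2) v(2) by (intro add_mono mult_left_mono) auto
    also have "\<dots> < e" 
    proof -
      have "(\<bar>a\<bar> + \<bar>b\<bar> + 1) * d = e" unfolding d_def using add_nonneg_pos[of "\<bar>a\<bar> + \<bar>b\<bar>" 1] by simp
      then show ?thesis using d by (simp add: algebra_simps)
    qed
    finally show ?thesis using FC_lin[OF u(1) v(1)] by blast
  qed
  then show ?thesis unfolding Dcl_def using L2_lin[OF fL gL] by blast
qed

text \<open>Dominated convergence: the limit inherits the bound \<open>g\<close>, so the squared
  error is at most 4 g^2.\<close>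

lemma Dcl_lim:
  assumes F: "\<And>n. F n \<in> Dcl" and f: "f \<in> L2 nu" and g: "g \<in> L2 nu" and b: "\<And>n z. \<bar>F n z\<bar> \<le> g z" and lim: "\<And>z. (\<lambda>n. F n z) \<longlonglongrightarrow> f z"
  shows "f \<in> Dcl"
proof -
  have FL: "F n \<in> L2 nu" for n using F by (auto simp: Dcl_def)
  have [measurable]: "F n \<in> borel_measurable nu" "f \<in> borel_measurable nu" for n using FL f by (auto simp: L2_def)
  have fb: "\<bar>f z\<bar> \<le> g z" for z
    by (rule LIMSEQ_le_const2[OF tendsto_rabs[OF lim]]) (use b in auto)
  have "(\<lambda>n. \<integral>z. (f z - F n z)\<^sup>2 \<partial>nu) \<longlonglongrightarrow> (\<integral>z. 0 \<partial>nu)"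
  proof (rule integral_dominated_convergence[of _ nu _ "\<lambda>z. 4 * (g z)\<^sup>2"])
    show "integrable nu (\<lambda>z. 4 * (g z)\<^sup>2)" using g by (simp add: L2_def)
    show "AE z in nu. (\<lambda>n. (f z - F n z)\<^sup>2) \<longlonglongrightarrow> 0"
    proof (rule AE_I2)
      fix z
      have "(\<lambda>n. (f z - F n z)\<^sup>2) \<longlonglongrightarrow> (f z - f z)\<^sup>2" by (intro tendsto_intros lim)
      then show "(\<lambda>n. (f z - F n z)\<^sup>2) \<longlonglongrightarrow> 0" by simp
    qed
    show "AE z in nu. norm ((f z - F n z)\<^sup>2) \<le> 4 * (g z)\<^sup>2" for n
    proof (rule AE_I2)
      fix z
      have "\<bar>f z - F n z\<bar> \<le> 2 * g z" using fb[of z] b[of n z] by linarith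
      from power_mono[OF this abs_ge_zero, of 2] show "norm ((f z - F n z)\<^sup>2) \<le> 4 * (g z)\<^sup>2" by (simp add: power_mult_distrib)
    qed
  qed measurable
  then have "(\<lambda>n. sqrt (l2dist2 nu f (F n))) \<longlonglongrightarrow> sqrt 0" unfolding l2dist2_def by (intro tendsto_real_sqrt) simp
  then have l: "(\<lambda>n. L2.nrm nu (fdiff f (F n))) \<longlonglongrightarrow> 0" unfolding l2dist2_nrm by simp
  have "\<exists>u\<in>FC s0. L2.nrm nu (fdiff f u) < e" if e: "e > 0" for e
  proof -
    obtain n where n: "L2.nrm nu (fdiff f (F n)) < e / 2"
      using order_tendstoD(2)[OF l, of "e / 2"] e eventually_happens'[OF sequentially_bot] by auto
    obtain u where u: "u \<in> FC s0" "L2.nrm nu (fdiff (F n) u) < e / 2" using F[of n] e half_gt_zero[OF e] unfolding Dcl_def by blast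
    have "L2.nrm nu (fdiff f u) \<le> L2.nrm nu (fdiff f (F n)) + L2.nrm nu (fdiff (F n) u)"
      by (rule L2.nrm_triangle[OF f FL FC_L2[OF u(1)]])
    then show ?thesis using n u by (intro bexI[of _ u]) auto
  qed
  then show ?thesis using f by (simp add: Dcl_def)
qed

lemma const_L2: "(\<lambda>_. c) \<in> L2 nu" by (rule FC_L2[OF FC_const])

lemma Dcl_sum: assumes "finite I" "\<And>i. i \<in> I \<Longrightarrow> f i \<in> Dcl" shows "(\<lambda>x. \<Sum>i\<in>I. c i * f i x) \<in> Dcl"
  using assms
proof (induction I rule: finite_induct)
  case empty show ?case using Dcl_FC[OF FC_const[of 0]] by simp
next
  case (insert i I)
  have "(\<lambda>x. c i * f i x + 1 * (\<Sum>i\<in>I. c i * f i x)) \<in> Dcl"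
    by (rule Dcl_lin) (use insert in auto)
  then show ?case using insert by simp
qed

text \<open>A generating class of the product sigma-algebra that is stable under intersections;
  \<open>F\<close> may bound the same coordinate several times, so an intersection corresponds to a
  union of the constraint sets.\<close>

definition boxes :: "coeffs set set" where
  "boxes = {{z. \<forall>(k, c)\<in>F. c < z k} | F. finite F}"

lemma sets_gff_boxes: "sets gff \<subseteq> sigma_sets UNIV boxes"
proof -
  have "(\<lambda>z. z) \<in> measurable (sigma UNIV boxes) (PiM UNIV (\<lambda>_. borel :: real measure))"
  proof (rule measurable_PiM_single')
    fix k :: "int \<times> int"
    show "(\<lambda>z. z k) \<in> borel_measurable (sigma UNIV boxes)"
      unfolding borel_measurable_iff_greater
    proof
      fix a
      have "{z::coeffs. a < z k} \<in> boxes" unfolding boxes_def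
        by (rule CollectI, rule exI[of _ "{(k, a)}"]) simp
      then show "{w \<in> space (sigma UNIV boxes). a < w k} \<in> sets (sigma UNIV boxes)"
        by (simp add: sets_measure_of_conv)
    qed
  qed (simp add: PiE_def)
  then have "A \<in> sets (sigma UNIV boxes)" if "A \<in> sets gff" for A
    using measurable_sets[of "\<lambda>z. z" "sigma UNIV boxes" _ A] that unfolding sets_gff by (simp add: space_measure_of_conv)
  then show ?thesis by (auto simp: sets_measure_of_conv)
qed

lemma indicator_L2: "A \<in> sets gff \<Longrightarrow> indicator A \<in> L2 nu"
  by (rule bounded_L2[of _ 1]) (auto simp: indicator_def)

lemma box1: "{z \<in> space gff. c < z k} \<in> sets gff" by measurable

lemma boxes_sets: "A \<in> boxes \<Longrightarrow> A \<in> sets gff"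
proof -
  assume "A \<in> boxes"
  then obtain F where F: "finite F" "A = {z. \<forall>(k, c)\<in>F. c < z k}" by (auto simp: boxes_def)
  have "A = (\<Inter>(k, c)\<in>F. {z \<in> space gff. c < z k})" using F by auto
  also have "\<dots> \<in> sets gff" 
  proof (cases "F = {}")
    case True then show ?thesis using sets.top[of gff] by simp
  next
    case False then show ?thesis using F(1) by (intro sets.finite_INT) (auto simp only: split_def intro!: box1)
  qed
  finally show ?thesis .
qed

text \<open>A product of logistic steps, one per constraint, stays between 0 and 1 and converges
  pointwise to the indicator.\<close>

lemma Dcl_boxes: assumes "A \<in> boxes" shows "indicator A \<in> Dcl"
proof -
  obtain F where F: "finite F" "A = {z. \<forall>(k, c)\<in>F. c < z k}" using assms by (auto simp: boxes_def)
  define h where "h n z = (\<Prod>p\<in>F. sgm (real n ^ 2 * (z (fst p) - snd p) - real n))" for n and z :: coeffs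
  have ind: "indicator A z = (\<Prod>p\<in>F. if snd p < z (fst p) then 1 else 0 :: real)" for z
  proof (cases "z \<in> A")
    case True
    then have "(\<Prod>p\<in>F. if snd p < z (fst p) then 1 else 0 :: real) = (\<Prod>p\<in>F. 1)" using F by (intro prod.cong) auto
    then show ?thesis using True by simp
  next
    case False
    then obtain p where "p \<in> F" "\<not> snd p < z (fst p)" using F by fastforce
    then have "(\<Prod>p\<in>F. if snd p < z (fst p) then 1 else 0 :: real) = 0" using F(1) by (intro prod_zero) auto
    then show ?thesis using False by simp
  qed
  have hF: "h n \<in> FC s0" for n
  proof -
    have "(\<lambda>z. sgm (real n ^ 2 * (z (fst p) - snd p) - real n)) \<in> FC s0" for p
      using FC_sgm[of "real n ^ 2" "fst p" "- (real n ^ 2 * snd p) - real n"] by (simp add: algebra_simps)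
    then show ?thesis unfolding h_def[abs_def] by (intro FC_prod F(1))
  qed
  show ?thesis
  proof (rule Dcl_lim[of h, OF Dcl_FC[OF hF] indicator_L2[OF boxes_sets[OF assms]] const_L2[of 1]])
    fix n z
    have "\<bar>h n z\<bar> = (\<Prod>p\<in>F. sgm (real n ^ 2 * (z (fst p) - snd p) - real n))"
      unfolding h_def using sgm_01(1) by (intro abs_of_nonneg prod_nonneg) (auto simp: less_imp_le)
    also have "\<dots> \<le> 1" by (rule prod_le_1) (use sgm_01 in \<open>auto simp: less_imp_le\<close>)
    finally show "\<bar>h n z\<bar> \<le> 1" .
  next
    fix z show "(\<lambda>n. h n z) \<longlonglongrightarrow> indicator A z" unfolding h_def ind by (rule tendsto_prod) (rule sgm_step)
  qed
qed

text \<open>Dynkin's argument: the sets whose indicator is approximable contain the boxes and are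
  stable under complements and countable disjoint unions, the latter by \<open>Dcl_lim\<close> with
  the constant majorant 1.\<close>

lemma Dcl_indicator: assumes "A \<in> sets gff" shows "indicator A \<in> Dcl"
proof -
  have "A \<in> sigma_sets UNIV boxes" using assms sets_gff_boxes by blast
  then have "A \<in> sets gff \<and> (indicator A :: coeffs \<Rightarrow> real) \<in> Dcl"
  proof (rule sigma_sets_induct_disjoint[rotated 2])
    show "Int_stable boxes"
    proof (rule Int_stableI)
      fix a b assume "a \<in> boxes" "b \<in> boxes"
      then obtain F G where F: "finite F" "a = {z. \<forall>(k, c)\<in>F. c < z k}" and G: "finite G" "b = {z. \<forall>(k, c)\<in>G. c < z k}"
        unfolding boxes_def by blast
      have "a \<inter> b = {z. \<forall>(k, c)\<in>F \<union> G. c < z k}" unfolding F G by auto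
      then show "a \<inter> b \<in> boxes" unfolding boxes_def using F G by blast
    qed
    show "boxes \<subseteq> Pow UNIV" by simp
  next
    fix A assume "A \<in> boxes"
    then show "A \<in> sets gff \<and> (indicator A :: coeffs \<Rightarrow> real) \<in> Dcl" using boxes_sets Dcl_boxes by blast
  next
    show "{} \<in> sets gff \<and> (indicator {} :: coeffs \<Rightarrow> real) \<in> Dcl" using Dcl_FC[OF FC_const[of 0]] by (simp add: indicator_def[abs_def])
  next
    fix A assume A: "A \<in> sets gff \<and> (indicator A :: coeffs \<Rightarrow> real) \<in> Dcl"
    have "indicator (UNIV - A) = (\<lambda>x. 1 * (1::real) + (-1) * indicator A x)" by (auto simp: indicator_def)
    moreover have "UNIV - A \<in> sets gff" using A sets.compl_sets[of A gff] by simp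
    ultimately show "UNIV - A \<in> sets gff \<and> (indicator (UNIV - A) :: coeffs \<Rightarrow> real) \<in> Dcl"
      using Dcl_lin[OF Dcl_FC[OF FC_const[of 1]], of "indicator A" 1 "-1"] A by simp
  next
    fix A :: "nat \<Rightarrow> coeffs set"
    assume d: "disjoint_family A" and A: "\<And>i. A i \<in> sets gff \<and> (indicator (A i) :: coeffs \<Rightarrow> real) \<in> Dcl"
    have U: "(\<Union>i. A i) \<in> sets gff" using A by blast
    have eq: "(\<Sum>i<n. indicator (A i) z) = (indicator (\<Union>i<n. A i) z :: real)" for n z
      using d by (subst indicator_UN_disjoint) (auto simp: disjoint_family_on_def)
    have "indicator (\<Union>i. A i) \<in> Dcl"
    proof (rule Dcl_lim[of "\<lambda>n z. \<Sum>i<n. indicator (A i) z" _ "\<lambda>_. 1"])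
      show "(\<lambda>z. \<Sum>i<n. indicator (A i) z) \<in> Dcl" for n
        using Dcl_sum[of "{..<n}" "\<lambda>i. indicator (A i)" "\<lambda>_. 1"] A by simp
      show "\<bar>\<Sum>i<n. indicator (A i) z :: real\<bar> \<le> 1" for n z unfolding eq by (simp add: indicator_def)
      show "(\<lambda>n. \<Sum>i<n. indicator (A i) z :: real) \<longlonglongrightarrow> indicator (\<Union>i. A i) z" for z
        unfolding eq by (rule LIMSEQ_indicator_UN)
    qed (rule indicator_L2[OF U], rule const_L2)
    then show "(\<Union>i. A i) \<in> sets gff \<and> (indicator (\<Union>i. A i) :: coeffs \<Rightarrow> real) \<in> Dcl" using U by blast
  qed
  then show ?thesis by blast
qed

text \<open>Simple functions are combinations of indicators and can be chosen dominated by 2 |f|, so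
  \<open>Dcl_lim\<close> applies.\<close>

lemma dense_FC:
  assumes f: "f \<in> L2 nu" and e: "e > 0" shows "\<exists>u\<in>FC s0. l2dist2 nu f u < e"
proof -
  have fm: "f \<in> borel_measurable nu" using f by (simp add: L2_def)
  obtain F where F: "\<And>i. simple_function nu (F i)" "\<And>x. x \<in> space nu \<Longrightarrow> (\<lambda>i. F i x) \<longlonglongrightarrow> f x"
      "\<And>i x. x \<in> space nu \<Longrightarrow> dist (F i x) 0 \<le> 2 * dist (f x) 0"
    using borel_measurable_implies_sequence_metric[OF fm, of 0] by blast
  have "F i \<in> Dcl" for i
  proof -
    have fin: "finite (range (F i))" using simple_functionD(1)[OF F(1)[of i]] by simp
    have st: "{x. F i x = y} \<in> sets gff" for y
      using simple_functionD(2)[OF F(1)[of i], of "{y}"] by (simp add: vimage_def)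
    have "F i x = (\<Sum>y\<in>range (F i). y * indicator {x. F i x = y} x)" for x
    proof -
      have "(\<Sum>y\<in>range (F i). y * indicator {x. F i x = y} x) = (\<Sum>y\<in>range (F i). if y = F i x then y else 0)"
        by (intro sum.cong) (auto simp: indicator_def)
      then show ?thesis using fin by simp
    qed
    then have "F i = (\<lambda>x. \<Sum>y\<in>range (F i). y * indicator {x. F i x = y} x)" by blast
    then show ?thesis using Dcl_sum[OF fin, of "\<lambda>y. indicator {x. F i x = y}" "\<lambda>y. y"] Dcl_indicator[OF st] by simp
  qed
  moreover have "(\<lambda>x. 2 * \<bar>f x\<bar>) \<in> L2 nu" using f by (auto simp: L2_def power_mult_distrib)
  ultimately have "f \<in> Dcl"
    by (rule Dcl_lim[OF _ f]) (use F(2,3) in auto)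
  then obtain u where u: "u \<in> FC s0" "L2.nrm nu (fdiff f u) < sqrt e" using e real_sqrt_gt_zero[OF e] unfolding Dcl_def by blast
  have "sqrt (l2dist2 nu f u) < sqrt e" using u(2) unfolding l2dist2_nrm .
  then show ?thesis using u(1) by (intro bexI[of _ u]) simp
qed

lemma dirichlet_FC: "dirichlet_form nu (closure_dom nu (FC s0) Eform) (closure_form nu (FC s0) Eform)"
  by (rule closable_pos_form.dirichlet_form_closure[OF closable_pos_form_FC dense_FC contraction_FC])

end

section \<open>Quasi-regularity\<close>

lemma Vinner_self: "Vinner \<alpha> u u = (u (0,0))\<^sup>2 + (\<Sum>\<^sub>\<infinity>k\<in>nz. lam k powr \<alpha> * (u k)\<^sup>2)"
  by (simp add: Vinner_def power2_eq_square mult.assoc)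

lemma V_infsum_nonneg: "0 \<le> (\<Sum>\<^sub>\<infinity>k\<in>nz. lam k powr \<alpha> * (u k)\<^sup>2)"
  by (rule infsum_nonneg) simp

text \<open>Coefficient families are functions on the lattice, so the seminorm calculus for forms
  applies to V^\<alpha>; it supplies the triangle inequality for \<open>Edist\<close> and
  Cauchy-Schwarz for pairings.\<close>

interpretation V: pos_form "{u. in_V \<alpha> u}" "Vinner \<alpha>" for \<alpha>
proof
  fix u v w :: coeffs and a b :: real
  assume "u \<in> {u. in_V \<alpha> u}" "v \<in> {u. in_V \<alpha> u}" "w \<in> {u. in_V \<alpha> u}"
  then have u: "in_V \<alpha> u" and v: "in_V \<alpha> v" and w: "in_V \<alpha> w" by auto
  show "Vinner \<alpha> (\<lambda>x. a * u x + b * v x) w = a * Vinner \<alpha> u w + b * Vinner \<alpha> v w"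
    by (rule Vinner_lin[OF u v w])
next
  fix u v :: coeffs and a b :: real
  assume "u \<in> {u. in_V \<alpha> u}" "v \<in> {u. in_V \<alpha> u}"
  then show "(\<lambda>x. a * u x + b * v x) \<in> {u. in_V \<alpha> u}" by (simp add: V_lin)
  show "Vinner \<alpha> u v = Vinner \<alpha> v u" by (simp add: Vinner_def mult_ac)
  show "0 \<le> Vinner \<alpha> u u" unfolding Vinner_self using V_infsum_nonneg by (intro add_nonneg_nonneg) auto
qed

lemma Vinner_ge_0: "(u (0,0))\<^sup>2 \<le> Vinner \<alpha> u u"
  unfolding Vinner_self using V_infsum_nonneg by simp

lemma Vinner_ge_sum:
  assumes u: "in_V \<alpha> u" and K: "finite K" "K \<subseteq> nz"
  shows "(u (0,0))\<^sup>2 + (\<Sum>k\<in>K. lam k powr \<alpha> * (u k)\<^sup>2) \<le> Vinner \<alpha> u u"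
  unfolding Vinner_self using finite_sum_le_infsum[OF u[unfolded in_V_def] K] by simp

lemma Vinner_eq_0:
  assumes u: "in_V \<alpha> u" and 0: "Vinner \<alpha> u u = 0" shows "u k = 0"
proof (cases "k \<in> nz")
  case True
  have "(u (0,0))\<^sup>2 + lam k powr \<alpha> * (u k)\<^sup>2 \<le> 0" using Vinner_ge_sum[OF u, of "{k}"] True 0 by simp
  then have "lam k powr \<alpha> * (u k)\<^sup>2 \<le> 0" using zero_le_power2[of "u (0,0)"] by linarith
  then show ?thesis using lam_pos[OF True] by (simp add: mult_le_0_iff)
next
  case False
  then have "k = (0,0)" by (simp add: nz_def)
  then show ?thesis using Vinner_ge_0[of u \<alpha>] 0 by simp
qed

lemma Edist_nrm: "Edist s0 u v = V.nrm (-1 - s0) (fdiff u v)"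
  by (simp add: Edist_def V.nrm_def fdiff_def)

lemma Metric_Espace: "Metric_space (Espace s0) (Edist s0)"
proof
  fix x y :: coeffs
  show "0 \<le> Edist s0 x y"
    unfolding Edist_def Vinner_self using V_infsum_nonneg by (intro real_sqrt_ge_zero add_nonneg_nonneg) auto
  show "Edist s0 x y = Edist s0 y x" unfolding Edist_def Vinner_self by (simp add: power2_commute)
next
  fix x y z assume x: "x \<in> Espace s0" and y: "y \<in> Espace s0"
  then have x': "x \<in> {u. in_V (-1 - s0) u}" and y': "y \<in> {u. in_V (-1 - s0) u}" by (simp_all add: Espace_def)
  have d: "in_V (-1 - s0) (fdiff x y)" using V.diff_mem[OF x' y'] by simp
  show "(Edist s0 x y = 0) = (x = y)"
  proof
    assume "Edist s0 x y = 0"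
    then have "Vinner (-1 - s0) (fdiff x y) (fdiff x y) = 0" by (simp add: Edist_def fdiff_def)
    from Vinner_eq_0[OF d this] show "x = y" by (auto simp: fdiff_def)
  qed (simp add: Edist_def Vinner_def)
  assume "z \<in> Espace s0"
  then have z': "z \<in> {u. in_V (-1 - s0) u}" by (simp add: Espace_def)
  show "Edist s0 x z \<le> Edist s0 x y + Edist s0 y z"
    unfolding Edist_nrm by (rule V.nrm_triangle[OF x' y' z'])
qed

interpretation ES: Metric_space "Espace s0" "Edist s0" for s0 by (rule Metric_Espace)

lemma topspace_Etop[simp]: "topspace (Etop s0) = Espace s0"
  by (simp add: Etop_def)

context fc_setting
begin

text \<open>Riesz representation in E: multiplying the coefficients of \<open>l\<close> by
  \<open>lam k\<close> to the power s0 moves it into V^{-1-s0} and turns the pairing into the inner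
  product of E; hence the pairing is Lipschitz.\<close>

lemma pairing_continuous:
  assumes l: "l \<in> Estar s0" shows "continuous_map (Etop s0) euclideanreal (pairing l)"
proof -
  define l' where "l' k = (if k = (0,0) then l k else lam k powr s0 * l k)" for k
  have eq: "lam k powr (-1 - s0) * (l' k)\<^sup>2 = lam k powr (s0 - 1) * (l k)\<^sup>2" if "k \<in> nz" for k
  proof -
    have "lam k powr (-1 - s0) * (lam k powr s0 * lam k powr s0) = lam k powr (s0 - 1)"
      by (simp flip: powr_add)
    then show ?thesis using that by (simp add: l'_def nz_def power2_eq_square mult_ac)
  qed
  have l'V: "in_V (-1 - s0) l'" using l unfolding Estar_def in_V_def mem_Collect_eq
    by (rule summable_on_cong[THEN iffD2, rotated]) (simp add: eq)
  have P: "pairing l z = Vinner (-1 - s0) l' z" if "z \<in> Espace s0" for z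
  proof -
    have "lam k powr (-1) * l k * z k = lam k powr (-1 - s0) * l' k * z k" if "k \<in> nz" for k
    proof -
      have "lam k powr (-1 - s0) * lam k powr s0 = lam k powr (-1)" by (simp flip: powr_add)
      then show ?thesis using that by (simp add: l'_def nz_def mult.assoc[symmetric])
    qed
    then have "(\<Sum>\<^sub>\<infinity>k\<in>nz. lam k powr (-1) * l k * z k) = (\<Sum>\<^sub>\<infinity>k\<in>nz. lam k powr (-1 - s0) * l' k * z k)"
      by (rule infsum_cong)
    then show ?thesis unfolding pairing_eq[OF psum_E[OF l that]] Vinner_def by (simp add: l'_def)
  qed
  define C where "C = V.nrm (-1 - s0) l' + 1"
  have C: "C > 0" unfolding C_def using V.nrm_nonneg[of l' "-1 - s0"] l'V by simp
  have lip: "\<bar>pairing l z - pairing l w\<bar> \<le> C * Edist s0 z w" if z: "z \<in> Espace s0" and w: "w \<in> Espace s0" for z w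
  proof -
    have z': "z \<in> {u. in_V (-1 - s0) u}" and w': "w \<in> {u. in_V (-1 - s0) u}" and l'': "l' \<in> {u. in_V (-1 - s0) u}"
      using z w l'V by (simp_all add: Espace_def)
    have "pairing l z - pairing l w = Vinner (-1 - s0) l' (fdiff z w)"
      unfolding P[OF z] P[OF w] V.B_diff_right[OF z' w' l''] ..
    then have "\<bar>pairing l z - pairing l w\<bar> \<le> V.nrm (-1 - s0) l' * Edist s0 z w"
      unfolding Edist_nrm using V.abs_le_nrm[OF l'' V.diff_mem[OF z' w']] by simp
    also have "\<dots> \<le> C * Edist s0 z w" unfolding C_def by (intro mult_right_mono) auto
    finally show ?thesis .
  qed
  have "continuous_map (ES.mtopology s0) Met_TC.mtopology (pairing l)"
    unfolding ES.metric_continuous_map[OF Met_TC.Metric_space_axioms]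
  proof (intro conjI ballI allI impI)
    fix a and e :: real assume a: "a \<in> Espace s0" and e: "e > 0"
    have "dist (pairing l a) (pairing l x) < e" if "x \<in> Espace s0 \<and> Edist s0 a x < e / C" for x
    proof -
      have "\<bar>pairing l a - pairing l x\<bar> \<le> C * Edist s0 a x" using that by (intro lip a) simp
      also have "\<dots> < C * (e / C)" using that C by (intro mult_strict_left_mono) auto
      also have "\<dots> = e" using C by simp
      finally show ?thesis by (simp add: dist_real_def)
    qed
    moreover have "e / C > 0" using e C by simp
    ultimately show "\<exists>\<delta>>0. \<forall>x. x \<in> Espace s0 \<and> Edist s0 a x < \<delta> \<longrightarrow> dist (pairing l a) (pairing l x) < e" by blast
  qed simp
  then show ?thesis by (simp add: Etop_def)
qed

lemma FC_continuous:
  assumes "\<phi> \<in> FC s0" shows "continuous_map (Etop s0) euclideanreal \<phi>"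
proof -
  obtain m f l where f: "Cb_inf m f" "\<forall>i<m. l i \<in> Estar s0" "\<phi> = (\<lambda>z. f (ev m l z))"
    using assms unfolding FC_iff by blast
  have "continuous_map (Etop s0) (product_topology (\<lambda>_. euclideanreal) UNIV) (ev m l)"
    unfolding continuous_map_componentwise_UNIV ev_def[abs_def]
  proof
    fix k show "continuous_map (Etop s0) euclideanreal (\<lambda>x. if k < m then pairing (l k) x else 0)"
      using pairing_continuous[of "l k"] f(2) by (cases "k < m") auto
  qed
  then have "continuous_map (Etop s0) euclidean (ev m l)" unfolding euclidean_product_topology .
  moreover have "continuous_map euclidean euclideanreal f"
    using Cb_inf_cont[OF f(1), of "[]"] by simp
  ultimately show ?thesis unfolding f(3) using continuous_map_compose[of "Etop s0" euclidean "ev m l" euclideanreal f] by (simp add: comp_def)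
qed

section \<open>Compact balls of V^-1 inside E\<close>

definition FQ :: "real \<Rightarrow> coeffs set" where
  "FQ r = {z. in_V (-1) z \<and> Vinner (-1) z z \<le> r}"

lemma V_subset_Espace: "in_V (-1) z \<Longrightarrow> z \<in> Espace s0"
proof -
  assume "in_V (-1) z"
  then show ?thesis unfolding Espace_def in_V_def mem_Collect_eq
  proof (rule summable_on_bound)
    fix k assume k: "k \<in> nz"
    have "lam k powr (-1 - s0) \<le> lam k powr (-1)" by (rule powr_mono) (use lam_ge_1[OF k] s0 in auto)
    then have "lam k powr (-1 - s0) * (z k)\<^sup>2 \<le> lam k powr (-1) * (z k)\<^sup>2" by (rule mult_right_mono) simp
    then show "\<bar>lam k powr (-1 - s0) * (z k)\<^sup>2\<bar> \<le> lam k powr (-1) * (z k)\<^sup>2" by simp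
  qed
qed

lemma lam_large: assumes "k \<in> nz" "k \<notin> Kn j" shows "real j \<le> lam k"
proof -
  have "int j < \<bar>fst k\<bar> \<or> int j < \<bar>snd k\<bar>" using assms by (auto simp: Kn_def)
  then have "real j \<le> \<bar>real_of_int (fst k)\<bar> \<or> real j \<le> \<bar>real_of_int (snd k)\<bar>" by linarith
  moreover have "max 1 a * 1 \<le> max 1 a * max 1 b" "1 * max 1 b \<le> max 1 a * max 1 b" for a b :: real
    by (intro mult_left_mono mult_right_mono; simp)+
  ultimately have "real j \<le> max 1 \<bar>real_of_int (fst k)\<bar> * max 1 \<bar>real_of_int (snd k)\<bar>"
    by (smt (verit) max.cobounded2 mult_1 mult.right_neutral)
  then show ?thesis using lam_lower[OF assms(1)] by linarith
qed

text \<open>Outside the box of size \<open>j\<close> the eigenvalues are at least \<open>j\<close>,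
  so passing from exponent -1 to -1 - s0 gains the factor j^-s0. This gain is the compactness of the
  embedding.\<close>

lemma FQ_tail:
  assumes z: "in_V (-1) z" and j: "j > 0"
  shows "Vinner (-1 - s0) z z \<le> (z (0,0))\<^sup>2 + (\<Sum>k\<in>Kn j. lam k powr (-1 - s0) * (z k)\<^sup>2) + real j powr (- s0) * Vinner (-1) z z"
proof -
  let ?f = "\<lambda>k. lam k powr (-1 - s0) * (z k)\<^sup>2" and ?g = "\<lambda>k. lam k powr (-1) * (z k)\<^sup>2"
  have sf: "?f summable_on nz" using V_subset_Espace[OF z] by (simp add: Espace_def in_V_def)
  have sg: "?g summable_on nz" using z by (simp add: in_V_def)
  have si: "(\<lambda>k. if k \<in> Kn j then ?f k else 0) summable_on nz"
    by (rule finite_nonzero_values_imp_summable_on, rule finite_subset[OF _ finite_Kn[of j]]) auto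
  have "infsum ?f nz \<le> (\<Sum>\<^sub>\<infinity>k\<in>nz. (if k \<in> Kn j then ?f k else 0) + real j powr (- s0) * ?g k)"
  proof (rule infsum_mono[OF sf])
    show "(\<lambda>k. (if k \<in> Kn j then ?f k else 0) + real j powr (- s0) * ?g k) summable_on nz"
      by (intro summable_on_add si summable_on_cmult_right sg)
    fix k assume k: "k \<in> nz"
    show "?f k \<le> (if k \<in> Kn j then ?f k else 0) + real j powr (- s0) * ?g k"
    proof (cases "k \<in> Kn j")
      case False
      have "lam k powr (-1 - s0) = lam k powr (- s0) * lam k powr (-1)"
        unfolding powr_add[symmetric] by (rule arg_cong[where f = "(powr) (lam k)"]) simp
      also have "\<dots> \<le> real j powr (- s0) * lam k powr (-1)"
        using lam_large[OF k False] j s0 by (intro mult_right_mono powr_mono2') auto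
      finally have "?f k \<le> (real j powr (- s0) * lam k powr (-1)) * (z k)\<^sup>2" by (rule mult_right_mono) simp
      then show ?thesis using False by (simp add: mult.assoc)
    qed simp
  qed
  also have "\<dots> = (\<Sum>\<^sub>\<infinity>k\<in>nz. if k \<in> Kn j then ?f k else 0) + real j powr (- s0) * infsum ?g nz"
    by (subst infsum_add[OF si summable_on_cmult_right[OF sg]]) (simp only: infsum_cmult_right')
  also have "(\<Sum>\<^sub>\<infinity>k\<in>nz. if k \<in> Kn j then ?f k else 0) = (\<Sum>\<^sub>\<infinity>k\<in>Kn j. ?f k)"
    by (rule infsum_cong_neutral) (use Kn_nz in auto)
  also have "\<dots> = (\<Sum>k\<in>Kn j. ?f k)" by (rule infsum_finite) simp
  finally have "infsum ?f nz \<le> (\<Sum>k\<in>Kn j. ?f k) + real j powr (- s0) * infsum ?g nz" .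
  moreover have "real j powr (- s0) * infsum ?g nz \<le> real j powr (- s0) * Vinner (-1) z z"
    unfolding Vinner_self by (intro mult_left_mono) auto
  ultimately show ?thesis unfolding Vinner_self[of "-1 - s0"] by linarith
qed

text \<open>Finite partial sums pass to the limit coordinate by coordinate, and their bound
  \<open>r\<close> is uniform in the set of modes.\<close>

lemma FQ_limit:
  assumes y: "\<And>n. y n \<in> FQ r" and l: "\<And>k. (\<lambda>n. y n k) \<longlonglongrightarrow> l k"
  shows "l \<in> FQ r"
proof -
  have fin: "(l (0,0))\<^sup>2 + (\<Sum>k\<in>K. lam k powr (-1) * (l k)\<^sup>2) \<le> r" if K: "finite K" "K \<subseteq> nz" for K
  proof (rule LIMSEQ_le_const2)
    show "(\<lambda>n. (y n (0,0))\<^sup>2 + (\<Sum>k\<in>K. lam k powr (-1) * (y n k)\<^sup>2)) \<longlonglongrightarrow> (l (0,0))\<^sup>2 + (\<Sum>k\<in>K. lam k powr (-1) * (l k)\<^sup>2)"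
      by (intro tendsto_intros l)
    have "(y n (0,0))\<^sup>2 + (\<Sum>k\<in>K. lam k powr (-1) * (y n k)\<^sup>2) \<le> r" for n
      using Vinner_ge_sum[OF _ K, of "-1" "y n"] y[of n] by (simp add: FQ_def)
    then show "\<exists>N. \<forall>n\<ge>N. (y n (0,0))\<^sup>2 + (\<Sum>k\<in>K. lam k powr (-1) * (y n k)\<^sup>2) \<le> r" by blast
  qed
  have fin': "(\<Sum>k\<in>K. lam k powr (-1) * (l k)\<^sup>2) \<le> r - (l (0,0))\<^sup>2" if K: "finite K" "K \<subseteq> nz" for K
    using fin[OF K] by linarith
  have s: "(\<lambda>k. lam k powr (-1) * (l k)\<^sup>2) summable_on nz"
    by (rule nonneg_bdd_above_summable_on, simp, rule bdd_aboveI2[of _ _ "r - (l (0,0))\<^sup>2"]) (use fin' in auto)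
  have "infsum (\<lambda>k. lam k powr (-1) * (l k)\<^sup>2) nz \<le> r - (l (0,0))\<^sup>2"
    by (rule infsum_le_finite_sums[OF s fin'])
  then show ?thesis using s by (simp add: FQ_def in_V_def Vinner_self)
qed

text \<open>Coordinatewise convergence handles finitely many modes, and \<open>FQ_tail\<close> makes
  the remaining ones uniformly small on bounded sets of V^-1.\<close>

lemma FQ_convergence:
  assumes y: "\<And>n. y n \<in> FQ r" and l: "\<And>k. (\<lambda>n. y n k) \<longlonglongrightarrow> l k"
  shows "(\<lambda>n. Edist s0 (y n) l) \<longlonglongrightarrow> 0"
proof -
  have lF: "l \<in> FQ r" by (rule FQ_limit[OF y l])
  define h where "h n = fdiff (y n) l" for n
  have hV: "in_V (-1) (h n)" and hb: "Vinner (-1) (h n) (h n) \<le> 4 * \<bar>r\<bar>" for n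
  proof -
    have a: "y n \<in> {u. in_V (-1) u}" "l \<in> {u. in_V (-1) u}" using y[of n] lF by (simp_all add: FQ_def)
    from V.diff_mem[OF a] show "in_V (-1) (h n)" by (simp add: h_def)
    \<comment> \<open>The parallelogram identity bounds the squared norm of the difference by 2 r +
      2 r.\<close>
    have "Vinner (-1) (h n) (h n) + Vinner (-1) (\<lambda>k. 1 * y n k + 1 * l k) (\<lambda>k. 1 * y n k + 1 * l k) = 2 * Vinner (-1) (y n) (y n) + 2 * Vinner (-1) l l"
      using V.expand[OF a, of 1 "-1"] V.expand[OF a, of 1 1] by (simp add: h_def fdiff_def)
    moreover have "0 \<le> Vinner (-1) (\<lambda>k. 1 * y n k + 1 * l k) (\<lambda>k. 1 * y n k + 1 * l k)"
      by (rule V.pos[OF V.lin[OF a]])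
    moreover have "Vinner (-1) (y n) (y n) \<le> r" "Vinner (-1) l l \<le> r" using y[of n] lF by (simp_all add: FQ_def)
    ultimately show "Vinner (-1) (h n) (h n) \<le> 4 * \<bar>r\<bar>" by linarith
  qed
  have hl: "(\<lambda>n. h n k) \<longlonglongrightarrow> 0" for k using tendsto_diff[OF l tendsto_const, of k "l k"] by (simp add: h_def fdiff_def)
  have "(\<lambda>n. Vinner (-1 - s0) (h n) (h n)) \<longlonglongrightarrow> 0"
  proof (rule LIMSEQ_I)
    fix e :: real assume e: "e > 0"
    have "((\<lambda>j. real j powr (- s0) * (4 * \<bar>r\<bar>)) \<longlongrightarrow> 0) sequentially"
      by (intro tendsto_mult_left_zero tendsto_neg_powr filterlim_real_sequentially) (use s0 in simp)
    from order_tendstoD(2)[OF this, of "e / 2"] e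
    have "\<forall>\<^sub>F j in sequentially. real j powr (- s0) * (4 * \<bar>r\<bar>) < e / 2 \<and> j > 0"
      by (intro eventually_conj eventually_gt_at_top) auto
    then obtain j where j: "real j powr (- s0) * (4 * \<bar>r\<bar>) < e / 2" "j > 0"
      using eventually_happens'[OF sequentially_bot] by auto
    have "(\<lambda>n. (h n (0,0))\<^sup>2 + (\<Sum>k\<in>Kn j. lam k powr (-1 - s0) * (h n k)\<^sup>2)) \<longlonglongrightarrow> 0\<^sup>2 + (\<Sum>k\<in>Kn j. lam k powr (-1 - s0) * 0\<^sup>2)"
      by (intro tendsto_intros hl)
    then have "(\<lambda>n. (h n (0,0))\<^sup>2 + (\<Sum>k\<in>Kn j. lam k powr (-1 - s0) * (h n k)\<^sup>2)) \<longlonglongrightarrow> 0" by simp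
    from order_tendstoD(2)[OF this, of "e / 2"] e
    obtain N where N: "\<forall>n\<ge>N. (h n (0,0))\<^sup>2 + (\<Sum>k\<in>Kn j. lam k powr (-1 - s0) * (h n k)\<^sup>2) < e / 2"
      unfolding eventually_sequentially by auto
    have "norm (Vinner (-1 - s0) (h n) (h n) - 0) < e" if n: "n \<ge> N" for n
    proof -
      have "real j powr (- s0) * Vinner (-1) (h n) (h n) \<le> real j powr (- s0) * (4 * \<bar>r\<bar>)"
        by (rule mult_left_mono[OF hb]) simp
      then have "Vinner (-1 - s0) (h n) (h n) < e" using FQ_tail[OF hV j(2), of n] N[rule_format, OF n] j(1) by linarith
      moreover have "0 \<le> Vinner (-1 - s0) (h n) (h n)" using Vinner_ge_0 zero_le_power2 order_trans by blast
      ultimately show ?thesis by simp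
    qed
    then show "\<exists>N. \<forall>n\<ge>N. norm (Vinner (-1 - s0) (h n) (h n) - 0) < e" by blast
  qed
  then have "(\<lambda>n. sqrt (Vinner (-1 - s0) (h n) (h n))) \<longlonglongrightarrow> sqrt 0" by (rule tendsto_real_sqrt)
  then show ?thesis by (simp add: Edist_def h_def fdiff_def)
qed

text \<open>A bounded set of V^-1 sits in a product of compact intervals, where Tychonoff gives a
  coordinatewise convergent subsequence; by the two preceding lemmas it converges in E to a point of
  the set.\<close>

lemma FQ_compact: "compactin (Etop s0) (FQ r)"
  unfolding Etop_def ES.compactin_sequentially
proof (intro conjI allI impI)
  show "FQ r \<subseteq> Espace s0" using V_subset_Espace by (auto simp: FQ_def)
  fix y :: "nat \<Rightarrow> coeffs" assume "range y \<subseteq> FQ r"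
  then have y: "y n \<in> FQ r" for n by blast
  \<comment> \<open>A generous bound with \<open>b k \<ge> 1\<close>: then (1 + lam k) |r| <= b k <=
    (b k)^2, which avoids square roots. The summand 1 next to \<open>lam k\<close> covers the zero
    mode, where \<open>lam\<close> is 0.\<close>
  define b where "b k = (1 + lam k) * (1 + \<bar>r\<bar>)" for k
  have yb: "y n k \<in> {- b k..b k}" for n k
  proof -
    have V: "in_V (-1) (y n)" "Vinner (-1) (y n) (y n) \<le> r" using y[of n] by (simp_all add: FQ_def)
    have "(y n k)\<^sup>2 \<le> (1 + lam k) * \<bar>r\<bar>"
    proof (cases "k \<in> nz")
      case True
      have "(y n (0,0))\<^sup>2 + lam k powr (-1) * (y n k)\<^sup>2 \<le> r" using Vinner_ge_sum[OF V(1), of "{k}"] V(2) True by simp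
      then have "(y n (0,0))\<^sup>2 + (y n k)\<^sup>2 / lam k \<le> r" by (simp add: powr_m1[OF True])
      then have "(y n k)\<^sup>2 / lam k \<le> r" using zero_le_power2[of "y n (0,0)"] by linarith
      then have "(y n k)\<^sup>2 \<le> r * lam k" using lam_pos[OF True] by (simp add: pos_divide_le_eq)
      also have "\<dots> \<le> \<bar>r\<bar> * (1 + lam k)" by (intro mult_mono) auto
      finally show ?thesis by (simp add: mult.commute)
    next
      case False
      then have "k = (0,0)" by (simp add: nz_def)
      then show ?thesis using Vinner_ge_0[of "y n" "-1"] V(2) by simp
    qed
    also have "\<dots> \<le> (b k)\<^sup>2"
    proof -
      have "(1 + lam k) * \<bar>r\<bar> \<le> b k * 1" unfolding b_def by (simp add: algebra_simps)
      also have "\<dots> \<le> b k * b k"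
      proof (rule mult_left_mono)
        show "1 \<le> b k" unfolding b_def using mult_mono[of 1 "1 + lam k" 1 "1 + \<bar>r\<bar>"] by simp
        show "0 \<le> b k" unfolding b_def by simp
      qed
      finally show ?thesis by (simp add: power2_eq_square)
    qed
    finally have "\<bar>y n k\<bar> \<le> b k" by (rule abs_le_square_iff[THEN iffD2, THEN order_trans]) (simp add: b_def)
    then show ?thesis by (simp add: abs_le_iff)
  qed
  have "compactin (product_topology (\<lambda>_. euclideanreal) UNIV) (PiE UNIV (\<lambda>k. {- b k..b k}))"
    unfolding compactin_PiE by simp
  then have "compact (PiE UNIV (\<lambda>k. {- b k..b k}))" unfolding euclidean_product_topology by simp
  moreover have "\<forall>n. y n \<in> PiE UNIV (\<lambda>k. {- b k..b k})" using yb by (auto simp: PiE_def)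
  ultimately obtain l s where s: "strict_mono (s :: nat \<Rightarrow> nat)" "(y \<circ> s) \<longlonglongrightarrow> l"
    unfolding compact_def by blast
  have lk: "(\<lambda>n. (y \<circ> s) n k) \<longlonglongrightarrow> l k" for k
    by (rule continuous_on_tendsto_compose[OF continuous_on_product_coordinates s(2)]) auto
  have ys: "(y \<circ> s) n \<in> FQ r" for n using y by simp
  have lF: "l \<in> FQ r" by (rule FQ_limit[OF ys lk])
  have sub: "FQ r \<subseteq> Espace s0" using V_subset_Espace by (auto simp: FQ_def)
  have "limitin (ES.mtopology s0) (y \<circ> s) l sequentially"
    unfolding ES.limitin_metric_dist_null using FQ_convergence[OF ys lk] lF ys sub by (auto intro!: always_eventually)
  then show "\<exists>l r'. l \<in> FQ r \<and> strict_mono r' \<and> limitin (ES.mtopology s0) (y \<circ> r') l sequentially"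
    using lF s(1) by blast
qed

lemma FQ_closed: "closedin (Etop s0) (FQ r)"
  using compactin_imp_closedin[OF _ FQ_compact] ES.Hausdorff_space_mtopology by (simp add: Etop_def)

end

text \<open>Induction on the polynomial with \<open>a\<close> arbitrary: half of the exponent
  absorbs the new factor x, the other half is left for the induction hypothesis.\<close>

lemma gaussian_bound:
  fixes p :: "real poly"
  shows "a > 0 \<Longrightarrow> \<exists>C. \<forall>x. \<bar>poly p x * exp (- (a * x\<^sup>2))\<bar> \<le> C"
proof (induction p arbitrary: a)
  case 0 show ?case by (intro exI[of _ 0]) simp
next
  case (pCons c p)
  define b where "b = a / 2"
  have b: "b > 0" "a = b + b" using pCons.prems by (auto simp: b_def)
  obtain C where C: "\<forall>x. \<bar>poly p x * exp (- (b * x\<^sup>2))\<bar> \<le> C" using pCons.IH[OF b(1)] by blast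
  define D where "D = 1 + 1 / b"
  have x: "\<bar>x * exp (- (b * x\<^sup>2))\<bar> \<le> D" for x
  proof -
    have "2 * \<bar>x\<bar> \<le> 1 + x\<^sup>2" using zero_le_power2[of "1 - \<bar>x\<bar>"] by (simp add: power2_diff)
    then have "\<bar>x\<bar> \<le> 1 + x\<^sup>2" by (smt (verit) zero_le_power2)
    also have "\<dots> \<le> D * (1 + b * x\<^sup>2)" unfolding D_def using b(1) by (simp add: field_simps)
    also have "\<dots> \<le> D * exp (b * x\<^sup>2)" unfolding D_def using b(1) exp_ge_add_one_self[of "b * x\<^sup>2"] by (intro mult_left_mono) auto
    finally show ?thesis by (simp add: abs_mult exp_minus divide_simps)
  qed
  have "\<bar>poly (pCons c p) x * exp (- (a * x\<^sup>2))\<bar> \<le> \<bar>c\<bar> + D * C" for x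
  proof -
    have "exp (- (a * x\<^sup>2)) = exp (- (b * x\<^sup>2)) * exp (- (b * x\<^sup>2))" unfolding b(2) by (simp flip: exp_add add: algebra_simps)
    then have "poly (pCons c p) x * exp (- (a * x\<^sup>2)) = c * exp (- (a * x\<^sup>2)) + (x * exp (- (b * x\<^sup>2))) * (poly p x * exp (- (b * x\<^sup>2)))"
      by (simp add: algebra_simps)
    moreover have "\<bar>c * exp (- (a * x\<^sup>2))\<bar> \<le> \<bar>c\<bar>" using pCons.prems by (simp add: abs_mult mult_left_le)
    moreover have "\<bar>(x * exp (- (b * x\<^sup>2))) * (poly p x * exp (- (b * x\<^sup>2)))\<bar> \<le> D * C"
      unfolding abs_mult[of "x * _"] using x[of x] C[rule_format, of x] b(1) by (intro mult_mono) (auto simp: D_def)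
    ultimately show ?thesis by linarith
  qed
  then show ?case by blast
qed

section \<open>Capacity of the complements of the compact sets\<close>

context fc_setting
begin

lemma FC_gauss: assumes a: "a > 0" shows "(\<lambda>z. exp (- (a * (z k)\<^sup>2))) \<in> FC s0"
proof -
  define B where "B = {\<lambda>x. poly p x * exp (- (a * x\<^sup>2)) | p. True}"
  have B: "bounded (range g) \<and> (\<exists>g'\<in>B. \<forall>x. (g has_real_derivative g' x) (at x))" if gB: "g \<in> B" for g
  proof -
    obtain p where g: "g = (\<lambda>x. poly p x * exp (- (a * x\<^sup>2)))" using gB unfolding B_def by blast
    let ?q = "pderiv p + p * [:0, - 2 * a:]"
    have "bounded (range g)" using gaussian_bound[OF a, of p] unfolding bounded_iff g by auto
    moreover have "(g has_real_derivative poly ?q x * exp (- (a * x\<^sup>2))) (at x)" for x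
    proof -
      have "((\<lambda>x. exp (- (a * x\<^sup>2))) has_real_derivative exp (- (a * x\<^sup>2)) * (- (a * (2 * x)))) (at x)"
        by (auto intro!: derivative_eq_intros)
      from DERIV_mult[OF poly_DERIV this] show ?thesis unfolding g by (rule DERIV_cong) (simp add: algebra_simps)
    qed
    moreover have "(\<lambda>x. poly ?q x * exp (- (a * x\<^sup>2))) \<in> B" unfolding B_def by blast
    ultimately show ?thesis by (intro conjI bexI[of _ "\<lambda>x. poly ?q x * exp (- (a * x\<^sup>2))"] allI)
  qed
  have "(\<lambda>x. exp (- (a * x\<^sup>2))) \<in> B" unfolding B_def by (rule CollectI, rule exI[of _ "[:1:]"]) simp
  from FC_coord[OF B this] show ?thesis .
qed

text \<open>Partial sums of Q without the zero mode, which vanishes \<open>nu\<close>-almost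
  everywhere. Being finite, they make \<open>Pn\<close> a product of one-dimensional Gaussians and
  thereby a cylinder function.\<close>

definition Sn :: "nat \<Rightarrow> coeffs \<Rightarrow> real" where "Sn n z = (\<Sum>k\<in>Kn n. (z k)\<^sup>2 / lam k)"

definition Pn :: "real \<Rightarrow> nat \<Rightarrow> coeffs \<Rightarrow> real" where "Pn r n z = exp (- (Sn n z / r))"

lemma Sn_nonneg: "0 \<le> Sn n z" unfolding Sn_def by (intro sum_nonneg) simp

lemma Pn_FC: assumes r: "r > 0" shows "Pn r n \<in> FC s0"
proof -
  have "Pn r n = (\<lambda>z. \<Prod>k\<in>Kn n. exp (- (1 / (lam k * r) * (z k)\<^sup>2)))"
    unfolding Pn_def[abs_def] Sn_def by (simp add: exp_sum[symmetric] sum_negf sum_divide_distrib)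
  moreover have "(\<lambda>z. \<Prod>k\<in>Kn n. exp (- (1 / (lam k * r) * (z k)\<^sup>2))) \<in> FC s0"
  proof (rule FC_prod[OF finite_Kn])
    fix k assume "k \<in> Kn n"
    then have "lam k > 0" using Kn_nz lam_pos by blast
    then show "(\<lambda>z. exp (- (1 / (lam k * r) * (z k)\<^sup>2))) \<in> FC s0" by (intro FC_gauss) (use r in simp)
  qed
  ultimately show ?thesis by simp
qed

text \<open>The gradient is read off from the derivative along the line, on which \<open>Sn\<close>
  is c + w x^2 with w = 1 / \<open>lam k\<close> or 0.\<close>

lemma grad_Pn:
  assumes r: "r > 0" and k: "k \<in> nz"
  shows "grad (Pn r n) z k = (if k \<in> Kn n then - (2 * z k / r) * Pn r n z else 0)"
proof -
  define c where "c = Sn n (z(k := 0))"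
  define w where "w = (if k \<in> Kn n then 1 / lam k else 0)"
  have S: "Sn n (z(k := x)) = c + w * x\<^sup>2" for x
  proof (cases "k \<in> Kn n")
    case True
    have "Sn n (z(k := x)) = x\<^sup>2 / lam k + (\<Sum>j\<in>Kn n - {k}. (z j)\<^sup>2 / lam j)" for x
      unfolding Sn_def using True by (subst sum.remove[OF finite_Kn True]) (intro arg_cong2[where f = "(+)"] sum.cong refl; simp)
    then show ?thesis using True by (simp add: c_def w_def)
  next
    case False
    have "Sn n (z(k := x)) = (\<Sum>j\<in>Kn n. (z j)\<^sup>2 / lam j)" for x
      unfolding Sn_def using False by (intro sum.cong) auto
    then show ?thesis using False by (simp add: c_def w_def)
  qed
  have "((\<lambda>x. Pn r n (z(k := x))) has_real_derivative exp (- ((c + w * (z k)\<^sup>2) / r)) * (- (w * (2 * z k) / r))) (at (z k))"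
    unfolding Pn_def S using r by (auto intro!: derivative_eq_intros)
  moreover have "((\<lambda>x. Pn r n (z(k := x))) has_real_derivative grad (Pn r n) (z(k := z k)) k / lam k) (at (z k))"
    by (rule line_deriv[OF Pn_FC[OF r] k])
  ultimately have "exp (- ((c + w * (z k)\<^sup>2) / r)) * (- (w * (2 * z k) / r)) = grad (Pn r n) (z(k := z k)) k / lam k"
    by (rule DERIV_unique)
  moreover have "exp (- ((c + w * (z k)\<^sup>2) / r)) = Pn r n z" unfolding S[symmetric] Pn_def by simp
  ultimately have "grad (Pn r n) z k / lam k = Pn r n z * (- (w * (2 * z k) / r))" by simp
  then have "grad (Pn r n) z k = lam k * (Pn r n z * (- (w * (2 * z k) / r)))"
    using lam_pos[OF k] by (simp add: field_simps)
  then show ?thesis using lam_pos[OF k] by (simp add: w_def)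
qed

text \<open>With s = \<open>Sn n z\<close> / r the energy density equals (4/r) s exp (-2 s), and 2 s
  <= exp (2 s). The bound is free of \<open>n\<close>, which the passage to infinitely many modes
  relies on.\<close>

lemma Gam_Pn: assumes r: "r > 0" shows "Gam (Pn r n) (Pn r n) z \<le> 2 / r"
proof -
  define s where "s = Sn n z / r"
  have s: "s \<ge> 0" unfolding s_def using Sn_nonneg r by simp
  have "Gam (Pn r n) (Pn r n) z = (\<Sum>\<^sub>\<infinity>k\<in>Kn n. 4 / r\<^sup>2 * (Pn r n z)\<^sup>2 * ((z k)\<^sup>2 / lam k))"
    unfolding Gam_eq
  proof (rule infsum_cong_neutral)
    fix k assume "k \<in> nz - Kn n" then show "lam k powr (-1) * grad (Pn r n) z k * grad (Pn r n) z k = 0" by (simp add: grad_Pn[OF r])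
  next
    fix k assume "k \<in> nz \<inter> Kn n"
    then have k: "k \<in> nz" "k \<in> Kn n" by auto
    show "lam k powr (-1) * grad (Pn r n) z k * grad (Pn r n) z k = 4 / r\<^sup>2 * (Pn r n z)\<^sup>2 * ((z k)\<^sup>2 / lam k)"
      unfolding grad_Pn[OF r k(1)] powr_m1[OF k(1)] using k(2) r lam_pos[OF k(1)] by (simp add: power2_eq_square mult_ac)
  qed (use Kn_nz in auto)
  also have "\<dots> = 4 / r\<^sup>2 * (Pn r n z)\<^sup>2 * Sn n z" unfolding Sn_def by (simp add: sum_distrib_left)
  also have "\<dots> = 4 / r * (s * exp (- (2 * s)))"
  proof -
    have "(Pn r n z)\<^sup>2 = exp (- (2 * s))" unfolding Pn_def s_def by (simp add: power2_eq_square flip: exp_add)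
    moreover have "Sn n z = s * r" unfolding s_def using r by simp
    ultimately show ?thesis using r by (simp add: power2_eq_square)
  qed
  also have "\<dots> \<le> 4 / r * (1 / 2)"
  proof (rule mult_left_mono)
    have "2 * s \<le> exp (2 * s)" using exp_ge_add_one_self[of "2 * s"] by linarith
    then show "s * exp (- (2 * s)) \<le> 1 / 2" by (simp add: exp_minus divide_simps)
  qed (use r in simp)
  finally show ?thesis by simp
qed

text \<open>Subtracting from 1 only changes the sign of the gradient, and the factor 1/2 of
  \<open>Eform\<close> halves the density bound 2/r.\<close>

lemma Eform_Pn: assumes r: "r > 0" shows "Eform (\<lambda>z. 1 - Pn r n z) (\<lambda>z. 1 - Pn r n z) \<le> measure nu UNIV / r"
proof -
  have "Eform (\<lambda>z. 1 - Pn r n z) (\<lambda>z. 1 - Pn r n z) \<le> Eform (Pn r n) (Pn r n)"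
    using energy_poly_le[OF Pn_FC[OF r], where p = "[:1, -1:]" and c = 1] by (simp add: pderiv_pCons)
  moreover have "(\<integral>z. Gam (Pn r n) (Pn r n) z \<partial>nu) \<le> (\<integral>z. 2 / r \<partial>nu)"
    by (rule integral_mono[OF Gam_integrable[OF Pn_FC[OF r] Pn_FC[OF r]]]) (simp_all add: Gam_Pn[OF r])
  moreover have "(\<integral>z. 2 / r \<partial>nu) = 2 * (measure nu UNIV / r)" by simp
  ultimately show ?thesis using Eform_Gam[of "Pn r n" "Pn r n"] by linarith
qed

text \<open>The limit of 1 - \<open>Pn r n\<close> where the series converges, which is
  \<open>nu\<close>-almost everywhere. Where it diverges \<open>infsum\<close> is 0 and so is
  \<open>Winf\<close>; the capacity estimate therefore argues only on the set of full
  measure.\<close>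

definition Winf :: "real \<Rightarrow> coeffs \<Rightarrow> real" where
  "Winf r z = 1 - exp (- ((\<Sum>\<^sub>\<infinity>k\<in>nz. (z k)\<^sup>2 / lam k) / r))"

lemma Winf_01: "r > 0 \<Longrightarrow> 0 \<le> Winf r z" "Winf r z \<le> 1"
proof -
  have "0 \<le> (\<Sum>\<^sub>\<infinity>k\<in>nz. (z k)\<^sup>2 / lam k)" by (rule infsum_nonneg) simp
  then show "r > 0 \<Longrightarrow> 0 \<le> Winf r z" unfolding Winf_def by simp
  show "Winf r z \<le> 1" unfolding Winf_def by simp
qed

lemma Winf_measurable[measurable]: "Winf r \<in> borel_measurable gff"
proof -
  have [measurable]: "(\<lambda>z. \<Sum>\<^sub>\<infinity>k\<in>nz. (z k)\<^sup>2 / lam k) \<in> borel_measurable gff"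
    by (rule infsum_measurable) (simp, measurable)
  show ?thesis unfolding Winf_def[abs_def] by measurable
qed

lemma Winf_L2: assumes r: "r > 0" shows "Winf r \<in> L2 nu"
  by (rule bounded_L2[OF Winf_measurable, of _ 1]) (simp add: Winf_01(1)[OF r] Winf_01(2))

lemma AE_nu_V: "AE z in nu. in_V (-1) z \<and> z (0,0) = 0"
  using AE_nu[OF AE_weighted_summable[OF zero_less_one]] AE_nu[OF AE_gff_0] by eventually_elim (simp add: in_V_def)

lemma V_m1_iff: "in_V (-1) z \<longleftrightarrow> (\<lambda>k. (z k)\<^sup>2 / lam k) summable_on nz"
  unfolding in_V_def by (rule summable_on_cong) (simp add: powr_m1)

lemma V_m1_infsum: "(\<Sum>\<^sub>\<infinity>k\<in>nz. lam k powr (-1) * (z k)\<^sup>2) = (\<Sum>\<^sub>\<infinity>k\<in>nz. (z k)\<^sup>2 / lam k)"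
  by (rule infsum_cong) (simp add: powr_m1)

lemma Pn_tendsto: assumes r: "r > 0" shows "(\<lambda>n. l2dist2 nu (\<lambda>z. 1 - Pn r n z) (Winf r)) \<longlonglongrightarrow> 0"
proof -
  note [measurable] = FC_measurable[OF Pn_FC[OF r]] Winf_measurable
  have [measurable]: "(\<lambda>z. (1 - Pn r n z - Winf r z)\<^sup>2) \<in> borel_measurable nu" for n
    unfolding measurable_cong_sets[OF sets_nu refl] by measurable
  have "(\<lambda>n. \<integral>z. (1 - Pn r n z - Winf r z)\<^sup>2 \<partial>nu) \<longlonglongrightarrow> (\<integral>z. 0 \<partial>nu)"
  proof (rule integral_dominated_convergence[of _ nu _ "\<lambda>_. 1"])
    show "AE z in nu. (\<lambda>n. (1 - Pn r n z - Winf r z)\<^sup>2) \<longlonglongrightarrow> 0"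
      using AE_nu_V
    proof eventually_elim
      case (elim z)
      have "(\<lambda>n. Sn n z) \<longlonglongrightarrow> (\<Sum>\<^sub>\<infinity>k\<in>nz. (z k)\<^sup>2 / lam k)" unfolding Sn_def by (rule sum_Kn_tendsto) (use elim V_m1_iff in blast)
      then have "(\<lambda>n. (1 - Pn r n z - Winf r z)\<^sup>2) \<longlonglongrightarrow> (1 - exp (- ((\<Sum>\<^sub>\<infinity>k\<in>nz. (z k)\<^sup>2 / lam k) / r)) - Winf r z)\<^sup>2"
        unfolding Pn_def using r by (intro tendsto_intros) auto
      then show ?case by (simp add: Winf_def)
    qed
    show "AE z in nu. norm ((1 - Pn r n z - Winf r z)\<^sup>2) \<le> 1" for n
    proof (rule AE_I2)
      fix z
      have "0 < Pn r n z" "Pn r n z \<le> 1" unfolding Pn_def using Sn_nonneg r by simp_all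
      then have "\<bar>1 - Pn r n z - Winf r z\<bar> \<le> 1" using Winf_01(1)[OF r, of z] Winf_01(2)[of r z] by linarith
      from power_mono[OF this abs_ge_zero, of 2] show "norm ((1 - Pn r n z - Winf r z)\<^sup>2) \<le> 1" by simp
    qed
  qed simp_all
  then show ?thesis unfolding l2dist2_def by simp
qed

abbreviation "cD \<equiv> closure_dom nu (FC s0) Eform"
abbreviation "cE \<equiv> closure_form nu (FC s0) Eform"

lemma Winf_closure: assumes r: "r > 0" shows "Winf r \<in> cD" "cE (Winf r) (Winf r) \<le> measure nu UNIV / r"
proof -
  interpret cl: closable_pos_form "FC s0" Eform nu by (rule closable_pos_form_FC)
  have F: "(\<lambda>z. 1 - Pn r n z) \<in> FC s0" for n
    using FC_lin[OF FC_const[of 1] Pn_FC[OF r], of 1 "-1" n] by simp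
  note * = cl.closure_bounded_limit[OF F Winf_L2[OF r] Pn_tendsto[OF r] Eform_Pn[OF r] tendsto_const]
  show "Winf r \<in> cD" by (rule *(1))
  show "cE (Winf r) (Winf r) \<le> measure nu UNIV / r" by (rule *(2))
qed

lemma Winf_tendsto_0: "(\<lambda>n. \<integral>z. (Winf (real (Suc n)) z)\<^sup>2 \<partial>nu) \<longlonglongrightarrow> 0"
proof -
  have [measurable]: "(\<lambda>z. (Winf r z)\<^sup>2) \<in> borel_measurable nu" for r
    unfolding measurable_cong_sets[OF sets_nu refl] by measurable
  have "(\<lambda>n. \<integral>z. (Winf (real (Suc n)) z)\<^sup>2 \<partial>nu) \<longlonglongrightarrow> (\<integral>z. 0 \<partial>nu)"
  proof (rule integral_dominated_convergence[of _ nu _ "\<lambda>_. 1"])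
    show "AE z in nu. (\<lambda>n. (Winf (real (Suc n)) z)\<^sup>2) \<longlonglongrightarrow> 0"
    proof (rule AE_I2)
      fix z
      have "(\<lambda>n. (\<Sum>\<^sub>\<infinity>k\<in>nz. (z k)\<^sup>2 / lam k) / real (Suc n)) \<longlonglongrightarrow> 0"
        by (rule LIMSEQ_Suc[OF lim_const_over_n])
      then have "(\<lambda>n. (1 - exp (- ((\<Sum>\<^sub>\<infinity>k\<in>nz. (z k)\<^sup>2 / lam k) / real (Suc n))))\<^sup>2) \<longlonglongrightarrow> (1 - exp (- 0))\<^sup>2"
        by (intro tendsto_intros)
      then show "(\<lambda>n. (Winf (real (Suc n)) z)\<^sup>2) \<longlonglongrightarrow> 0" by (simp add: Winf_def)
    qed
    show "AE z in nu. norm ((Winf (real (Suc n)) z)\<^sup>2) \<le> 1" for n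
      using Winf_01(1)[of "real (Suc n)"] Winf_01(2)[of "real (Suc n)"] by (intro AE_I2) (simp add: power_le_one)
  qed simp_all
  then show ?thesis by simp
qed

lemma capacity_le:
  assumes "openin (Etop s0) U" "A \<subseteq> U" "u \<in> cD" "AE x in nu. x \<in> U \<longrightarrow> 1 \<le> u x"
  shows "capacity (Etop s0) nu cD cE A \<le> ennreal (E1 nu cE u u)"
proof -
  have "capacity (Etop s0) nu cD cE A \<le> cap_open (Etop s0) nu cD cE U"
    unfolding capacity_def using assms(1,2) by (intro Inf_lower) blast
  also have "\<dots> \<le> ennreal (E1 nu cE u u)"
    unfolding cap_open_def using assms(3,4) by (intro Inf_lower) blast
  finally show ?thesis .
qed

lemma capacity_FQ:
  "capacity (Etop s0) nu cD cE (Espace s0 - FQ (real (Suc n)))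
    \<le> ennreal ((1 / (1 - exp (-1)))\<^sup>2 * (measure nu UNIV / real (Suc n) + (\<integral>z. (Winf (real (Suc n)) z)\<^sup>2 \<partial>nu)))"
proof -
  interpret cl: closable_pos_form "FC s0" Eform nu by (rule closable_pos_form_FC)
  define r where "r = real (Suc n)"
  have r: "r > 0" by (simp add: r_def)
  \<comment> \<open>Off \<open>FQ r\<close> the exponent is below -1 almost everywhere, so
    \<open>Winf r\<close> is at least 1 - exp (-1) there; dividing by this makes the test function
    at least 1.\<close>
  define c where "c = 1 / (1 - exp (-1 :: real))"
  have c: "c > 0" by (simp add: c_def)
  define u where "u z = c * Winf r z" for z
  have W: "Winf r \<in> cD" by (rule Winf_closure(1)[OF r])
  have u: "u \<in> cD" unfolding u_def[abs_def] by (rule cl.cl.scale_mem[OF W])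
  have "cE u u = c\<^sup>2 * cE (Winf r) (Winf r)"
    using cl.cl.expand[OF W W, of c 0] by (simp add: u_def[abs_def])
  also have "\<dots> \<le> c\<^sup>2 * (measure nu UNIV / r)" by (rule mult_left_mono[OF Winf_closure(2)[OF r]]) simp
  finally have "E1 nu cE u u \<le> c\<^sup>2 * (measure nu UNIV / r + (\<integral>z. (Winf r z)\<^sup>2 \<partial>nu))"
    unfolding E1_def u_def by (simp add: power2_eq_square algebra_simps flip: integral_mult_right_zero)
  moreover have "capacity (Etop s0) nu cD cE (Espace s0 - FQ r) \<le> ennreal (E1 nu cE u u)"
  proof (rule capacity_le[OF _ subset_refl u])
    show "openin (Etop s0) (Espace s0 - FQ r)" using FQ_closed[of r] unfolding closedin_def by simp
    show "AE z in nu. z \<in> Espace s0 - FQ r \<longrightarrow> 1 \<le> u z"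
      using AE_nu_V
    proof eventually_elim
      case (elim z)
      show ?case
      proof
        assume "z \<in> Espace s0 - FQ r"
        then have F: "z \<notin> FQ r" by blast
        have V: "in_V (-1) z" "z (0,0) = 0" using elim by auto
        have "\<not> Vinner (-1) z z \<le> r" using F V(1) unfolding FQ_def by blast
        moreover have "Vinner (-1) z z = (\<Sum>\<^sub>\<infinity>k\<in>nz. (z k)\<^sup>2 / lam k)" unfolding Vinner_self V_m1_infsum V(2) by simp
        ultimately have "r < (\<Sum>\<^sub>\<infinity>k\<in>nz. (z k)\<^sup>2 / lam k)" by linarith
        then have "exp (- ((\<Sum>\<^sub>\<infinity>k\<in>nz. (z k)\<^sup>2 / lam k) / r)) \<le> exp (-1)" using r by (simp add: le_divide_eq)
        then have "1 - exp (-1) \<le> Winf r z" unfolding Winf_def by linarith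
        then have "c * (1 - exp (-1)) \<le> u z" unfolding u_def using c by (intro mult_left_mono) auto
        then show "1 \<le> u z" by (simp add: c_def)
      qed
    qed
  qed
  ultimately show ?thesis unfolding r_def c_def by (meson ennreal_leI order_trans)
qed

text \<open>The energy part of the capacity bound is the total mass over n+1, and the L2 part
  vanishes because the series in \<open>Winf\<close>, divided by n+1, tends to 0 pointwise.\<close>

lemma nest_FQ: "is_nest (Etop s0) nu cD cE (\<lambda>n. FQ (real (Suc n)))"
  unfolding is_nest_def
proof (intro conjI allI)
  show "closedin (Etop s0) (FQ (real (Suc k)))" for k by (rule FQ_closed)
  show "incseq (\<lambda>n. FQ (real (Suc n)))" unfolding incseq_def FQ_def by auto
  let ?b = "\<lambda>n. (1 / (1 - exp (-1)))\<^sup>2 * (measure nu UNIV / real (Suc n) + (\<integral>z. (Winf (real (Suc n)) z)\<^sup>2 \<partial>nu))"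
  have "?b \<longlonglongrightarrow> (1 / (1 - exp (-1)))\<^sup>2 * (0 + 0)"
    by (intro tendsto_mult tendsto_add tendsto_const LIMSEQ_Suc[OF lim_const_over_n] Winf_tendsto_0)
  then have "(\<lambda>n. ennreal (?b n)) \<longlonglongrightarrow> 0" using tendsto_ennrealI[of ?b 0] by simp
  then show "(\<lambda>k. capacity (Etop s0) nu cD cE (topspace (Etop s0) - FQ (real (Suc k)))) \<longlonglongrightarrow> 0"
    by (rule tendsto_sandwich[OF _ _ tendsto_const, rotated 2]) (auto intro!: always_eventually simp only: capacity_FQ topspace_Etop zero_le)
qed

text \<open>The empty complement has capacity 0, with the zero function as test. Hence continuous
  functions are quasi-continuous and the empty set is exceptional.\<close>

lemma nest_trivial: "is_nest (Etop s0) nu cD cE (\<lambda>_. Espace s0)"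
proof -
  interpret cl: closable_pos_form "FC s0" Eform nu by (rule closable_pos_form_FC)
  have Z: "(\<lambda>_. 0) \<in> FC s0" by (rule FC_const)
  have "cE (\<lambda>_. 0) (\<lambda>_. 0) = 0" using cl.cl.expand[OF cl.D_cD[OF Z] cl.D_cD[OF Z], of 0 0] by simp
  then have "E1 nu cE (\<lambda>_. 0) (\<lambda>_. 0) = 0" by (simp add: E1_def)
  then have "capacity (Etop s0) nu cD cE {} = 0"
    using capacity_le[OF openin_empty subset_refl cl.D_cD[OF Z]] by simp
  then show ?thesis unfolding is_nest_def using closedin_topspace[of "Etop s0"] by (simp add: incseq_def)
qed

lemma FC_qc: assumes "\<phi> \<in> FC s0" shows "qc_version (Etop s0) nu cD cE \<phi> \<phi>"
  unfolding qc_version_def quasi_continuous_def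
  using nest_trivial continuous_map_from_subtopology[OF FC_continuous[OF assms]] by blast

text \<open>Cylinder functions are continuous on E and dense for the closed form by construction,
  and the logistic functions of the countably many coordinates separate all points; the capacity
  estimate is spent on the compact nest.\<close>

lemma quasi_regular_FC: "quasi_regular (Etop s0) nu cD cE"
  unfolding quasi_regular_def
proof (intro conjI)
  interpret cl: closable_pos_form "FC s0" Eform nu by (rule closable_pos_form_FC)
  show "\<exists>F. is_nest (Etop s0) nu cD cE F \<and> (\<forall>k. compactin (Etop s0) (F k))"
    using nest_FQ FQ_compact by blast
  show "\<exists>D0\<subseteq>cD. (\<forall>u\<in>cD. \<forall>e>0. \<exists>v\<in>D0. E1 nu cE (fdiff u v) (fdiff u v) < e) \<and> (\<forall>u\<in>D0. \<exists>v. qc_version (Etop s0) nu cD cE u v)"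
  proof (intro exI[of _ "FC s0"] conjI ballI allI impI)
    show "FC s0 \<subseteq> cD" using cl.D_cD by blast
    show "\<exists>v\<in>FC s0. E1 nu cE (fdiff u v) (fdiff u v) < e" if "u \<in> cD" "e > 0" for u e
      by (rule cl.D_E1_dense[OF that])
    show "\<exists>v. qc_version (Etop s0) nu cD cE u v" if "u \<in> FC s0" for u using FC_qc[OF that] by blast
  qed
  define u where "u n z = sgm (1 * z (from_nat n :: int \<times> int) + 0)" for n z
  have uF: "u n \<in> FC s0" for n unfolding u_def[abs_def] by (rule FC_sgm)
  show "\<exists>u v N. (\<forall>n::nat. u n \<in> cD \<and> qc_version (Etop s0) nu cD cE (u n) (v n)) \<and> exceptional (Etop s0) nu cD cE N
        \<and> (\<forall>x\<in>topspace (Etop s0) - N. \<forall>y\<in>topspace (Etop s0) - N. x \<noteq> y \<longrightarrow> (\<exists>n. v n x \<noteq> v n y))"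
  proof (intro exI[of _ u] exI[of _ "{} :: coeffs set"] conjI allI ballI impI)
    show "u n \<in> cD" for n by (rule cl.D_cD[OF uF])
    show "qc_version (Etop s0) nu cD cE (u n) (u n)" for n by (rule FC_qc[OF uF])
    show "exceptional (Etop s0) nu cD cE {}" unfolding exceptional_def using nest_trivial by blast
    fix x y :: coeffs assume "x \<noteq> y"
    then obtain k where "x k \<noteq> y k" by blast
    then have "u (to_nat k) x \<noteq> u (to_nat k) y" unfolding u_def using sgm_inj[of "x k" "y k"] by auto
    then show "\<exists>n. u n x \<noteq> u n y" by blast
  qed
qed

end

theorem theorem6p2:
  shows "\<exists>s1>0. \<forall>s0. 0 < s0 \<and> s0 < s1 \<longrightarrow>
     closable_form nu (FC s0) Eform \<and>
     dirichlet_form nu (closure_dom nu (FC s0) Eform) (closure_form nu (FC s0) Eform) \<and>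
     quasi_regular (Etop s0) nu (closure_dom nu (FC s0) Eform) (closure_form nu (FC s0) Eform)"
proof (intro exI[of _ 1] conjI allI impI)
  fix s0 :: real assume "0 < s0 \<and> s0 < 1"
  then interpret fc_setting s0 by unfold_locales simp
  show "closable_form nu (FC s0) Eform" by (rule closable_FC)
  show "dirichlet_form nu (closure_dom nu (FC s0) Eform) (closure_form nu (FC s0) Eform)" by (rule dirichlet_FC)
  show "quasi_regular (Etop s0) nu (closure_dom nu (FC s0) Eform) (closure_form nu (FC s0) Eform)" by (rule quasi_regular_FC)
qed simp

end
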